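(* Let $\mathbf{A}:\mathbb{R}^d\to\mathbb{R}^d$ be a smooth vector potential whose magnetic field $\mathbf{B}=\mathrm{d}\mathbf{A}$ satisfies the standing assumptions (i)–(iii) below, and let $\mathscr{L}_h=(-ih\nabla-\mathbf{A})^2$. Let $n\in\mathbb{N}$. There exist $h_0>0$ and $C>0$ such that for all $h\in(0,h_0)$ and all $\psi\in\mathrm{Dom}(\mathscr{L}_h^n)$, \[ \sum_{\sigma\in\mathfrak{A}(2n)}\|L_\sigma\psi\|\le C h^{-3n/2}\|\mathscr{L}_h^n\psi\|, \] where $\|\cdot\|$ is the $L^2(\mathbb{R}^d)$ norm (in particular each $L_\sigma\psi$, $\sigma\in\mathfrak{A}(2n)$, belongs to $L^2(\mathbb{R}^d)$).
   Context: Let $\mathscr{P}$ be the class of functions $\psi\in\mathscr{C}^\infty(\mathbb{R}^d)$ such that for every $\alpha\in\mathbb{N}^d$ there exist $C,m\ge0$ with $|\partial^\alpha\psi(x)|\le C\langle x\rangle^m$ for all $x$, where $\langle x\rangle=(1+|x|^2)^{1/2}$. $\mathbf{B}=\mathrm{d}\mathbf{A}$ is identified with the antisymmetric matrix $(B_{k,\ell})$, $B_{k,\ell}=\partial_kA_\ell-\partial_\ell A_k$; $\mathrm{Tr}^+\mathbf{B}(x)$ is the sum of the moduli of the eigenvalues of $\mathbf{B}(x)$ with positive imaginary part. Standing assumptions: (i) each component of $\mathbf{A}$ belongs to $\mathscr{P}$; (ii) there is $b_0>0$ with $\mathrm{Tr}^+\mathbf{B}(x)\ge b_0$ for all $x$;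 (iii) for every $\alpha\in\mathbb{N}^d$ there is $C>0$ with $\|\partial^\alpha\mathbf{B}(x)\|\le C\|\mathbf{B}(x)\|$ for all $x$. Set $L_j=-ih\partial_j-A_j$ and $\mathscr{L}_h=\sum_j L_j^2$, self-adjoint with domain $\mathrm{Dom}(\mathscr{L}_h)=\{\psi\in L^2:(-ih\nabla-\mathbf{A})^2\psi\in L^2\}$. For $n\in\mathbb{N}$, $\mathrm{Dom}(\mathscr{L}_h^n)=\{\psi\in L^2:\mathscr{L}_h^{\ell-1}\psi\in\mathrm{Dom}(\mathscr{L}_h)\text{ for }\ell=1,\dots,n\}$, with $\mathscr{L}_h^n\psi=\mathscr{L}_h(\mathscr{L}_h^{n-1}\psi)$. For $k\in\mathbb{N}$, $\mathfrak{A}(k)=\bigcup_{p=0}^k\{1,\dots,d\}^{\{1,\dots,p\}}$, and for $\sigma\in\{1,\dots,d\}^{\{1,\dots,p\}}$, $L_\sigma=L_{\sigma(1)}\cdots L_{\sigma(p)}$ (applied in the sense of distributions), with $L_\emptyset=\mathrm{Id}$. *)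

theory Defs
  imports "HOL-Analysis.Analysis" "HOL-Computational_Algebra.Polynomial"
begin

definition pd :: "'d::finite \<Rightarrow> (real^'d \<Rightarrow> 'a::real_normed_vector) \<Rightarrow> real^'d \<Rightarrow> 'a" where
  "pd j f = (\<lambda>x. vector_derivative (\<lambda>t::real. f (x + t *\<^sub>R axis j 1)) (at 0))"

fun iterpd :: "'d::finite list \<Rightarrow> (real^'d \<Rightarrow> 'a::real_normed_vector) \<Rightarrow> real^'d \<Rightarrow> 'a" where
  "iterpd [] f = f"
| "iterpd (j # js) f = pd j (iterpd js f)"

definition smooth :: "(real^'d::finite \<Rightarrow> 'a::real_normed_vector) \<Rightarrow> bool" where
  "smooth f \<longleftrightarrow> (\<forall>js. continuous_on UNIV (iterpd js f) \<and>
      (\<forall>j x. (\<lambda>t::real. iterpd js f (x + t *\<^sub>R axis j 1)) differentiable (at 0)))"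

definition jbr :: "real^'d::finite \<Rightarrow> real" where
  "jbr x = sqrt (1 + (norm x)^2)"

definition classP :: "(real^'d::finite \<Rightarrow> real) \<Rightarrow> bool" where
  "classP f \<longleftrightarrow> smooth f \<and>
     (\<forall>js. \<exists>C m. C \<ge> 0 \<and> m \<ge> 0 \<and> (\<forall>x. \<bar>iterpd js f x\<bar> \<le> C * jbr x powr m))"

definition magB :: "('d::finite \<Rightarrow> real^'d \<Rightarrow> real) \<Rightarrow> real^'d \<Rightarrow> real^'d^'d" where
  "magB A x = (\<chi> k l. pd k (A l) x - pd l (A k) x)"

definition charpoly :: "real^'d::finite^'d \<Rightarrow> complex poly" where
  "charpoly M = det (\<chi> i j. (if i = j then [:0, 1:] else 0) - [:complex_of_real (M $ i $ j):])"

definition trplus :: "real^'d::finite^'d \<Rightarrow> real" where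
  "trplus M = (\<Sum>z\<in>{z. poly (charpoly M) z = 0 \<and> Im z > 0}. real (order z (charpoly M)) * cmod z)"

definition L2 :: "(real^'d::finite \<Rightarrow> complex) \<Rightarrow> bool" where
  "L2 f \<longleftrightarrow> f \<in> borel_measurable lborel \<and> integrable lborel (\<lambda>x. (cmod (f x))^2)"

definition L2norm :: "(real^'d::finite \<Rightarrow> complex) \<Rightarrow> real" where
  "L2norm f = sqrt (\<integral>x. (cmod (f x))^2 \<partial>lborel)"

definition test_fun :: "(real^'d::finite \<Rightarrow> complex) \<Rightarrow> bool" where
  "test_fun \<phi> \<longleftrightarrow> smooth \<phi> \<and> (\<exists>K. compact K \<and> (\<forall>x. x \<notin> K \<longrightarrow> \<phi> x = 0))"

definition Lc :: "real \<Rightarrow> ('d::finite \<Rightarrow> real^'d \<Rightarrow> real) \<Rightarrow> 'd \<Rightarrow> (real^'d \<Rightarrow> complex) \<Rightarrow> real^'d \<Rightarrow> complex" where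
  "Lc h A j \<phi> = (\<lambda>x. - \<i> * complex_of_real h * pd j \<phi> x - complex_of_real (A j x) * \<phi> x)"

definition Lapc :: "real \<Rightarrow> ('d::finite \<Rightarrow> real^'d \<Rightarrow> real) \<Rightarrow> (real^'d \<Rightarrow> complex) \<Rightarrow> real^'d \<Rightarrow> complex" where
  "Lapc h A \<phi> = (\<lambda>x. \<Sum>j\<in>UNIV. Lc h A j (Lc h A j \<phi>) x)"

text \<open>g = L_j u in the sense of distributions (L_j is formally symmetric since A is real).\<close>
definition weak_L :: "real \<Rightarrow> ('d::finite \<Rightarrow> real^'d \<Rightarrow> real) \<Rightarrow> 'd \<Rightarrow> (real^'d \<Rightarrow> complex) \<Rightarrow> (real^'d \<Rightarrow> complex) \<Rightarrow> bool" where
  "weak_L h A j u g \<longleftrightarrow> (\<forall>\<phi>. test_fun \<phi> \<longrightarrow>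
     (\<integral>x. u x * cnj (Lc h A j \<phi> x) \<partial>lborel) = (\<integral>x. g x * cnj (\<phi> x) \<partial>lborel))"

definition weak_Lap :: "real \<Rightarrow> ('d::finite \<Rightarrow> real^'d \<Rightarrow> real) \<Rightarrow> (real^'d \<Rightarrow> complex) \<Rightarrow> (real^'d \<Rightarrow> complex) \<Rightarrow> bool" where
  "weak_Lap h A u g \<longleftrightarrow> (\<forall>\<phi>. test_fun \<phi> \<longrightarrow>
     (\<integral>x. u x * cnj (Lapc h A \<phi> x) \<partial>lborel) = (\<integral>x. g x * cnj (\<phi> x) \<partial>lborel))"

text \<open>psi in Dom(L_h^n) and f = L_h^n psi: psi_0 = psi, psi_k in L2, psi_(k+1) = L_h psi_k, f = psi_n.\<close>
definition Lpow_rel :: "real \<Rightarrow> ('d::finite \<Rightarrow> real^'d \<Rightarrow> real) \<Rightarrow> nat \<Rightarrow> (real^'d \<Rightarrow> complex) \<Rightarrow> (real^'d \<Rightarrow> complex) \<Rightarrow> bool" where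
  "Lpow_rel h A n \<psi> f \<longleftrightarrow> (\<exists>u. u 0 = \<psi> \<and> u n = f \<and> (\<forall>k\<le>n. L2 (u k)) \<and>
       (\<forall>k<n. weak_Lap h A (u k) (u (Suc k))))"

end

theory Submission
  imports Defs
begin

text \<open>Write \<open>\<bar>B\<bar>\<close> for the Frobenius norm of the magnetic field. Testing \<open>[L\<^sub>j, L\<^sub>k] = i h B\<^sub>j\<^sub>k\<close> against \<open>B\<^sub>j\<^sub>k u / \<bar>B\<bar>\<close> gives
  \<open>h \<integral> \<bar>B\<bar> \<bar>u\<bar>\<^sup>2 \<le> C \<Sum>\<^sub>j \<parallel>L\<^sub>j u\<parallel>\<^sup>2\<close>. Since \<open>\<bar>B\<bar>\<close> varies slowly by (iii), for small \<open>h\<close> this yields, for all test functions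
  \<open>u\<close> and every \<open>s\<close>, bounds of \<open>h \<bar>B\<bar> u\<close>, \<open>(h \<bar>B\<bar>)\<^bsup>1/2\<^esup> L\<^sub>j u\<close> and \<open>L\<^sub>j L\<^sub>k u\<close> by \<open>\<L>\<^sub>h u\<close> in the norm \<open>\<parallel>\<bar>B\<bar>\<^sup>s \<cdot>\<parallel>\<close>. Cutting off and
  mollifying shows that test functions are dense in the weighted graph norm, so the bounds also hold for weak solutions.
  Estimates of \<open>(h \<bar>B\<bar>)\<^bsup>n - |\<sigma>|/2\<^esup> L\<^sub>\<sigma> \<psi>\<close> by \<open>\<L>\<^sub>h\<^sup>n \<psi>\<close> follow by induction on \<open>n\<close> and \<open>|\<sigma>|\<close>, because the commutator \<open>[\<L>\<^sub>h, L\<^sub>\<tau>]\<close>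
  is a combination of \<open>h\<^bsup>1+|\<tau>|-|\<rho>|\<^esup> a L\<^sub>\<rho>\<close> with \<open>|\<rho>| \<le> |\<tau>|\<close> and \<open>a = O(\<bar>B\<bar>)\<close>. As the eigenvalues of \<open>B\<close> are at most \<open>\<bar>B\<bar>\<close>,
  (ii) bounds \<open>\<bar>B\<bar>\<close> from below, and removing the weights costs only \<open>h\<^bsup>-n\<^esup>\<close>.\<close>

section \<open>Partial derivatives\<close>

text \<open>Two obstacles shape the argument. The magnetic field may be unbounded and a commutator
  of two operators L_j costs h|B|, so estimates of L_sigma psi in plain L^2 do not close. Counting
  each L_j like (h|B|)^(1/2) makes these commutators homogeneous, whereas a derivative that falls on
  a weight or on B costs a factor h and no additional |B|. Since |B| is bounded below, in the
  estimates of u and L_j u such terms are smaller by a power of h and are absorbed; this fixes h_0.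
  The other obstacle is that the domain is defined by distributions, so there are no derivatives to
  integrate by parts with. That L_j(chi u) lies in L^2 for a cutoff chi has to be shown first, by
  solving the equation for the Laplacian of chi u; only then can a cutoff of u be approximated by
  test functions. Weak derivatives being determined only almost everywhere, the functions L_sigma
  psi are carried as a family indexed by words and linked by weak relations.\<close>

definition haspd :: "'d::finite \<Rightarrow> (real^'d \<Rightarrow> 'a::real_normed_vector) \<Rightarrow> real^'d \<Rightarrow> 'a \<Rightarrow> bool" where
  "haspd j f x d \<longleftrightarrow> ((\<lambda>t::real. f (x + t *\<^sub>R axis j 1)) has_vector_derivative d) (at 0)"

text \<open>\<open>pd\<close> is a choice operator and has an arbitrary value where no derivative
  exists. Calculus rules are therefore proved for the relation \<open>haspd\<close> and carried over
  to \<open>pd\<close> here.\<close>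

lemma haspd_pd: "haspd j f x d \<Longrightarrow> pd j f x = d"
  unfolding haspd_def pd_def by (rule vector_derivative_at)

text \<open>\<open>haspd\<close> differentiates along a line only at parameter 0. The mean value
  inequality and the fundamental theorem of calculus need every parameter, which moving the base
  point along the line provides.\<close>

lemma haspd_shift:
  assumes "\<And>x. haspd j f x (f' x)"
  shows "((\<lambda>t. f (x + t *\<^sub>R axis j 1)) has_vector_derivative f' (x + s *\<^sub>R axis j 1)) (at s)"
proof -
  have 1: "((\<lambda>t. t - s) has_vector_derivative 1) (at s)"
    by (auto intro!: derivative_eq_intros)
  have 2: "((\<lambda>t. f ((x + s *\<^sub>R axis j 1) + t *\<^sub>R axis j 1)) has_vector_derivative f' (x + s *\<^sub>R axis j 1)) (at (s - s))"
    using assms[of "x + s *\<^sub>R axis j 1"] unfolding haspd_def by simp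
  have "(((\<lambda>t. f ((x + s *\<^sub>R axis j 1) + t *\<^sub>R axis j 1)) \<circ> (\<lambda>t. t - s)) has_vector_derivative 1 *\<^sub>R f' (x + s *\<^sub>R axis j 1)) (at s)"
    by (rule vector_diff_chain_at[OF 1 2])
  then show ?thesis by (simp add: o_def algebra_simps)
qed

lemma haspd_const: "haspd j (\<lambda>x. c) x 0"
  unfolding haspd_def by simp

lemma haspd_add: "haspd j f x a \<Longrightarrow> haspd j g x b \<Longrightarrow> haspd j (\<lambda>x. f x + g x) x (a + b)"
  unfolding haspd_def by (rule has_vector_derivative_add)

lemma haspd_mult:
  fixes f g :: "real^'d::finite \<Rightarrow> 'a::real_normed_algebra"
  shows "haspd j f x a \<Longrightarrow> haspd j g x b \<Longrightarrow> haspd j (\<lambda>x. f x * g x) x (f x * b + a * g x)"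
  unfolding haspd_def using has_vector_derivative_mult by fastforce

lemma haspd_linear: "bounded_linear l \<Longrightarrow> haspd j f x a \<Longrightarrow> haspd j (\<lambda>x. l (f x)) x (l a)"
  unfolding haspd_def by (rule bounded_linear.has_vector_derivative)

lemma haspd_chain:
  fixes f :: "real^'d::finite \<Rightarrow> real"
  assumes "haspd j f x a" "(g has_vector_derivative b) (at (f x))"
  shows "haspd j (\<lambda>x. g (f x)) x (a *\<^sub>R b)"
proof -
  have "((g \<circ> (\<lambda>t. f (x + t *\<^sub>R axis j 1))) has_vector_derivative a *\<^sub>R b) (at 0)"
    using assms unfolding haspd_def by (intro vector_diff_chain_at) auto
  then show ?thesis unfolding haspd_def o_def by simp
qed

lemma iterpd_snoc: "iterpd (js @ [j]) f = iterpd js (pd j f)"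
  by (induction js) auto

lemma smooth_cont: "smooth f \<Longrightarrow> continuous_on UNIV f"
  unfolding smooth_def by (metis iterpd.simps(1))

lemma smooth_haspd: "smooth f \<Longrightarrow> haspd j f x (pd j f x)"
  unfolding smooth_def haspd_def pd_def
  by (metis iterpd.simps(1) vector_derivative_works)

lemma smooth_pd: "smooth f \<Longrightarrow> smooth (pd j f)"
  unfolding smooth_def by (metis iterpd_snoc)

text \<open>Smoothness concerns all iterated derivatives at once; it follows from any set of
  continuous functions that is closed under partial derivatives and contains the function.\<close>

lemma smooth_coinduct:
  assumes S: "f \<in> S"
    and cont: "\<And>g. g \<in> S \<Longrightarrow> continuous_on UNIV g"
    and der: "\<And>g j. g \<in> S \<Longrightarrow> \<exists>g'\<in>S. \<forall>x. haspd j g x (g' x)"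
  shows "smooth f"
proof -
  have pdS: "pd j g \<in> S \<and> (\<forall>x. haspd j g x (pd j g x))" if g: "g \<in> S" for g j
  proof -
    obtain g' where "g' \<in> S" "\<forall>x. haspd j g x (g' x)" using der[OF g] by blast
    moreover have "pd j g = g'" using calculation haspd_pd by blast
    ultimately show ?thesis by simp
  qed
  have it: "iterpd js f \<in> S" for js by (induction js) (use S pdS in auto)
  show ?thesis unfolding smooth_def
    using it pdS cont unfolding haspd_def by (metis differentiableI_vector)
qed

text \<open>Scalar multiples are left out because the generating sets used with it already absorb
  coefficients.\<close>

inductive_set addspan :: "('b \<Rightarrow> 'a::plus) set \<Rightarrow> ('b \<Rightarrow> 'a) set" for B where
  incl: "g \<in> B \<Longrightarrow> g \<in> addspan B"
| add: "f \<in> addspan B \<Longrightarrow> g \<in> addspan B \<Longrightarrow> (\<lambda>x. f x + g x) \<in> addspan B"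

text \<open>The product rule turns one generator into a sum of several, so a set of products is
  closed under derivatives only up to sums. This is the form of coinduction needed for products,
  powers and the bump function.\<close>

lemma smooth_addspan:
  assumes f: "f \<in> B"
    and cont: "\<And>g. g \<in> B \<Longrightarrow> continuous_on UNIV g"
    and der: "\<And>g j. g \<in> B \<Longrightarrow> \<exists>g'\<in>addspan B. \<forall>x. haspd j g x (g' x)"
  shows "smooth f"
proof (rule smooth_coinduct[where S="addspan B"])
  show "f \<in> addspan B" using f by (rule addspan.incl)
  show "continuous_on UNIV g" if "g \<in> addspan B" for g
    using that by induction (auto intro: cont continuous_on_add)
  show "\<exists>g'\<in>addspan B. \<forall>x. haspd j g x (g' x)" if "g \<in> addspan B" for g j
    using that
  proof induction
    case (add f g)
    then obtain f' g' where "f' \<in> addspan B" "\<forall>x. haspd j f x (f' x)" "g' \<in> addspan B" "\<forall>x. haspd j g x (g' x)"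
      by blast
    then show ?case by (intro bexI[of _ "\<lambda>x. f' x + g' x"]) (auto intro: haspd_add addspan.add)
  qed (rule der)
qed

lemma smooth_mult:
  fixes f g :: "real^'d::finite \<Rightarrow> 'a::real_normed_algebra"
  assumes "smooth f" "smooth g"
  shows "smooth (\<lambda>x. f x * g x)"
proof (rule smooth_addspan[where B="{h. \<exists>f g. smooth f \<and> smooth g \<and> h = (\<lambda>x. f x * g x)}"])
  let ?B = "{h :: real^'d \<Rightarrow> 'a. \<exists>f g. smooth f \<and> smooth g \<and> h = (\<lambda>x. f x * g x)}"
  show "(\<lambda>x. f x * g x) \<in> ?B" using assms by blast
  show "continuous_on UNIV h" if "h \<in> ?B" for h
    using that continuous_on_mult[OF smooth_cont smooth_cont] by blast
  show "\<exists>g'\<in>addspan ?B. \<forall>x. haspd j h x (g' x)" if h: "h \<in> ?B" for h j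
  proof -
    obtain f g where fg: "smooth f" "smooth g" "h = (\<lambda>x. f x * g x)" using h by blast
    have "(\<lambda>x. f x * pd j g x + pd j f x * g x) \<in> addspan ?B"
      using fg(1,2) smooth_pd by (intro addspan.add addspan.incl) blast+
    then show ?thesis unfolding fg(3)
      using fg(1,2) by (intro bexI) (auto intro!: haspd_mult smooth_haspd)
  qed
qed

lemma smooth_add:
  fixes f g :: "real^'d::finite \<Rightarrow> 'a::real_normed_vector"
  assumes "smooth f" "smooth g"
  shows "smooth (\<lambda>x. f x + g x)"
proof (rule smooth_coinduct[where S="{h. \<exists>f g. smooth f \<and> smooth g \<and> h = (\<lambda>x. f x + g x)}"])
  let ?S = "{h :: real^'d \<Rightarrow> 'a. \<exists>f g. smooth f \<and> smooth g \<and> h = (\<lambda>x. f x + g x)}"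
  show "(\<lambda>x. f x + g x) \<in> ?S" using assms by blast
  show "continuous_on UNIV h" if "h \<in> ?S" for h
    using that continuous_on_add[OF smooth_cont smooth_cont] by blast
  show "\<exists>g'\<in>?S. \<forall>x. haspd j h x (g' x)" if h: "h \<in> ?S" for h j
  proof -
    obtain f g where fg: "smooth f" "smooth g" "h = (\<lambda>x. f x + g x)" using h by blast
    show ?thesis unfolding fg(3) using smooth_pd[OF fg(1), of j] smooth_pd[OF fg(2), of j] fg(1,2)
      by (intro bexI[of _ "\<lambda>x. pd j f x + pd j g x"]) (blast intro: haspd_add smooth_haspd)+
  qed
qed

lemma smooth_linear:
  assumes l: "bounded_linear l" and "smooth f"
  shows "smooth (\<lambda>x. l (f x))"
proof (rule smooth_coinduct[where S="{h. \<exists>f. smooth f \<and> h = (\<lambda>x. l (f x))}"])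
  let ?S = "{h. \<exists>f. smooth f \<and> h = (\<lambda>x. l (f x))}"
  show "(\<lambda>x. l (f x)) \<in> ?S" using assms by blast
  show "continuous_on UNIV h" if "h \<in> ?S" for h
    using that bounded_linear.continuous_on[OF l smooth_cont] by blast
  fix h j assume "h \<in> ?S"
  then obtain f where f: "smooth f" "h = (\<lambda>x. l (f x))" by blast
  show "\<exists>g'\<in>?S. \<forall>x. haspd j h x (g' x)"
    unfolding f(2) using smooth_pd[OF f(1), of j] haspd_linear[OF l smooth_haspd[OF f(1)]]
    by (intro bexI[of _ "\<lambda>x. l (pd j f x)"]) blast+
qed

lemma smooth_const: "smooth (\<lambda>x::real^'d::finite. c)"
  by (rule smooth_coinduct[where S="range (\<lambda>c x. c)"]) (auto intro!: haspd_const)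

lemma smooth_of_real: "smooth f \<Longrightarrow> smooth (\<lambda>x. complex_of_real (f x))"
  by (rule smooth_linear[OF bounded_linear_of_real])

lemma smooth_cnj: "smooth f \<Longrightarrow> smooth (\<lambda>x. cnj (f x))"
  by (rule smooth_linear[OF bounded_linear_cnj])

lemma smooth_uminus: "smooth f \<Longrightarrow> smooth (\<lambda>x. - f x)"
  by (rule smooth_linear[OF bounded_linear_minus[OF bounded_linear_ident]])

lemma smooth_diff: "smooth f \<Longrightarrow> smooth g \<Longrightarrow> smooth (\<lambda>x. f x - g x)"
  using smooth_add[of f "\<lambda>x. - g x"] smooth_uminus[of g] by simp

lemma smooth_sum: "(\<And>i. i \<in> I \<Longrightarrow> smooth (f i)) \<Longrightarrow> smooth (\<lambda>x. \<Sum>i\<in>I. f i x)"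
  by (induction I rule: infinite_finite_induct) (auto intro!: smooth_const smooth_add)

lemma smooth_power:
  fixes f :: "real^'d::finite \<Rightarrow> 'a::real_normed_algebra_1"
  shows "smooth f \<Longrightarrow> smooth (\<lambda>x. f x ^ n)"
  by (induction n) (auto intro!: smooth_const smooth_mult)

lemma haspd_nth: "haspd j (\<lambda>x. x $ k) x (if k = j then 1 else 0)"
  unfolding haspd_def by (auto simp: axis_def intro!: derivative_eq_intros)

lemma smooth_nth: "smooth (\<lambda>x::real^'d::finite. x $ k)"
proof (rule smooth_coinduct[where S="insert (\<lambda>x::real^'d. x $ k) (range (\<lambda>c x. c))"])
  fix g :: "real^'d \<Rightarrow> real" and j assume "g \<in> insert (\<lambda>x::real^'d. x $ k) (range (\<lambda>c x. c))"
  then show "\<exists>g'\<in>insert (\<lambda>x::real^'d. x $ k) (range (\<lambda>c x. c)). \<forall>x. haspd j g x (g' x)"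
  proof
    assume "g = (\<lambda>x. x $ k)"
    then show ?thesis using haspd_nth[of j k] by auto
  next
    assume "g \<in> range (\<lambda>c x. c)"
    then obtain c where "g = (\<lambda>x. c)" by blast
    then show ?thesis using haspd_const[of j c]
      by (intro bexI[of _ "\<lambda>x. 0"]) auto
  qed
qed (auto intro!: continuous_intros)

text \<open>Covers both reflections \<open>y \<mapsto> x - y\<close> and dilations \<open>y \<mapsto> y / R\<close>.\<close>
lemma haspd_affine:
  assumes "\<And>x. haspd j f x (f' x)"
  shows "haspd j (\<lambda>y. f (a + c *\<^sub>R y)) y (c *\<^sub>R f' (a + c *\<^sub>R y))"
proof -
  have 1: "((\<lambda>t. c * t) has_vector_derivative c) (at 0)"
    by (auto intro!: derivative_eq_intros)
  have 2: "((\<lambda>t. f ((a + c *\<^sub>R y) + t *\<^sub>R axis j 1)) has_vector_derivative f' (a + c *\<^sub>R y)) (at (c * 0))"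
    using assms[of "a + c *\<^sub>R y"] unfolding haspd_def by simp
  have "(((\<lambda>t. f ((a + c *\<^sub>R y) + t *\<^sub>R axis j 1)) \<circ> (\<lambda>t. c * t)) has_vector_derivative c *\<^sub>R f' (a + c *\<^sub>R y)) (at 0)"
    by (rule vector_diff_chain_at[OF 1 2])
  then show ?thesis unfolding haspd_def o_def by (simp add: algebra_simps)
qed

lemma smooth_affine:
  assumes "smooth f"
  shows "smooth (\<lambda>y. f (a + c *\<^sub>R y))"
proof (rule smooth_coinduct[where S="{h. \<exists>f k. smooth f \<and> h = (\<lambda>y. k *\<^sub>R f (a + c *\<^sub>R y))}"])
  let ?S = "{h. \<exists>f k. smooth f \<and> h = (\<lambda>y. k *\<^sub>R f (a + c *\<^sub>R y))}"
  show "(\<lambda>y. f (a + c *\<^sub>R y)) \<in> ?S" using assms by (auto intro!: exI[of _ f] exI[of _ "1::real"])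
  show "continuous_on UNIV h" if "h \<in> ?S" for h
    using that by (auto intro!: continuous_intros continuous_on_compose2[OF smooth_cont])
  fix h j assume "h \<in> ?S"
  then obtain f k where f: "smooth f" "h = (\<lambda>y. k *\<^sub>R f (a + c *\<^sub>R y))" by blast
  have "haspd j h y ((k * c) *\<^sub>R pd j f (a + c *\<^sub>R y))" for y
    unfolding f(2) using haspd_linear[OF bounded_linear_scaleR_right haspd_affine[OF smooth_haspd[OF f(1)]]]
    by simp
  then show "\<exists>g'\<in>?S. \<forall>x. haspd j h x (g' x)"
    using smooth_pd[OF f(1)] by (intro bexI[of _ "\<lambda>y. (k * c) *\<^sub>R pd j f (a + c *\<^sub>R y)"]) auto
qed

text \<open>The generators are g w^s with g smooth and s arbitrary: differentiating the power lowers
  s by one and moves the derivative of w into g.\<close>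

lemma smooth_powr:
  fixes w :: "real^'d::finite \<Rightarrow> real"
  assumes w: "smooth w" "\<And>x. w x > 0"
  shows haspd_powr: "haspd j (\<lambda>x. w x powr s) x (s * pd j w x * w x powr (s - 1))"
    and "smooth (\<lambda>x. w x powr s)"
proof -
  show *: "haspd j (\<lambda>x. w x powr s) x (s * pd j w x * w x powr (s - 1))" for j s x
  proof -
    have "((\<lambda>t. t powr s) has_real_derivative (s * w x powr (s - 1))) (at (w x))"
      using w(2)[of x] by (rule has_real_derivative_powr)
    then have "((\<lambda>t. t powr s) has_vector_derivative (s * w x powr (s - 1))) (at (w x))"
      by (simp add: has_real_derivative_iff_has_vector_derivative)
    from haspd_chain[OF smooth_haspd[OF w(1)] this]
    show ?thesis by (simp add: mult_ac)
  qed
  let ?B = "{h. \<exists>g s. smooth g \<and> h = (\<lambda>x. g x * w x powr s)}"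
  show "smooth (\<lambda>x. w x powr s)"
  proof (rule smooth_addspan[where B="?B"])
    show "(\<lambda>x. w x powr s) \<in> ?B"
      using smooth_const[of "1::real"] by (auto intro!: exI[of _ "\<lambda>x. 1::real"])
    show "continuous_on UNIV h" if h: "h \<in> ?B" for h
    proof -
      obtain g s where g: "smooth g" "h = (\<lambda>x. g x * w x powr s)" using h by blast
      have "w x \<noteq> 0" for x using w(2)[of x] by simp
      then show ?thesis unfolding g(2)
        by (intro continuous_on_mult continuous_on_powr continuous_on_const smooth_cont g(1) w(1)) simp
    qed
    fix h j assume "h \<in> ?B"
    then obtain g s where g: "smooth g" "h = (\<lambda>x. g x * w x powr s)" by blast
    have "haspd j h x ((g x * (s * pd j w x)) * w x powr (s - 1) + pd j g x * w x powr s)" for x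
      unfolding g(2) using haspd_mult[OF smooth_haspd[OF g(1)] *] by (simp add: mult_ac)
    moreover have "(\<lambda>x. (g x * (s * pd j w x)) * w x powr (s - 1) + pd j g x * w x powr s) \<in> addspan ?B"
    proof (intro addspan.add addspan.incl)
      have "smooth (\<lambda>x. g x * (s * pd j w x))"
        by (intro smooth_mult smooth_const smooth_pd g w)
      then show "(\<lambda>x. (g x * (s * pd j w x)) * w x powr (s - 1)) \<in> ?B" by blast
      show "(\<lambda>x. pd j g x * w x powr s) \<in> ?B" using smooth_pd[OF g(1)] by blast
    qed
    ultimately show "\<exists>g'\<in>addspan ?B. \<forall>x. haspd j h x (g' x)" by (intro bexI) auto
  qed
qed

lemma pd_const: "pd j (\<lambda>x. c) = (\<lambda>x. 0)"
  using haspd_pd[OF haspd_const] by (auto simp: fun_eq_iff)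

lemma pd_add: "smooth f \<Longrightarrow> smooth g \<Longrightarrow> pd j (\<lambda>x. f x + g x) x = pd j f x + pd j g x"
  by (intro haspd_pd haspd_add smooth_haspd)

lemma pd_mult:
  fixes f g :: "real^'d::finite \<Rightarrow> 'a::real_normed_algebra"
  shows "smooth f \<Longrightarrow> smooth g \<Longrightarrow> pd j (\<lambda>x. f x * g x) x = f x * pd j g x + pd j f x * g x"
  by (intro haspd_pd haspd_mult smooth_haspd)

lemma pd_linear: "bounded_linear l \<Longrightarrow> smooth f \<Longrightarrow> pd j (\<lambda>x. l (f x)) x = l (pd j f x)"
  using haspd_pd[OF haspd_linear[OF _ smooth_haspd]] by blast

lemma pd_of_real: "smooth f \<Longrightarrow> pd j (\<lambda>x. complex_of_real (f x)) x = of_real (pd j f x)"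
  by (rule pd_linear[OF bounded_linear_of_real])

lemma pd_cnj: "smooth f \<Longrightarrow> pd j (\<lambda>x. cnj (f x)) x = cnj (pd j f x)"
  by (rule pd_linear[OF bounded_linear_cnj])

lemma pd_uminus: "smooth f \<Longrightarrow> pd j (\<lambda>x. - f x) x = - pd j f x"
  by (rule pd_linear[OF bounded_linear_minus[OF bounded_linear_ident]])

lemma pd_diff: "smooth f \<Longrightarrow> smooth g \<Longrightarrow> pd j (\<lambda>x. f x - g x) x = pd j f x - pd j g x"
  using pd_add[of f "\<lambda>x. - g x"] pd_uminus[of g] smooth_uminus[of g] by simp

lemma pd_sum: "(\<And>i. i \<in> I \<Longrightarrow> smooth (f i)) \<Longrightarrow> pd j (\<lambda>x. \<Sum>i\<in>I. f i x) x = (\<Sum>i\<in>I. pd j (f i) x)"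
  by (induction I rule: infinite_finite_induct) (auto simp: pd_const pd_add smooth_sum)

lemma pd_cmult:
  fixes f :: "real^'d::finite \<Rightarrow> 'a::real_normed_algebra"
  shows "smooth f \<Longrightarrow> pd j (\<lambda>x. c * f x) x = c * pd j f x"
  by (rule pd_linear[OF bounded_linear_mult_right])

lemma pd_affine: "smooth f \<Longrightarrow> pd j (\<lambda>y. f (a + c *\<^sub>R y)) y = c *\<^sub>R pd j f (a + c *\<^sub>R y)"
  by (rule haspd_pd[OF haspd_affine[OF smooth_haspd]])

lemma pd_eq_on_open:
  assumes "open S" "x \<in> S" "\<And>y. y \<in> S \<Longrightarrow> f y = g y"
  shows "pd j f x = pd j g x"
proof -
  have "continuous (at 0) (\<lambda>t::real. x + t *\<^sub>R axis j 1)" by (intro continuous_intros)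
  then have "((\<lambda>t::real. x + t *\<^sub>R axis j 1) \<longlongrightarrow> x) (at 0)" by (simp add: continuous_at)
  then have "\<forall>\<^sub>F t in at 0. x + t *\<^sub>R axis j 1 \<in> S" using assms(1,2) by (rule topological_tendstoD)
  then have ev: "\<forall>\<^sub>F t in nhds 0. f (x + t *\<^sub>R axis j 1) = g (x + t *\<^sub>R axis j 1)"
    unfolding eventually_at_filter using assms(2,3) by (auto elim!: eventually_mono)
  have "((\<lambda>t. f (x + t *\<^sub>R axis j 1)) has_vector_derivative d) (at 0) \<longleftrightarrow>
     ((\<lambda>t. g (x + t *\<^sub>R axis j 1)) has_vector_derivative d) (at 0)" for d
    by (intro has_vector_derivative_cong_ev refl) (use ev eventually_nhds_x_imp_x[OF ev] in \<open>auto elim: eventually_mono\<close>)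
  then show ?thesis unfolding pd_def vector_derivative_def by simp
qed

text \<open>Symmetry of second derivatives from one-dimensional calculus only: f is an integral of
  its k-derivative along the k-line, one differentiates under the integral in direction j and then
  differentiates the integral in its upper limit.\<close>

lemma pd_commute:
  fixes f :: "real^'d::finite \<Rightarrow> 'a::banach"
  assumes f: "smooth f"
  shows "pd k (pd j f) x = pd j (pd k f) x"
proof -
  let ?p = "\<lambda>s t::real. x + s *\<^sub>R axis j 1 + t *\<^sub>R axis k 1"
  define G where "G s t = pd k f (?p s t)" for s t
  define M where "M s t = pd j (pd k f) (?p s t)" for s t
  have cont: "continuous_on T (\<lambda>z. g (?p (fst z) (snd z)))" if "smooth g" for T and g :: "real^'d \<Rightarrow> 'a"
    by (rule continuous_on_compose2[OF smooth_cont[OF that]]) (auto intro!: continuous_intros)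
  have cont1: "continuous_on T (\<lambda>t. g (?p s t))" if "smooth g" for T s and g :: "real^'d \<Rightarrow> 'a"
    by (rule continuous_on_compose2[OF smooth_cont[OF that]]) (auto intro!: continuous_intros)
  have dt: "((\<lambda>t. g (?p s t)) has_vector_derivative pd k g (?p s t)) (at t)" if "smooth g" for g :: "real^'d \<Rightarrow> 'a" and s t
    using haspd_shift[OF smooth_haspd[OF that], where j=k and x="x + s *\<^sub>R axis j 1" and s=t] by simp
  have ds: "((\<lambda>s. g (?p s t)) has_vector_derivative pd j g (?p s t)) (at s)" if "smooth g" for g :: "real^'d \<Rightarrow> 'a" and s t
    using haspd_shift[OF smooth_haspd[OF that], where j=j and x="x + t *\<^sub>R axis k 1" and s=s] by (simp add: add_ac)
  \<comment> \<open>The lower limit is -1 rather than 0 so that t = 0 is interior to the interval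
    and the derivative of the integral there is two-sided.\<close>
  have ftc: "f (?p s t) = f (?p s (-1)) + integral (cbox (-1) t) (G s)" if "t \<ge> -1" for s t
  proof -
    have "(G s has_integral (f (?p s t) - f (?p s (-1)))) {-1..t}"
      unfolding G_def
      by (rule fundamental_theorem_of_calculus[OF that]) (blast intro: has_vector_derivative_at_within dt[OF f])
    then show ?thesis by (simp add: integral_unique)
  qed
  have pj: "pd j f (?p 0 t) = pd j f (?p 0 (-1)) + integral {-1..t} (M 0)" if t: "t \<ge> -1" for t
  proof -
    have "((\<lambda>s. integral (cbox (-1) t) (G s)) has_vector_derivative integral (cbox (-1) t) (M 0)) (at 0 within UNIV)"
    proof (rule leibniz_rule_vector_derivative)
      show "((\<lambda>s. G s u) has_vector_derivative M s u) (at s within UNIV)" for s u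
        unfolding G_def M_def using ds[OF smooth_pd[OF f]] by simp
      show "G s integrable_on cbox (-1) t" for s
        unfolding G_def by (intro integrable_continuous cont1 smooth_pd f)
      show "continuous_on (UNIV \<times> cbox (- 1) t) (\<lambda>(x, t). M x t)"
        unfolding M_def split_beta by (intro cont smooth_pd f)
    qed auto
    then have "((\<lambda>s. f (?p s (-1)) + integral (cbox (-1) t) (G s)) has_vector_derivative
        pd j f (?p 0 (-1)) + integral (cbox (-1) t) (M 0)) (at 0)"
      by (intro has_vector_derivative_add ds[OF f]) simp
    then have "((\<lambda>s. f (?p s t)) has_vector_derivative
        pd j f (?p 0 (-1)) + integral (cbox (-1) t) (M 0)) (at 0)"
      using ftc[OF t] by simp
    from vector_derivative_unique_at[OF this ds[OF f]] show ?thesis by simp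
  qed
  have at0: "at (0::real) within {-1..1} = at 0" by (rule at_within_interior) simp
  have "((\<lambda>t. integral {-1..t} (M 0)) has_vector_derivative M 0 0) (at 0 within {-1..1})"
    unfolding M_def
    by (rule integral_has_vector_derivative) (use cont1[OF smooth_pd[OF smooth_pd[OF f]], where s=0] in auto)
  then have "((\<lambda>t. pd j f (?p 0 (-1)) + integral {-1..t} (M 0)) has_vector_derivative 0 + M 0 0) (at 0 within {-1..1})"
    by (intro has_vector_derivative_add has_vector_derivative_const)
  then have "((\<lambda>t. pd j f (?p 0 t)) has_vector_derivative M 0 0) (at 0 within {-1..1})"
    unfolding add_0 by (rule has_vector_derivative_transform[rotated 2]) (simp, rule pj, simp)
  then have 1: "((\<lambda>t. pd j f (?p 0 t)) has_vector_derivative M 0 0) (at 0)"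
    unfolding at0 .
  from vector_derivative_unique_at[OF 1 dt[OF smooth_pd[OF f]]]
  show ?thesis unfolding M_def by simp
qed

section \<open>Square-integrable functions\<close>

text \<open>Antilinear in the second argument. A non-integrable product gives the value 0, so
  additivity always needs integrability, supplied by \<open>L2\<close> or later by
  \<open>tint\<close>.\<close>

definition ip :: "(real^'d::finite \<Rightarrow> complex) \<Rightarrow> (real^'d \<Rightarrow> complex) \<Rightarrow> complex" where
  "ip f g = (\<integral>x. f x * cnj (g x) \<partial>lborel)"

lemma L2_meas: "L2 f \<Longrightarrow> f \<in> borel_measurable borel"
  unfolding L2_def by simp

lemma L2_sq: "L2 f \<Longrightarrow> integrable lborel (\<lambda>x. (cmod (f x))^2)"
  unfolding L2_def by simp

lemma L2I: "f \<in> borel_measurable borel \<Longrightarrow> integrable lborel (\<lambda>x. (cmod (f x))^2) \<Longrightarrow> L2 f"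
  unfolding L2_def by simp

lemma L2norm_nonneg [simp]: "L2norm f \<ge> 0"
  unfolding L2norm_def by simp

lemma L2norm_sq: "(L2norm f)^2 = (\<integral>x. (cmod (f x))^2 \<partial>lborel)"
  unfolding L2norm_def by simp

lemma L2norm_le_sq: "L2norm f \<le> a" if "(\<integral>x. (cmod (f x))^2 \<partial>lborel) \<le> a^2" "a \<ge> 0"
  using that by (simp add: L2norm_def real_le_lsqrt)

lemma L2_dom:
  assumes f: "L2 f" and g: "g \<in> borel_measurable borel" and le: "\<And>x. cmod (g x) \<le> C * cmod (f x)"
  shows "L2 g" "C \<ge> 0 \<Longrightarrow> L2norm g \<le> C * L2norm f"
proof -
  have b: "(cmod (g x))^2 \<le> C^2 * (cmod (f x))^2" for x
    using power_mono[OF le[of x], of 2] by (simp add: power_mult_distrib)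
  have i: "integrable lborel (\<lambda>x. C^2 * (cmod (f x))^2)" using L2_sq[OF f] by simp
  have "integrable lborel (\<lambda>x. (cmod (g x))^2)"
    by (rule Bochner_Integration.integrable_bound[OF i]) (use g b in auto)
  then show g2: "L2 g" using g by (rule L2I[rotated])
  assume C: "C \<ge> 0"
  have "(\<integral>x. (cmod (g x))^2 \<partial>lborel) \<le> (\<integral>x. C^2 * (cmod (f x))^2 \<partial>lborel)"
    by (rule integral_mono[OF L2_sq[OF g2] i b])
  also have "\<dots> = (C * L2norm f)^2" by (simp add: power_mult_distrib L2norm_sq)
  finally show "L2norm g \<le> C * L2norm f" using C by (intro L2norm_le_sq) auto
qed

lemma L2_zero [simp]: "L2 (\<lambda>x. 0)"
  unfolding L2_def by simp

lemma L2_mono: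
  assumes "L2 f" "g \<in> borel_measurable borel" "\<And>x. cmod (g x) \<le> cmod (f x)"
  shows "L2 g" "L2norm g \<le> L2norm f"
  using L2_dom[OF assms(1,2), of 1] assms(3) by auto

lemma L2_integrable_mult:
  assumes "L2 f" "L2 g"
  shows "integrable lborel (\<lambda>x. f x * g x)"
proof (rule Bochner_Integration.integrable_bound)
  show "integrable lborel (\<lambda>x. (cmod (f x))^2 + (cmod (g x))^2)"
    using L2_sq[OF assms(1)] L2_sq[OF assms(2)] by simp
  show "AE x in lborel. norm (f x * g x) \<le> norm ((cmod (f x))^2 + (cmod (g x))^2)"
  proof (rule AE_I2)
    fix x
    have "2 * (cmod (f x) * cmod (g x)) \<le> (cmod (f x))^2 + (cmod (g x))^2"
      using sum_squares_bound[of "cmod (f x)" "cmod (g x)"] by simp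
    moreover have "cmod (f x) * cmod (g x) \<ge> 0" by simp
    ultimately have "cmod (f x) * cmod (g x) \<le> (cmod (f x))^2 + (cmod (g x))^2" by linarith
    then show "norm (f x * g x) \<le> norm ((cmod (f x))^2 + (cmod (g x))^2)"
      by (simp add: norm_mult)
  qed
qed (use assms in \<open>auto dest!: L2_meas\<close>)

lemma measurable_cnj [measurable (raw)]:
  "f \<in> borel_measurable M \<Longrightarrow> (\<lambda>x. cnj (f x)) \<in> borel_measurable M"
  by (rule measurable_compose[OF _ borel_measurable_continuous_onI]) (auto intro: continuous_intros)

lemma L2_cnj: "L2 f \<Longrightarrow> L2 (\<lambda>x. cnj (f x))"
  unfolding L2_def by auto

lemma L2_ip: "L2 f \<Longrightarrow> L2 g \<Longrightarrow> integrable lborel (\<lambda>x. f x * cnj (g x))"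
  by (rule L2_integrable_mult) (auto intro: L2_cnj)

lemma L2_cmult: "L2 f \<Longrightarrow> L2 (\<lambda>x. c * f x)"
  by (rule L2_dom(1)[of f _ "cmod c"]) (auto simp: norm_mult dest: L2_meas)

lemma L2norm_cmult: "L2norm (\<lambda>x. c * f x) = cmod c * L2norm f"
  by (simp add: L2norm_def norm_mult power_mult_distrib real_sqrt_mult)

lemma L2_uminus: "L2 f \<Longrightarrow> L2 (\<lambda>x. - f x)"
  unfolding L2_def by auto

lemma L2norm_uminus: "L2norm (\<lambda>x. - f x) = L2norm f"
  by (simp add: L2norm_def)

lemma L2norm_minus_commute: "L2norm (\<lambda>x. f x - g x) = L2norm (\<lambda>x. g x - f x)"
  by (simp add: L2norm_def norm_minus_commute)

lemma L2_add:
  assumes "L2 f" "L2 g"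
  shows "L2 (\<lambda>x. f x + g x)"
proof (rule L2I)
  have m: "f \<in> borel_measurable borel" "g \<in> borel_measurable borel" using assms by (auto dest: L2_meas)
  then show "(\<lambda>x. f x + g x) \<in> borel_measurable borel" by auto
  show "integrable lborel (\<lambda>x. (cmod (f x + g x))^2)"
  proof (rule Bochner_Integration.integrable_bound)
    show "integrable lborel (\<lambda>x. 2 * (cmod (f x))^2 + 2 * (cmod (g x))^2)"
      using L2_sq[OF assms(1)] L2_sq[OF assms(2)] by simp
    show "AE x in lborel. norm ((cmod (f x + g x))^2) \<le> norm (2 * (cmod (f x))^2 + 2 * (cmod (g x))^2)"
    proof (rule AE_I2)
      fix x
      have "(cmod (f x + g x))^2 \<le> (cmod (f x) + cmod (g x))^2"
        by (intro power_mono norm_triangle_ineq) auto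
      also have "\<dots> \<le> 2 * (cmod (f x))^2 + 2 * (cmod (g x))^2"
        using sum_squares_bound[of "cmod (f x)" "cmod (g x)"] by (simp add: power2_sum)
      finally show "norm ((cmod (f x + g x))^2) \<le> norm (2 * (cmod (f x))^2 + 2 * (cmod (g x))^2)"
        by simp
    qed
  qed (use m in auto)
qed

lemma L2_diff: "L2 f \<Longrightarrow> L2 g \<Longrightarrow> L2 (\<lambda>x. f x - g x)"
  using L2_add[OF _ L2_uminus, of f g] by simp

lemma L2_sum: "(\<And>i. i \<in> I \<Longrightarrow> L2 (f i)) \<Longrightarrow> L2 (\<lambda>x. \<Sum>i\<in>I. f i x)"
  by (induction I rule: infinite_finite_induct) (auto intro!: L2_add)

lemma ip_add_left: "L2 f \<Longrightarrow> L2 g \<Longrightarrow> L2 k \<Longrightarrow> ip (\<lambda>x. f x + g x) k = ip f k + ip g k"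
  unfolding ip_def by (simp add: distrib_right Bochner_Integration.integral_add[OF L2_ip L2_ip])

lemma ip_diff_left: "L2 f \<Longrightarrow> L2 g \<Longrightarrow> L2 k \<Longrightarrow> ip (\<lambda>x. f x - g x) k = ip f k - ip g k"
  unfolding ip_def by (simp add: left_diff_distrib Bochner_Integration.integral_diff[OF L2_ip L2_ip])

lemma ip_diff_right: "L2 f \<Longrightarrow> L2 g \<Longrightarrow> L2 k \<Longrightarrow> ip k (\<lambda>x. f x - g x) = ip k f - ip k g"
  unfolding ip_def by (simp add: right_diff_distrib Bochner_Integration.integral_diff[OF L2_ip L2_ip])

lemma ip_cmult_left: "ip (\<lambda>x. c * f x) g = c * ip f g"
  unfolding ip_def by (simp add: mult.assoc)

lemma ip_cmult_right: "ip f (\<lambda>x. c * g x) = cnj c * ip f g"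
proof -
  have "f x * cnj (c * g x) = cnj c * (f x * cnj (g x))" for x by simp
  then show ?thesis unfolding ip_def by (simp only: integral_mult_right_zero)
qed

lemma ip_zero_left [simp]: "ip (\<lambda>x. 0) g = 0"
  unfolding ip_def by simp

lemma ip_zero_right [simp]: "ip f (\<lambda>x. 0) = 0"
  unfolding ip_def by simp

lemma ip_uminus_left: "ip (\<lambda>x. - f x) g = - ip f g"
  using ip_cmult_left[of "-1" f g] by simp

lemma ip_uminus_right: "ip g (\<lambda>x. - f x) = - ip g f"
  using ip_cmult_right[of g "-1" f] by simp

lemma ip_sum_left: "(\<And>i. i \<in> I \<Longrightarrow> L2 (f i)) \<Longrightarrow> L2 k \<Longrightarrow> ip (\<lambda>x. \<Sum>i\<in>I. f i x) k = (\<Sum>i\<in>I. ip (f i) k)"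
  by (induction I rule: infinite_finite_induct) (auto simp: ip_add_left L2_sum)

lemma ip_shift: "(\<And>x. f x * cnj (g x) = f' x * cnj (g' x)) \<Longrightarrow> ip f g = ip f' g'"
  unfolding ip_def by simp

lemma ip_self: "ip f f = of_real ((L2norm f)^2)"
proof -
  have "ip f f = (\<integral>x. complex_of_real ((cmod (f x))^2) \<partial>lborel)"
    unfolding ip_def by (simp only: complex_norm_square)
  then show ?thesis by (simp only: L2norm_sq integral_complex_of_real)
qed

lemma cmod_ip_le_integral: "L2 f \<Longrightarrow> L2 g \<Longrightarrow> cmod (ip f g) \<le> (\<integral>x. cmod (f x) * cmod (g x) \<partial>lborel)"
  unfolding ip_def using integral_norm_bound[of lborel "\<lambda>x. f x * cnj (g x)"] by (simp add: norm_mult)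

lemma L2_integrable_cmod: "L2 f \<Longrightarrow> L2 g \<Longrightarrow> integrable lborel (\<lambda>x. cmod (f x) * cmod (g x))"
  using integrable_norm[OF L2_ip] by (simp add: norm_mult)

text \<open>The discriminant argument: \<open>q\<close> is a quadratic inequality in the parameter
  s. If f has norm zero it becomes linear in s, and a large s forces the integral to vanish;
  otherwise the optimal s gives the bound.\<close>

lemma integral_cmod_CS:
  assumes f: "L2 f" and g: "L2 g"
  shows "(\<integral>x. cmod (f x) * cmod (g x) \<partial>lborel) \<le> L2norm f * L2norm g"
proof -
  let ?I = "\<integral>x. cmod (f x) * cmod (g x) \<partial>lborel"
  have I0: "?I \<ge> 0" by simp
  have q: "2 * s * ?I \<le> s^2 * (L2norm f)^2 + (L2norm g)^2" for s :: real
  proof -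
    have "2 * s * ?I = (\<integral>x. 2 * s * (cmod (f x) * cmod (g x)) \<partial>lborel)" by simp
    also have "\<dots> \<le> (\<integral>x. s^2 * (cmod (f x))^2 + (cmod (g x))^2 \<partial>lborel)"
    proof (rule integral_mono)
      fix x show "2 * s * (cmod (f x) * cmod (g x)) \<le> s^2 * (cmod (f x))^2 + (cmod (g x))^2"
        using sum_squares_bound[of "s * cmod (f x)" "cmod (g x)"] by (simp add: power_mult_distrib mult_ac)
    qed (use L2_integrable_cmod[OF f g] L2_sq[OF f] L2_sq[OF g] in auto)
    also have "\<dots> = s^2 * (L2norm f)^2 + (L2norm g)^2"
      using L2_sq[OF f] L2_sq[OF g] by (simp add: L2norm_sq)
    finally show ?thesis .
  qed
  show ?thesis
  proof (cases "L2norm f = 0")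
    case True
    have "?I = 0"
    proof (rule ccontr)
      assume "?I \<noteq> 0"
      then have "?I > 0" using I0 by linarith
      then show False using q[of "((L2norm g)^2 + 1) / (2 * ?I)"] True by simp
    qed
    then show ?thesis by simp
  next
    case False
    then have a: "L2norm f > 0" using L2norm_nonneg[of f] by linarith
    have "2 * ?I^2 / (L2norm f)^2 \<le> ?I^2 / (L2norm f)^2 + (L2norm g)^2"
      using q[of "?I / (L2norm f)^2"] a by (simp add: power2_eq_square field_simps)
    then have "?I^2 \<le> (L2norm f * L2norm g)^2"
      using a by (simp add: field_simps power_mult_distrib)
    then show ?thesis by (rule power2_le_imp_le) simp
  qed
qed

lemma ip_CS: "L2 f \<Longrightarrow> L2 g \<Longrightarrow> cmod (ip f g) \<le> L2norm f * L2norm g"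
  using cmod_ip_le_integral integral_cmod_CS by (meson order_trans)

text \<open>Only the product of f and g is compared with F and G, so weights may be redistributed
  between the factors before Cauchy-Schwarz. A non-integrable product has integral 0 by convention,
  which settles the remaining case.\<close>

lemma ip_bound:
  assumes "L2 F" "L2 G" "\<And>x. cmod (f x) * cmod (g x) \<le> C * (cmod (F x) * cmod (G x))" "C \<ge> 0"
  shows "cmod (ip f g) \<le> C * (L2norm F * L2norm G)"
proof (cases "integrable lborel (\<lambda>x. f x * cnj (g x))")
  case True
  have "cmod (ip f g) \<le> (\<integral>x. cmod (f x) * cmod (g x) \<partial>lborel)"
    unfolding ip_def using integral_norm_bound[of lborel "\<lambda>x. f x * cnj (g x)"] by (simp add: norm_mult)
  also have "\<dots> \<le> (\<integral>x. C * (cmod (F x) * cmod (G x)) \<partial>lborel)"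
    using integrable_norm[OF True] L2_integrable_cmod[OF assms(1,2)] assms(3)
    by (intro integral_mono) (auto simp: norm_mult)
  also have "\<dots> \<le> C * (L2norm F * L2norm G)"
    using integral_cmod_CS[OF assms(1,2)] assms(4) by (simp add: mult_left_mono)
  finally show ?thesis .
next
  case False
  then show ?thesis using assms(4) by (simp add: ip_def not_integrable_integral_eq)
qed

lemma L2norm_triangle:
  assumes f: "L2 f" and g: "L2 g"
  shows "L2norm (\<lambda>x. f x + g x) \<le> L2norm f + L2norm g"
proof (rule L2norm_le_sq)
  have "(\<integral>x. (cmod (f x + g x))^2 \<partial>lborel) \<le>
      (\<integral>x. (cmod (f x))^2 + 2 * (cmod (f x) * cmod (g x)) + (cmod (g x))^2 \<partial>lborel)"
  proof (rule integral_mono)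
    fix x
    have "(cmod (f x + g x))^2 \<le> (cmod (f x) + cmod (g x))^2"
      by (intro power_mono norm_triangle_ineq) auto
    then show "(cmod (f x + g x))^2 \<le> (cmod (f x))^2 + 2 * (cmod (f x) * cmod (g x)) + (cmod (g x))^2"
      by (simp add: power2_sum)
  qed (use L2_sq[OF f] L2_sq[OF g] L2_sq[OF L2_add[OF f g]] L2_integrable_cmod[OF f g] in auto)
  also have "\<dots> = (L2norm f)^2 + 2 * (\<integral>x. cmod (f x) * cmod (g x) \<partial>lborel) + (L2norm g)^2"
    using L2_sq[OF f] L2_sq[OF g] L2_integrable_cmod[OF f g] by (simp add: L2norm_sq)
  also have "\<dots> \<le> (L2norm f + L2norm g)^2"
    using integral_cmod_CS[OF f g] by (simp add: power2_sum)
  finally show "(\<integral>x. (cmod (f x + g x))^2 \<partial>lborel) \<le> (L2norm f + L2norm g)^2" .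
qed simp

lemma L2norm_triangle_diff: "L2 f \<Longrightarrow> L2 g \<Longrightarrow> L2norm (\<lambda>x. f x - g x) \<le> L2norm f + L2norm g"
  using L2norm_triangle[OF _ L2_uminus, of f g] by (simp add: L2norm_uminus)

lemma L2norm_triangle_mid:
  assumes "L2 f" "L2 g" "L2 k"
  shows "L2norm (\<lambda>x. f x - k x) \<le> L2norm (\<lambda>x. f x - g x) + L2norm (\<lambda>x. g x - k x)"
  using L2norm_triangle[OF L2_diff[OF assms(1,2)] L2_diff[OF assms(2,3)]] by simp

lemma L2norm_reverse_triangle:
  assumes "L2 f" "L2 g"
  shows "\<bar>L2norm f - L2norm g\<bar> \<le> L2norm (\<lambda>x. f x - g x)"
  using L2norm_triangle[OF L2_diff[OF assms] assms(2)] L2norm_triangle[OF L2_diff[OF assms(2,1)] assms(1)]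
    L2norm_minus_commute[of f g] by simp

lemma L2norm_sum: "(\<And>i. i \<in> I \<Longrightarrow> L2 (f i)) \<Longrightarrow> L2norm (\<lambda>x. \<Sum>i\<in>I. f i x) \<le> (\<Sum>i\<in>I. L2norm (f i))"
proof (induction I rule: infinite_finite_induct)
  case (insert i I)
  then have "L2norm (\<lambda>x. f i x + (\<Sum>i\<in>I. f i x)) \<le> L2norm (f i) + L2norm (\<lambda>x. \<Sum>i\<in>I. f i x)"
    by (intro L2norm_triangle L2_sum) auto
  then show ?case using insert by simp
qed (auto simp: L2norm_def)

section \<open>Convergence and completeness in L^2\<close>

definition L2lim :: "(nat \<Rightarrow> real^'d::finite \<Rightarrow> complex) \<Rightarrow> (real^'d \<Rightarrow> complex) \<Rightarrow> bool" where
  "L2lim F f \<longleftrightarrow> (\<forall>m. L2 (F m)) \<and> L2 f \<and> (\<lambda>m. L2norm (\<lambda>x. F m x - f x)) \<longlonglongrightarrow> 0"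

lemma L2limD: "L2lim F f \<Longrightarrow> L2 (F m)" "L2lim F f \<Longrightarrow> L2 f" "L2lim F f \<Longrightarrow> (\<lambda>m. L2norm (\<lambda>x. F m x - f x)) \<longlonglongrightarrow> 0"
  unfolding L2lim_def by auto

lemma L2lim_const: "L2 f \<Longrightarrow> L2lim (\<lambda>m. f) f"
  unfolding L2lim_def by (simp add: L2norm_def)

lemma L2limI:
  assumes "\<And>m. L2 (F m)" "L2 f" "\<And>m. L2norm (\<lambda>x. F m x - f x) \<le> e m" "e \<longlonglongrightarrow> 0"
  shows "L2lim F f"
  unfolding L2lim_def using assms
  by (auto intro!: tendsto_sandwich[of "\<lambda>_. 0" "\<lambda>m. L2norm (\<lambda>x. F m x - f x)" _ e])

lemma L2lim_add:
  assumes F: "L2lim F f" and G: "L2lim G g"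
  shows "L2lim (\<lambda>m x. F m x + G m x) (\<lambda>x. f x + g x)"
proof (rule L2limI)
  show "L2norm (\<lambda>x. F m x + G m x - (f x + g x)) \<le> L2norm (\<lambda>x. F m x - f x) + L2norm (\<lambda>x. G m x - g x)" for m
    using L2norm_triangle[OF L2_diff[OF L2limD(1)[OF F] L2limD(2)[OF F]] L2_diff[OF L2limD(1)[OF G] L2limD(2)[OF G]], of m m]
    by (simp only: add_diff_add)
  show "(\<lambda>m. L2norm (\<lambda>x. F m x - f x) + L2norm (\<lambda>x. G m x - g x)) \<longlonglongrightarrow> 0"
    using tendsto_add[OF L2limD(3)[OF F] L2limD(3)[OF G]] by simp
qed (use L2limD(1)[OF F] L2limD(2)[OF F] L2limD(1)[OF G] L2limD(2)[OF G] in \<open>auto intro: L2_add\<close>)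

text \<open>The set K makes unbounded multipliers admissible: a bound is required only where the
  functions live, for instance on a ball containing all supports.\<close>

lemma L2lim_mult:
  assumes F: "L2lim F f" and a: "a \<in> borel_measurable borel"
    and b: "\<And>x. x \<in> K \<Longrightarrow> cmod (a x) \<le> C"
    and z: "\<And>m x. x \<notin> K \<Longrightarrow> F m x = 0" "\<And>x. x \<notin> K \<Longrightarrow> f x = 0"
  shows "L2lim (\<lambda>m x. a x * F m x) (\<lambda>x. a x * f x)"
proof -
  have C: "cmod (a x * v) \<le> \<bar>C\<bar> * cmod v" if "x \<notin> K \<Longrightarrow> v = 0" for x v
    using b[of x] that by (cases "x \<in> K") (auto simp: norm_mult intro: mult_right_mono)
  note m = L2_meas[OF L2limD(1)[OF F]] L2_meas[OF L2limD(2)[OF F]]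
  show ?thesis
  proof (rule L2limI)
    show "L2 (\<lambda>x. a x * F m x)" for m
      by (rule L2_dom(1)[OF L2limD(1)[OF F, of m], where C="\<bar>C\<bar>"]) (use C a z m in auto)
    show "L2 (\<lambda>x. a x * f x)"
      by (rule L2_dom(1)[OF L2limD(2)[OF F], where C="\<bar>C\<bar>"]) (use C a z m in auto)
    show "L2norm (\<lambda>x. a x * F m x - a x * f x) \<le> \<bar>C\<bar> * L2norm (\<lambda>x. F m x - f x)" for m
    proof (rule L2_dom(2)[OF L2_diff[OF L2limD(1)[OF F] L2limD(2)[OF F]]])
      show "cmod (a x * F m x - a x * f x) \<le> \<bar>C\<bar> * cmod (F m x - f x)" for x
        using C[of x "F m x - f x"] z(1)[of x m] z(2)[of x] by (simp add: algebra_simps)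
    qed (use a m in auto)
    show "(\<lambda>m. \<bar>C\<bar> * L2norm (\<lambda>x. F m x - f x)) \<longlonglongrightarrow> 0"
      using tendsto_mult_left[OF L2limD(3)[OF F], of "\<bar>C\<bar>"] by simp
  qed
qed

lemma L2lim_cmult: "L2lim F f \<Longrightarrow> L2lim (\<lambda>m x. c * F m x) (\<lambda>x. c * f x)"
  by (rule L2lim_mult[where K=UNIV and C="cmod c"]) auto

lemma L2lim_diff: "L2lim F f \<Longrightarrow> L2lim G g \<Longrightarrow> L2lim (\<lambda>m x. F m x - G m x) (\<lambda>x. f x - g x)"
  using L2lim_add[OF _ L2lim_cmult[of G g "-1"], of F f] by simp

lemma L2lim_sum: "(\<And>i. i \<in> I \<Longrightarrow> L2lim (F i) (f i)) \<Longrightarrow> L2lim (\<lambda>m x. \<Sum>i\<in>I. F i m x) (\<lambda>x. \<Sum>i\<in>I. f i x)"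
  by (induction I rule: infinite_finite_induct) (auto intro: L2lim_add L2lim_const)

lemma L2lim_norm:
  assumes "L2lim F f"
  shows "(\<lambda>m. L2norm (F m)) \<longlonglongrightarrow> L2norm f"
proof (rule LIM_zero_cancel, rule Lim_null_comparison)
  show "\<forall>\<^sub>F m in sequentially. norm (L2norm (F m) - L2norm f) \<le> L2norm (\<lambda>x. F m x - f x)"
    using L2norm_reverse_triangle[OF L2limD(1)[OF assms] L2limD(2)[OF assms]] by simp
qed (rule L2limD(3)[OF assms])

lemma L2lim_ip:
  assumes F: "L2lim F f" and G: "L2lim G g"
  shows "(\<lambda>m. ip (F m) (G m)) \<longlonglongrightarrow> ip f g"
proof -
  have "(\<lambda>m. L2norm (\<lambda>x. F m x - f x) * L2norm (G m) + L2norm f * L2norm (\<lambda>x. G m x - g x)) \<longlonglongrightarrow> 0 * L2norm g + L2norm f * 0"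
    by (intro tendsto_intros L2lim_norm L2limD(3) F G)
  moreover have "cmod (ip (F m) (G m) - ip f g) \<le> L2norm (\<lambda>x. F m x - f x) * L2norm (G m) + L2norm f * L2norm (\<lambda>x. G m x - g x)" for m
  proof -
    note l = L2limD(1)[OF F, of m] L2limD(1)[OF G, of m] L2limD(2)[OF F] L2limD(2)[OF G]
    have "ip (F m) (G m) - ip f g = ip (\<lambda>x. F m x - f x) (G m) + ip f (\<lambda>x. G m x - g x)"
      using l by (simp add: ip_diff_left ip_diff_right)
    moreover have "cmod (ip (\<lambda>x. F m x - f x) (G m)) \<le> L2norm (\<lambda>x. F m x - f x) * L2norm (G m)"
      by (intro ip_CS L2_diff l)
    moreover have "cmod (ip f (\<lambda>x. G m x - g x)) \<le> L2norm f * L2norm (\<lambda>x. G m x - g x)"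
      by (intro ip_CS L2_diff l)
    ultimately show ?thesis by (simp only: norm_triangle_mono)
  qed
  ultimately have "(\<lambda>m. ip (F m) (G m) - ip f g) \<longlonglongrightarrow> 0"
    using Lim_null_comparison[OF always_eventually] by fastforce
  then show ?thesis by (rule LIM_zero_cancel)
qed

lemma L2norm_zero_AE: "L2 f \<Longrightarrow> L2norm f = 0 \<Longrightarrow> AE x in lborel. f x = 0"
  using integral_nonneg_eq_0_iff_AE[OF L2_sq, of f] by (auto simp: L2norm_def)

lemma L2lim_unique:
  assumes F: "L2lim F f" and G: "L2lim F g"
  shows "AE x in lborel. f x = g x"
proof -
  have "(\<lambda>m. L2norm (\<lambda>x. F m x - F m x - (f x - g x))) \<longlonglongrightarrow> 0"
    using L2lim_diff[OF F G] by (rule L2limD(3))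
  then have "L2norm (\<lambda>x. f x - g x) = 0"
    using L2norm_uminus[of "\<lambda>x. f x - g x"] by (simp add: LIMSEQ_const_iff)
  from L2norm_zero_AE[OF L2_diff[OF L2limD(2)[OF F] L2limD(2)[OF G]] this] show ?thesis by auto
qed

lemma L2norm_cong_AE:
  assumes "AE x in lborel. f x = g x" "f \<in> borel_measurable borel" "g \<in> borel_measurable borel"
  shows "L2norm f = L2norm g" "L2 f = L2 g"
proof -
  show "L2norm f = L2norm g" unfolding L2norm_def
    using assms by (intro arg_cong[where f=sqrt] integral_cong_AE) auto
  show "L2 f = L2 g" unfolding L2_def
    using assms by (intro arg_cong2[where f="(\<and>)"] integrable_cong_AE) auto
qed

text \<open>The Riesz-Fischer argument: a fast subsequence converges almost everywhere, and Fatou's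
  lemma shows that its limit is the L^2 limit of the whole sequence.\<close>

lemma L2_complete:
  fixes F :: "nat \<Rightarrow> real^'d::finite \<Rightarrow> complex"
  assumes F: "\<And>m. L2 (F m)"
    and Cauchy: "\<And>e. e > 0 \<Longrightarrow> \<exists>N. \<forall>m\<ge>N. \<forall>k\<ge>N. L2norm (\<lambda>x. F m x - F k x) < e"
  obtains f where "L2lim F f"
proof -
  have Fm[measurable]: "F m \<in> borel_measurable borel" for m using F by (rule L2_meas)
  define N where "N i = (SOME N. \<forall>m\<ge>N. \<forall>k\<ge>N. L2norm (\<lambda>x. F m x - F k x) < (1/2)^(2*i))" for i :: nat
  have N: "L2norm (\<lambda>x. F m x - F k x) < (1/2)^(2*i)" if "m \<ge> N i" "k \<ge> N i" for i m k
    unfolding N_def using someI_ex[OF Cauchy[of "(1/2)^(2*i)"]] that N_def by auto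
  \<comment> \<open>Adding up the thresholds makes \<open>r i\<close> exceed \<open>N i\<close>,
    keeps \<open>r (Suc i)\<close> above \<open>N i\<close> as well, and gives
    \<open>r i \<ge> i\<close>.\<close>
  define r where "r i = i + (\<Sum>l\<le>i. N l)" for i
  have rN: "r i \<ge> N i" for i unfolding r_def by (simp add: trans_le_add2 member_le_sum)
  have rS: "r (Suc i) \<ge> N i" for i
    using rN[of i] unfolding r_def by simp
  have ri: "r i \<ge> i" for i unfolding r_def by simp
  \<comment> \<open>Successive differences have norm at most 4^(-i). Squared and multiplied by 4^i
    they remain summable, while a finite sum at x bounds the increments at x by a multiple of
    2^(-i).\<close>
  define G where "G i x = 4^i * (cmod (F (r (Suc i)) x - F (r i) x))^2" for i x
  have Gm[measurable]: "G i \<in> borel_measurable borel" for i unfolding G_def by measurable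
  have G0: "G i x \<ge> 0" for i x unfolding G_def by simp
  have Gi: "(\<integral>\<^sup>+x. ennreal (G i x) \<partial>lborel) \<le> ennreal ((1/2)^i)" for i
  proof -
    have I: "integrable lborel (G i)" unfolding G_def using L2_sq[OF L2_diff[OF F F]] by simp
    have "(\<integral>x. G i x \<partial>lborel) = 4^i * (L2norm (\<lambda>x. F (r (Suc i)) x - F (r i) x))^2"
      unfolding G_def by (simp add: L2norm_sq)
    also have "\<dots> \<le> 4^i * ((1/2)^(2*i))^2"
      using N[OF rS rN, of i] by (intro mult_left_mono power_mono) auto
    also have "((1/2::real)^(2*i))^2 = ((1/2)^4)^i"
      by (simp only: power_mult[symmetric]) (simp add: mult_ac)
    also have "4^i * ((1/2::real)^4)^i = (1/4)^i"
      by (simp only: power_mult_distrib[symmetric]) (simp add: power4_eq_xxxx)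
    also have "\<dots> \<le> (1/2)^i" by (intro power_mono) auto
    finally show ?thesis using I G0 by (subst nn_integral_eq_integral) (auto intro: ennreal_leI)
  qed
  have "(\<integral>\<^sup>+x. (\<Sum>i. ennreal (G i x)) \<partial>lborel) = (\<Sum>i. (\<integral>\<^sup>+x. ennreal (G i x) \<partial>lborel))"
    by (rule nn_integral_suminf) simp
  also have "\<dots> \<le> (\<Sum>i. ennreal ((1/2)^i))" by (intro suminf_le Gi) auto
  also have "\<dots> < \<infinity>"
    by (subst suminf_ennreal2) (auto intro!: summable_geometric)
  finally have "AE x in lborel. (\<Sum>i. ennreal (G i x)) \<noteq> \<infinity>"
    by (intro nn_integral_PInf_AE) auto
  then have conv: "AE x in lborel. convergent (\<lambda>i. F (r i) x)"
  proof eventually_elim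
    fix x assume fin: "(\<Sum>i. ennreal (G i x)) \<noteq> \<infinity>"
    define S where "S = enn2real (\<Sum>i. ennreal (G i x))"
    have "ennreal (G i x) \<le> ennreal S" for i
      unfolding S_def using fin sum_le_suminf[of "\<lambda>i. ennreal (G i x)" "{i}"] by (simp add: less_top)
    then have GS: "G i x \<le> S" for i unfolding S_def by (subst (asm) ennreal_le_iff) auto
    have bd: "norm (F (r (Suc i)) x - F (r i) x) \<le> sqrt S * (1/2)^i" for i
    proof (rule power2_le_imp_le)
      have "S \<ge> 0" unfolding S_def by simp
      have "(norm (F (r (Suc i)) x - F (r i) x))^2 \<le> S / 4^i"
        using GS[of i] unfolding G_def by (simp add: field_simps)
      also have "\<dots> = (sqrt S * (1/2)^i)^2"
        using \<open>S \<ge> 0\<close> by (simp add: power_mult_distrib power_divide flip: power_mult) (simp add: power_mult mult.commute[of i])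
      finally show "(norm (F (r (Suc i)) x - F (r i) x))^2 \<le> (sqrt S * (1/2)^i)^2" .
      show "0 \<le> sqrt S * (1/2)^i" using \<open>S \<ge> 0\<close> by simp
    qed
    have "summable (\<lambda>i. F (r (Suc i)) x - F (r i) x)"
      by (rule summable_comparison_test'[of "\<lambda>i. sqrt S * (1/2)^i" 0]) (use bd in \<open>auto intro!: summable_mult summable_geometric\<close>)
    then show "convergent (\<lambda>i. F (r i) x)" 
      using sum_lessThan_telescope[of "\<lambda>i. F (r i) x"]
      by (simp add: summable_iff_convergent convergent_diff_const_right_iff)
  qed
  \<comment> \<open>\<open>lim\<close> is arbitrary on the null set where the subsequence diverges,
    but f is measurable everywhere.\<close>
  define f where "f x = lim (\<lambda>i. F (r i) x)" for x
  have fm[measurable]: "f \<in> borel_measurable borel" unfolding f_def by measurable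
  have fl: "AE x in lborel. (\<lambda>i. F (r i) x) \<longlonglongrightarrow> f x"
    using conv unfolding f_def by eventually_elim (simp add: convergent_LIMSEQ_iff)
  have fat: "(\<integral>\<^sup>+x. ennreal ((cmod (F m x - f x))^2) \<partial>lborel) \<le> ennreal (((1/2)^(2*i))^2)" if m: "m \<ge> N i" for m i
  proof -
    have "(\<integral>\<^sup>+x. ennreal ((cmod (F m x - f x))^2) \<partial>lborel) = (\<integral>\<^sup>+x. liminf (\<lambda>k. ennreal ((cmod (F m x - F (r k) x))^2)) \<partial>lborel)"
    proof (rule nn_integral_cong_AE, use fl in eventually_elim)
      fix x assume "(\<lambda>i. F (r i) x) \<longlonglongrightarrow> f x"
      then have "(\<lambda>k. ennreal ((cmod (F m x - F (r k) x))^2)) \<longlonglongrightarrow> ennreal ((cmod (F m x - f x))^2)"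
        by (intro tendsto_intros)
      from lim_imp_Liminf[OF sequentially_bot this] show "ennreal ((cmod (F m x - f x))^2) = liminf (\<lambda>k. ennreal ((cmod (F m x - F (r k) x))^2))"
        by (rule sym)
    qed
    also have "\<dots> \<le> liminf (\<lambda>k. \<integral>\<^sup>+x. ennreal ((cmod (F m x - F (r k) x))^2) \<partial>lborel)"
      by (rule nn_integral_liminf) simp
    also have "\<dots> \<le> ennreal (((1/2)^(2*i))^2)"
    proof (rule order_trans[OF Liminf_le_Limsup], simp, rule Limsup_bounded)
      show "\<forall>\<^sub>F k in sequentially. (\<integral>\<^sup>+x. ennreal ((cmod (F m x - F (r k) x))^2) \<partial>lborel) \<le> ennreal (((1/2)^(2*i))^2)"
        using eventually_ge_at_top[of "N i"]
      proof eventually_elim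
        fix k assume k: "k \<ge> N i"
        then have "r k \<ge> N i" using ri[of k] by simp
        then have "(L2norm (\<lambda>x. F m x - F (r k) x))^2 \<le> ((1/2)^(2*i))^2"
          using N[OF m] by (intro power_mono) (auto intro: less_imp_le)
        then show "(\<integral>\<^sup>+x. ennreal ((cmod (F m x - F (r k) x))^2) \<partial>lborel) \<le> ennreal (((1/2)^(2*i))^2)"
          using L2_sq[OF L2_diff[OF F F], of m "r k"]
          by (subst nn_integral_eq_integral) (auto simp: L2norm_sq intro!: ennreal_leI)
      qed
    qed
    finally show ?thesis .
  qed
  have D: "L2 (\<lambda>x. F m x - f x) \<and> L2norm (\<lambda>x. F m x - f x) \<le> (1/2)^(2*i)" if m: "m \<ge> N i" for m i
  proof
    have int: "integrable lborel (\<lambda>x. (cmod (F m x - f x))^2)"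
      by (rule integrableI_bounded) (use fat[OF m] in \<open>auto intro: le_less_trans\<close>)
    then show "L2 (\<lambda>x. F m x - f x)" by (intro L2I) auto
    have "ennreal (\<integral>x. (cmod (F m x - f x))^2 \<partial>lborel) \<le> ennreal (((1/2)^(2*i))^2)"
      using fat[OF m] int by (subst (asm) nn_integral_eq_integral) auto
    then show "L2norm (\<lambda>x. F m x - f x) \<le> (1/2)^(2*i)"
      by (intro L2norm_le_sq) (auto simp: ennreal_le_iff)
  qed
  have "L2 f" using L2_diff[OF F[of "N 0"] conjunct1[OF D[of 0 "N 0"]]] by simp
  have "(\<lambda>m. L2norm (\<lambda>x. F m x - f x)) \<longlonglongrightarrow> 0"
  proof (rule LIMSEQ_I)
    fix e :: real assume "e > 0"
    then obtain i where i: "(1/2)^i < e" using real_arch_pow_inv[of e "1/2"] by auto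
    have "(1/2::real)^(2*i) \<le> (1/2)^i" by (intro power_decreasing) auto
    then have "L2norm (\<lambda>x. F n x - f x) < e" if "n \<ge> N i" for n
      using D[OF that] i by linarith
    then show "\<exists>no. \<forall>n\<ge>no. norm (L2norm (\<lambda>x. F n x - f x) - 0) < e"
      by (intro exI[of _ "N i"]) simp
  qed
  then have "L2lim F f" using F \<open>L2 f\<close> unfolding L2lim_def by blast
  then show ?thesis by (rule that)
qed

section \<open>Test functions and convolution\<close>

lemma test_smooth: "test_fun \<phi> \<Longrightarrow> smooth \<phi>"
  unfolding test_fun_def by simp

lemma test_cont: "test_fun \<phi> \<Longrightarrow> continuous_on UNIV \<phi>"
  by (rule smooth_cont[OF test_smooth])

lemma test_meas [measurable_dest]: "test_fun \<phi> \<Longrightarrow> \<phi> \<in> borel_measurable borel"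
  by (rule borel_measurable_continuous_onI[OF test_cont])

lemma smooth_meas: "smooth \<phi> \<Longrightarrow> (\<phi> :: real^'d::finite \<Rightarrow> 'a::real_normed_vector) \<in> borel_measurable borel"
  by (rule borel_measurable_continuous_onI[OF smooth_cont])

lemma test_compact: "test_fun \<phi> \<Longrightarrow> \<exists>K. compact K \<and> (\<forall>x. x \<notin> K \<longrightarrow> \<phi> x = 0)"
  unfolding test_fun_def by simp

lemma test_zero: "test_fun (\<lambda>x. 0)"
  unfolding test_fun_def using smooth_const[of "0::complex"] compact_empty by blast

lemma test_add:
  assumes "test_fun f" "test_fun g"
  shows "test_fun (\<lambda>x. f x + g x)"
proof -
  obtain K K' where "compact K" "\<forall>x. x \<notin> K \<longrightarrow> f x = 0" "compact K'" "\<forall>x. x \<notin> K' \<longrightarrow> g x = 0"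
    using assms test_compact by metis
  then have "compact (K \<union> K')" "\<forall>x. x \<notin> K \<union> K' \<longrightarrow> f x + g x = 0" by auto
  then show ?thesis unfolding test_fun_def
    using smooth_add[OF test_smooth[OF assms(1)] test_smooth[OF assms(2)]] by blast
qed

lemma test_mult: "smooth a \<Longrightarrow> test_fun f \<Longrightarrow> test_fun (\<lambda>x. a x * f x)"
  unfolding test_fun_def using smooth_mult by (metis mult_zero_right)

lemma test_cmult: "test_fun f \<Longrightarrow> test_fun (\<lambda>x. c * f x)"
  by (rule test_mult[OF smooth_const])

lemma test_uminus: "test_fun f \<Longrightarrow> test_fun (\<lambda>x. - f x)"
  using test_cmult[of f "-1"] by simp

lemma test_diff: "test_fun f \<Longrightarrow> test_fun g \<Longrightarrow> test_fun (\<lambda>x. f x - g x)"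
  using test_add[OF _ test_uminus, of f g] by simp

lemma test_sum: "(\<And>i. i \<in> I \<Longrightarrow> test_fun (f i)) \<Longrightarrow> test_fun (\<lambda>x. \<Sum>i\<in>I. f i x)"
  by (induction I rule: infinite_finite_induct) (auto intro: test_zero test_add)

lemma test_cnj: "test_fun f \<Longrightarrow> test_fun (\<lambda>x. cnj (f x))"
  unfolding test_fun_def using smooth_cnj by (metis complex_cnj_zero)

lemma pd_vanish:
  assumes "closed K" "\<And>x. x \<notin> K \<Longrightarrow> f x = 0" "x \<notin> K"
  shows "pd j f x = 0"
proof -
  have "pd j f x = pd j (\<lambda>x. 0) x"
    by (rule pd_eq_on_open[of "- K"]) (use assms in auto)
  then show ?thesis by (simp add: pd_const)
qed

lemma test_pd:
  assumes "test_fun f" shows "test_fun (pd j f)"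
proof -
  obtain K where K: "compact K" "\<forall>x. x \<notin> K \<longrightarrow> f x = 0" using test_compact[OF assms] by blast
  then have "\<forall>x. x \<notin> K \<longrightarrow> pd j f x = 0" using pd_vanish[of K f] compact_imp_closed by blast
  then show ?thesis unfolding test_fun_def using K(1) smooth_pd[OF test_smooth[OF assms]] by blast
qed

lemma test_affine:
  assumes "test_fun f" "c \<noteq> 0"
  shows "test_fun (\<lambda>y. f (a + c *\<^sub>R y))"
proof -
  obtain K where K: "compact K" "\<forall>x. x \<notin> K \<longrightarrow> f x = 0" using test_compact[OF assms(1)] by blast
  have "compact ((\<lambda>x. (1/c) *\<^sub>R (x - a)) ` K)"
    by (intro compact_continuous_image continuous_intros K)
  moreover have "f (a + c *\<^sub>R y) = 0" if "y \<notin> (\<lambda>x. (1/c) *\<^sub>R (x - a)) ` K" for y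
  proof (rule ccontr)
    assume "f (a + c *\<^sub>R y) \<noteq> 0"
    then have "a + c *\<^sub>R y \<in> K" using K(2) by blast
    then have "(1/c) *\<^sub>R ((a + c *\<^sub>R y) - a) \<in> (\<lambda>x. (1/c) *\<^sub>R (x - a)) ` K" by blast
    then show False using that assms(2) by simp
  qed
  ultimately show ?thesis unfolding test_fun_def
    using smooth_affine[OF test_smooth[OF assms(1)]] by blast
qed

lemma test_reflect: "test_fun f \<Longrightarrow> test_fun (\<lambda>y. f (x - y))"
  using test_affine[of f "-1" x] by simp

lemma pd_reflect: "smooth f \<Longrightarrow> pd j (\<lambda>y. f (x - y)) y = - pd j f (x - y)"
  using pd_affine[of f j x "-1" y] by simp

lemma compact_supp_bounded:
  fixes f :: "real^'d::finite \<Rightarrow> complex"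
  assumes "continuous_on UNIV f" "compact K" "\<And>x. x \<notin> K \<Longrightarrow> f x = 0"
  obtains C where "C \<ge> 0" "\<And>x. cmod (f x) \<le> C"
proof -
  have "bounded (f ` K)"
    by (intro compact_imp_bounded compact_continuous_image continuous_on_subset[OF assms(1)] assms(2)) auto
  then obtain C where C: "\<And>x. x \<in> K \<Longrightarrow> cmod (f x) \<le> C" unfolding bounded_iff by auto
  show ?thesis
  proof (rule that[of "max C 0"])
    show "cmod (f x) \<le> max C 0" for x using C[of x] assms(3)[of x] by (cases "x \<in> K") auto
  qed simp
qed

lemma test_bounded:
  assumes "test_fun \<phi>" obtains C where "C \<ge> 0" "\<And>x. cmod (\<phi> x) \<le> C"
  using compact_supp_bounded[OF test_cont[OF assms]] test_compact[OF assms] by metis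

lemma compact_supp_integrable:
  fixes f :: "real^'d::finite \<Rightarrow> 'a::{banach, second_countable_topology}"
  assumes "continuous_on UNIV f" "compact K" "\<And>x. x \<notin> K \<Longrightarrow> f x = 0"
  shows "integrable lborel f"
proof -
  have "(\<lambda>x. indicator K x *\<^sub>R f x) = f" using assms(3) by (auto simp: fun_eq_iff indicator_def)
  then show ?thesis
    using borel_integrable_compact[OF assms(2) continuous_on_subset[OF assms(1), of K]] by simp
qed

lemma test_integrable: "test_fun \<phi> \<Longrightarrow> integrable lborel \<phi>"
  using compact_supp_integrable[OF test_cont] test_compact by metis

lemma compact_supp_L2:
  assumes "continuous_on UNIV f" "compact K" "\<And>x. x \<notin> K \<Longrightarrow> f x = 0"
  shows "L2 f"
proof (rule L2I)
  show "f \<in> borel_measurable borel" by (rule borel_measurable_continuous_onI[OF assms(1)])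
  show "integrable lborel (\<lambda>x. (cmod (f x))^2)"
    by (rule compact_supp_integrable[OF _ assms(2)]) (auto intro!: continuous_intros assms)
qed

lemma test_L2: "test_fun \<phi> \<Longrightarrow> L2 \<phi>"
  using compact_supp_L2[OF test_cont] test_compact by metis

lemma integrable_mult_bounded:
  fixes F :: "real^'d::finite \<Rightarrow> complex"
  assumes "integrable lborel F" "g \<in> borel_measurable borel" "\<And>x. cmod (g x) \<le> C"
  shows "integrable lborel (\<lambda>x. F x * g x)"
proof (rule Bochner_Integration.integrable_bound)
  show "integrable lborel (\<lambda>x. of_real \<bar>C\<bar> * F x)" using assms(1) by simp
  show "(\<lambda>x. F x * g x) \<in> borel_measurable lborel"
    using borel_measurable_integrable[OF assms(1)] assms(2) by simp
  show "AE x in lborel. norm (F x * g x) \<le> norm (of_real \<bar>C\<bar> * F x)"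
  proof (rule AE_I2)
    fix x
    have "cmod (F x) * cmod (g x) \<le> cmod (F x) * \<bar>C\<bar>"
      using assms(3)[of x] by (intro mult_left_mono) auto
    then show "norm (F x * g x) \<le> norm (of_real \<bar>C\<bar> * F x)" by (simp add: norm_mult mult.commute)
  qed
qed

lemma smooth_mean_value:
  fixes f :: "real^'d::finite \<Rightarrow> complex"
  assumes "smooth f" "\<And>x. cmod (pd j f x) \<le> C"
  shows "cmod (f (x + t *\<^sub>R axis j 1) - f x) \<le> C * \<bar>t\<bar>"
proof -
  have "norm (f (x + t *\<^sub>R axis j 1) - f (x + 0 *\<^sub>R axis j 1)) \<le> C * norm (t - 0)"
  proof (rule differentiable_bound[of UNIV "\<lambda>t. f (x + t *\<^sub>R axis j 1)"])
    fix s :: real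
    show "((\<lambda>t. f (x + t *\<^sub>R axis j 1)) has_derivative (\<lambda>h. h *\<^sub>R pd j f (x + s *\<^sub>R axis j 1))) (at s within UNIV)"
      using haspd_shift[OF smooth_haspd[OF assms(1)]] by (simp add: has_vector_derivative_def)
    show "onorm (\<lambda>h. h *\<^sub>R pd j f (x + s *\<^sub>R axis j 1)) \<le> C"
    proof (rule onorm_bound)
      show "0 \<le> C" by (rule order_trans[OF norm_ge_zero assms(2)])
      show "norm (h *\<^sub>R pd j f (x + s *\<^sub>R axis j 1)) \<le> C * norm h" for h :: real
        using mult_left_mono[OF assms(2)[of "x + s *\<^sub>R axis j 1"], of "\<bar>h\<bar>"] by (simp add: mult.commute)
    qed
  qed auto
  then show ?thesis by simp
qed

text \<open>Dominated convergence is a statement about sequences, so derivatives of parameter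
  integrals are obtained from difference quotients along null sequences.\<close>

lemma has_vector_derivative_sequentiallyI:
  fixes f :: "real \<Rightarrow> complex"
  assumes "\<And>X. (\<And>n. X n \<noteq> 0) \<Longrightarrow> X \<longlonglongrightarrow> 0 \<Longrightarrow> (\<lambda>n. (f (X n) - f 0) / of_real (X n)) \<longlonglongrightarrow> d"
  shows "(f has_vector_derivative d) (at 0)"
proof -
  have "((\<lambda>t. (f t - f 0) / of_real t) \<longlongrightarrow> d) (at 0)"
    unfolding tendsto_at_iff_sequentially using assms by (auto simp: o_def)
  then have "((\<lambda>t. norm ((f t - f 0) / of_real t - d)) \<longlongrightarrow> 0) (at 0)"
    by (intro tendsto_norm_zero LIM_zero)
  moreover have "\<forall>\<^sub>F t in at 0. norm ((f t - f 0) / of_real t - d) = norm (f t - f 0 - (t - 0) *\<^sub>R d) / norm (t - 0)"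
    unfolding eventually_at_filter
  proof (intro always_eventually allI impI)
    fix t :: real assume "t \<noteq> 0"
    then have "(f t - f 0) / of_real t - d = (f t - f 0 - of_real t * d) / of_real t"
      by (simp add: field_simps)
    then show "norm ((f t - f 0) / of_real t - d) = norm (f t - f 0 - (t - 0) *\<^sub>R d) / norm (t - 0)"
      by (simp add: norm_divide scaleR_conv_of_real)
  qed
  ultimately have "((\<lambda>t. norm (f t - f 0 - (t - 0) *\<^sub>R d) / norm (t - 0)) \<longlongrightarrow> 0) (at 0)"
    by (rule Lim_transform_eventually)
  then show ?thesis
    unfolding has_vector_derivative_def has_derivative_iff_norm by (simp add: bounded_linear_scaleR_left)
qed

section \<open>Convolution with a test function\<close>

definition conv :: "(real^'d::finite \<Rightarrow> complex) \<Rightarrow> (real^'d \<Rightarrow> complex) \<Rightarrow> real^'d \<Rightarrow> complex" where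
  "conv \<rho> F x = (\<integral>y. F y * \<rho> (x - y) \<partial>lborel)"

lemma conv_integrable:
  assumes "integrable lborel F" "test_fun \<rho>"
  shows "integrable lborel (\<lambda>y. F y * \<rho> (x - y))"
proof -
  obtain C where "\<And>x. cmod (\<rho> x) \<le> C" using test_bounded[OF assms(2)] by blast
  then show ?thesis
    using integrable_mult_bounded[OF assms(1) test_meas[OF test_reflect[OF assms(2)]]] by blast
qed

text \<open>All regularity comes from the kernel: by the mean value inequality its difference
  quotients are bounded uniformly, so a constant times |F| dominates the integrands.\<close>

lemma haspd_conv:
  assumes F: "integrable lborel F" and \<rho>: "test_fun \<rho>"
  shows "haspd j (conv \<rho> F) x (conv (pd j \<rho>) F x)"
  unfolding haspd_def
proof (rule has_vector_derivative_sequentiallyI)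
  fix X :: "nat \<Rightarrow> real" assume X0: "\<And>n. X n \<noteq> 0" and X: "X \<longlonglongrightarrow> 0"
  let ?e = "axis j 1 :: real^'a"
  obtain C where C: "\<And>x. cmod (pd j \<rho> x) \<le> C" using test_bounded[OF test_pd[OF \<rho>]] by blast
  have Fm[measurable]: "F \<in> borel_measurable borel" using borel_measurable_integrable[OF F] by simp
  note rm[measurable] = test_meas[OF \<rho>] test_meas[OF test_pd[OF \<rho>]]
  define s where "s n y = F y * ((\<rho> (x + X n *\<^sub>R ?e - y) - \<rho> (x - y)) / of_real (X n))" for n y
  have eq: "(conv \<rho> F (x + X n *\<^sub>R ?e) - conv \<rho> F (x + 0 *\<^sub>R ?e)) / of_real (X n) = (\<integral>y. s n y \<partial>lborel)" for n
  proof -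
    have "(\<integral>y. s n y \<partial>lborel) = (\<integral>y. (F y * \<rho> (x + X n *\<^sub>R ?e - y) - F y * \<rho> (x - y)) / of_real (X n) \<partial>lborel)"
      unfolding s_def by (simp add: right_diff_distrib)
    also have "\<dots> = (conv \<rho> F (x + X n *\<^sub>R ?e) - conv \<rho> F x) / of_real (X n)"
      unfolding conv_def integral_divide_zero by (subst Bochner_Integration.integral_diff) (auto intro!: conv_integrable[OF F \<rho>])
    finally show ?thesis by simp
  qed
  have "(\<lambda>n. \<integral>y. s n y \<partial>lborel) \<longlonglongrightarrow> (\<integral>y. F y * pd j \<rho> (x - y) \<partial>lborel)"
  proof (rule integral_dominated_convergence)
    show "integrable lborel (\<lambda>y. \<bar>C\<bar> * norm (F y))" using F by simp
    show "AE y in lborel. (\<lambda>n. s n y) \<longlonglongrightarrow> F y * pd j \<rho> (x - y)"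
    proof (rule AE_I2)
      fix y
      have "((\<lambda>t. \<rho> ((x - y) + t *\<^sub>R ?e)) has_derivative (\<lambda>h. h *\<^sub>R pd j \<rho> (x - y))) (at 0)"
        using smooth_haspd[OF test_smooth[OF \<rho>]] unfolding haspd_def has_vector_derivative_def by blast
      then have "((\<lambda>t. norm ((\<rho> ((x - y) + t *\<^sub>R ?e) - \<rho> (x - y)) - t *\<^sub>R pd j \<rho> (x - y)) / norm t) \<longlongrightarrow> 0) (at 0)"
        unfolding has_derivative_iff_norm by simp
      then have "(\<lambda>n. norm ((\<rho> ((x - y) + X n *\<^sub>R ?e) - \<rho> (x - y)) - X n *\<^sub>R pd j \<rho> (x - y)) / norm (X n)) \<longlonglongrightarrow> 0"
        unfolding tendsto_at_iff_sequentially using X0 X by (auto simp: o_def)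
      moreover have "norm ((\<rho> ((x - y) + X n *\<^sub>R ?e) - \<rho> (x - y)) - X n *\<^sub>R pd j \<rho> (x - y)) / norm (X n)
         = norm ((\<rho> (x + X n *\<^sub>R ?e - y) - \<rho> (x - y)) / of_real (X n) - pd j \<rho> (x - y))" for n
      proof -
        have "(\<rho> (x + X n *\<^sub>R ?e - y) - \<rho> (x - y)) / of_real (X n) - pd j \<rho> (x - y)
           = ((\<rho> (x + X n *\<^sub>R ?e - y) - \<rho> (x - y)) - of_real (X n) * pd j \<rho> (x - y)) / of_real (X n)"
          using X0[of n] by (simp add: field_simps)
        then show ?thesis by (simp add: norm_divide scaleR_conv_of_real algebra_simps)
      qed
      ultimately have "(\<lambda>n. norm ((\<rho> (x + X n *\<^sub>R ?e - y) - \<rho> (x - y)) / of_real (X n) - pd j \<rho> (x - y))) \<longlonglongrightarrow> 0"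
        by (simp only:)
      then have "(\<lambda>n. (\<rho> (x + X n *\<^sub>R ?e - y) - \<rho> (x - y)) / of_real (X n)) \<longlonglongrightarrow> pd j \<rho> (x - y)"
        by (rule LIM_zero_cancel[OF tendsto_norm_zero_cancel])
      then show "(\<lambda>n. s n y) \<longlonglongrightarrow> F y * pd j \<rho> (x - y)"
        unfolding s_def by (rule tendsto_mult_left)
    qed
    show "AE y in lborel. norm (s n y) \<le> \<bar>C\<bar> * norm (F y)" for n
    proof (rule AE_I2)
      fix y
      have "cmod (\<rho> ((x - y) + X n *\<^sub>R ?e) - \<rho> (x - y)) \<le> C * \<bar>X n\<bar>"
        by (rule smooth_mean_value[OF test_smooth[OF \<rho>] C])
      then have "cmod ((\<rho> (x + X n *\<^sub>R ?e - y) - \<rho> (x - y)) / of_real (X n)) \<le> C"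
        using X0[of n] by (simp add: norm_divide divide_le_eq algebra_simps)
      then show "norm (s n y) \<le> \<bar>C\<bar> * norm (F y)"
        unfolding s_def norm_mult by (subst mult.commute) (rule mult_right_mono, auto)
    qed
    show "(\<lambda>y. F y * pd j \<rho> (x - y)) \<in> borel_measurable lborel"
      by measurable
    show "s n \<in> borel_measurable lborel" for n unfolding s_def by measurable
  qed
  then show "(\<lambda>n. (conv \<rho> F (x + X n *\<^sub>R ?e) - conv \<rho> F (x + 0 *\<^sub>R ?e)) / of_real (X n)) \<longlonglongrightarrow> conv (pd j \<rho>) F x"
    unfolding eq by (simp only: conv_def)
qed

lemma continuous_conv:
  assumes F: "integrable lborel F" and \<rho>: "test_fun \<rho>"
  shows "continuous_on UNIV (conv \<rho> F)"
proof -
  have [measurable]: "F \<in> borel_measurable borel" using borel_measurable_integrable[OF F] by simp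
  note [measurable] = test_meas[OF \<rho>]
  obtain C where C: "\<And>x. cmod (\<rho> x) \<le> C" using test_bounded[OF \<rho>] by blast
  have "continuous (at x) (conv \<rho> F)" for x
  proof (rule continuous_at_sequentiallyI)
    fix X assume X: "X \<longlonglongrightarrow> x"
    show "(\<lambda>n. conv \<rho> F (X n)) \<longlonglongrightarrow> conv \<rho> F x"
      unfolding conv_def
    proof (rule integral_dominated_convergence)
      show "integrable lborel (\<lambda>y. \<bar>C\<bar> * norm (F y))" using F by simp
      show "AE y in lborel. norm (F y * \<rho> (X n - y)) \<le> \<bar>C\<bar> * norm (F y)" for n
      proof (rule AE_I2)
        fix y show "norm (F y * \<rho> (X n - y)) \<le> \<bar>C\<bar> * norm (F y)"
          unfolding norm_mult by (subst mult.commute) (rule mult_right_mono, use C[of "X n - y"] in auto)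
      qed
      show "AE y in lborel. (\<lambda>n. F y * \<rho> (X n - y)) \<longlonglongrightarrow> F y * \<rho> (x - y)"
      proof (rule AE_I2)
        fix y
        have "isCont \<rho> (x - y)" using test_cont[OF \<rho>] by (simp add: continuous_on_eq_continuous_at)
        then show "(\<lambda>n. F y * \<rho> (X n - y)) \<longlonglongrightarrow> F y * \<rho> (x - y)"
          by (intro tendsto_mult_left isCont_tendsto_compose[of _ \<rho>]) (auto intro!: tendsto_intros X)
      qed
    qed measurable
  qed
  then show ?thesis by (simp add: continuous_on_eq_continuous_at)
qed

lemma smooth_conv:
  assumes F: "integrable lborel F" and \<rho>: "test_fun \<rho>"
  shows "smooth (conv \<rho> F)"
proof (rule smooth_coinduct[where S="{conv \<rho> F | \<rho>. test_fun \<rho>}"])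
  show "conv \<rho> F \<in> {conv \<rho> F | \<rho>. test_fun \<rho>}" using \<rho> by blast
  show "continuous_on UNIV g" if "g \<in> {conv \<rho> F | \<rho>. test_fun \<rho>}" for g
    using that continuous_conv[OF F] by blast
  show "\<exists>g'\<in>{conv \<rho> F | \<rho>. test_fun \<rho>}. \<forall>x. haspd j g x (g' x)" if "g \<in> {conv \<rho> F | \<rho>. test_fun \<rho>}" for g j
    using that haspd_conv[OF F] test_pd by blast
qed

lemma pd_conv: "integrable lborel F \<Longrightarrow> test_fun \<rho> \<Longrightarrow> pd j (conv \<rho> F) x = conv (pd j \<rho>) F x"
  by (intro haspd_pd haspd_conv)

lemma test_conv:
  assumes F: "integrable lborel F" and \<rho>: "test_fun \<rho>"
    and K: "\<And>x. norm x > r \<Longrightarrow> F x = 0" and s: "\<And>x. norm x > s \<Longrightarrow> \<rho> x = 0"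
  shows "norm x > r + s \<Longrightarrow> conv \<rho> F x = 0" and "test_fun (conv \<rho> F)"
proof -
  show z: "conv \<rho> F x = 0" if "norm x > r + s" for x
  proof -
    have "F y * \<rho> (x - y) = 0" for y
    proof (cases "norm y > r")
      case False
      then have "norm (x - y) > s" using that norm_triangle_ineq2[of x y] by linarith
      then show ?thesis using s by simp
    qed (simp add: K)
    then show ?thesis unfolding conv_def by (simp only: integral_zero)
  qed
  have "conv \<rho> F x = 0" if "x \<notin> cball 0 (r + s)" for x using z[of x] that by auto
  then show "test_fun (conv \<rho> F)" unfolding test_fun_def
    using smooth_conv[OF F \<rho>] compact_cball[of 0 "r + s"] by blast
qed

lemma test_norm_bound:
  assumes "test_fun \<phi>" obtains r where "r \<ge> 0" "\<And>x. norm x > r \<Longrightarrow> \<phi> x = 0"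
proof -
  obtain K where K: "compact K" "\<forall>x. x \<notin> K \<longrightarrow> \<phi> x = 0" using test_compact[OF assms] by blast
  obtain r where r: "\<And>x. x \<in> K \<Longrightarrow> norm x \<le> r" using compact_imp_bounded[OF K(1)] unfolding bounded_iff by blast
  have "\<phi> x = 0" if "norm x > max r 0" for x using r[of x] K(2) that by fastforce
  then show ?thesis using that[of "max r 0"] by auto
qed

text \<open>The indicator of a large ball is convolved with the test function. Near the origin the
  result is the full integral of the test function, hence constant by translation invariance, and
  its derivative there is the integral in question.\<close>

lemma integral_pd_zero:
  assumes \<phi>: "test_fun \<phi>"
  shows "(\<integral>x. pd j \<phi> x \<partial>lborel) = 0"
proof -
  have *: "(\<integral>x. pd j \<phi> (0 - x) \<partial>lborel) = 0" if \<phi>: "test_fun \<phi>" for \<phi>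
  proof -
    obtain r where r: "r \<ge> 0" "\<And>x. norm x > r \<Longrightarrow> \<phi> x = 0" using test_norm_bound[OF \<phi>] by blast
    \<comment> \<open>For x in the unit ball the support of y -> phi(x - y) lies in the ball of
      radius r + 1.\<close>
    define F :: "real^'a \<Rightarrow> complex" where "F = indicator (cball 0 (r + 1))"
    have "F = (\<lambda>x. indicator (cball 0 (r + 1)) x *\<^sub>R 1)"
      unfolding F_def by (auto simp: indicator_def fun_eq_iff)
    then have F: "integrable lborel F"
      using borel_integrable_compact[OF compact_cball continuous_on_const, of 0 "r + 1" "1::complex"] by simp
    have c: "conv \<phi> F x = (\<integral>y. \<phi> (x - y) \<partial>lborel)" if "norm x \<le> 1" for x
      unfolding conv_def
    proof (intro Bochner_Integration.integral_cong refl)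
      fix y
      show "F y * \<phi> (x - y) = \<phi> (x - y)"
      proof (cases "norm y \<le> r + 1")
        case False
        then have "norm (x - y) > r" using that norm_triangle_ineq2[of y x] by (simp add: norm_minus_commute)
        then show ?thesis using r(2) by simp
      qed (simp add: F_def)
    qed
    have trans: "(\<integral>y. \<phi> (x - y) \<partial>lborel) = (\<integral>y. \<phi> (- y) \<partial>lborel)" for x
    proof -
      have [measurable]: "\<phi> \<in> borel_measurable borel" by (rule test_meas[OF \<phi>])
      have "(\<integral>y. \<phi> (x - y) \<partial>lborel) = (\<integral>y. \<phi> (x - y) \<partial>(distr lborel borel ((+) x)))"
        by (simp add: lborel_distr_plus)
      also have "\<dots> = (\<integral>y. \<phi> (x - (x + y)) \<partial>lborel)"
        by (rule integral_distr) simp_all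
      finally show ?thesis by simp
    qed
    have "pd j (conv \<phi> F) 0 = pd j (\<lambda>x. \<integral>y. \<phi> (- y) \<partial>lborel) 0"
      by (rule pd_eq_on_open[of "ball 0 1"]) (auto simp: c trans)
    then have "conv (pd j \<phi>) F 0 = 0" by (simp add: pd_conv[OF F \<phi>] pd_const)
    moreover have "conv (pd j \<phi>) F 0 = (\<integral>y. pd j \<phi> (0 - y) \<partial>lborel)"
      unfolding conv_def
    proof (intro Bochner_Integration.integral_cong refl)
      fix y
      have "pd j \<phi> z = 0" if "z \<notin> cball 0 r" for z
        using pd_vanish[of "cball 0 r" \<phi> z j] r(2) that by auto
      then show "F y * pd j \<phi> (0 - y) = pd j \<phi> (0 - y)"
        using r(1) by (cases "norm y \<le> r + 1") (auto simp: F_def)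
    qed
    ultimately show ?thesis by simp
  qed
  \<comment> \<open>The auxiliary claim integrates the reflected derivative; applying it to the
    reflected function undoes the reflection up to a sign.\<close>
  have "(\<integral>x. pd j (\<lambda>y. \<phi> (0 - y)) (0 - x) \<partial>lborel) = 0"
    by (rule *[OF test_reflect[OF \<phi>]])
  then show ?thesis by (simp only: pd_reflect[OF test_smooth[OF \<phi>]]) simp
qed

lemma ip_pd:
  assumes "test_fun \<phi>" "test_fun \<psi>"
  shows "ip (pd j \<phi>) \<psi> = - ip \<phi> (pd j \<psi>)"
proof -
  note s = test_smooth[OF assms(1)] smooth_cnj[OF test_smooth[OF assms(2)]]
  have "(\<integral>x. pd j (\<lambda>x. \<phi> x * cnj (\<psi> x)) x \<partial>lborel) = 0"
    by (rule integral_pd_zero[OF test_mult[OF s(1) test_cnj[OF assms(2)]]])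
  moreover have "pd j (\<lambda>x. \<phi> x * cnj (\<psi> x)) x = \<phi> x * cnj (pd j \<psi> x) + pd j \<phi> x * cnj (\<psi> x)" for x
    using pd_mult[OF s] by (simp add: pd_cnj[OF test_smooth[OF assms(2)]])
  ultimately have "ip \<phi> (pd j \<psi>) + ip (pd j \<phi>) \<psi> = 0"
    unfolding ip_def using assms
    by (simp add: Bochner_Integration.integral_add L2_ip test_L2 test_pd)
  then show ?thesis by (simp add: add_eq_0_iff)
qed

section \<open>Mollifiers\<close>

text \<open>The functions e^(-1/t) / t^k extended by zero. All k are needed because the derivative
  of one member is a combination of members with larger k.\<close>

definition expinv :: "nat \<Rightarrow> real \<Rightarrow> real" where
  "expinv k t = (if t \<le> 0 then 0 else exp (- 1 / t) / t ^ k)"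

text \<open>From e^y \<ge> (1 + y/n)^n with y = 1/t and n = k + 2. The two powers beyond k leave the
  factor t^2, which makes the derivative at the origin zero.\<close>

lemma expinv_bound: "\<bar>expinv k t\<bar> \<le> real (k + 2) ^ (k + 2) * t^2"
proof (cases "t \<le> 0")
  case False
  then have t: "t > 0" by simp
  have "(1 + (1 / t) / real (k + 2)) ^ (k + 2) \<le> exp (1 / t)"
    using exp_ge_one_plus_x_over_n_power_n[of "k + 2" "1 / t"] t by (simp add: order_trans[of _ 0])
  moreover have "((1 / t) / real (k + 2)) ^ (k + 2) \<le> (1 + (1 / t) / real (k + 2)) ^ (k + 2)"
    using t by (intro power_mono) auto
  ultimately have "(1 / (t * real (k + 2))) ^ (k + 2) \<le> exp (1 / t)" by simp
  then have "1 \<le> exp (1 / t) * (t * real (k + 2)) ^ (k + 2)"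
    using t by (simp add: power_divide divide_le_eq)
  then have "exp (- 1 / t) \<le> (t * real (k + 2)) ^ (k + 2)"
    by (simp add: exp_minus field_simps minus_divide_left[symmetric])
  then have "exp (- 1 / t) / t ^ k \<le> (t * real (k + 2)) ^ (k + 2) / t ^ k"
    using t by (intro divide_right_mono) auto
  also have "\<dots> = real (k + 2) ^ (k + 2) * t^2"
    using t unfolding power_mult_distrib power_add[of t] by simp
  finally show ?thesis using t by (simp add: expinv_def)
qed (simp add: expinv_def)

lemma expinv_deriv: "(expinv k has_real_derivative expinv (k + 2) t - real k * expinv (k + 1) t) (at t)"
proof -
  consider "t < 0" | "t = 0" | "t > 0" by linarith
  then show ?thesis
  proof cases
    case 1
    have "((\<lambda>t. 0) has_real_derivative 0) (at t)" by simp
    then have "(expinv k has_real_derivative 0) (at t)"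
      by (rule has_field_derivative_transform_within_open[of _ _ _ "{..<0}"]) (use 1 in \<open>auto simp: expinv_def\<close>)
    then show ?thesis using 1 by (simp add: expinv_def)
  next
    case 2
    have "((\<lambda>h. (expinv k (0 + h) - expinv k 0) / h) \<longlongrightarrow> 0) (at 0)"
    proof (rule Lim_null_comparison)
      show "\<forall>\<^sub>F h in at 0. norm ((expinv k (0 + h) - expinv k 0) / h) \<le> real (k + 2) ^ (k + 2) * \<bar>h\<bar>"
        unfolding eventually_at_filter
      proof (intro always_eventually allI impI)
        fix h :: real assume "h \<noteq> 0"
        have "\<bar>expinv k h\<bar> \<le> (real (k + 2) ^ (k + 2) * \<bar>h\<bar>) * \<bar>h\<bar>"
          using expinv_bound[of k h] by (simp add: power2_eq_square abs_mult[symmetric] del: of_nat_add)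
        then show "norm ((expinv k (0 + h) - expinv k 0) / h) \<le> real (k + 2) ^ (k + 2) * \<bar>h\<bar>"
          using \<open>h \<noteq> 0\<close> by (simp add: expinv_def[of k 0] divide_le_eq del: of_nat_add)
      qed
      have "((\<lambda>h::real. real (k + 2) ^ (k + 2) * \<bar>h\<bar>) \<longlongrightarrow> real (k + 2) ^ (k + 2) * \<bar>0\<bar>) (at 0)"
        by (intro tendsto_intros)
      then show "((\<lambda>h::real. real (k + 2) ^ (k + 2) * \<bar>h\<bar>) \<longlongrightarrow> 0) (at 0)" by simp
    qed
    then show ?thesis using 2 by (simp add: DERIV_def expinv_def[of _ 0])
  next
    case 3
    have "((\<lambda>t. exp (- 1 / t) / t ^ k) has_real_derivative
        (exp (- 1 / t) * (1 / t^2) * t ^ k - exp (- 1 / t) * (real k * t ^ (k - 1))) / (t ^ k * t ^ k)) (at t)"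
      using 3 by (auto intro!: derivative_eq_intros simp: power2_eq_square)
    also have "(exp (- 1 / t) * (1 / t^2) * t ^ k - exp (- 1 / t) * (real k * t ^ (k - 1))) / (t ^ k * t ^ k)
        = exp (- 1 / t) / t ^ (k + 2) - real k * (exp (- 1 / t) / t ^ (k + 1))"
    proof -
      have e: "real k * t ^ (k - 1) = real k * t ^ k / t" using 3 by (cases k) auto
      show ?thesis unfolding e using 3 by (simp add: field_simps power2_eq_square)
    qed
    finally have "(expinv k has_real_derivative exp (- 1 / t) / t ^ (k + 2) - real k * (exp (- 1 / t) / t ^ (k + 1))) (at t)"
      by (rule has_field_derivative_transform_within_open[of _ _ _ "{0<..}"]) (use 3 in \<open>auto simp: expinv_def\<close>)
    then show ?thesis using 3 by (simp add: expinv_def)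
  qed
qed

text \<open>The standard bump exp(-1/(1 - |x|^2)) on the unit ball.\<close>

definition bump :: "real^'d::finite \<Rightarrow> real" where
  "bump x = expinv 0 (1 - (\<Sum>k\<in>UNIV. (x $ k)^2))"

lemma norm_sq_vec: "(norm (x::real^'d::finite))^2 = (\<Sum>k\<in>UNIV. (x $ k)^2)"
  by (simp add: norm_vec_def L2_set_def sum_nonneg)

lemma smooth_bump: "smooth (bump :: real^'d::finite \<Rightarrow> real)"
proof -
  let ?q = "\<lambda>x::real^'d. 1 - (\<Sum>k\<in>UNIV. (x $ k)^2)"
  let ?B = "{h. \<exists>g k. smooth g \<and> h = (\<lambda>x. g x * expinv k (?q x))}"
  have q: "smooth ?q" by (intro smooth_diff smooth_const smooth_sum smooth_power smooth_nth)
  have ce: "continuous_on UNIV (expinv k)" for k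
    using expinv_deriv DERIV_isCont by (metis continuous_at_imp_continuous_on)
  show ?thesis
  proof (rule smooth_addspan[where B="?B"])
    have "bump = (\<lambda>x. 1 * expinv 0 (?q x))" by (simp add: fun_eq_iff bump_def)
    then show "bump \<in> ?B" using smooth_const[of "1::real"] by blast
    show "continuous_on UNIV h" if h: "h \<in> ?B" for h
    proof -
      obtain g k where g: "smooth g" "h = (\<lambda>x. g x * expinv k (?q x))" using h by blast
      show ?thesis unfolding g(2)
        by (intro continuous_on_mult smooth_cont g(1) continuous_on_compose2[OF ce smooth_cont[OF q]]) simp
    qed
    fix h j assume "h \<in> ?B"
    then obtain g k where g: "smooth g" "h = (\<lambda>x. g x * expinv k (?q x))" by blast
    have e: "haspd j (\<lambda>x. expinv k (?q x)) x (pd j ?q x *\<^sub>R (expinv (k + 2) (?q x) - real k * expinv (k + 1) (?q x)))" for x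
      by (rule haspd_chain[OF smooth_haspd[OF q] expinv_deriv[unfolded has_real_derivative_iff_has_vector_derivative]])
    have "haspd j h x ((g x * pd j ?q x) * expinv (k + 2) (?q x) + ((- real k * (g x * pd j ?q x)) * expinv (k + 1) (?q x)
       + pd j g x * expinv k (?q x)))" for x
      unfolding g(2) using haspd_mult[OF smooth_haspd[OF g(1)] e] by (simp add: algebra_simps)
    moreover have "(\<lambda>x. (g x * pd j ?q x) * expinv (k + 2) (?q x) + ((- real k * (g x * pd j ?q x)) * expinv (k + 1) (?q x)
       + pd j g x * expinv k (?q x))) \<in> addspan ?B"
    proof (intro addspan.add addspan.incl)
      have 1: "smooth (\<lambda>x. g x * pd j ?q x)" by (intro smooth_mult g smooth_pd q)
      then show "(\<lambda>x. (g x * pd j ?q x) * expinv (k + 2) (?q x)) \<in> ?B" by blast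
      have "smooth (\<lambda>x. - real k * (g x * pd j ?q x))" by (intro smooth_mult[OF smooth_const] 1)
      then show "(\<lambda>x. (- real k * (g x * pd j ?q x)) * expinv (k + 1) (?q x)) \<in> ?B" by blast
      show "(\<lambda>x. pd j g x * expinv k (?q x)) \<in> ?B" using smooth_pd[OF g(1)] by blast
    qed
    ultimately show "\<exists>g'\<in>addspan ?B. \<forall>x. haspd j h x (g' x)" by (intro bexI) auto
  qed
qed

lemma bump_nonneg: "bump x \<ge> 0"
  unfolding bump_def expinv_def by simp

lemma bump_0: "bump 0 = exp (-1)"
  unfolding bump_def expinv_def by simp

lemma bump_le: "bump x \<le> exp (-1)"
proof -
  let ?s = "\<Sum>k\<in>UNIV. (x $ k)^2"
  have "?s \<ge> 0" by (simp add: sum_nonneg)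
  then show ?thesis unfolding bump_def expinv_def by (auto simp: divide_simps)
qed

lemma bump_vanish: "norm x \<ge> 1 \<Longrightarrow> bump x = 0"
  unfolding bump_def expinv_def norm_sq_vec[symmetric] by (simp add: one_le_power)

lemma bump_minus: "bump (- x) = bump x"
  unfolding bump_def by simp

lemma test_bump: "c \<noteq> 0 \<Longrightarrow> test_fun (\<lambda>x. complex_of_real (bump (c *\<^sub>R x)))"
proof -
  have "bump x = 0" if "x \<notin> cball 0 1" for x using bump_vanish[of x] that by auto
  then have "test_fun (\<lambda>x. complex_of_real (bump x))"
    unfolding test_fun_def using smooth_of_real[OF smooth_bump] compact_cball by (metis of_real_0)
  then show "c \<noteq> 0 \<Longrightarrow> test_fun (\<lambda>x. complex_of_real (bump (c *\<^sub>R x)))"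
    using test_affine[of "\<lambda>x. complex_of_real (bump x)" c 0] by simp
qed

text \<open>Each dilated bump is normalised by its own integral, so no scaling law for Lebesgue
  measure enters. The type argument carries the dimension.\<close>

definition mol_mass :: "'d::finite itself \<Rightarrow> nat \<Rightarrow> real" where
  "mol_mass _ m = (\<integral>x. bump (real (Suc m) *\<^sub>R (x::real^'d)) \<partial>lborel)"

definition mollifier :: "nat \<Rightarrow> real^'d::finite \<Rightarrow> complex" where
  "mollifier m x = of_real (bump (real (Suc m) *\<^sub>R x) / mol_mass TYPE('d) m)"

lemma bump_scaled_integrable: "integrable lborel (\<lambda>x. bump (real (Suc m) *\<^sub>R (x::real^'d::finite)))"
  using integrable_Re[OF test_integrable[OF test_bump[of "real (Suc m)"]]] by simp

lemma mol_mass_pos: "mol_mass TYPE('d::finite) m > 0"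
proof (rule ccontr)
  let ?f = "\<lambda>x::real^'d. bump (real (Suc m) *\<^sub>R x)"
  assume "\<not> ?thesis"
  moreover have "mol_mass TYPE('d) m \<ge> 0" unfolding mol_mass_def by (simp add: bump_nonneg)
  ultimately have "mol_mass TYPE('d) m = 0" by linarith
  then have "AE x in lborel. ?f x = 0"
    unfolding mol_mass_def using integral_nonneg_eq_0_iff_AE[OF bump_scaled_integrable] bump_nonneg by auto
  moreover have op: "open {x. \<not> ?f x = 0}"
    using smooth_cont[OF smooth_affine[OF smooth_bump, of 0 "real (Suc m)"]]
    by (intro open_Collect_neq) (auto intro: continuous_intros)
  ultimately have "emeasure lborel {x. \<not> ?f x = 0} = 0"
    by (subst (asm) AE_iff_measurable[OF _ refl]) auto
  moreover obtain e where e: "e > 0" "ball 0 e \<subseteq> {x. \<not> ?f x = 0}"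
  proof -
    have "0 \<in> {x. \<not> ?f x = 0}" by (simp add: bump_0)
    then show ?thesis using openE[OF op] that by blast
  qed
  ultimately have "emeasure lborel (ball (0::real^'d) e) = 0"
    using emeasure_mono[OF e(2), of lborel] op by simp
  then show False using content_ball_pos[OF e(1), of "0::real^'d"] by (simp add: measure_def)
qed

lemma test_mollifier: "test_fun (mollifier m)"
  using test_cmult[OF test_bump[of "real (Suc m)"], of "1 / of_real (mol_mass TYPE('a) m)"]
  unfolding mollifier_def by (simp add: mult.commute divide_inverse)

lemma mollifier_real: "mollifier m x = of_real (Re (mollifier m x))"
  unfolding mollifier_def by simp

lemma mollifier_nonneg: "Re (mollifier m (x::real^'d::finite)) \<ge> 0"
  unfolding mollifier_def using divide_nonneg_pos[OF bump_nonneg mol_mass_pos[where 'd='d]] by simp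

lemma mollifier_minus: "mollifier m (- x) = mollifier m x"
  unfolding mollifier_def by (simp add: bump_minus)

lemma mollifier_vanish: "norm x \<ge> 1 / real (Suc m) \<Longrightarrow> mollifier m x = 0"
proof -
  assume "norm x \<ge> 1 / real (Suc m)"
  then have "1 \<le> norm x * real (Suc m)" by (subst (asm) pos_divide_le_eq) simp_all
  then have "norm (real (Suc m) *\<^sub>R x) \<ge> 1" by (simp only: norm_scaleR real_norm_def abs_of_nat mult.commute)
  then show ?thesis unfolding mollifier_def by (simp only: bump_vanish) simp
qed

lemma mollifier_integral: "(\<integral>x. mollifier m (x::real^'d::finite) \<partial>lborel) = 1"
proof -
  have "(\<integral>x. mollifier m (x::real^'d) \<partial>lborel) = of_real ((\<integral>x. bump (real (Suc m) *\<^sub>R (x::real^'d)) \<partial>lborel) / mol_mass TYPE('d) m)"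
    unfolding mollifier_def integral_complex_of_real by (subst integral_divide_zero) (rule refl)
  also have "(\<integral>x. bump (real (Suc m) *\<^sub>R (x::real^'d)) \<partial>lborel) = mol_mass TYPE('d) m"
    unfolding mol_mass_def ..
  finally show ?thesis using mol_mass_pos[where 'd='d, of m] by simp
qed

lemma integral_translate:
  fixes f :: "real^'d::finite \<Rightarrow> 'a::{banach, second_countable_topology}"
  assumes "f \<in> borel_measurable borel"
  shows "(\<integral>x. f (z + x) \<partial>lborel) = (\<integral>x. f x \<partial>lborel)"
proof -
  have "(\<integral>x. f x \<partial>(distr lborel borel ((+) z))) = (\<integral>x. f (z + x) \<partial>lborel)"
    using assms by (intro integral_distr) simp_all
  then show ?thesis by (simp add: lborel_distr_plus)
qed

lemma nn_integral_translate:
  fixes f :: "real^'d::finite \<Rightarrow> ennreal"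
  assumes "f \<in> borel_measurable borel"
  shows "(\<integral>\<^sup>+x. f (z + x) \<partial>lborel) = (\<integral>\<^sup>+x. f x \<partial>lborel)"
proof -
  have "(\<integral>\<^sup>+x. f x \<partial>(distr lborel borel ((+) z))) = (\<integral>\<^sup>+x. f (z + x) \<partial>lborel)"
    using assms by (intro nn_integral_distr) simp_all
  then show ?thesis by (simp add: lborel_distr_plus)
qed

lemma integrable_translate:
  fixes f :: "real^'d::finite \<Rightarrow> 'a::{banach, second_countable_topology}"
  assumes "integrable lborel f"
  shows "integrable lborel (\<lambda>x. f (z + x))"
proof -
  have "integrable (distr lborel borel ((+) z)) f" using assms by (simp add: lborel_distr_plus)
  then show ?thesis by (rule integrable_distr[rotated]) simp
qed

lemma L2_translate:
  assumes "L2 f"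
  shows "L2 (\<lambda>x. f (z + x))" "L2norm (\<lambda>x. f (z + x)) = L2norm f"
proof -
  note m = L2_meas[OF assms]
  show "L2 (\<lambda>x. f (z + x))"
    using integrable_translate[OF L2_sq[OF assms]] m by (intro L2I) auto
  show "L2norm (\<lambda>x. f (z + x)) = L2norm f"
    unfolding L2norm_def using m integral_translate[of "\<lambda>x. (cmod (f x))^2" z] by simp
qed

text \<open>Evenness of the mollifier turns the reflection into a translation.\<close>

lemma mollifier_integral': "(\<integral>y. mollifier m (x - y) \<partial>lborel) = 1"
proof -
  have "(\<integral>y. mollifier m (x - y) \<partial>lborel) = (\<integral>y. mollifier m (- x + y) \<partial>lborel)"
    using mollifier_minus[of m "x - y" for y] by (simp add: algebra_simps)
  also have "\<dots> = 1"
    using integral_translate[OF test_meas[OF test_mollifier], of m "- x"] mollifier_integral by simp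
  finally show ?thesis .
qed

section \<open>Continuity of translations in L^2\<close>

definition transl_cont :: "(real^'d::finite \<Rightarrow> complex) \<Rightarrow> bool" where
  "transl_cont f \<longleftrightarrow> L2 f \<and> (\<forall>z. z \<longlonglongrightarrow> 0 \<longrightarrow> (\<lambda>n. L2norm (\<lambda>x. f (z n + x) - f x)) \<longlonglongrightarrow> 0)"

lemma transl_cont_add:
  assumes "transl_cont f" "transl_cont g" shows "transl_cont (\<lambda>x. f x + g x)"
  unfolding transl_cont_def
proof (intro conjI allI impI)
  note L = assms[unfolded transl_cont_def, THEN conjunct1]
  show "L2 (\<lambda>x. f x + g x)" using L by (rule L2_add)
  fix z :: "nat \<Rightarrow> real^'a" assume z: "z \<longlonglongrightarrow> 0"
  have "L2lim (\<lambda>n x. f (z n + x) - f x) (\<lambda>x. 0)" "L2lim (\<lambda>n x. g (z n + x) - g x) (\<lambda>x. 0)"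
    using assms z unfolding L2lim_def transl_cont_def by (auto intro!: L2_diff L2_translate)
  from L2lim_add[OF this] show "(\<lambda>n. L2norm (\<lambda>x. f (z n + x) + g (z n + x) - (f x + g x))) \<longlonglongrightarrow> 0"
    unfolding L2lim_def by (simp add: algebra_simps)
qed

lemma transl_cont_cmult:
  assumes "transl_cont f" shows "transl_cont (\<lambda>x. c * f x)"
proof -
  have "L2norm (\<lambda>x. c * f (z + x) - c * f x) = cmod c * L2norm (\<lambda>x. f (z + x) - f x)" for z
    by (simp only: right_diff_distrib[symmetric] L2norm_cmult)
  then show ?thesis using assms unfolding transl_cont_def
    using tendsto_mult_left[of _ 0 sequentially "cmod c"] by (auto intro: L2_cmult)
qed

lemma transl_cont_sum: "(\<And>i. i \<in> I \<Longrightarrow> transl_cont (f i)) \<Longrightarrow> transl_cont (\<lambda>x. \<Sum>i\<in>I. f i x)"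
  by (induction I rule: infinite_finite_induct)
     (auto intro: transl_cont_add simp: transl_cont_def[of "\<lambda>x. 0"] L2norm_def)

lemma transl_cont_approx:
  assumes f: "L2 f" and ap: "\<And>e. e > 0 \<Longrightarrow> \<exists>g. transl_cont g \<and> L2norm (\<lambda>x. f x - g x) \<le> e"
  shows "transl_cont f"
  unfolding transl_cont_def
proof (intro conjI f allI impI LIMSEQ_I)
  fix z :: "nat \<Rightarrow> real^'a" and e :: real assume z: "z \<longlonglongrightarrow> 0" and e: "e > 0"
  obtain g where g: "transl_cont g" "L2norm (\<lambda>x. f x - g x) \<le> e / 4" using ap[of "e/4"] e by auto
  then have gL: "L2 g" and gz: "(\<lambda>n. L2norm (\<lambda>x. g (z n + x) - g x)) \<longlonglongrightarrow> 0"
    unfolding transl_cont_def using z by auto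
  obtain N where N: "\<And>n. n \<ge> N \<Longrightarrow> norm (L2norm (\<lambda>x. g (z n + x) - g x) - 0) < e / 4"
    using LIMSEQ_D[OF gz, of "e/4"] e by auto
  have "L2norm (\<lambda>x. f (z n + x) - f x) < e" if n: "n \<ge> N" for n
  proof -
    have "L2norm (\<lambda>x. f (z n + x) - f x) \<le> L2norm (\<lambda>x. f (z n + x) - g (z n + x)) + L2norm (\<lambda>x. g (z n + x) - f x)"
      by (intro L2norm_triangle_mid L2_translate f gL)
    also have "\<dots> \<le> L2norm (\<lambda>x. f (z n + x) - g (z n + x)) + (L2norm (\<lambda>x. g (z n + x) - g x) + L2norm (\<lambda>x. g x - f x))"
      by (intro add_left_mono L2norm_triangle_mid L2_translate f gL)
    also have "L2norm (\<lambda>x. f (z n + x) - g (z n + x)) = L2norm (\<lambda>x. f x - g x)"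
      by (rule L2_translate(2)[OF L2_diff[OF f gL]])
    also have "L2norm (\<lambda>x. g x - f x) = L2norm (\<lambda>x. f x - g x)" by (rule L2norm_minus_commute)
    finally show ?thesis using N[OF n] g(2) e by simp
  qed
  then show "\<exists>no. \<forall>n\<ge>no. norm (L2norm (\<lambda>x. f (z n + x) - f x) - 0) < e" by auto
qed

lemma L2_indicator:
  assumes "S \<in> sets borel" "emeasure lborel S < \<infinity>"
  shows "L2 (indicator S)" "(L2norm (indicator S))^2 = measure lborel S"
proof -
  have sq: "(\<lambda>x. (cmod (indicator S x))^2) = indicat_real S" by (auto simp: indicator_def)
  show "L2 (indicator S)" unfolding L2_def sq using assms by simp
  show "(L2norm (indicator S))^2 = measure lborel S" unfolding L2norm_sq sq using assms by simp
qed

text \<open>The integral of \<open>\<bar>1\<^sub>U(\<cdot> + z) - 1\<^sub>U\<bar>\<close> is twice that of the positive part of \<open>1\<^sub>U - 1\<^sub>U(\<cdot> + z)\<close>, which tends to zero pointwise.\<close>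
lemma transl_cont_open:
  assumes U: "open U" "emeasure lborel U < \<infinity>"
  shows "transl_cont (indicator U)"
  unfolding transl_cont_def
proof (intro conjI allI impI)
  have [measurable]: "U \<in> sets borel" using U by simp
  show L: "L2 (indicator U)" by (rule L2_indicator) (use U in auto)
  fix z :: "nat \<Rightarrow> real^'a" assume z: "z \<longlonglongrightarrow> 0"
  let ?u = "indicat_real U"
  have ui: "integrable lborel ?u" using U by simp
  have ut: "integrable lborel (\<lambda>x. ?u (z n + x))" for n by (rule integrable_translate[OF ui])
  have eq: "(L2norm (\<lambda>x. indicator U (z n + x) - indicator U x))^2 = 2 * (\<integral>x. max 0 (?u x - ?u (z n + x)) \<partial>lborel)" for n
  proof -
    have "(cmod (indicator U (z n + x) - indicator U x))^2 = 2 * max 0 (?u x - ?u (z n + x)) - (?u x - ?u (z n + x))" for x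
      by (auto simp: indicator_def)
    then have "(L2norm (\<lambda>x. indicator U (z n + x) - indicator U x))^2 =
       (\<integral>x. 2 * max 0 (?u x - ?u (z n + x)) - (?u x - ?u (z n + x)) \<partial>lborel)" by (simp add: L2norm_sq)
    also have "\<dots> = 2 * (\<integral>x. max 0 (?u x - ?u (z n + x)) \<partial>lborel) - ((\<integral>x. ?u x \<partial>lborel) - (\<integral>x. ?u (z n + x) \<partial>lborel))"
      using ui ut[of n] by (subst Bochner_Integration.integral_diff) auto
    also have "(\<integral>x. ?u (z n + x) \<partial>lborel) = (\<integral>x. ?u x \<partial>lborel)" by (rule integral_translate) simp
    finally show ?thesis by simp
  qed
  have "(\<lambda>n. \<integral>x. max 0 (?u x - ?u (z n + x)) \<partial>lborel) \<longlonglongrightarrow> (\<integral>x. 0 \<partial>(lborel::(real^'a) measure))"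
  proof (rule integral_dominated_convergence)
    show "integrable lborel ?u" by (rule ui)
    show "AE x in lborel. norm (max 0 (?u x - ?u (z n + x))) \<le> ?u x" for n by (auto simp: indicator_def)
    show "AE x in lborel. (\<lambda>n. max 0 (?u x - ?u (z n + x))) \<longlonglongrightarrow> 0"
    proof (rule AE_I2)
      fix x
      have "\<forall>\<^sub>F n in sequentially. max 0 (?u x - ?u (z n + x)) = 0"
      proof (cases "x \<in> U")
        case True
        have "(\<lambda>n. z n + x) \<longlonglongrightarrow> 0 + x" by (intro tendsto_intros z)
        then have "\<forall>\<^sub>F n in sequentially. z n + x \<in> U" using U(1) True by (intro topological_tendstoD) auto
        then show ?thesis by eventually_elim (simp add: True)
      qed (simp add: indicator_def)
      then show "(\<lambda>n. max 0 (?u x - ?u (z n + x))) \<longlonglongrightarrow> 0" by (rule tendsto_eventually)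
    qed
  qed measurable
  then have "(\<lambda>n. (L2norm (\<lambda>x. indicator U (z n + x) - indicator U x))^2) \<longlonglongrightarrow> 2 * 0"
    unfolding eq by (intro tendsto_mult_left) simp
  then have "(\<lambda>n. sqrt ((L2norm (\<lambda>x. indicator U (z n + x) - indicator U x))^2)) \<longlonglongrightarrow> sqrt 0"
    by (intro tendsto_real_sqrt) simp
  then show "(\<lambda>n. L2norm (\<lambda>x. indicator U (z n + x) - indicator U x)) \<longlonglongrightarrow> 0" by simp
qed

text \<open>Outer regularity approximates a measurable set of finite measure by an open one, for
  which the claim is known.\<close>

lemma transl_cont_indicator:
  assumes S: "S \<in> sets borel" "emeasure lborel S < \<infinity>"
  shows "transl_cont (indicator S)"
proof (rule transl_cont_approx)
  show "L2 (indicator S)" by (rule L2_indicator[OF S])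
  fix e :: real assume e: "e > 0"
  obtain U where U: "open U" "S \<subseteq> U" "emeasure lborel (U - S) < ennreal (e^2)"
    using outer_regular_lborel[OF S(1), of "e^2"] e by auto
  have "emeasure lborel U \<le> emeasure lborel S + emeasure lborel (U - S)"
    using emeasure_subadditive[of S lborel "U - S"] S U by (simp add: Un_absorb1)
  also have "\<dots> < \<infinity>" using S(2) U(3) by (auto simp: ennreal_add_less_top intro: less_trans)
  finally have Uf: "emeasure lborel U < \<infinity>" .
  have D: "U - S \<in> sets borel" "emeasure lborel (U - S) < \<infinity>" using U S by (auto intro: less_trans)
  have "(\<lambda>x. indicator S x - indicator U x) = (\<lambda>x. - indicator (U - S) x :: complex)"
    using U(2) by (auto simp: indicator_def fun_eq_iff)
  then have "L2norm (\<lambda>x. indicator S x - indicator U x) = L2norm (indicator (U - S))"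
    by (simp add: L2norm_uminus)
  also have "\<dots> \<le> e"
  proof (rule power2_le_imp_le)
    have "measure lborel (U - S) \<le> e^2"
      using U(3) D(2) by (simp add: emeasure_eq_ennreal_measure ennreal_less_iff less_imp_le)
    then show "(L2norm (indicator (U - S)))^2 \<le> e^2" using L2_indicator(2)[OF D] by simp
  qed (use e in simp)
  finally show "\<exists>g. transl_cont g \<and> L2norm (\<lambda>x. indicator S x - g x) \<le> e"
    using transl_cont_open[OF U(1) Uf] by blast
qed

lemma L2lim_dominated:
  assumes "\<And>n. F n \<in> borel_measurable borel" "f \<in> borel_measurable borel" "L2 k"
    and "\<And>n x. cmod (F n x) \<le> C * cmod (k x)"
    and "\<And>x. (\<lambda>n. F n x) \<longlonglongrightarrow> f x"
  shows "L2lim F f"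
proof -
  note m[measurable] = assms(1,2)
  have F: "L2 (F n)" for n by (rule L2_dom(1)[OF assms(3) m(1) assms(4)])
  have fb: "cmod (f x) \<le> C * cmod (k x)" for x
    by (rule LIMSEQ_le_const2[OF tendsto_norm[OF assms(5)]]) (use assms(4) in auto)
  have f: "L2 f" by (rule L2_dom(1)[OF assms(3) m(2) fb])
  have "(\<lambda>n. \<integral>x. (cmod (F n x - f x))^2 \<partial>lborel) \<longlonglongrightarrow> (\<integral>x. 0 \<partial>(lborel::(real^'a) measure))"
  proof (rule integral_dominated_convergence)
    show "integrable lborel (\<lambda>x. (2 * C)^2 * (cmod (k x))^2)" using L2_sq[OF assms(3)] by simp
    show "AE x in lborel. norm ((cmod (F n x - f x))^2) \<le> (2 * C)^2 * (cmod (k x))^2" for n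
    proof (rule AE_I2)
      fix x
      have "cmod (F n x - f x) \<le> 2 * C * cmod (k x)"
        using norm_triangle_ineq4[of "F n x" "f x"] assms(4)[of n x] fb[of x] by linarith
      from power_mono[OF this, of 2] show "norm ((cmod (F n x - f x))^2) \<le> (2 * C)^2 * (cmod (k x))^2"
        by (simp add: power_mult_distrib)
    qed
    show "AE x in lborel. (\<lambda>n. (cmod (F n x - f x))^2) \<longlonglongrightarrow> 0"
    proof (rule AE_I2)
      fix x
      have "(\<lambda>n. (cmod (F n x - f x))^2) \<longlonglongrightarrow> (cmod (f x - f x))^2" by (intro tendsto_intros assms(5))
      then show "(\<lambda>n. (cmod (F n x - f x))^2) \<longlonglongrightarrow> 0" by simp
    qed
  qed measurable
  then have "(\<lambda>n. L2norm (\<lambda>x. F n x - f x)) \<longlonglongrightarrow> sqrt 0"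
    unfolding L2norm_def by (intro tendsto_real_sqrt) simp
  then show ?thesis unfolding L2lim_def using F f by simp
qed

text \<open>Simple functions dominated by 2|f| approximate f in L^2. Their nonzero level sets have
  finite measure because the simple functions are square-integrable.\<close>

lemma transl_cont_L2:
  assumes f: "L2 f" shows "transl_cont f"
proof (rule transl_cont_approx[OF f])
  fix e :: real assume e: "e > 0"
  obtain s where s: "\<And>i. simple_function lborel (s i)" "\<And>x. (\<lambda>i. s i x) \<longlonglongrightarrow> f x" "\<And>i x. cmod (s i x) \<le> 2 * cmod (f x)"
    using borel_measurable_implies_sequence_metric[of f lborel 0] L2_meas[OF f] by auto
  have sm: "s i \<in> borel_measurable borel" for i using borel_measurable_simple_function[OF s(1)] by simp
  have lim: "L2lim s f" by (rule L2lim_dominated[OF sm L2_meas[OF f] f s(3,2)])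
  have "transl_cont (s i)" for i
  proof -
    have fin: "finite (range (s i))" using s(1)[of i] unfolding simple_function_def by simp
    have eq: "s i = (\<lambda>x. \<Sum>y\<in>range (s i) - {0}. y * indicator (s i -` {y}) x)"
    proof
      fix x
      have "(\<Sum>y\<in>range (s i) - {0}. y * indicator (s i -` {y}) x) = (\<Sum>y\<in>range (s i) - {0}. if y = s i x then s i x else 0)"
        by (intro sum.cong) (auto simp: indicator_def)
      also have "\<dots> = s i x" using fin by (subst sum.delta) auto
      finally show "s i x = (\<Sum>y\<in>range (s i) - {0}. y * indicator (s i -` {y}) x)" by simp
    qed
    have "transl_cont (indicator (s i -` {y}))" if y: "y \<noteq> 0" for y
    proof (rule transl_cont_indicator)
      show S: "s i -` {y} \<in> sets borel" using measurable_sets[OF sm, of "{y}" i] by simp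
      have "integrable lborel (indicat_real (s i -` {y}))"
      proof (rule Bochner_Integration.integrable_bound)
        show "integrable lborel (\<lambda>x. (1 / cmod y)^2 * (cmod (s i x))^2)"
          using L2_sq[OF L2limD(1)[OF lim], of i] by simp
        show "AE x in lborel. norm (indicat_real (s i -` {y}) x) \<le> norm ((1 / cmod y)^2 * (cmod (s i x))^2)"
          using y by (auto simp: indicator_def power_divide)
      qed (use S in simp)
      then show "emeasure lborel (s i -` {y}) < \<infinity>" unfolding integrable_indicator_iff by simp
    qed
    then show ?thesis by (subst eq) (intro transl_cont_sum transl_cont_cmult, simp)
  qed
  moreover obtain i where "L2norm (\<lambda>x. s i x - f x) < e"
    using LIMSEQ_D[OF L2limD(3)[OF lim] e] by auto
  ultimately show "\<exists>g. transl_cont g \<and> L2norm (\<lambda>x. f x - g x) \<le> e"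
    using L2norm_minus_commute[of f] by (metis less_imp_le)
qed

lemma transl_cont_small:
  assumes f: "L2 f" and e: "e > 0"
  obtains d where "d > 0" "\<And>z. norm z < d \<Longrightarrow> L2norm (\<lambda>x. f (z + x) - f x) \<le> e"
proof (rule ccontr)
  assume "\<not> thesis"
  then have "\<exists>z. norm z < 1 / real (Suc n) \<and> \<not> L2norm (\<lambda>x. f (z + x) - f x) \<le> e" for n
    using that[of "1 / real (Suc n)"] by (metis of_nat_0_less_iff zero_less_Suc zero_less_divide_1_iff)
  then obtain z where z: "\<And>n. norm (z n) < 1 / real (Suc n)" "\<And>n. L2norm (\<lambda>x. f (z n + x) - f x) > e"
    by (metis not_le)
  have "z \<longlonglongrightarrow> 0"
    by (rule Lim_null_comparison[OF _ LIMSEQ_inverse_real_of_nat]) (use z(1) in \<open>auto simp: inverse_eq_divide less_imp_le\<close>)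
  then have "(\<lambda>n. L2norm (\<lambda>x. f (z n + x) - f x)) \<longlonglongrightarrow> 0"
    using transl_cont_L2[OF f] unfolding transl_cont_def by blast
  from LIMSEQ_D[OF this e] obtain N where "\<forall>n\<ge>N. norm (L2norm (\<lambda>x. f (z n + x) - f x) - 0) < e" by blast
  then have "L2norm (\<lambda>x. f (z N + x) - f x) < e" by auto
  then show False using z(2)[of N] by simp
qed

text \<open>Jensen's inequality and Tonelli bound the error by an average of translates.\<close>
lemma mollify_error:
  assumes F: "L2 F" and e: "e \<ge> 0"
    and small: "\<And>z. norm z < 1 / real (Suc m) \<Longrightarrow> L2norm (\<lambda>x. F (z + x) - F x) \<le> e"
  shows "L2 (conv (mollifier m) F)" "L2norm (\<lambda>x. conv (mollifier m) F x - F x) \<le> e"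
proof -
  define r where "r x = Re (mollifier m x)" for x :: "real^'a"
  have r0: "r x \<ge> 0" for x unfolding r_def by (rule mollifier_nonneg)
  have rm: "mollifier m x = of_real (r x)" for x unfolding r_def by (rule mollifier_real)
  note mm[measurable] = test_meas[OF test_mollifier[of m]]
  have rmeas[measurable]: "r \<in> borel_measurable borel" unfolding r_def by measurable
  note Fm[measurable] = L2_meas[OF F]
  have ri: "integrable lborel (\<lambda>y. r (x - y))" for x
    unfolding r_def by (rule integrable_Re[OF test_integrable[OF test_reflect[OF test_mollifier]]])
  have rint: "(\<integral>y. r (x - y) \<partial>lborel) = 1" for x
    using mollifier_integral'[of m x] unfolding rm by (simp add: integral_complex_of_real)
  have rnn: "(\<integral>\<^sup>+y. ennreal (r (x - y)) \<partial>lborel) = 1" for x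
    using nn_integral_eq_integral[OF ri] r0 rint by simp
  have Fr: "integrable lborel (\<lambda>y. F y * mollifier m (x - y))" for x
    by (rule L2_integrable_mult[OF F test_L2[OF test_reflect[OF test_mollifier]]])
  have cm[measurable]: "conv (mollifier m) F \<in> borel_measurable borel"
  proof -
    have "(\<lambda>x. \<integral>y. F y * mollifier m (x - y) \<partial>lborel) \<in> borel_measurable lborel"
      by (rule lborel.borel_measurable_lebesgue_integral) measurable
    then show ?thesis unfolding conv_def[abs_def] by simp
  qed
  define D where "D x y = cmod (F y - F x)" for x y
  have dm[measurable]: "(\<lambda>(x, y). D x y) \<in> borel_measurable (lborel \<Otimes>\<^sub>M lborel)" unfolding D_def by measurable
  \<comment> \<open>Cauchy-Schwarz for the probability density y -> r(x - y), with r split into two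
    square roots; the second factor integrates to 1.\<close>
  have pt: "ennreal ((cmod (conv (mollifier m) F x - F x))^2) \<le> (\<integral>\<^sup>+y. ennreal ((D x y)^2 * r (x - y)) \<partial>lborel)" for x
  proof -
    have "conv (mollifier m) F x - F x = (\<integral>y. F y * mollifier m (x - y) \<partial>lborel) - F x * (\<integral>y. mollifier m (x - y) \<partial>lborel)"
      by (simp add: conv_def mollifier_integral')
    also have "\<dots> = (\<integral>y. F y * mollifier m (x - y) - F x * mollifier m (x - y) \<partial>lborel)"
      using Fr[of x] test_integrable[OF test_reflect[OF test_mollifier[of m]], of x]
      by (subst Bochner_Integration.integral_diff) auto
    finally have c: "conv (mollifier m) F x - F x = (\<integral>y. (F y - F x) * mollifier m (x - y) \<partial>lborel)"
      by (simp add: left_diff_distrib)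
    have ci: "integrable lborel (\<lambda>y. (F y - F x) * mollifier m (x - y))"
      using Fr[of x] test_integrable[OF test_reflect[OF test_mollifier[of m]], of x]
      by (simp add: left_diff_distrib)
    have "ennreal (cmod (conv (mollifier m) F x - F x)) \<le> (\<integral>\<^sup>+y. ennreal (norm ((F y - F x) * mollifier m (x - y))) \<partial>lborel)"
      unfolding c using ci by (rule integral_norm_bound_ennreal)
    also have "\<dots> = (\<integral>\<^sup>+y. ennreal (D x y * sqrt (r (x - y))) * ennreal (sqrt (r (x - y))) \<partial>lborel)"
      using r0 by (intro nn_integral_cong) (simp add: norm_mult rm D_def ennreal_mult'[symmetric] mult.assoc)
    finally have "(ennreal (cmod (conv (mollifier m) F x - F x)))^2 \<le>
        (\<integral>\<^sup>+y. ennreal (D x y * sqrt (r (x - y))) * ennreal (sqrt (r (x - y))) \<partial>lborel)^2"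
      by (rule power_mono) simp
    also have "\<dots> \<le> (\<integral>\<^sup>+y. (ennreal (D x y * sqrt (r (x - y))))^2 \<partial>lborel) * (\<integral>\<^sup>+y. (ennreal (sqrt (r (x - y))))^2 \<partial>lborel)"
      by (rule Cauchy_Schwarz_nn_integral) (auto simp: D_def)
    also have "(\<integral>\<^sup>+y. (ennreal (sqrt (r (x - y))))^2 \<partial>lborel) = 1"
      using r0 rnn[of x] by (simp add: ennreal_power)
    also have "(\<integral>\<^sup>+y. (ennreal (D x y * sqrt (r (x - y))))^2 \<partial>lborel) = (\<integral>\<^sup>+y. ennreal ((D x y)^2 * r (x - y)) \<partial>lborel)"
      using r0 by (intro nn_integral_cong) (simp add: ennreal_power D_def power_mult_distrib)
    finally show ?thesis by (simp add: ennreal_power)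
  qed
  have "(\<integral>\<^sup>+x. ennreal ((cmod (conv (mollifier m) F x - F x))^2) \<partial>lborel) \<le>
      (\<integral>\<^sup>+x. (\<integral>\<^sup>+y. ennreal ((D x y)^2 * r (x - y)) \<partial>lborel) \<partial>lborel)"
    by (intro nn_integral_mono pt)
  also have "\<dots> = (\<integral>\<^sup>+y. (\<integral>\<^sup>+x. ennreal ((D x y)^2 * r (x - y)) \<partial>lborel) \<partial>lborel)"
    by (rule lborel_pair.Fubini'[symmetric]) (unfold D_def, measurable)
  \<comment> \<open>The substitution x = y + z separates the kernel r(z) from the translation error.
    After exchanging the order again, the y-integral is r(z) times the squared norm of F(z + y) -
    F(y).\<close>
  also have "\<dots> = (\<integral>\<^sup>+y. (\<integral>\<^sup>+z. ennreal ((D (y + z) y)^2 * r z) \<partial>lborel) \<partial>lborel)"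
  proof (rule nn_integral_cong)
    fix y
    have "(\<integral>\<^sup>+z. ennreal ((D (y + z) y)^2 * r ((y + z) - y)) \<partial>lborel) = (\<integral>\<^sup>+x. ennreal ((D x y)^2 * r (x - y)) \<partial>lborel)"
      by (rule nn_integral_translate) (unfold D_def, measurable)
    then show "(\<integral>\<^sup>+x. ennreal ((D x y)^2 * r (x - y)) \<partial>lborel) = (\<integral>\<^sup>+z. ennreal ((D (y + z) y)^2 * r z) \<partial>lborel)"
      by simp
  qed
  also have "\<dots> = (\<integral>\<^sup>+z. (\<integral>\<^sup>+y. ennreal ((D (y + z) y)^2 * r z) \<partial>lborel) \<partial>lborel)"
    by (rule lborel_pair.Fubini'[symmetric]) (unfold D_def, measurable)
  also have "\<dots> \<le> (\<integral>\<^sup>+z. ennreal (e^2) * ennreal (r (0 - z)) \<partial>lborel)"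
  proof (intro nn_integral_mono)
    fix z
    have rz: "r (0 - z) = r z" unfolding r_def using mollifier_minus[of m z] by simp
    show "(\<integral>\<^sup>+y. ennreal ((D (y + z) y)^2 * r z) \<partial>lborel) \<le> ennreal (e^2) * ennreal (r (0 - z))"
    proof (cases "norm z < 1 / real (Suc m)")
      case True
      have L: "L2 (\<lambda>x. F (z + x) - F x)" by (intro L2_diff L2_translate F)
      have "(\<integral>\<^sup>+y. ennreal ((D (y + z) y)^2 * r z) \<partial>lborel) = (\<integral>\<^sup>+y. ennreal ((cmod (F (z + y) - F y))^2) * ennreal (r z) \<partial>lborel)"
        using r0 by (intro nn_integral_cong) (simp add: D_def ennreal_mult norm_minus_commute add.commute)
      also have "\<dots> = (\<integral>\<^sup>+y. ennreal ((cmod (F (z + y) - F y))^2) \<partial>lborel) * ennreal (r z)"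
        by (rule nn_integral_multc) measurable
      also have "\<dots> = ennreal ((L2norm (\<lambda>x. F (z + x) - F x))^2) * ennreal (r z)"
        using L2_sq[OF L] by (subst nn_integral_eq_integral) (auto simp: L2norm_sq)
      also have "\<dots> \<le> ennreal (e^2) * ennreal (r z)"
        using small[OF True] by (intro mult_right_mono ennreal_leI power_mono) auto
      finally show ?thesis unfolding rz .
    next
      case False
      then have "r z = 0" unfolding r_def using mollifier_vanish[of m z] by simp
      then show ?thesis by simp
    qed
  qed
  also have "\<dots> = ennreal (e^2) * (\<integral>\<^sup>+z. ennreal (r (0 - z)) \<partial>lborel)"
    by (rule nn_integral_cmult) measurable
  also have "\<dots> = ennreal (e^2)" using rnn[of 0] by simp
  finally have nn: "(\<integral>\<^sup>+x. ennreal ((cmod (conv (mollifier m) F x - F x))^2) \<partial>lborel) \<le> ennreal (e^2)" .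
  have int: "integrable lborel (\<lambda>x. (cmod (conv (mollifier m) F x - F x))^2)"
    by (rule integrableI_bounded) (use nn in \<open>auto intro: le_less_trans\<close>)
  then have L: "L2 (\<lambda>x. conv (mollifier m) F x - F x)" by (intro L2I) auto
  then show "L2 (conv (mollifier m) F)" using L2_add[OF L F] by simp
  have "ennreal (\<integral>x. (cmod (conv (mollifier m) F x - F x))^2 \<partial>lborel) \<le> ennreal (e^2)"
    using nn nn_integral_eq_integral[OF int] by simp
  then show "L2norm (\<lambda>x. conv (mollifier m) F x - F x) \<le> e"
    using e by (intro L2norm_le_sq) (auto simp: ennreal_le_iff)
qed

lemma mollify_L2lim:
  assumes F: "L2 F" shows "L2lim (\<lambda>m. conv (mollifier m) F) F"
  unfolding L2lim_def
proof (intro conjI allI F)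
  show "L2 (conv (mollifier m) F)" for m
  \<comment> \<open>The crude bound by twice the norm serves only to get membership in L^2 for every
    m.\<close>
  proof (rule mollify_error(1)[OF F, of "2 * L2norm F"])
    show "L2norm (\<lambda>x. F (z + x) - F x) \<le> 2 * L2norm F" for z
      using L2norm_triangle_diff[OF L2_translate(1)[OF F, of z] F] L2_translate(2)[OF F, of z] by simp
  qed simp
  show "(\<lambda>m. L2norm (\<lambda>x. conv (mollifier m) F x - F x)) \<longlonglongrightarrow> 0"
  proof (rule LIMSEQ_I)
    fix e :: real assume e: "e > 0"
    obtain d where d: "d > 0" "\<And>z. norm z < d \<Longrightarrow> L2norm (\<lambda>x. F (z + x) - F x) \<le> e / 2"
      using transl_cont_small[OF F, of "e/2"] e by auto
    obtain N where N: "1 / real (Suc N) < d" using nat_approx_posE[OF d(1)] by blast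
    have "L2norm (\<lambda>x. conv (mollifier m) F x - F x) < e" if m: "m \<ge> N" for m
    proof -
      have "1 / real (Suc m) \<le> 1 / real (Suc N)" using m by (simp add: frac_le)
      then have "L2norm (\<lambda>x. conv (mollifier m) F x - F x) \<le> e / 2"
        using d(2) N e by (intro mollify_error(2)[OF F]) auto
      then show ?thesis using e by simp
    qed
    then show "\<exists>no. \<forall>m\<ge>no. norm (L2norm (\<lambda>x. conv (mollifier m) F x - F x) - 0) < e" by auto
  qed
qed

lemma test_mollify:
  assumes "integrable lborel F" "\<And>x. norm x > r \<Longrightarrow> F x = 0"
  shows "test_fun (conv (mollifier m) F)" "norm x > r + 1 \<Longrightarrow> conv (mollifier m) F x = 0"
proof -
  have "mollifier m x = 0" if "norm x > 1" for x :: "real^'a"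
  proof (rule mollifier_vanish)
    have "1 / real (Suc m) \<le> 1" by simp
    then show "1 / real (Suc m) \<le> norm x" using that by linarith
  qed
  from test_conv[OF assms(1) test_mollifier assms(2) this]
  show "test_fun (conv (mollifier m) F)" "norm x > r + 1 \<Longrightarrow> conv (mollifier m) F x = 0" by blast+
qed

lemma L2_compact_integrable:
  assumes "L2 F" "\<And>x. norm x > r \<Longrightarrow> F x = 0"
  shows "integrable lborel F"
proof -
  have "emeasure lborel (cball (0::real^'a) r) < \<infinity>" by (intro emeasure_bounded_finite) simp
  then have "L2 (indicator (cball (0::real^'a) r))" by (intro L2_indicator) auto
  from L2_integrable_mult[OF assms(1) this] have "integrable lborel (\<lambda>x. F x * indicator (cball 0 r) x)" .
  moreover have "F x * indicator (cball 0 r) x = F x" for x using assms(2)[of x] by (auto simp: indicator_def)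
  ultimately show ?thesis by simp
qed

lemma conv_eq_ip: "conv \<rho> F x = ip F (\<lambda>y. cnj (\<rho> (x - y)))"
  unfolding conv_def ip_def by simp

text \<open>Reflected mollifiers are test functions, so every mollification of g vanishes
  identically, and these converge to g.\<close>

lemma L2_eq_zero_AE:
  assumes g: "L2 g" and z: "\<And>\<phi>. test_fun \<phi> \<Longrightarrow> ip g \<phi> = 0"
  shows "AE x in lborel. g x = 0"
proof -
  have "conv (mollifier m) g = (\<lambda>x. 0)" for m
    unfolding conv_eq_ip fun_eq_iff by (intro allI z test_cnj test_reflect test_mollifier)
  then have "L2lim (\<lambda>m x. 0) g" using mollify_L2lim[OF g] by simp
  then have "AE x in lborel. 0 = g x" by (rule L2lim_unique[OF L2lim_const[OF L2_zero]])
  then show ?thesis by (rule AE_mp) auto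
qed

section \<open>Magnetic derivatives\<close>

lemmas smooth_intros = smooth_add smooth_diff smooth_mult smooth_uminus smooth_const smooth_sum
  smooth_of_real smooth_cnj smooth_pd smooth_power

text \<open>Enough integrability to pair with test functions. Unlike \<open>L2\<close> it survives
  multiplication by an arbitrary smooth function such as A_j, whose product with an L^2 function
  need not be in L^2.\<close>

definition tint :: "(real^'d::finite \<Rightarrow> complex) \<Rightarrow> bool" where
  "tint f \<longleftrightarrow> (\<forall>\<phi>. test_fun \<phi> \<longrightarrow> integrable lborel (\<lambda>x. f x * cnj (\<phi> x)))"

lemma tint_L2: "L2 f \<Longrightarrow> tint f"
  unfolding tint_def by (auto intro: L2_ip test_L2)

lemma tint_add: "tint f \<Longrightarrow> tint g \<Longrightarrow> tint (\<lambda>x. f x + g x)"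
  unfolding tint_def by (auto simp: distrib_right)

lemma tint_diff: "tint f \<Longrightarrow> tint g \<Longrightarrow> tint (\<lambda>x. f x - g x)"
  unfolding tint_def by (auto simp: left_diff_distrib)

lemma tint_zero: "tint (\<lambda>x. 0)"
  unfolding tint_def by simp

lemma tint_sum: "(\<And>i. i \<in> I \<Longrightarrow> tint (f i)) \<Longrightarrow> tint (\<lambda>x. \<Sum>i\<in>I. f i x)"
  by (induction I rule: infinite_finite_induct) (auto intro: tint_zero tint_add)

lemma tint_mult:
  assumes "tint f" "smooth a" shows "tint (\<lambda>x. a x * f x)"
  unfolding tint_def
proof (intro allI impI)
  fix \<phi> :: "real^'a \<Rightarrow> complex" assume "test_fun \<phi>"
  then have "integrable lborel (\<lambda>x. f x * cnj (cnj (a x) * \<phi> x))"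
    using assms(1) test_mult[OF smooth_cnj[OF assms(2)]] unfolding tint_def by blast
  then show "integrable lborel (\<lambda>x. a x * f x * cnj (\<phi> x))" by (simp add: mult_ac)
qed

lemma tint_cmult: "tint f \<Longrightarrow> tint (\<lambda>x. c * f x)"
  by (rule tint_mult[OF _ smooth_const])

lemma tip_add: "tint f \<Longrightarrow> tint g \<Longrightarrow> test_fun \<phi> \<Longrightarrow> ip (\<lambda>x. f x + g x) \<phi> = ip f \<phi> + ip g \<phi>"
  unfolding ip_def tint_def by (simp add: distrib_right)

lemma tip_diff: "tint f \<Longrightarrow> tint g \<Longrightarrow> test_fun \<phi> \<Longrightarrow> ip (\<lambda>x. f x - g x) \<phi> = ip f \<phi> - ip g \<phi>"
  unfolding ip_def tint_def by (simp add: left_diff_distrib)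

lemma tip_sum: "(\<And>i. i \<in> I \<Longrightarrow> tint (f i)) \<Longrightarrow> test_fun \<phi> \<Longrightarrow> ip (\<lambda>x. \<Sum>i\<in>I. f i x) \<phi> = (\<Sum>i\<in>I. ip (f i) \<phi>)"
  by (induction I rule: infinite_finite_induct) (auto simp: tip_add tint_sum)

lemma tip_add_right: "tint u \<Longrightarrow> test_fun f \<Longrightarrow> test_fun g \<Longrightarrow> ip u (\<lambda>x. f x + g x) = ip u f + ip u g"
  unfolding ip_def tint_def by (simp add: distrib_left)

lemma tip_diff_right: "tint u \<Longrightarrow> test_fun f \<Longrightarrow> test_fun g \<Longrightarrow> ip u (\<lambda>x. f x - g x) = ip u f - ip u g"
  unfolding ip_def tint_def by (simp add: right_diff_distrib)

lemma tip_sum_right: "tint u \<Longrightarrow> (\<And>i. i \<in> I \<Longrightarrow> test_fun (f i)) \<Longrightarrow> ip u (\<lambda>x. \<Sum>i\<in>I. f i x) = (\<Sum>i\<in>I. ip u (f i))"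
  by (induction I rule: infinite_finite_induct) (auto simp: tip_add_right test_sum)

lemma ip_mult_left: "ip (\<lambda>x. a x * f x) \<phi> = ip f (\<lambda>x. cnj (a x) * \<phi> x)"
  by (rule ip_shift) (simp add: mult_ac)

lemma L2_test_mult:
  assumes "test_fun a" "L2 f" shows "L2 (\<lambda>x. a x * f x)"
proof -
  obtain C where "\<And>x. cmod (a x) \<le> C" using test_bounded[OF assms(1)] by blast
  then have "cmod (a x * f x) \<le> C * cmod (f x)" for x by (simp add: norm_mult mult_right_mono)
  then show ?thesis
    by (intro L2_dom(1)[OF assms(2)]) (use test_meas[OF assms(1)] L2_meas[OF assms(2)] in auto)
qed

lemma L2_compact_mult:
  assumes "smooth a" "L2 f" "\<And>x. norm x > r \<Longrightarrow> f x = 0"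
  shows "L2 (\<lambda>x. a x * f x)"
proof -
  have "bounded (a ` cball 0 r)"
    by (intro compact_imp_bounded compact_continuous_image continuous_on_subset[OF smooth_cont[OF assms(1)]]) auto
  then obtain C where C: "\<And>x. x \<in> cball 0 r \<Longrightarrow> norm (a x) \<le> C" unfolding bounded_iff by blast
  have "cmod (a x * f x) \<le> C * cmod (f x)" for x
    using C[of x] assms(3)[of x] by (cases "norm x > r") (auto simp: norm_mult intro: mult_right_mono)
  then show ?thesis
    by (intro L2_dom(1)[OF assms(2)]) (use smooth_meas[OF assms(1)] L2_meas[OF assms(2)] in auto)
qed

lemma L2lim_compact_mult:
  assumes "L2lim F f" "smooth a" "\<And>m x. norm x > r \<Longrightarrow> F m x = 0" "\<And>x. norm x > r \<Longrightarrow> f x = 0"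
  shows "L2lim (\<lambda>m x. a x * F m x) (\<lambda>x. a x * f x)"
proof -
  have "bounded (a ` cball 0 r)"
    by (intro compact_imp_bounded compact_continuous_image continuous_on_subset[OF smooth_cont[OF assms(2)]]) auto
  then obtain C where C: "\<And>x. x \<in> cball 0 r \<Longrightarrow> norm (a x) \<le> C" unfolding bounded_iff by blast
  show ?thesis
    by (rule L2lim_mult[OF assms(1) smooth_meas[OF assms(2)], where K="cball 0 r" and C=C])
       (use C assms(3,4) in auto)
qed

lemma weak_L_ip: "weak_L h A j u g \<longleftrightarrow> (\<forall>\<phi>. test_fun \<phi> \<longrightarrow> ip u (Lc h A j \<phi>) = ip g \<phi>)"
  unfolding weak_L_def ip_def ..

lemma weak_Lap_ip: "weak_Lap h A u g \<longleftrightarrow> (\<forall>\<phi>. test_fun \<phi> \<longrightarrow> ip u (Lapc h A \<phi>) = ip g \<phi>)"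
  unfolding weak_Lap_def ip_def ..

locale magnetic =
  fixes A :: "'d::finite \<Rightarrow> real^'d \<Rightarrow> real"
  assumes smoothA: "\<And>j. smooth (A j)"
begin

definition B :: "'d \<Rightarrow> 'd \<Rightarrow> real^'d \<Rightarrow> real" where
  "B j k x = pd j (A k) x - pd k (A j) x"

lemma smoothB: "smooth (B j k)"
  unfolding B_def[abs_def] by (intro smooth_intros smoothA)

lemma magB_nth: "magB A x $ j $ k = B j k x"
  unfolding magB_def B_def by simp

lemma smooth_Lc: "smooth \<phi> \<Longrightarrow> smooth (Lc h A j \<phi>)"
  unfolding Lc_def by (intro smooth_intros smoothA)

lemma test_Lc: "test_fun \<phi> \<Longrightarrow> test_fun (Lc h A j \<phi>)"
  unfolding Lc_def by (intro test_diff test_cmult test_pd test_mult smooth_of_real smoothA)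

lemma test_Lapc: "test_fun \<phi> \<Longrightarrow> test_fun (Lapc h A \<phi>)"
  unfolding Lapc_def by (intro test_sum test_Lc)

lemma Lc_add: "smooth f \<Longrightarrow> smooth g \<Longrightarrow> Lc h A j (\<lambda>x. f x + g x) x = Lc h A j f x + Lc h A j g x"
  unfolding Lc_def by (simp add: pd_add algebra_simps)

lemma Lc_diff: "smooth f \<Longrightarrow> smooth g \<Longrightarrow> Lc h A j (\<lambda>x. f x - g x) x = Lc h A j f x - Lc h A j g x"
  unfolding Lc_def by (simp add: pd_diff algebra_simps)

lemma Lc_cmult: "smooth f \<Longrightarrow> Lc h A j (\<lambda>x. c * f x) x = c * Lc h A j f x"
  unfolding Lc_def by (simp add: pd_cmult algebra_simps)

lemma Lc_sum: "(\<And>i. i \<in> I \<Longrightarrow> smooth (f i)) \<Longrightarrow> Lc h A j (\<lambda>x. \<Sum>i\<in>I. f i x) x = (\<Sum>i\<in>I. Lc h A j (f i) x)"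
  unfolding Lc_def by (simp add: pd_sum sum_distrib_left sum_subtractf)

lemma Lapc_diff: "smooth f \<Longrightarrow> smooth g \<Longrightarrow> Lapc h A (\<lambda>x. f x - g x) x = Lapc h A f x - Lapc h A g x"
proof -
  assume s: "smooth f" "smooth g"
  have "Lc h A j (\<lambda>x. f x - g x) = (\<lambda>x. Lc h A j f x - Lc h A j g x)" for j
    using Lc_diff[OF s] by blast
  then show ?thesis unfolding Lapc_def by (simp add: Lc_diff smooth_Lc s sum_subtractf)
qed

lemma Lc_mult:
  "smooth a \<Longrightarrow> smooth \<phi> \<Longrightarrow> Lc h A j (\<lambda>x. a x * \<phi> x) x = a x * Lc h A j \<phi> x - \<i> * of_real h * pd j a x * \<phi> x"
  unfolding Lc_def by (simp add: pd_mult algebra_simps)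

lemma Lc_rmult:
  "smooth a \<Longrightarrow> smooth \<phi> \<Longrightarrow>
    Lc h A j (\<lambda>x. of_real (a x) * \<phi> x) x = of_real (a x) * Lc h A j \<phi> x - \<i> * of_real h * of_real (pd j a x) * \<phi> x"
  using Lc_mult[OF smooth_of_real] by (simp add: pd_of_real)

lemma Lc_sym:
  assumes \<phi>: "test_fun \<phi>" and \<psi>: "test_fun \<psi>"
  shows "ip (Lc h A j \<phi>) \<psi> = ip \<phi> (Lc h A j \<psi>)"
proof -
  have t: "test_fun (\<lambda>x. - \<i> * of_real h * pd j \<theta> x)" "test_fun (\<lambda>x. of_real (A j x) * \<theta> x)" if "test_fun \<theta>" for \<theta>
    by (rule test_cmult[OF test_pd[OF that]], rule test_mult[OF smooth_of_real[OF smoothA] that])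
  have "ip (Lc h A j \<phi>) \<psi> = - \<i> * of_real h * ip (pd j \<phi>) \<psi> - ip (\<lambda>x. of_real (A j x) * \<phi> x) \<psi>"
    unfolding Lc_def ip_diff_left[OF test_L2[OF t(1)[OF \<phi>]] test_L2[OF t(2)[OF \<phi>]] test_L2[OF \<psi>]] ip_cmult_left ..
  moreover have "ip \<phi> (Lc h A j \<psi>) = \<i> * of_real h * ip \<phi> (pd j \<psi>) - ip \<phi> (\<lambda>x. of_real (A j x) * \<psi> x)"
    unfolding Lc_def ip_diff_right[OF test_L2[OF t(1)[OF \<psi>]] test_L2[OF t(2)[OF \<psi>]] test_L2[OF \<phi>]] ip_cmult_right by simp
  moreover have "ip (\<lambda>x. of_real (A j x) * \<phi> x) \<psi> = ip \<phi> (\<lambda>x. of_real (A j x) * \<psi> x)"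
    by (rule ip_shift) simp
  ultimately show ?thesis using ip_pd[OF \<phi> \<psi>, of j] by simp
qed

text \<open>Second derivatives cancel by \<open>pd_commute\<close> and the products of two
  components of A cancel as well; only the derivatives of A, that is the field, remain.\<close>

lemma Lc_comm:
  assumes s: "smooth \<phi>"
  shows "Lc h A j (Lc h A k \<phi>) x = Lc h A k (Lc h A j \<phi>) x + \<i> * of_real h * of_real (B j k x) * \<phi> x"
proof -
  have e: "Lc h A j (Lc h A k \<phi>) x = - ((of_real h)^2 * pd j (pd k \<phi>) x) + \<i> * of_real h * (of_real (A k x) * pd j \<phi> x + of_real (pd j (A k) x) * \<phi> x)
     - of_real (A j x) * (- \<i> * of_real h * pd k \<phi> x - of_real (A k x) * \<phi> x)" for j k
  proof -
    have p: "pd j (\<lambda>x. - \<i> * of_real h * pd k \<phi> x - of_real (A k x) * \<phi> x) x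
      = - \<i> * of_real h * pd j (pd k \<phi>) x - (of_real (A k x) * pd j \<phi> x + of_real (pd j (A k) x) * \<phi> x)"
      using s smoothA by (simp only: pd_diff pd_cmult pd_mult pd_of_real smooth_intros)
    show ?thesis unfolding Lc_def[of h A j] Lc_def[of h A k] p by (simp add: algebra_simps power2_eq_square)
  qed
  show ?thesis unfolding e B_def using pd_commute[OF s, of j k x] by (simp add: algebra_simps)
qed

text \<open>Isolates the constant-coefficient principal part, so that the equation can be read as a
  Poisson equation with lower order terms as data.\<close>

lemma Lapc_expand:
  assumes s: "smooth \<phi>"
  shows "Lapc h A \<phi> x = (\<Sum>j\<in>UNIV. - ((of_real h)^2 * pd j (pd j \<phi>) x) + 2 * \<i> * of_real h * of_real (A j x) * pd j \<phi> x
     + (\<i> * of_real h * of_real (pd j (A j) x) + (of_real (A j x))^2) * \<phi> x)"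
proof -
  have "Lc h A j (Lc h A j \<phi>) x = - ((of_real h)^2 * pd j (pd j \<phi>) x) + 2 * \<i> * of_real h * of_real (A j x) * pd j \<phi> x
     + (\<i> * of_real h * of_real (pd j (A j) x) + (of_real (A j x))^2) * \<phi> x" for j
  proof -
    have p: "pd j (\<lambda>x. - \<i> * of_real h * pd j \<phi> x - of_real (A j x) * \<phi> x) x
      = - \<i> * of_real h * pd j (pd j \<phi>) x - (of_real (A j x) * pd j \<phi> x + of_real (pd j (A j) x) * \<phi> x)"
      using s smoothA by (simp only: pd_diff pd_cmult pd_mult pd_of_real smooth_intros)
    show ?thesis unfolding Lc_def[of h A j] p by (simp add: algebra_simps power2_eq_square)
  qed
  then show ?thesis unfolding Lapc_def by simp
qed

lemma Lapc_mult:
  assumes s: "smooth a" "smooth \<phi>"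
  shows "Lapc h A (\<lambda>x. a x * \<phi> x) x = a x * Lapc h A \<phi> x
    - (\<Sum>j\<in>UNIV. 2 * \<i> * of_real h * pd j a x * Lc h A j \<phi> x + (of_real h)^2 * pd j (pd j a) x * \<phi> x)"
proof -
  have "Lc h A j (Lc h A j (\<lambda>x. a x * \<phi> x)) x = a x * Lc h A j (Lc h A j \<phi>) x
     - (2 * \<i> * of_real h * pd j a x * Lc h A j \<phi> x + (of_real h)^2 * pd j (pd j a) x * \<phi> x)" for j
  proof -
    have e: "Lc h A j (\<lambda>x. a x * \<phi> x) = (\<lambda>x. a x * Lc h A j \<phi> x - (\<i> * of_real h * pd j a x) * \<phi> x)"
      using Lc_mult[OF s] by (simp add: fun_eq_iff)
    have c: "smooth (\<lambda>x. \<i> * of_real h * pd j a x)" by (intro smooth_intros s)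
    note l = smooth_Lc[OF s(2), of h j]
    show ?thesis unfolding e
        Lc_diff[OF smooth_mult[OF s(1) l] smooth_mult[OF c s(2)]] Lc_mult[OF s(1) l] Lc_mult[OF c s(2)]
        pd_cmult[OF smooth_pd[OF s(1)]]
      by (simp add: algebra_simps power2_eq_square)
  qed
  then show ?thesis unfolding Lapc_def by (simp add: sum_subtractf sum_distrib_left)
qed

lemma Lapc_Lc_comm:
  assumes s: "smooth \<phi>"
  shows "Lapc h A (Lc h A k \<phi>) x = Lc h A k (Lapc h A \<phi>) x
    + (\<Sum>j\<in>UNIV. 2 * \<i> * of_real h * of_real (B j k x) * Lc h A j \<phi> x + (of_real h)^2 * of_real (pd j (B j k) x) * \<phi> x)"
proof -
  have "Lc h A j (Lc h A j (Lc h A k \<phi>)) x = Lc h A k (Lc h A j (Lc h A j \<phi>)) x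
     + (2 * \<i> * of_real h * of_real (B j k x) * Lc h A j \<phi> x + (of_real h)^2 * of_real (pd j (B j k) x) * \<phi> x)" for j
  proof -
    have e: "Lc h A j (Lc h A k \<phi>) = (\<lambda>x. Lc h A k (Lc h A j \<phi>) x + \<i> * of_real h * (of_real (B j k x) * \<phi> x))"
      by (rule ext) (simp only: Lc_comm[OF s, of h j k] mult.assoc)
    have b: "smooth (\<lambda>x. complex_of_real (B j k x) * \<phi> x)" by (intro smooth_intros smoothB s)
    show ?thesis unfolding e
      by (simp only: Lc_add[OF smooth_Lc[OF smooth_Lc[OF s]] smooth_mult[OF smooth_const b]] Lc_cmult[OF b]
          Lc_rmult[OF smoothB s] Lc_comm[OF smooth_Lc[OF s, of h j], of h j k x])
         (simp add: algebra_simps power2_eq_square)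
  qed
  then show ?thesis unfolding Lapc_def
    by (simp add: sum.distrib Lc_sum smooth_Lc s)
qed

lemma weak_L_mult:
  assumes w: "weak_L h A j u g" and ti: "tint u" "tint g" and a: "smooth a"
  shows "weak_L h A j (\<lambda>x. a x * u x) (\<lambda>x. a x * g x - \<i> * of_real h * pd j a x * u x)"
  unfolding weak_L_ip
proof (intro allI impI)
  fix \<phi> :: "real^'d \<Rightarrow> complex" assume \<phi>: "test_fun \<phi>"
  have ca: "smooth (\<lambda>x. cnj (a x))" by (rule smooth_cnj[OF a])
  have t1: "test_fun (\<lambda>x. cnj (a x) * \<phi> x)" by (rule test_mult[OF ca \<phi>])
  have t2: "test_fun (\<lambda>x. \<i> * of_real h * pd j (\<lambda>x. cnj (a x)) x * \<phi> x)"
    by (rule test_mult[OF smooth_mult[OF smooth_const smooth_pd[OF ca]] \<phi>])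
  have "ip (\<lambda>x. a x * u x) (Lc h A j \<phi>) = ip u (\<lambda>x. cnj (a x) * Lc h A j \<phi> x)" by (rule ip_mult_left)
  also have "(\<lambda>x. cnj (a x) * Lc h A j \<phi> x) = (\<lambda>x. Lc h A j (\<lambda>x. cnj (a x) * \<phi> x) x + \<i> * of_real h * pd j (\<lambda>x. cnj (a x)) x * \<phi> x)"
    using Lc_mult[OF ca test_smooth[OF \<phi>]] by (simp add: fun_eq_iff)
  also have "ip u \<dots> = ip u (Lc h A j (\<lambda>x. cnj (a x) * \<phi> x)) + ip u (\<lambda>x. \<i> * of_real h * pd j (\<lambda>x. cnj (a x)) x * \<phi> x)"
    by (rule tip_add_right[OF ti(1) test_Lc[OF t1] t2])
  also have "ip u (Lc h A j (\<lambda>x. cnj (a x) * \<phi> x)) = ip g (\<lambda>x. cnj (a x) * \<phi> x)"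
    using w t1 unfolding weak_L_ip by blast
  also have "ip g (\<lambda>x. cnj (a x) * \<phi> x) = ip (\<lambda>x. a x * g x) \<phi>" by (rule ip_mult_left[symmetric])
  also have "ip u (\<lambda>x. \<i> * of_real h * pd j (\<lambda>x. cnj (a x)) x * \<phi> x) = - ip (\<lambda>x. \<i> * of_real h * pd j a x * u x) \<phi>"
    unfolding ip_uminus_left[symmetric] by (rule ip_shift) (simp add: pd_cnj[OF a])
  finally show "ip (\<lambda>x. a x * u x) (Lc h A j \<phi>) = ip (\<lambda>x. a x * g x - \<i> * of_real h * pd j a x * u x) \<phi>"
    using tip_diff[OF tint_mult[OF ti(2) a] tint_mult[OF ti(1) smooth_mult[OF smooth_const smooth_pd[OF a]]] \<phi>, of "\<i> * of_real h" j]
    by simp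
qed

lemma weak_L_add:
  assumes "weak_L h A j u g" "weak_L h A j v k" "tint u" "tint g" "tint v" "tint k"
  shows "weak_L h A j (\<lambda>x. u x + v x) (\<lambda>x. g x + k x)"
  using assms unfolding weak_L_ip by (auto simp: tip_add test_Lc)

lemma weak_L_unique:
  assumes "weak_L h A j u g" "weak_L h A j u k" "L2 g" "L2 k"
  shows "AE x in lborel. g x = k x"
proof -
  have "AE x in lborel. g x - k x = 0"
    by (rule L2_eq_zero_AE[OF L2_diff[OF assms(3,4)]])
       (use assms in \<open>auto simp: ip_diff_left test_L2 weak_L_ip\<close>)
  then show ?thesis by (rule AE_mp) auto
qed

end

section \<open>Local regularity\<close>

definition wpd :: "'d::finite \<Rightarrow> (real^'d \<Rightarrow> complex) \<Rightarrow> (real^'d \<Rightarrow> complex) \<Rightarrow> bool" where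
  "wpd j U D \<longleftrightarrow> (\<forall>\<phi>. test_fun \<phi> \<longrightarrow> ip U (pd j \<phi>) = - ip D \<phi>)"

lemma conv_ip_real:
  assumes "\<And>x. cnj (\<rho> x) = \<rho> x"
  shows "conv \<rho> F x = ip F (\<lambda>y. \<rho> (x - y))"
  unfolding conv_eq_ip assms ..

lemma pd_real: "smooth \<rho> \<Longrightarrow> (\<And>x. cnj (\<rho> x) = \<rho> x) \<Longrightarrow> cnj (pd j \<rho> x) = pd j \<rho> x"
  using pd_cnj[of \<rho> j x] by simp

lemma mollifier_cnj: "cnj (mollifier m x) = mollifier m x"
  by (subst (1 2) mollifier_real) simp

lemma pd_reflect_fun: "smooth f \<Longrightarrow> pd j (\<lambda>y. f (x - y)) = (\<lambda>y. - pd j f (x - y))"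
  using pd_reflect by blast

text \<open>Derivatives of a mollification are pairings with derivatives of the test function y ->
  rho(x - y); each derivative changes sign under the reflection. A weak equation tested with this
  function thus becomes a pointwise equation for mollifications.\<close>

lemma pd_conv_mollifier:
  assumes F: "integrable lborel F"
  shows "pd j (conv (mollifier m) F) x = - ip F (pd j (\<lambda>y. mollifier m (x - y)))"
    and "pd j (pd j (conv (mollifier m) F)) x = ip F (pd j (pd j (\<lambda>y. mollifier m (x - y))))"
proof -
  note t = test_mollifier[of m] test_pd[OF test_mollifier[of m], of j]
  note s = test_smooth[OF t(1)] test_smooth[OF t(2)]
  have r1: "cnj (pd j (mollifier m) x) = pd j (mollifier m) x" for x by (rule pd_real[OF s(1) mollifier_cnj])
  have r2: "cnj (pd j (pd j (mollifier m)) x) = pd j (pd j (mollifier m)) x" for x by (rule pd_real[OF s(2) r1])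
  have e: "pd j (conv (mollifier m) F) = conv (pd j (mollifier m)) F" using pd_conv[OF F t(1)] by blast
  show "pd j (conv (mollifier m) F) x = - ip F (pd j (\<lambda>y. mollifier m (x - y)))"
    unfolding e conv_ip_real[OF r1] pd_reflect_fun[OF s(1)] ip_uminus_right by simp
  have "pd j (pd j (\<lambda>y. mollifier m (x - y))) = (\<lambda>y. pd j (pd j (mollifier m)) (x - y))"
    unfolding pd_reflect_fun[OF s(1)]
    using pd_uminus[OF smooth_affine[OF s(2), of x "-1"], of j] pd_reflect[OF s(2)] by (simp add: fun_eq_iff)
  then show "pd j (pd j (conv (mollifier m) F)) x = ip F (pd j (pd j (\<lambda>y. mollifier m (x - y))))"
    unfolding e pd_conv[OF F t(2)] conv_ip_real[OF r2] by simp
qed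

lemma wpd_mollify:
  assumes "integrable lborel U" "wpd j U D"
  shows "pd j (conv (mollifier m) U) = conv (mollifier m) D"
proof
  fix x
  have "ip U (pd j (\<lambda>y. mollifier m (x - y))) = - ip D (\<lambda>y. mollifier m (x - y))"
    using assms(2) test_reflect[OF test_mollifier] unfolding wpd_def by blast
  then show "pd j (conv (mollifier m) U) x = conv (mollifier m) D x"
    unfolding pd_conv_mollifier[OF assms(1)] conv_ip_real[OF mollifier_cnj] by simp
qed

lemma L2_complete_dominated:
  assumes F: "\<And>m. L2 (F m)" and le: "\<And>m k. L2norm (\<lambda>x. F m x - F k x) \<le> t m + t k" and t: "t \<longlonglongrightarrow> 0"
  obtains f where "L2lim F f"
proof (rule L2_complete[OF F])
  fix e :: real assume "e > 0"
  then obtain N where N: "\<And>m. m \<ge> N \<Longrightarrow> norm (t m - 0) < e / 2" using LIMSEQ_D[OF t, of "e/2"] by auto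
  have "L2norm (\<lambda>x. F m x - F k x) < e" if "m \<ge> N" "k \<ge> N" for m k
    using N[OF that(1)] N[OF that(2)] le[of m k] by simp
  then show "\<exists>N. \<forall>m\<ge>N. \<forall>k\<ge>N. L2norm (\<lambda>x. F m x - F k x) < e" by blast
qed (rule that)

lemma L2lim_Cauchy_bound:
  assumes "L2lim F f"
  shows "L2norm (\<lambda>x. F m x - F k x) \<le> L2norm (\<lambda>x. F m x - f x) + L2norm (\<lambda>x. F k x - f x)"
  using L2norm_triangle_mid[OF L2limD(1)[OF assms] L2limD(2)[OF assms] L2limD(1)[OF assms], of m k]
    L2norm_minus_commute[of f "F k"] by simp

text \<open>\<open>\<Delta>U = F\<^sub>0 - \<Sum>\<^sub>j \<partial>\<^sub>jF\<^sub>j\<close> in the sense of distributions: testing the equation of the mollified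
  differences against themselves shows that their gradients form a Cauchy sequence.\<close>
lemma weak_gradient_exists:
  fixes U :: "real^'d::finite \<Rightarrow> complex" and F :: "'d \<Rightarrow> real^'d \<Rightarrow> complex"
  assumes U: "L2 U" and F0: "L2 F0" and F: "\<And>j. L2 (F j)"
    and v: "\<And>x. norm x > r \<Longrightarrow> U x = 0" "\<And>x. norm x > r \<Longrightarrow> F0 x = 0" "\<And>j x. norm x > r \<Longrightarrow> F j x = 0"
    and eq: "\<And>\<phi>. test_fun \<phi> \<Longrightarrow> (\<Sum>j\<in>UNIV. ip U (pd j (pd j \<phi>))) = ip F0 \<phi> + (\<Sum>j\<in>UNIV. ip (F j) (pd j \<phi>))"
  obtains D where "\<And>j. L2 (D j)" "\<And>j. wpd j U (D j)"
proof -
  define Um where "Um m = conv (mollifier m) U" for m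
  define F0m where "F0m m = conv (mollifier m) F0" for m
  define Fm where "Fm j m = conv (mollifier m) (F j)" for j m
  have Ui: "integrable lborel U" and F0i: "integrable lborel F0" and Fi: "integrable lborel (F j)" for j
    by (rule L2_compact_integrable[OF U v(1)] L2_compact_integrable[OF F0 v(2)] L2_compact_integrable[OF F v(3)], assumption)+
  have tU: "test_fun (Um m)" for m unfolding Um_def by (rule test_mollify[OF Ui v(1)])
  have tF0: "test_fun (F0m m)" for m unfolding F0m_def by (rule test_mollify[OF F0i v(2)])
  have tF: "test_fun (Fm j m)" for j m unfolding Fm_def by (rule test_mollify[OF Fi v(3)])
  have lU: "L2lim Um U" and lF0: "L2lim F0m F0" and lF: "L2lim (Fm j) (F j)" for j
    unfolding Um_def F0m_def Fm_def using mollify_L2lim[OF U] mollify_L2lim[OF F0] mollify_L2lim[OF F] by auto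
  \<comment> \<open>The weak equation tested with the reflected mollifier centred at x.\<close>
  have lap: "(\<Sum>j\<in>UNIV. pd j (pd j (Um m)) x) = F0m m x - (\<Sum>j\<in>UNIV. pd j (Fm j m) x)" for m x
    using eq[OF test_reflect[OF test_mollifier[of m]], of x]
    by (simp add: Um_def F0m_def Fm_def pd_conv_mollifier[OF Ui] pd_conv_mollifier[OF Fi] conv_ip_real[OF mollifier_cnj] sum_negf)
  \<comment> \<open>One null sequence that dominates all data errors, so that the gradients can be
    compared with \<open>t m + t k\<close>.\<close>
  define t where "t m = L2norm (\<lambda>x. Um m x - U x) + L2norm (\<lambda>x. F0m m x - F0 x) + (\<Sum>j\<in>UNIV. L2norm (\<lambda>x. Fm j m x - F j x))" for m
  have t0: "t \<longlonglongrightarrow> 0 + 0 + (\<Sum>j\<in>(UNIV::'d set). 0)" unfolding t_def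
    by (intro tendsto_add tendsto_sum L2limD(3) lU lF0 lF)
  \<comment> \<open>Young's inequality absorbs half of the gradient energy of the difference. What
    remains is 2 for the pair \<open>G0\<close>, \<open>W\<close> and 1 for each of the CARD('d)
    fields \<open>G j\<close>, whence the constant.\<close>
  have key: "L2norm (\<lambda>x. pd i (Um m) x - pd i (Um k) x) \<le> sqrt (2 + CARD('d)) * (t m + t k)" for i m k
  proof -
    define W where "W x = Um m x - Um k x" for x
    define G0 where "G0 x = F0m m x - F0m k x" for x
    define G where "G j x = Fm j m x - Fm j k x" for j x
    have tW: "test_fun W" "test_fun G0" "test_fun (G j)" for j
      unfolding W_def G0_def G_def by (intro test_diff tU tF0 tF)+
    have pW: "pd j W = (\<lambda>x. pd j (Um m) x - pd j (Um k) x)" for j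
      unfolding W_def using pd_diff[OF test_smooth[OF tU] test_smooth[OF tU]] by blast
    have pG: "pd j (G j) = (\<lambda>x. pd j (Fm j m) x - pd j (Fm j k) x)" for j
      unfolding G_def using pd_diff[OF test_smooth[OF tF] test_smooth[OF tF]] by blast
    have lW: "(\<Sum>j\<in>UNIV. pd j (pd j W) x) = G0 x - (\<Sum>j\<in>UNIV. pd j (G j) x)" for x
      using lap[of m x] lap[of k x] unfolding pW pG G0_def
      by (simp add: pd_diff[OF test_smooth[OF test_pd[OF tU]] test_smooth[OF test_pd[OF tU]]] sum_subtractf)
    define S where "S = (\<Sum>j\<in>UNIV. (L2norm (pd j W))^2)"
    have L: "L2 (pd j W)" "L2 (pd j (pd j W))" "L2 (pd j (G j))" "L2 W" "L2 G0" "L2 (G j)" for j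
      by (intro test_L2 test_pd tW)+
    have "of_real S = (\<Sum>j\<in>UNIV. ip (pd j W) (pd j W))" unfolding S_def by (simp add: ip_self)
    also have "\<dots> = (\<Sum>j\<in>UNIV. - ip (pd j (pd j W)) W)" using ip_pd[OF test_pd[OF tW(1)] tW(1)] by simp
    also have "\<dots> = - ip (\<lambda>x. \<Sum>j\<in>UNIV. pd j (pd j W) x) W" using L by (simp add: ip_sum_left sum_negf)
    also have "\<dots> = - ip G0 W + (\<Sum>j\<in>UNIV. ip (pd j (G j)) W)"
      unfolding lW using L by (subst ip_diff_left) (auto simp: ip_sum_left intro: L2_sum)
    also have "\<dots> = - ip G0 W - (\<Sum>j\<in>UNIV. ip (G j) (pd j W))" using ip_pd[OF tW(3) tW(1)] by (simp add: sum_negf)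
    finally have "cmod (of_real S) = cmod (- ip G0 W - (\<Sum>j\<in>UNIV. ip (G j) (pd j W)))" by simp
    also have "\<dots> \<le> cmod (ip G0 W) + (\<Sum>j\<in>UNIV. cmod (ip (G j) (pd j W)))"
      by (rule order_trans[OF norm_triangle_ineq4]) (simp add: norm_sum)
    also have "\<dots> \<le> L2norm G0 * L2norm W + (\<Sum>j\<in>UNIV. L2norm (G j) * L2norm (pd j W))"
      by (intro add_mono sum_mono ip_CS L)
    also have "\<dots> \<le> L2norm G0 * L2norm W + (\<Sum>j\<in>UNIV. ((L2norm (G j))^2 + (L2norm (pd j W))^2) / 2)"
    proof (intro add_left_mono sum_mono)
      fix j show "L2norm (G j) * L2norm (pd j W) \<le> ((L2norm (G j))^2 + (L2norm (pd j W))^2) / 2"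
        using sum_squares_bound[of "L2norm (G j)" "L2norm (pd j W)"] by simp
    qed
    also have "\<dots> = L2norm G0 * L2norm W + (\<Sum>j\<in>UNIV. (L2norm (G j))^2) / 2 + S / 2"
      unfolding S_def by (simp add: sum.distrib add_divide_distrib sum_divide_distrib)
    finally have S1: "S \<le> 2 * (L2norm G0 * L2norm W) + (\<Sum>j\<in>UNIV. (L2norm (G j))^2)" by simp
    have nn: "L2norm (\<lambda>x. Fm j m x - F j x) \<le> (\<Sum>j\<in>UNIV. L2norm (\<lambda>x. Fm j m x - F j x))" for j m
      by (rule member_le_sum) auto
    have sn: "(\<Sum>j\<in>UNIV. L2norm (\<lambda>x. Fm j m x - F j x)) \<ge> 0" for m by (simp add: sum_nonneg)
    have b: "L2norm G0 \<le> t m + t k" "L2norm W \<le> t m + t k" "L2norm (G j) \<le> t m + t k" for j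
      using L2lim_Cauchy_bound[OF lF0, of m k] L2lim_Cauchy_bound[OF lU, of m k] L2lim_Cauchy_bound[OF lF, of j m k]
        nn[of j m] nn[of j k] sn[of m] sn[of k] L2norm_nonneg[of "\<lambda>x. Um m x - U x"] L2norm_nonneg[of "\<lambda>x. F0m m x - F0 x"]
        L2norm_nonneg[of "\<lambda>x. Um k x - U x"] L2norm_nonneg[of "\<lambda>x. F0m k x - F0 x"]
      unfolding G0_def W_def G_def t_def by linarith+
    have tt: "t m + t k \<ge> 0" using b(1) L2norm_nonneg[of G0] by linarith
    have "(L2norm (pd i W))^2 \<le> S" unfolding S_def by (rule member_le_sum) auto
    also have "S \<le> 2 * ((t m + t k) * (t m + t k)) + (\<Sum>j\<in>(UNIV::'d set). (t m + t k)^2)"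
      by (rule order_trans[OF S1]) (intro add_mono mult_left_mono mult_mono sum_mono power_mono b tt, simp_all)
    also have "\<dots> = (sqrt (2 + CARD('d)) * (t m + t k))^2"
      by (simp add: power_mult_distrib power2_eq_square algebra_simps)
    finally have "L2norm (pd i W) \<le> sqrt (2 + CARD('d)) * (t m + t k)"
      by (rule power2_le_imp_le) (use tt in simp)
    then show ?thesis unfolding pW .
  qed
  have "\<exists>D. L2lim (\<lambda>m. pd j (Um m)) D" for j
  proof -
    have "L2 (pd j (Um m))" for m by (intro test_L2 test_pd tU)
    moreover have "(\<lambda>m. sqrt (2 + CARD('d)) * t m) \<longlonglongrightarrow> 0"
      using tendsto_mult_left[OF t0, of "sqrt (2 + CARD('d))"] by simp
    ultimately show ?thesis
      using L2_complete_dominated[of "\<lambda>m. pd j (Um m)" "\<lambda>m. sqrt (2 + CARD('d)) * t m"] key[of j]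
      by (metis distrib_left)
  qed
  then obtain D where D: "\<And>j. L2lim (\<lambda>m. pd j (Um m)) (D j)" by metis
  have "wpd j U (D j)" for j
    unfolding wpd_def
  proof (intro allI impI)
    fix \<phi> :: "real^'d \<Rightarrow> complex" assume \<phi>: "test_fun \<phi>"
    have "(\<lambda>m. ip (Um m) (pd j \<phi>)) \<longlonglongrightarrow> ip U (pd j \<phi>)"
      by (intro L2lim_ip lU L2lim_const test_L2 test_pd \<phi>)
    moreover have "(\<lambda>m. - ip (pd j (Um m)) \<phi>) \<longlonglongrightarrow> - ip (D j) \<phi>"
      by (intro tendsto_minus L2lim_ip D L2lim_const test_L2 \<phi>)
    moreover have "- ip (pd j (Um m)) \<phi> = ip (Um m) (pd j \<phi>)" for m using ip_pd[OF tU \<phi>] by simp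
    ultimately show "ip U (pd j \<phi>) = - ip (D j) \<phi>" using LIMSEQ_unique by simp
  qed
  with that L2limD(2)[OF D] show ?thesis by blast
qed

context magnetic begin

lemma wpd_weak_L:
  assumes U: "tint U" and D: "tint D" "wpd j U D"
  shows "weak_L h A j U (\<lambda>x. - \<i> * of_real h * D x - of_real (A j x) * U x)"
  unfolding weak_L_ip
proof (intro allI impI)
  fix \<phi> :: "real^'d \<Rightarrow> complex" assume \<phi>: "test_fun \<phi>"
  have a: "smooth (\<lambda>x. complex_of_real (A j x))" by (intro smooth_of_real smoothA)
  have "ip U (Lc h A j \<phi>) = \<i> * of_real h * ip U (pd j \<phi>) - ip U (\<lambda>x. of_real (A j x) * \<phi> x)"
    unfolding Lc_def tip_diff_right[OF U test_cmult[OF test_pd[OF \<phi>]] test_mult[OF a \<phi>]] ip_cmult_right by simp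
  also have "ip U (\<lambda>x. of_real (A j x) * \<phi> x) = ip (\<lambda>x. of_real (A j x) * U x) \<phi>" by (simp add: ip_mult_left)
  also have "ip U (pd j \<phi>) = - ip D \<phi>" using D(2) \<phi> unfolding wpd_def by blast
  finally show "ip U (Lc h A j \<phi>) = ip (\<lambda>x. - \<i> * of_real h * D x - of_real (A j x) * U x) \<phi>"
    unfolding tip_diff[OF tint_cmult[OF D(1)] tint_mult[OF U a] \<phi>] ip_cmult_left by simp
qed

lemma Lapc_cutoff_expand:
  assumes s: "smooth a" "smooth \<phi>"
  shows "Lapc h A (\<lambda>x. a x * \<phi> x) x = (\<Sum>j\<in>UNIV. - ((of_real h)^2 * (a x * pd j (pd j \<phi>) x))
      + ((2 * \<i> * of_real h * of_real (A j x) * a x - 2 * (of_real h)^2 * pd j a x) * pd j \<phi> x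
      + ((\<i> * of_real h * of_real (pd j (A j) x) + (of_real (A j x))^2) * a x + 2 * \<i> * of_real h * of_real (A j x) * pd j a x
          - (of_real h)^2 * pd j (pd j a) x) * \<phi> x))"
proof -
  have "Lapc h A (\<lambda>x. a x * \<phi> x) x = (\<Sum>j\<in>UNIV. a x * (- ((of_real h)^2 * pd j (pd j \<phi>) x) + 2 * \<i> * of_real h * of_real (A j x) * pd j \<phi> x
     + (\<i> * of_real h * of_real (pd j (A j) x) + (of_real (A j x))^2) * \<phi> x)
     - (2 * \<i> * of_real h * pd j a x * Lc h A j \<phi> x + (of_real h)^2 * pd j (pd j a) x * \<phi> x))"
    unfolding Lapc_mult[OF s] Lapc_expand[OF s(2)] by (simp only: sum_distrib_left sum_subtractf)
  also have "\<dots> = (\<Sum>j\<in>UNIV. - ((of_real h)^2 * (a x * pd j (pd j \<phi>) x))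
      + ((2 * \<i> * of_real h * of_real (A j x) * a x - 2 * (of_real h)^2 * pd j a x) * pd j \<phi> x
      + ((\<i> * of_real h * of_real (pd j (A j) x) + (of_real (A j x))^2) * a x + 2 * \<i> * of_real h * of_real (A j x) * pd j a x
          - (of_real h)^2 * pd j (pd j a) x) * \<phi> x))"
    unfolding Lc_def by (intro sum.cong refl) (simp add: algebra_simps power2_eq_square)
  finally show ?thesis .
qed

text \<open>The weak equation is tested with X phi. Every coefficient then carries X or one of its
  derivatives and is bounded, and the first order terms stay on the test function as fluxes, so no
  derivative of u is presupposed and \<open>weak_gradient_exists\<close> applies.\<close>

lemma local_gradient:
  assumes h: "h > 0" and u: "L2 u" and f: "L2 f" and w: "weak_Lap h A u f"
    and X: "test_fun X" and Xr: "\<And>x. cnj (X x) = X x"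
  obtains G where "\<And>j. L2 (G j)" "\<And>j. weak_L h A j (\<lambda>x. X x * u x) (G j)"
proof -
  let ?H = "complex_of_real h"
  note sX = test_smooth[OF X]
  obtain r where r: "r \<ge> 0" "\<And>x. norm x > r \<Longrightarrow> X x = 0" using test_norm_bound[OF X] by blast
  have r1: "pd j X x = 0" if "norm x > r" for j x
    by (rule pd_vanish[of "cball 0 r"]) (use that r in auto)
  have r2: "pd j (pd j X) x = 0" if "norm x > r" for j x
    by (rule pd_vanish[of "cball 0 r"]) (use that r1 in auto)
  \<comment> \<open>\<open>a j\<close> and \<open>b j\<close> are the coefficients of the first
    derivative of phi and of phi itself in the expansion of the operator applied to X phi.\<close>
  define a where "a j x = 2 * \<i> * ?H * of_real (A j x) * X x - 2 * ?H^2 * pd j X x" for j x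
  define b where "b j x = (\<i> * ?H * of_real (pd j (A j) x) + (of_real (A j x))^2) * X x + 2 * \<i> * ?H * of_real (A j x) * pd j X x
          - ?H^2 * pd j (pd j X) x" for j x
  have ta: "test_fun (a j)" "test_fun (b j)" for j
  proof -
    have sm: "smooth (\<lambda>x. 2 * \<i> * ?H * complex_of_real (A j x))"
      "smooth (\<lambda>x. \<i> * ?H * complex_of_real (pd j (A j) x) + (complex_of_real (A j x))^2)"
      by (intro smooth_intros smoothA)+
    show "test_fun (a j)" unfolding a_def by (intro test_diff test_mult[OF sm(1)] test_cmult test_pd X)
    show "test_fun (b j)" unfolding b_def
      by (intro test_diff test_add test_mult[OF sm(1)] test_mult[OF sm(2)] test_cmult test_pd X)
  qed
  have tca: "test_fun (\<lambda>x. cnj (a j x))" "test_fun (\<lambda>x. cnj (b j x))" for j by (intro test_cnj ta)+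
  define U where "U x = X x * u x" for x
  define F0 where "F0 x = (1 / ?H^2) * ((\<Sum>j\<in>UNIV. cnj (b j x) * u x) - X x * f x)" for x
  define F where "F j x = (1 / ?H^2) * (cnj (a j x) * u x)" for j x
  have LU: "L2 U" unfolding U_def by (rule L2_test_mult[OF X u])
  have Lb: "L2 (\<lambda>x. \<Sum>j\<in>UNIV. cnj (b j x) * u x)" by (intro L2_sum L2_test_mult[OF tca(2) u])
  have LF0: "L2 F0" unfolding F0_def by (intro L2_cmult L2_diff Lb L2_test_mult[OF X f])
  have LF: "L2 (F j)" for j unfolding F_def by (intro L2_cmult L2_test_mult[OF tca(1) u])
  have eq: "(\<Sum>j\<in>UNIV. ip U (pd j (pd j \<phi>))) = ip F0 \<phi> + (\<Sum>j\<in>UNIV. ip (F j) (pd j \<phi>))" if \<phi>: "test_fun \<phi>" for \<phi>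
  proof -
    note s\<phi> = test_smooth[OF \<phi>]
    have tX: "test_fun (\<lambda>x. X x * \<phi> x)" by (rule test_mult[OF sX \<phi>])
    have t2: "test_fun (\<lambda>x. a j x * pd j \<phi> x)" "test_fun (\<lambda>x. b j x * \<phi> x)" for j
      by (intro test_mult test_smooth[OF ta(1)] test_smooth[OF ta(2)] test_pd \<phi>)+
    have t3: "test_fun (\<lambda>x. ?H^2 * (X x * pd j (pd j \<phi>) x))" for j
      by (intro test_cmult test_mult sX test_pd \<phi>)
    have e: "Lapc h A (\<lambda>x. X x * \<phi> x) = (\<lambda>x. (\<Sum>j\<in>UNIV. (a j x * pd j \<phi> x + b j x * \<phi> x)) - (\<Sum>j\<in>UNIV. ?H^2 * (X x * pd j (pd j \<phi>) x)))"
      unfolding fun_eq_iff Lapc_cutoff_expand[OF sX s\<phi>] a_def b_def sum_subtractf[symmetric] by simp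
    have "ip f (\<lambda>x. X x * \<phi> x) = ip u (Lapc h A (\<lambda>x. X x * \<phi> x))"
      using w tX unfolding weak_Lap_ip by simp
    also have "\<dots> = (\<Sum>j\<in>UNIV. ip u (\<lambda>x. a j x * pd j \<phi> x) + ip u (\<lambda>x. b j x * \<phi> x))
        - (\<Sum>j\<in>UNIV. ip u (\<lambda>x. ?H^2 * (X x * pd j (pd j \<phi>) x)))"
      unfolding e tip_diff_right[OF tint_L2[OF u] test_sum[OF test_add[OF t2]] test_sum[OF t3]]
        tip_sum_right[OF tint_L2[OF u] test_add[OF t2]] tip_sum_right[OF tint_L2[OF u] t3] tip_add_right[OF tint_L2[OF u] t2] ..
    also have "(\<Sum>j\<in>UNIV. ip u (\<lambda>x. ?H^2 * (X x * pd j (pd j \<phi>) x))) = ?H^2 * (\<Sum>j\<in>UNIV. ip U (pd j (pd j \<phi>)))"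
      unfolding U_def by (simp add: ip_cmult_right sum_distrib_left ip_mult_left[of X u] Xr)
    finally have 1: "?H^2 * (\<Sum>j\<in>UNIV. ip U (pd j (pd j \<phi>))) =
       (\<Sum>j\<in>UNIV. ip u (\<lambda>x. a j x * pd j \<phi> x) + ip u (\<lambda>x. b j x * \<phi> x)) - ip f (\<lambda>x. X x * \<phi> x)" by simp
    have 2: "ip F0 \<phi> = (1 / ?H^2) * ((\<Sum>j\<in>UNIV. ip u (\<lambda>x. b j x * \<phi> x)) - ip f (\<lambda>x. X x * \<phi> x))"
      unfolding F0_def ip_cmult_left ip_diff_left[OF Lb L2_test_mult[OF X f] test_L2[OF \<phi>]]
      by (simp add: ip_sum_left[OF L2_test_mult[OF tca(2) u] test_L2[OF \<phi>]] ip_mult_left Xr)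
    have 3: "ip (F j) (pd j \<phi>) = (1 / ?H^2) * ip u (\<lambda>x. a j x * pd j \<phi> x)" for j
      unfolding F_def ip_cmult_left by (simp add: ip_mult_left)
    have "?H^2 * (ip F0 \<phi> + (\<Sum>j\<in>UNIV. ip (F j) (pd j \<phi>))) =
       (\<Sum>j\<in>UNIV. ip u (\<lambda>x. a j x * pd j \<phi> x) + ip u (\<lambda>x. b j x * \<phi> x)) - ip f (\<lambda>x. X x * \<phi> x)"
      unfolding 2 3 sum_distrib_left[symmetric] using h by (simp add: distrib_left sum.distrib)
    with 1 have "?H^2 * (\<Sum>j\<in>UNIV. ip U (pd j (pd j \<phi>))) = ?H^2 * (ip F0 \<phi> + (\<Sum>j\<in>UNIV. ip (F j) (pd j \<phi>)))" by (rule trans[OF _ sym])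
    then show ?thesis using h by simp
  qed
  obtain D where D: "\<And>j. L2 (D j)" "\<And>j. wpd j U (D j)"
  proof (rule weak_gradient_exists[OF LU LF0 LF, of r])
    show "U x = 0" "F0 x = 0" "F j x = 0" if "norm x > r" for x j
      using r(2)[OF that] r1[OF that] r2[OF that] by (auto simp: U_def F0_def F_def a_def b_def)
  qed (use eq in auto)
  show ?thesis
  proof (rule that)
    show "weak_L h A j (\<lambda>x. X x * u x) (\<lambda>x. - \<i> * of_real h * D j x - of_real (A j x) * U x)" for j
      using wpd_weak_L[OF tint_L2[OF LU] tint_L2[OF D(1)] D(2)] unfolding U_def .
    show "L2 (\<lambda>x. - \<i> * of_real h * D j x - of_real (A j x) * U x)" for j
      by (intro L2_diff L2_cmult D L2_compact_mult[OF smooth_of_real[OF smoothA] LU, of r])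
         (simp add: U_def r(2))
  qed
qed

text \<open>Each L_j U being square-integrable, compact support makes the gradient and, through the
  equation, the Laplacian of U square-integrable. Mollification commutes with both, and the
  remaining coefficients are bounded on a ball that contains all supports.\<close>

lemma mollify_graph:
  assumes h: "h > 0" and U: "L2 U" and H: "\<And>j. L2 (H j)" and F: "L2 F"
    and v: "\<And>x. norm x > r \<Longrightarrow> U x = 0" "\<And>j x. norm x > r \<Longrightarrow> H j x = 0" "\<And>x. norm x > r \<Longrightarrow> F x = 0"
    and wH: "\<And>j. weak_L h A j U (H j)" and wF: "weak_Lap h A U F"
  obtains \<phi> where "\<And>m. test_fun (\<phi> m)" "\<And>m x. norm x > r + 1 \<Longrightarrow> \<phi> m x = 0"
    "L2lim \<phi> U" "\<And>j. L2lim (\<lambda>m. Lc h A j (\<phi> m)) (H j)" "L2lim (\<lambda>m. Lapc h A (\<phi> m)) F"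
proof -
  let ?H = "complex_of_real h"
  have H0: "?H \<noteq> 0" using h by simp
  define c where "c j x = \<i> * ?H * of_real (pd j (A j) x) + (of_real (A j x))^2" for j x
  have sA: "smooth (\<lambda>x. complex_of_real (A j x))" for j by (intro smooth_of_real smoothA)
  have sc: "smooth (c j)" for j unfolding c_def by (intro smooth_intros smoothA)
  \<comment> \<open>The weak partial derivative, obtained by solving the defining relation of L_j
    for it.\<close>
  define D where "D j x = (\<i> / ?H) * (H j x + of_real (A j x) * U x)" for j x
  have LD: "L2 (D j)" for j unfolding D_def by (intro L2_cmult L2_add H L2_compact_mult[OF sA U v(1)])
  have vD: "D j x = 0" if "norm x > r" for j x unfolding D_def using v[OF that] by simp
  have wD: "wpd j U (D j)" for j
    unfolding wpd_def
  proof (intro allI impI)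
    fix \<phi> :: "real^'d \<Rightarrow> complex" assume \<phi>: "test_fun \<phi>"
    have "pd j \<phi> = (\<lambda>x. (\<i> / ?H) * (Lc h A j \<phi> x + of_real (A j x) * \<phi> x))"
      unfolding Lc_def using H0 by (simp add: fun_eq_iff field_simps)
    then have "ip U (pd j \<phi>) = cnj (\<i> / ?H) * (ip U (Lc h A j \<phi>) + ip U (\<lambda>x. of_real (A j x) * \<phi> x))"
      by (simp only: ip_cmult_right tip_add_right[OF tint_L2[OF U] test_Lc[OF \<phi>] test_mult[OF sA \<phi>]])
    also have "ip U (Lc h A j \<phi>) = ip (H j) \<phi>" using wH \<phi> unfolding weak_L_ip by blast
    also have "ip U (\<lambda>x. of_real (A j x) * \<phi> x) = ip (\<lambda>x. of_real (A j x) * U x) \<phi>" by (simp add: ip_mult_left)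
    finally show "ip U (pd j \<phi>) = - ip (D j) \<phi>"
      unfolding D_def ip_cmult_left tip_add[OF tint_L2[OF H] tint_mult[OF tint_L2[OF U] sA] \<phi>] by simp
  qed
  \<comment> \<open>The weak Laplacian of U, obtained by solving the expanded equation for
    it.\<close>
  define Q where "Q x = (1 / ?H^2) * ((\<Sum>j\<in>UNIV. 2 * \<i> * ?H * (of_real (A j x) * D j x) + c j x * U x) - F x)" for x
  have LA: "L2 (\<lambda>x. of_real (A j x) * D j x)" "L2 (\<lambda>x. c j x * U x)" for j
    by (intro L2_compact_mult[OF sA LD vD] L2_compact_mult[OF sc U v(1)], assumption)+
  have LS: "L2 (\<lambda>x. \<Sum>j\<in>UNIV. 2 * \<i> * ?H * (of_real (A j x) * D j x) + c j x * U x)"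
    by (intro L2_sum L2_add L2_cmult LA)
  have LQ: "L2 Q" unfolding Q_def by (intro L2_cmult L2_diff LS F)
  have eq: "(\<Sum>j\<in>UNIV. ip U (pd j (pd j \<phi>))) = ip Q \<phi>" if \<phi>: "test_fun \<phi>" for \<phi>
  proof -
    note s\<phi> = test_smooth[OF \<phi>]
    have tA: "test_fun (\<lambda>x. of_real (A j x) * \<phi> x)" for j by (rule test_mult[OF sA \<phi>])
    have t: "test_fun (\<lambda>x. 2 * \<i> * ?H * pd j (\<lambda>x. of_real (A j x) * \<phi> x) x)" "test_fun (\<lambda>x. cnj (c j x) * \<phi> x)"
      "test_fun (\<lambda>x. ?H^2 * pd j (pd j \<phi>) x)" for j
      by (intro test_cmult test_pd tA test_mult[OF smooth_cnj[OF sc]] \<phi>)+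
    \<comment> \<open>The first order term is written in divergence form, so that pairing with U
      produces \<open>D j\<close>; this turns the zero order coefficient into its conjugate.\<close>
    have e: "Lapc h A \<phi> = (\<lambda>x. (\<Sum>j\<in>UNIV. 2 * \<i> * ?H * pd j (\<lambda>x. of_real (A j x) * \<phi> x) x + cnj (c j x) * \<phi> x) - (\<Sum>j\<in>UNIV. ?H^2 * pd j (pd j \<phi>) x))"
      unfolding fun_eq_iff Lapc_expand[OF s\<phi>] sum_subtractf[symmetric] pd_mult[OF sA s\<phi>] pd_of_real[OF smoothA] c_def
      by (intro allI sum.cong refl) (simp add: algebra_simps)
    have "ip F \<phi> = ip U (Lapc h A \<phi>)"
      using wF \<phi> unfolding weak_Lap_ip by simp
    also have "\<dots> = (\<Sum>j\<in>UNIV. ip U (\<lambda>x. 2 * \<i> * ?H * pd j (\<lambda>x. of_real (A j x) * \<phi> x) x) + ip U (\<lambda>x. cnj (c j x) * \<phi> x))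
        - (\<Sum>j\<in>UNIV. ip U (\<lambda>x. ?H^2 * pd j (pd j \<phi>) x))"
      unfolding e tip_diff_right[OF tint_L2[OF U] test_sum[OF test_add[OF t(1,2)]] test_sum[OF t(3)]]
        tip_sum_right[OF tint_L2[OF U] test_add[OF t(1,2)]] tip_sum_right[OF tint_L2[OF U] t(3)] tip_add_right[OF tint_L2[OF U] t(1,2)] ..
    also have "(\<Sum>j\<in>UNIV. ip U (\<lambda>x. ?H^2 * pd j (pd j \<phi>) x)) = ?H^2 * (\<Sum>j\<in>UNIV. ip U (pd j (pd j \<phi>)))"
      by (simp add: ip_cmult_right sum_distrib_left)
    also have "(\<lambda>j. ip U (\<lambda>x. 2 * \<i> * ?H * pd j (\<lambda>x. of_real (A j x) * \<phi> x) x) + ip U (\<lambda>x. cnj (c j x) * \<phi> x))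
      = (\<lambda>j. ip (\<lambda>x. 2 * \<i> * ?H * (of_real (A j x) * D j x) + c j x * U x) \<phi>)"
    proof
      fix j
      have "ip U (\<lambda>x. 2 * \<i> * ?H * pd j (\<lambda>x. of_real (A j x) * \<phi> x) x) = 2 * \<i> * ?H * ip (\<lambda>x. of_real (A j x) * D j x) \<phi>"
        using wD[of j] tA unfolding ip_cmult_right wpd_def by (simp add: ip_mult_left)
      moreover have "ip U (\<lambda>x. cnj (c j x) * \<phi> x) = ip (\<lambda>x. c j x * U x) \<phi>" by (rule ip_mult_left[symmetric])
      ultimately show "ip U (\<lambda>x. 2 * \<i> * ?H * pd j (\<lambda>x. of_real (A j x) * \<phi> x) x) + ip U (\<lambda>x. cnj (c j x) * \<phi> x)
          = ip (\<lambda>x. 2 * \<i> * ?H * (of_real (A j x) * D j x) + c j x * U x) \<phi>"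
        unfolding ip_add_left[OF L2_cmult[OF LA(1)] LA(2) test_L2[OF \<phi>]] ip_cmult_left by simp
    qed
    also have "(\<Sum>j\<in>UNIV. ip (\<lambda>x. 2 * \<i> * ?H * (of_real (A j x) * D j x) + c j x * U x) \<phi>)
       = ip (\<lambda>x. \<Sum>j\<in>UNIV. 2 * \<i> * ?H * (of_real (A j x) * D j x) + c j x * U x) \<phi>"
      by (rule ip_sum_left[symmetric]) (intro L2_add L2_cmult LA test_L2[OF \<phi>])+
    finally have "?H^2 * (\<Sum>j\<in>UNIV. ip U (pd j (pd j \<phi>))) = ip (\<lambda>x. \<Sum>j\<in>UNIV. 2 * \<i> * ?H * (of_real (A j x) * D j x) + c j x * U x) \<phi> - ip F \<phi>"
      by simp
    then show ?thesis unfolding Q_def ip_cmult_left ip_diff_left[OF LS F test_L2[OF \<phi>]] using H0 by (simp add: field_simps)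
  qed
  define \<phi> where "\<phi> m = conv (mollifier m) U" for m
  have Ui: "integrable lborel U" by (rule L2_compact_integrable[OF U v(1)])
  have t\<phi>: "test_fun (\<phi> m)" for m unfolding \<phi>_def by (rule test_mollify[OF Ui v(1)])
  have v\<phi>: "\<phi> m x = 0" if "norm x > r + 1" for m x unfolding \<phi>_def by (rule test_mollify(2)[OF Ui v(1) that])
  have l\<phi>: "L2lim \<phi> U" unfolding \<phi>_def by (rule mollify_L2lim[OF U])
  have lD: "L2lim (\<lambda>m. pd j (\<phi> m)) (D j)" for j
  proof -
    have "pd j (\<phi> m) = conv (mollifier m) (D j)" for m
      unfolding \<phi>_def by (rule wpd_mollify[OF Ui wD])
    then show ?thesis using mollify_L2lim[OF LD] by simp
  qed
  have vp: "pd j (\<phi> m) x = 0" if "norm x > r + 1" for j m x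
    by (rule pd_vanish[of "cball 0 (r + 1)"]) (use that v\<phi> in auto)
  have lQ: "L2lim (\<lambda>m x. \<Sum>j\<in>UNIV. pd j (pd j (\<phi> m)) x) Q"
  proof -
    have "(\<Sum>j\<in>UNIV. pd j (pd j (\<phi> m)) x) = conv (mollifier m) Q x" for m x
      unfolding \<phi>_def pd_conv_mollifier[OF Ui] conv_ip_real[OF mollifier_cnj, where F=Q]
      by (rule eq[OF test_reflect[OF test_mollifier]])
    then show ?thesis using mollify_L2lim[OF LQ] by simp
  qed
  have AU: "L2lim (\<lambda>m x. a x * \<phi> m x) (\<lambda>x. a x * U x)" if "smooth a" for a
    by (rule L2lim_compact_mult[OF l\<phi> that, of "r + 1"]) (use v\<phi> v(1) in auto)
  have AD: "L2lim (\<lambda>m x. of_real (A j x) * pd j (\<phi> m) x) (\<lambda>x. of_real (A j x) * D j x)" for j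
    by (rule L2lim_compact_mult[OF lD sA, of "r + 1"]) (use vp vD in auto)
  show ?thesis
  proof (rule that[OF t\<phi> v\<phi> l\<phi>])
    fix j
    have "L2lim (\<lambda>m x. - \<i> * ?H * pd j (\<phi> m) x - of_real (A j x) * \<phi> m x) (\<lambda>x. - \<i> * ?H * D j x - of_real (A j x) * U x)"
      by (intro L2lim_diff L2lim_cmult lD AU sA)
    moreover have "(\<lambda>x. - \<i> * ?H * D j x - of_real (A j x) * U x) = H j"
      unfolding D_def using H0 by (simp add: fun_eq_iff field_simps)
    ultimately show "L2lim (\<lambda>m. Lc h A j (\<phi> m)) (H j)" unfolding Lc_def by simp
  next
    have "L2lim (\<lambda>m x. - (?H^2) * (\<Sum>j\<in>UNIV. pd j (pd j (\<phi> m)) x) + (\<Sum>j\<in>UNIV. 2 * \<i> * ?H * (of_real (A j x) * pd j (\<phi> m) x) + c j x * \<phi> m x))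
        (\<lambda>x. - (?H^2) * Q x + (\<Sum>j\<in>UNIV. 2 * \<i> * ?H * (of_real (A j x) * D j x) + c j x * U x))"
      by (intro L2lim_add L2lim_sum L2lim_cmult lQ AD AU sc)
    moreover have "(\<lambda>x. - (?H^2) * Q x + (\<Sum>j\<in>UNIV. 2 * \<i> * ?H * (of_real (A j x) * D j x) + c j x * U x)) = F"
      unfolding Q_def using H0 by (simp add: fun_eq_iff)
    moreover have "(\<lambda>m x. - (?H^2) * (\<Sum>j\<in>UNIV. pd j (pd j (\<phi> m)) x) + (\<Sum>j\<in>UNIV. 2 * \<i> * ?H * (of_real (A j x) * pd j (\<phi> m) x) + c j x * \<phi> m x))
        = (\<lambda>m. Lapc h A (\<phi> m))"
      unfolding fun_eq_iff Lapc_expand[OF test_smooth[OF t\<phi>]] c_def sum_distrib_left sum.distrib[symmetric]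
      by (intro allI sum.cong refl) (simp add: algebra_simps)
    ultimately show "L2lim (\<lambda>m. Lapc h A (\<phi> m)) F" by simp
  qed
qed

end

section \<open>Energy estimates\<close>

context magnetic begin

text \<open>The cutoff is X^2 rather than X: the first order commutator terms then contain X L_j u,
  which is L_j(X u) up to a multiple of u. Thus \<open>G\<close>, the only gradient known to be in
  L^2, suffices to express everything.\<close>

lemma cutoff_graph:
  assumes u: "L2 u" and f: "L2 f" and w: "weak_Lap h A u f"
    and X: "test_fun X" and Xr: "\<And>x. cnj (X x) = X x"
    and G: "\<And>j. L2 (G j)" and wG: "\<And>j. weak_L h A j (\<lambda>x. X x * u x) (G j)"
  defines "H \<equiv> \<lambda>j x. X x * G j x - \<i> * of_real h * pd j X x * (X x * u x)"
    and "F \<equiv> \<lambda>x. X x * (X x * f x) + (\<Sum>j\<in>UNIV. - 4 * \<i> * of_real h * (pd j X x * G j x)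
          + 2 * (of_real h)^2 * (((pd j X x)^2 - X x * pd j (pd j X) x) * u x))"
  shows "L2 (\<lambda>x. X x * (X x * u x))" "\<And>j. L2 (H j)" "L2 F"
    and "\<And>j. weak_L h A j (\<lambda>x. X x * (X x * u x)) (H j)"
    and "weak_Lap h A (\<lambda>x. X x * (X x * u x)) F"
proof -
  let ?H = "complex_of_real h"
  note sX = test_smooth[OF X]
  have Xu: "L2 (\<lambda>x. X x * u x)" by (rule L2_test_mult[OF X u])
  show "L2 (\<lambda>x. X x * (X x * u x))" by (rule L2_test_mult[OF X Xu])
  show "L2 (H j)" for j unfolding H_def
    by (intro L2_diff L2_test_mult[OF X G] L2_test_mult[OF test_cmult[OF test_pd[OF X]] Xu])
  have tq: "test_fun (\<lambda>x. (pd j X x)^2 - X x * pd j (pd j X) x)" for j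
    unfolding power2_eq_square by (intro test_diff test_mult test_smooth[OF test_pd[OF X]] test_pd X sX)
  have LG: "L2 (\<lambda>x. pd j X x * G j x)" "L2 (\<lambda>x. ((pd j X x)^2 - X x * pd j (pd j X) x) * u x)" for j
    by (rule L2_test_mult[OF test_pd[OF X] G], rule L2_test_mult[OF tq u])
  have LT: "L2 (\<lambda>x. - 4 * \<i> * ?H * (pd j X x * G j x) + 2 * ?H^2 * (((pd j X x)^2 - X x * pd j (pd j X) x) * u x))" for j
    by (intro L2_add L2_cmult LG)
  have LXf: "L2 (\<lambda>x. X x * (X x * f x))" by (intro L2_test_mult X f)
  show "L2 F" unfolding F_def by (intro L2_add L2_sum LT LXf)
  show "weak_L h A j (\<lambda>x. X x * (X x * u x)) (H j)" for j
    unfolding H_def by (rule weak_L_mult[OF wG tint_L2[OF Xu] tint_L2[OF G] sX])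
  show "weak_Lap h A (\<lambda>x. X x * (X x * u x)) F"
    unfolding weak_Lap_ip
  proof (intro allI impI)
    fix \<phi> :: "real^'d \<Rightarrow> complex" assume \<phi>: "test_fun \<phi>"
    note s\<phi> = test_smooth[OF \<phi>]
    have XX: "smooth (\<lambda>x. X x * X x)" by (intro smooth_mult sX)
    have d1: "pd j (\<lambda>x. X x * X x) = (\<lambda>x. 2 * (X x * pd j X x))" for j
      using pd_mult[OF sX sX] by (simp add: fun_eq_iff mult.commute)
    have d2: "pd j (pd j (\<lambda>x. X x * X x)) x = 2 * (X x * pd j (pd j X) x + (pd j X x)^2)" for j x
      unfolding d1 pd_cmult[OF smooth_mult[OF sX smooth_pd[OF sX]]] pd_mult[OF sX smooth_pd[OF sX]]
      by (simp add: power2_eq_square)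
    have t1: "test_fun (\<lambda>x. X x * X x * \<phi> x)" by (rule test_mult[OF XX \<phi>])
    have t2: "test_fun (\<lambda>x. pd j X x * \<phi> x)" for j by (rule test_mult[OF smooth_pd[OF sX] \<phi>])
    have t3: "test_fun (\<lambda>x. 4 * \<i> * ?H * (X x * Lc h A j (\<lambda>x. pd j X x * \<phi> x) x))" for j
      by (intro test_cmult test_mult[OF sX] test_Lc t2)
    have t4: "test_fun (\<lambda>x. 2 * ?H^2 * (((pd j X x)^2 - X x * pd j (pd j X) x) * \<phi> x))" for j
      by (intro test_cmult test_mult[OF test_smooth[OF tq]] \<phi>)
    have e: "(\<lambda>x. X x * (X x * Lapc h A \<phi> x)) = (\<lambda>x. Lapc h A (\<lambda>x. X x * X x * \<phi> x) x
       + (\<Sum>j\<in>UNIV. 4 * \<i> * ?H * (X x * Lc h A j (\<lambda>x. pd j X x * \<phi> x) x) + 2 * ?H^2 * (((pd j X x)^2 - X x * pd j (pd j X) x) * \<phi> x)))"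
    proof
      fix x
      have "X x * (X x * Lapc h A \<phi> x) = Lapc h A (\<lambda>x. X x * X x * \<phi> x) x
        + (\<Sum>j\<in>UNIV. 2 * \<i> * ?H * pd j (\<lambda>x. X x * X x) x * Lc h A j \<phi> x + ?H^2 * pd j (pd j (\<lambda>x. X x * X x)) x * \<phi> x)"
        unfolding Lapc_mult[OF XX s\<phi>] by (simp add: mult.assoc)
      also have "(\<Sum>j\<in>UNIV. 2 * \<i> * ?H * pd j (\<lambda>x. X x * X x) x * Lc h A j \<phi> x + ?H^2 * pd j (pd j (\<lambda>x. X x * X x)) x * \<phi> x)
        = (\<Sum>j\<in>UNIV. 4 * \<i> * ?H * (X x * Lc h A j (\<lambda>x. pd j X x * \<phi> x) x) + 2 * ?H^2 * (((pd j X x)^2 - X x * pd j (pd j X) x) * \<phi> x))"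
        unfolding d2 Lc_mult[OF smooth_pd[OF sX] s\<phi>] unfolding d1
        by (intro sum.cong refl) (simp add: algebra_simps power2_eq_square)
      finally show "X x * (X x * Lapc h A \<phi> x) = Lapc h A (\<lambda>x. X x * X x * \<phi> x) x
        + (\<Sum>j\<in>UNIV. 4 * \<i> * ?H * (X x * Lc h A j (\<lambda>x. pd j X x * \<phi> x) x) + 2 * ?H^2 * (((pd j X x)^2 - X x * pd j (pd j X) x) * \<phi> x))" .
    qed
    have "ip (\<lambda>x. X x * (X x * u x)) (Lapc h A \<phi>) = ip u (\<lambda>x. X x * (X x * Lapc h A \<phi> x))"
      by (rule ip_shift) (simp add: Xr mult_ac)
    also have "\<dots> = ip u (Lapc h A (\<lambda>x. X x * X x * \<phi> x)) + (\<Sum>j\<in>UNIV. ip u (\<lambda>x. 4 * \<i> * ?H * (X x * Lc h A j (\<lambda>x. pd j X x * \<phi> x) x))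
        + ip u (\<lambda>x. 2 * ?H^2 * (((pd j X x)^2 - X x * pd j (pd j X) x) * \<phi> x)))"
      unfolding e tip_add_right[OF tint_L2[OF u] test_Lapc[OF t1] test_sum[OF test_add[OF t3 t4]]]
        tip_sum_right[OF tint_L2[OF u] test_add[OF t3 t4]] tip_add_right[OF tint_L2[OF u] t3 t4] ..
    also have "ip u (Lapc h A (\<lambda>x. X x * X x * \<phi> x)) = ip f (\<lambda>x. X x * X x * \<phi> x)"
      using w t1 unfolding weak_Lap_ip by blast
    also have "\<dots> = ip (\<lambda>x. X x * (X x * f x)) \<phi>" by (rule ip_shift) (simp add: Xr mult_ac)
    also have "(\<lambda>j. ip u (\<lambda>x. 4 * \<i> * ?H * (X x * Lc h A j (\<lambda>x. pd j X x * \<phi> x) x))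
        + ip u (\<lambda>x. 2 * ?H^2 * (((pd j X x)^2 - X x * pd j (pd j X) x) * \<phi> x)))
      = (\<lambda>j. ip (\<lambda>x. - 4 * \<i> * ?H * (pd j X x * G j x) + 2 * ?H^2 * (((pd j X x)^2 - X x * pd j (pd j X) x) * u x)) \<phi>)"
    proof
      fix j
      have Xpr: "cnj (pd j X x) = pd j X x" "cnj (pd j (pd j X) x) = pd j (pd j X) x" for x
        using pd_real[OF sX Xr] pd_real[OF smooth_pd[OF sX] pd_real[OF sX Xr]] by auto
      have "ip u (\<lambda>x. X x * Lc h A j (\<lambda>x. pd j X x * \<phi> x) x) = ip (\<lambda>x. X x * u x) (Lc h A j (\<lambda>x. pd j X x * \<phi> x))"
        by (rule ip_shift) (simp add: Xr)
      also have "\<dots> = ip (G j) (\<lambda>x. pd j X x * \<phi> x)" using wG t2 unfolding weak_L_ip by blast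
      also have "\<dots> = ip (\<lambda>x. pd j X x * G j x) \<phi>" by (rule ip_shift) (simp add: Xpr)
      finally have 1: "ip u (\<lambda>x. 4 * \<i> * ?H * (X x * Lc h A j (\<lambda>x. pd j X x * \<phi> x) x)) = - 4 * \<i> * ?H * ip (\<lambda>x. pd j X x * G j x) \<phi>"
        unfolding ip_cmult_right by simp
      have 2: "ip u (\<lambda>x. 2 * ?H^2 * (((pd j X x)^2 - X x * pd j (pd j X) x) * \<phi> x))
          = 2 * ?H^2 * ip (\<lambda>x. ((pd j X x)^2 - X x * pd j (pd j X) x) * u x) \<phi>"
        unfolding ip_cmult_right by (simp add: ip_mult_left Xr Xpr)
      show "ip u (\<lambda>x. 4 * \<i> * ?H * (X x * Lc h A j (\<lambda>x. pd j X x * \<phi> x) x))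
        + ip u (\<lambda>x. 2 * ?H^2 * (((pd j X x)^2 - X x * pd j (pd j X) x) * \<phi> x))
        = ip (\<lambda>x. - 4 * \<i> * ?H * (pd j X x * G j x) + 2 * ?H^2 * (((pd j X x)^2 - X x * pd j (pd j X) x) * u x)) \<phi>"
        unfolding 1 2 ip_add_left[OF L2_cmult[OF LG(1)] L2_cmult[OF LG(2)] test_L2[OF \<phi>]] ip_cmult_left ..
    qed
    finally show "ip (\<lambda>x. X x * (X x * u x)) (Lapc h A \<phi>) = ip F \<phi>"
      unfolding F_def ip_add_left[OF LXf L2_sum[OF LT] test_L2[OF \<phi>]] ip_sum_left[OF LT test_L2[OF \<phi>]] .
  qed
qed

text \<open>The operator applied to phi is tested against p^2 phi. Moving L_j across p^2 leaves the
  derivative 2 p (pd p), and the bound on the logarithmic derivative of p turns this into a term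
  with one factor h and the same weight.\<close>

lemma energy_test:
  assumes p: "smooth p" "\<And>x. p x > 0" "\<And>j x. \<bar>pd j p x\<bar> \<le> M * p x" and h: "h \<ge> 0" and \<phi>: "test_fun \<phi>"
  shows "(\<Sum>j\<in>UNIV. (L2norm (\<lambda>x. of_real (p x) * Lc h A j \<phi> x))^2)
    \<le> cmod (ip (\<lambda>x. of_real (p x) * Lapc h A \<phi> x) (\<lambda>x. of_real (p x) * \<phi> x))
      + 2 * h * M * (\<Sum>j\<in>UNIV. L2norm (\<lambda>x. of_real (p x) * Lc h A j \<phi> x) * L2norm (\<lambda>x. of_real (p x) * \<phi> x))"
proof -
  let ?P = "\<lambda>x. complex_of_real (p x)"
  have sP: "smooth ?P" by (rule smooth_of_real[OF p(1)])
  have sPP: "smooth (\<lambda>x. ?P x * ?P x)" by (intro smooth_mult sP)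
  have M: "M \<ge> 0" using p(2)[of undefined] p(3)[of undefined undefined] by (smt (verit) zero_le_mult_iff)
  have tP: "test_fun (\<lambda>x. ?P x * \<psi> x)" if "test_fun \<psi>" for \<psi> by (rule test_mult[OF sP that])
  have dPP: "pd j (\<lambda>x. ?P x * ?P x) x = 2 * (?P x * of_real (pd j p x))" for j x
    by (simp add: pd_mult[OF sP sP] pd_of_real[OF p(1)])
  have t1: "test_fun (\<lambda>x. ?P x * ?P x * Lc h A j \<phi> x)" "test_fun (\<lambda>x. ?P x * ?P x * Lc h A j (Lc h A j \<phi>) x)" for j
    by (intro test_mult[OF sPP] test_Lc \<phi>)+
  have t2: "test_fun (\<lambda>x. 2 * (?P x * of_real (pd j p x)) * Lc h A j \<phi> x)" for j
    by (intro test_mult[OF _ test_Lc[OF \<phi>]] smooth_mult smooth_const sP smooth_of_real smooth_pd p(1))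
  have "of_real ((L2norm (\<lambda>x. ?P x * Lc h A j \<phi> x))^2) = ip (\<lambda>x. ?P x * ?P x * Lc h A j (Lc h A j \<phi>) x) \<phi>
      - \<i> * of_real h * ip (\<lambda>x. 2 * (?P x * of_real (pd j p x)) * Lc h A j \<phi> x) \<phi>" for j
  proof -
    have "of_real ((L2norm (\<lambda>x. ?P x * Lc h A j \<phi> x))^2) = ip (\<lambda>x. ?P x * Lc h A j \<phi> x) (\<lambda>x. ?P x * Lc h A j \<phi> x)"
      by (rule ip_self[symmetric])
    also have "\<dots> = ip (\<lambda>x. ?P x * ?P x * Lc h A j \<phi> x) (Lc h A j \<phi>)" by (rule ip_shift) simp
    also have "\<dots> = ip (Lc h A j (\<lambda>x. ?P x * ?P x * Lc h A j \<phi> x)) \<phi>" by (rule Lc_sym[OF t1(1) \<phi>, symmetric])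
    also have "Lc h A j (\<lambda>x. ?P x * ?P x * Lc h A j \<phi> x) =
       (\<lambda>x. ?P x * ?P x * Lc h A j (Lc h A j \<phi>) x - \<i> * of_real h * (2 * (?P x * of_real (pd j p x)) * Lc h A j \<phi> x))"
      using Lc_mult[OF sPP smooth_Lc[OF test_smooth[OF \<phi>]]] by (simp add: fun_eq_iff dPP)
    finally show ?thesis
      unfolding ip_diff_left[OF test_L2[OF t1(2)] L2_cmult[OF test_L2[OF t2]] test_L2[OF \<phi>]] ip_cmult_left .
  qed
  then have "of_real (\<Sum>j\<in>UNIV. (L2norm (\<lambda>x. ?P x * Lc h A j \<phi> x))^2) = (\<Sum>j\<in>UNIV. ip (\<lambda>x. ?P x * ?P x * Lc h A j (Lc h A j \<phi>) x) \<phi>)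
      - (\<Sum>j\<in>UNIV. \<i> * of_real h * ip (\<lambda>x. 2 * (?P x * of_real (pd j p x)) * Lc h A j \<phi> x) \<phi>)"
    by (simp add: sum_subtractf)
  also have "(\<Sum>j\<in>UNIV. ip (\<lambda>x. ?P x * ?P x * Lc h A j (Lc h A j \<phi>) x) \<phi>) = ip (\<lambda>x. ?P x * Lapc h A \<phi> x) (\<lambda>x. ?P x * \<phi> x)"
    unfolding ip_sum_left[OF test_L2[OF t1(2)] test_L2[OF \<phi>], symmetric] Lapc_def
    by (rule ip_shift) (simp add: sum_distrib_left sum_distrib_right mult_ac)
  finally have "cmod (of_real (\<Sum>j\<in>UNIV. (L2norm (\<lambda>x. ?P x * Lc h A j \<phi> x))^2)) \<le> cmod (ip (\<lambda>x. ?P x * Lapc h A \<phi> x) (\<lambda>x. ?P x * \<phi> x))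
      + (\<Sum>j\<in>UNIV. cmod (\<i> * of_real h * ip (\<lambda>x. 2 * (?P x * of_real (pd j p x)) * Lc h A j \<phi> x) \<phi>))"
    by (simp only:) (rule order_trans[OF norm_triangle_ineq4 add_left_mono[OF norm_sum]])
  also have "\<dots> \<le> cmod (ip (\<lambda>x. ?P x * Lapc h A \<phi> x) (\<lambda>x. ?P x * \<phi> x))
      + (\<Sum>j\<in>UNIV. h * (2 * M * (L2norm (\<lambda>x. ?P x * Lc h A j \<phi> x) * L2norm (\<lambda>x. ?P x * \<phi> x))))"
  proof (intro add_left_mono sum_mono)
    fix j
    have "cmod (ip (\<lambda>x. 2 * (?P x * of_real (pd j p x)) * Lc h A j \<phi> x) \<phi>) \<le> 2 * M * (L2norm (\<lambda>x. ?P x * Lc h A j \<phi> x) * L2norm (\<lambda>x. ?P x * \<phi> x))"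
    proof (rule ip_bound)
      fix x
      have "2 * (p x * \<bar>pd j p x\<bar>) * (cmod (Lc h A j \<phi> x) * cmod (\<phi> x)) \<le> 2 * (p x * (M * p x)) * (cmod (Lc h A j \<phi> x) * cmod (\<phi> x))"
        using p(2)[of x] p(3)[of j x] by (intro mult_right_mono mult_left_mono) auto
      then show "cmod (2 * (?P x * of_real (pd j p x)) * Lc h A j \<phi> x) * cmod (\<phi> x) \<le> 2 * M * (cmod (?P x * Lc h A j \<phi> x) * cmod (?P x * \<phi> x))"
        using p(2)[of x] by (simp add: norm_mult mult_ac)
    qed (use M in \<open>auto intro!: test_L2 tP test_Lc \<phi>\<close>)
    then show "cmod (\<i> * of_real h * ip (\<lambda>x. 2 * (?P x * of_real (pd j p x)) * Lc h A j \<phi> x) \<phi>)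
       \<le> h * (2 * M * (L2norm (\<lambda>x. ?P x * Lc h A j \<phi> x) * L2norm (\<lambda>x. ?P x * \<phi> x)))"
      using h by (simp add: norm_mult mult_left_mono)
  qed
  also have "(\<Sum>j\<in>UNIV. h * (2 * M * (L2norm (\<lambda>x. ?P x * Lc h A j \<phi> x) * L2norm (\<lambda>x. ?P x * \<phi> x))))
      = 2 * h * M * (\<Sum>j\<in>UNIV. L2norm (\<lambda>x. ?P x * Lc h A j \<phi> x) * L2norm (\<lambda>x. ?P x * \<phi> x))"
    by (simp add: sum_distrib_left mult_ac)
  finally show ?thesis unfolding norm_of_real by (rule order_trans[OF abs_ge_self])
qed

text \<open>The bound depends on the cutoff only through K, so it survives when the cutoff exhausts
  the space. Since U carries the factor X^2, the gradient terms in F occur in the energy only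
  multiplied by X.\<close>

lemma energy_cutoff:
  assumes p: "smooth p" "\<And>x. p x > 0" "\<And>j x. \<bar>pd j p x\<bar> \<le> M * p x"
    and h: "h > 0" and u: "L2 u" and f: "L2 f" and w: "weak_Lap h A u f"
    and pu: "L2 (\<lambda>x. of_real (p x) * u x)" and pf: "L2 (\<lambda>x. of_real (p x) * f x)"
    and X: "test_fun X" and Xr: "\<And>x. cnj (X x) = X x"
    and X1: "\<And>x. cmod (X x) \<le> 1" "\<And>j x. cmod (pd j X x) \<le> K" "\<And>j x. cmod (pd j (pd j X) x) \<le> K"
    and G: "\<And>j. L2 (G j)" and wG: "\<And>j. weak_L h A j (\<lambda>x. X x * u x) (G j)"
  shows "\<And>j. L2 (\<lambda>x. of_real (p x) * (X x * G j x - \<i> * of_real h * pd j X x * (X x * u x)))"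
    "L2norm (\<lambda>x. of_real (p x) * (X x * G i x - \<i> * of_real h * pd i X x * (X x * u x)))
    \<le> (1 + real CARD('d) * (6 * h^2 * K^2 + 2 * h^2 * K + 4 * h * K + 2 * h * M)) * (L2norm (\<lambda>x. of_real (p x) * f x) + L2norm (\<lambda>x. of_real (p x) * u x))"
proof -
  let ?P = "\<lambda>x. complex_of_real (p x)"
  let ?n = "real CARD('d)"
  define H where "H j x = X x * G j x - \<i> * of_real h * pd j X x * (X x * u x)" for j x
  define F where "F x = X x * (X x * f x) + (\<Sum>j\<in>UNIV. - 4 * \<i> * of_real h * (pd j X x * G j x)
          + 2 * (of_real h)^2 * (((pd j X x)^2 - X x * pd j (pd j X) x) * u x))" for x
  define U where "U x = X x * (X x * u x)" for x
  have cg: "L2 U" "\<And>j. L2 (H j)" "L2 F" "\<And>j. weak_L h A j U (H j)" "weak_Lap h A U F"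
    using cutoff_graph[OF u f w X Xr G wG] unfolding U_def[abs_def] H_def[abs_def] F_def[abs_def] by auto
  have K: "K \<ge> 0" by (rule order_trans[OF norm_ge_zero X1(2)])
  have M: "M \<ge> 0" using p(2)[of undefined] p(3)[of undefined undefined] by (smt (verit) zero_le_mult_iff)
  obtain r where r: "r \<ge> 0" "\<And>x. norm x > r \<Longrightarrow> X x = 0" using test_norm_bound[OF X] by blast
  have r1: "pd j X x = 0" if "norm x > r" for j x
    by (rule pd_vanish[of "cball 0 r"]) (use that r in auto)
  have v: "U x = 0" "H j x = 0" "F x = 0" if "norm x > r" for x j
    using r(2)[OF that] r1[OF that] by (auto simp: U_def H_def F_def)
  have sP: "smooth ?P" by (rule smooth_of_real[OF p(1)])
  obtain \<phi> where t: "\<And>m. test_fun (\<phi> m)" and v\<phi>: "\<And>m x. norm x > r + 1 \<Longrightarrow> \<phi> m x = 0"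
    and l: "L2lim \<phi> U" "\<And>j. L2lim (\<lambda>m. Lc h A j (\<phi> m)) (H j)" "L2lim (\<lambda>m. Lapc h A (\<phi> m)) F"
    using mollify_graph[OF h cg(1,2,3) v cg(4,5)] by metis
  have vp: "pd j (\<phi> m) x = 0" if "norm x > r + 1" for j m x
    by (rule pd_vanish[of "cball 0 (r + 1)"]) (use that v\<phi> in auto)
  have vp2: "pd j (pd j (\<phi> m)) x = 0" if "norm x > r + 1" for j m x
    by (rule pd_vanish[of "cball 0 (r + 1)"]) (use that vp in auto)
  have vL: "Lc h A j (\<phi> m) x = 0" if "norm x > r + 1" for j m x
    unfolding Lc_def using vp[OF that] v\<phi>[OF that] by simp
  have vLap: "Lapc h A (\<phi> m) x = 0" if "norm x > r + 1" for m x
    unfolding Lapc_expand[OF test_smooth[OF t]] using vp[OF that] vp2[OF that] v\<phi>[OF that] by simp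
  have pl: "L2lim (\<lambda>m x. ?P x * \<phi> m x) (\<lambda>x. ?P x * U x)" "L2lim (\<lambda>m x. ?P x * Lc h A j (\<phi> m) x) (\<lambda>x. ?P x * H j x)"
    "L2lim (\<lambda>m x. ?P x * Lapc h A (\<phi> m) x) (\<lambda>x. ?P x * F x)" for j
    by (rule L2lim_compact_mult[OF l(1) sP, of "r + 1"] L2lim_compact_mult[OF l(2) sP, of "r + 1"] L2lim_compact_mult[OF l(3) sP, of "r + 1"];
        use v v\<phi> vL vLap in force)+
  have PU: "L2 (\<lambda>x. ?P x * U x)" and PH: "L2 (\<lambda>x. ?P x * H j x)" and PF: "L2 (\<lambda>x. ?P x * F x)" for j
    using pl L2limD(2) by blast+
  show "L2 (\<lambda>x. ?P x * (X x * G j x - \<i> * of_real h * pd j X x * (X x * u x)))" for j using PH[of j] unfolding H_def .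
  \<comment> \<open>The energy inequality for test functions, carried over along the mollified
    approximants of \<open>U\<close>, all supported in one ball.\<close>
  have en: "(\<Sum>j\<in>UNIV. (L2norm (\<lambda>x. ?P x * H j x))^2) \<le> cmod (ip (\<lambda>x. ?P x * F x) (\<lambda>x. ?P x * U x))
      + 2 * h * M * (\<Sum>j\<in>UNIV. L2norm (\<lambda>x. ?P x * H j x) * L2norm (\<lambda>x. ?P x * U x))"
  proof (rule LIMSEQ_le)
    show "(\<lambda>m. \<Sum>j\<in>UNIV. (L2norm (\<lambda>x. ?P x * Lc h A j (\<phi> m) x))^2) \<longlonglongrightarrow> (\<Sum>j\<in>UNIV. (L2norm (\<lambda>x. ?P x * H j x))^2)"
      by (intro tendsto_intros L2lim_norm pl)
    show "(\<lambda>m. cmod (ip (\<lambda>x. ?P x * Lapc h A (\<phi> m) x) (\<lambda>x. ?P x * \<phi> m x))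
      + 2 * h * M * (\<Sum>j\<in>UNIV. L2norm (\<lambda>x. ?P x * Lc h A j (\<phi> m) x) * L2norm (\<lambda>x. ?P x * \<phi> m x))) \<longlonglongrightarrow>
       cmod (ip (\<lambda>x. ?P x * F x) (\<lambda>x. ?P x * U x)) + 2 * h * M * (\<Sum>j\<in>UNIV. L2norm (\<lambda>x. ?P x * H j x) * L2norm (\<lambda>x. ?P x * U x))"
      by (intro tendsto_intros L2lim_norm L2lim_ip pl)
    show "\<exists>N. \<forall>m\<ge>N. (\<Sum>j\<in>UNIV. (L2norm (\<lambda>x. ?P x * Lc h A j (\<phi> m) x))^2) \<le> cmod (ip (\<lambda>x. ?P x * Lapc h A (\<phi> m) x) (\<lambda>x. ?P x * \<phi> m x))
      + 2 * h * M * (\<Sum>j\<in>UNIV. L2norm (\<lambda>x. ?P x * Lc h A j (\<phi> m) x) * L2norm (\<lambda>x. ?P x * \<phi> m x))"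
      using energy_test[OF p less_imp_le[OF h] t] by blast
  qed
  define a where "a = L2norm (\<lambda>x. ?P x * f x)"
  define b where "b = L2norm (\<lambda>x. ?P x * u x)"
  define N where "N = sqrt (\<Sum>j\<in>UNIV. (L2norm (\<lambda>x. ?P x * H j x))^2)"
  have N2: "N^2 = (\<Sum>j\<in>UNIV. (L2norm (\<lambda>x. ?P x * H j x))^2)" unfolding N_def by (simp add: sum_nonneg)
  have N0: "N \<ge> 0" unfolding N_def by (simp add: sum_nonneg)
  have HN: "L2norm (\<lambda>x. ?P x * H j x) \<le> N" for j
  proof (rule power2_le_imp_le[OF _ N0])
    show "(L2norm (\<lambda>x. ?P x * H j x))^2 \<le> N^2" unfolding N2 by (rule member_le_sum) auto
  qed
  have ab: "a \<ge> 0" "b \<ge> 0" unfolding a_def b_def by auto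
  have Ub: "L2norm (\<lambda>x. ?P x * U x) \<le> b"
    unfolding b_def
  proof (rule L2_mono(2)[OF pu L2_meas[OF PU]])
    fix x
    have "cmod (X x) * cmod (X x) \<le> 1 * 1" by (intro mult_mono X1) auto
    then have "(cmod (X x) * cmod (X x)) * cmod (?P x * u x) \<le> 1 * cmod (?P x * u x)" by (intro mult_right_mono) auto
    then show "cmod (?P x * U x) \<le> cmod (?P x * u x)" unfolding U_def by (simp add: norm_mult mult_ac)
  qed
  text \<open>\<open>X\<^sup>2 \<bar>F\<bar> \<le> \<bar>Z\<bar>\<close> pointwise, where only \<open>X G\<^sub>j = H\<^sub>j + i h (\<partial>\<^sub>jX) X u\<close> is used.\<close>
  define c where "c = 6 * h^2 * K^2 + 2 * h^2 * K"
  define Z where "Z x = complex_of_real (cmod (?P x * f x)) + (\<Sum>j\<in>UNIV. of_real (4 * h * K) * of_real (cmod (?P x * H j x)) + of_real c * of_real (cmod (?P x * u x)))" for x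
  have Lc': "L2 (\<lambda>x. complex_of_real (cmod (g x)))" "L2norm (\<lambda>x. complex_of_real (cmod (g x))) = L2norm g" if "L2 g" for g
    using that unfolding L2_def L2norm_def by auto
  have ZL: "L2 Z" unfolding Z_def by (intro L2_add L2_sum L2_cmult Lc' pf PH pu)
  have c0: "c \<ge> 0" unfolding c_def using K h by simp
  have Zn: "L2norm Z \<le> a + (\<Sum>j\<in>(UNIV::'d set). 4 * h * K * N + c * b)"
  proof -
    have "L2norm Z \<le> L2norm (\<lambda>x. complex_of_real (cmod (?P x * f x))) + L2norm (\<lambda>x. \<Sum>j\<in>UNIV. of_real (4 * h * K) * of_real (cmod (?P x * H j x)) + of_real c * of_real (cmod (?P x * u x)))"
      unfolding Z_def by (intro L2norm_triangle L2_add L2_sum L2_cmult Lc' pf PH pu)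
    also have "L2norm (\<lambda>x. complex_of_real (cmod (?P x * f x))) = a" unfolding a_def by (rule Lc'(2)[OF pf])
    also have "L2norm (\<lambda>x. \<Sum>j\<in>UNIV. of_real (4 * h * K) * of_real (cmod (?P x * H j x)) + of_real c * of_real (cmod (?P x * u x)))
      \<le> (\<Sum>j\<in>UNIV. L2norm (\<lambda>x. of_real (4 * h * K) * of_real (cmod (?P x * H j x)) + of_real c * of_real (cmod (?P x * u x))))"
      by (intro L2norm_sum L2_add L2_cmult Lc' PH pu)
    also have "\<dots> \<le> (\<Sum>j\<in>(UNIV::'d set). 4 * h * K * N + c * b)"
    proof (rule sum_mono)
      fix j
      have "L2norm (\<lambda>x. of_real (4 * h * K) * of_real (cmod (?P x * H j x)) + of_real c * of_real (cmod (?P x * u x)))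
        \<le> L2norm (\<lambda>x. of_real (4 * h * K) * of_real (cmod (?P x * H j x))) + L2norm (\<lambda>x. of_real c * of_real (cmod (?P x * u x)))"
        by (intro L2norm_triangle L2_cmult Lc' PH pu)
      also have "\<dots> = 4 * h * K * L2norm (\<lambda>x. ?P x * H j x) + c * b"
        unfolding L2norm_cmult Lc'(2)[OF PH] Lc'(2)[OF pu] b_def norm_of_real using h K c0 by simp
      also have "\<dots> \<le> 4 * h * K * N + c * b" using HN[of j] h K by (intro add_right_mono mult_left_mono) auto
      finally show "L2norm (\<lambda>x. of_real (4 * h * K) * of_real (cmod (?P x * H j x)) + of_real c * of_real (cmod (?P x * u x))) \<le> 4 * h * K * N + c * b" .
    qed
    finally show ?thesis by simp
  qed
  have Zb: "cmod (ip (\<lambda>x. ?P x * F x) (\<lambda>x. ?P x * U x)) \<le> 1 * (L2norm Z * b)"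
    unfolding b_def
  proof (rule ip_bound[OF ZL pu])
    fix x
    have e: "(4 * h * cmod (pd j X x) * cmod (G j x) + 2 * h^2 * (cmod (pd j X x)^2 + cmod (X x) * cmod (pd j (pd j X) x)) * cmod (u x)) * (cmod (X x) * cmod (X x))
        \<le> 4 * h * K * cmod (H j x) + c * cmod (u x)" for j
    proof -
      have "cmod (X x * G j x) = cmod (H j x + \<i> * of_real h * pd j X x * (X x * u x))" unfolding H_def by simp
      also have "\<dots> \<le> cmod (H j x) + cmod (\<i> * of_real h * pd j X x * (X x * u x))" by (rule norm_triangle_ineq)
      also have "cmod (\<i> * of_real h * pd j X x * (X x * u x)) = h * (cmod (pd j X x) * (cmod (X x) * cmod (u x)))" using h by (simp add: norm_mult)
      also have "\<dots> \<le> h * (K * (1 * cmod (u x)))" using h K X1 by (intro mult_left_mono mult_mono) auto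
      finally have XG: "cmod (X x) * cmod (G j x) \<le> cmod (H j x) + h * K * cmod (u x)" by (simp add: norm_mult)
      have "4 * h * cmod (pd j X x) * (cmod (X x) * cmod (G j x)) * cmod (X x) \<le> 4 * h * K * (cmod (H j x) + h * K * cmod (u x)) * 1"
        using h K X1 XG by (intro mult_mono) (auto intro!: mult_nonneg_nonneg add_nonneg_nonneg)
      moreover have "2 * h^2 * (cmod (pd j X x)^2 + cmod (X x) * cmod (pd j (pd j X) x)) * cmod (u x) * (cmod (X x) * cmod (X x)) \<le> 2 * h^2 * (K^2 + 1 * K) * cmod (u x) * (1 * 1)"
        using h K X1 by (intro mult_mono add_mono power_mono) (auto intro!: mult_nonneg_nonneg add_nonneg_nonneg)
      ultimately show ?thesis unfolding c_def by (simp add: algebra_simps power2_eq_square)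
    qed
    have "cmod (F x) * (cmod (X x) * cmod (X x)) \<le> cmod (f x) + (\<Sum>j\<in>UNIV. 4 * h * K * cmod (H j x) + c * cmod (u x))"
    proof -
      have "cmod (F x) \<le> cmod (X x * (X x * f x)) + (\<Sum>j\<in>UNIV. cmod (- 4 * \<i> * of_real h * (pd j X x * G j x)
          + 2 * (of_real h)^2 * (((pd j X x)^2 - X x * pd j (pd j X) x) * u x)))"
        unfolding F_def by (rule order_trans[OF norm_triangle_ineq add_left_mono[OF norm_sum]])
      also have "\<dots> \<le> cmod (f x) + (\<Sum>j\<in>UNIV. 4 * h * cmod (pd j X x) * cmod (G j x) + 2 * h^2 * (cmod (pd j X x)^2 + cmod (X x) * cmod (pd j (pd j X) x)) * cmod (u x))"
      proof (intro add_mono sum_mono)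
        have "cmod (X x) * cmod (X x) \<le> 1 * 1" by (intro mult_mono X1) auto
        then have "(cmod (X x) * cmod (X x)) * cmod (f x) \<le> 1 * cmod (f x)" by (intro mult_right_mono) auto
        then show "cmod (X x * (X x * f x)) \<le> cmod (f x)" by (simp add: norm_mult mult_ac)
        fix j
        have "cmod (- 4 * \<i> * of_real h * (pd j X x * G j x) + 2 * (of_real h)^2 * (((pd j X x)^2 - X x * pd j (pd j X) x) * u x))
          \<le> cmod (- 4 * \<i> * of_real h * (pd j X x * G j x)) + cmod (2 * (of_real h)^2 * (((pd j X x)^2 - X x * pd j (pd j X) x) * u x))"
          by (rule norm_triangle_ineq)
        also have "\<dots> = 4 * h * cmod (pd j X x) * cmod (G j x) + 2 * h^2 * cmod ((pd j X x)^2 - X x * pd j (pd j X) x) * cmod (u x)"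
          using h by (simp add: norm_mult norm_power)
        also have "\<dots> \<le> 4 * h * cmod (pd j X x) * cmod (G j x) + 2 * h^2 * (cmod (pd j X x)^2 + cmod (X x) * cmod (pd j (pd j X) x)) * cmod (u x)"
          using norm_triangle_ineq4[of "(pd j X x)^2" "X x * pd j (pd j X) x"]
          by (intro add_left_mono mult_right_mono mult_left_mono) (auto simp: norm_mult norm_power)
        finally show "cmod (- 4 * \<i> * of_real h * (pd j X x * G j x) + 2 * (of_real h)^2 * (((pd j X x)^2 - X x * pd j (pd j X) x) * u x))
          \<le> 4 * h * cmod (pd j X x) * cmod (G j x) + 2 * h^2 * (cmod (pd j X x)^2 + cmod (X x) * cmod (pd j (pd j X) x)) * cmod (u x)" .
      qed
      finally have "cmod (F x) * (cmod (X x) * cmod (X x)) \<le> (cmod (f x) + (\<Sum>j\<in>UNIV. 4 * h * cmod (pd j X x) * cmod (G j x) + 2 * h^2 * (cmod (pd j X x)^2 + cmod (X x) * cmod (pd j (pd j X) x)) * cmod (u x))) * (cmod (X x) * cmod (X x))"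
        by (rule mult_right_mono) simp
      also have "\<dots> \<le> cmod (f x) + (\<Sum>j\<in>UNIV. 4 * h * K * cmod (H j x) + c * cmod (u x))"
        unfolding distrib_right[of "cmod (f x)"] sum_distrib_right
      proof (rule add_mono[OF _ sum_mono[OF e]])
        have "cmod (X x) * cmod (X x) \<le> 1 * 1" by (intro mult_mono X1) auto
        then show "cmod (f x) * (cmod (X x) * cmod (X x)) \<le> cmod (f x)" using mult_left_mono[of "cmod (X x) * cmod (X x)" 1 "cmod (f x)"] by simp
      qed
      finally show ?thesis .
    qed
    then have "(p x)^2 * cmod (u x) * (cmod (F x) * (cmod (X x) * cmod (X x))) \<le> (p x)^2 * cmod (u x) * (cmod (f x) + (\<Sum>j\<in>UNIV. 4 * h * K * cmod (H j x) + c * cmod (u x)))"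
      by (rule mult_left_mono) simp
    moreover have "cmod (Z x) = p x * (cmod (f x) + (\<Sum>j\<in>UNIV. 4 * h * K * cmod (H j x) + c * cmod (u x)))"
    proof -
      have "Z x = of_real (p x * (cmod (f x) + (\<Sum>j\<in>UNIV. 4 * h * K * cmod (H j x) + c * cmod (u x))))"
        unfolding Z_def using p(2)[of x] by (simp add: norm_mult distrib_left sum_distrib_left mult_ac)
      moreover have "p x * (cmod (f x) + (\<Sum>j\<in>UNIV. 4 * h * K * cmod (H j x) + c * cmod (u x))) \<ge> 0"
        using p(2)[of x] h K c0 by (intro mult_nonneg_nonneg add_nonneg_nonneg sum_nonneg) auto
      ultimately show ?thesis by (simp only: norm_of_real abs_of_nonneg)
    qed
    ultimately show "cmod (?P x * F x) * cmod (?P x * U x) \<le> 1 * (cmod (Z x) * cmod (?P x * u x))"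
      unfolding U_def using p(2)[of x] by (simp add: norm_mult power2_eq_square mult_ac)
  qed simp
  have "(\<Sum>j\<in>UNIV. L2norm (\<lambda>x. ?P x * H j x) * L2norm (\<lambda>x. ?P x * U x)) \<le> (\<Sum>j\<in>(UNIV::'d set). N * b)"
    by (intro sum_mono mult_mono HN Ub N0) auto
  then have "2 * h * M * (\<Sum>j\<in>UNIV. L2norm (\<lambda>x. ?P x * H j x) * L2norm (\<lambda>x. ?P x * U x)) \<le> 2 * h * M * (?n * (N * b))"
    using h M by (intro mult_left_mono) auto
  moreover have "L2norm Z * b \<le> (a + ?n * (4 * h * K * N + c * b)) * b"
    using Zn ab by (intro mult_right_mono) auto
  ultimately have main: "N^2 \<le> (a + ?n * (4 * h * K * N + c * b)) * b + 2 * h * M * (?n * (N * b))"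
    using en Zb unfolding N2 by linarith
  define s where "s = a + b"
  have s: "s \<ge> 0" "a \<le> s" "b \<le> s" unfolding s_def using ab by auto
  define c1 where "c1 = ?n * (4 * h * K + 2 * h * M)"
  have c10: "c1 \<ge> 0" unfolding c1_def using h K M by simp
  \<comment> \<open>No smallness of h is used: if N exceeds s = a + b, both data norms are below N,
    every term on the right has a factor N, and dividing by N gives the bound.\<close>
  have "N \<le> (1 + ?n * c + c1) * s"
  proof (cases "N \<le> s")
    case True
    then show ?thesis using s c0 c10 mult_right_mono[of 1 "1 + ?n * c + c1" s] by simp
  next
    case False
    then have sN: "s \<le> N" by simp
    have "N * N \<le> a * b + ?n * c * (b * b) + c1 * (N * b)"
      using main unfolding c1_def by (simp add: algebra_simps power2_eq_square)
    also have "\<dots> \<le> N * s + ?n * c * (N * s) + c1 * (N * s)"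
      using s sN ab c0 c10 N0 by (intro add_mono mult_left_mono mult_mono) auto
    also have "\<dots> = N * ((1 + ?n * c + c1) * s)" by (simp add: algebra_simps)
    finally show ?thesis using False s by (simp add: mult_le_cancel_left_pos)
  qed
  with HN[of i] have "L2norm (\<lambda>x. ?P x * H i x) \<le> (1 + ?n * c + c1) * s" by linarith
  then show "L2norm (\<lambda>x. ?P x * (X x * G i x - \<i> * of_real h * pd i X x * (X x * u x)))
    \<le> (1 + ?n * (6 * h^2 * K^2 + 2 * h^2 * K + 4 * h * K + 2 * h * M)) * (L2norm (\<lambda>x. ?P x * f x) + L2norm (\<lambda>x. ?P x * u x))"
    unfolding H_def[symmetric] s_def a_def b_def c_def c1_def by (simp add: algebra_simps)
qed

end

section \<open>Density of test functions\<close>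

text \<open>The factor \<open>exp 1\<close> normalises the value at the origin to 1.\<close>

definition cutoff :: "nat \<Rightarrow> real^'d::finite \<Rightarrow> complex" where
  "cutoff m x = of_real (exp 1 * bump ((1 / real (Suc m)) *\<^sub>R x))"

lemma test_cutoff: "test_fun (cutoff m)"
  unfolding cutoff_def using test_cmult[OF test_bump[of "1 / real (Suc m)"], of "of_real (exp 1)"] by simp

lemma cutoff_cnj: "cnj (cutoff m x) = cutoff m x"
  unfolding cutoff_def by simp

lemma cutoff_le: "cmod (cutoff m x) \<le> 1"
proof -
  have "exp 1 * bump ((1 / real (Suc m)) *\<^sub>R x) \<le> exp 1 * exp (- 1)"
    by (intro mult_left_mono bump_le) simp
  then show ?thesis unfolding cutoff_def norm_of_real using bump_nonneg[of "(1 / real (Suc m)) *\<^sub>R x"]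
    by (simp add: exp_minus)
qed

lemma cutoff_scale: "cutoff m x = cutoff 0 (0 + (1 / real (Suc m)) *\<^sub>R x)"
  unfolding cutoff_def by simp

lemma cutoff_tendsto: "(\<lambda>m. cutoff m (x::real^'d::finite)) \<longlonglongrightarrow> 1"
proof -
  have "continuous_on UNIV (cutoff 0 :: real^'d \<Rightarrow> complex)" by (rule test_cont[OF test_cutoff])
  then have "isCont (cutoff 0) (0 :: real^'d)" by (simp add: continuous_on_eq_continuous_at)
  moreover have "(\<lambda>m. 0 + (1 / real (Suc m)) *\<^sub>R x) \<longlonglongrightarrow> 0 + 0 *\<^sub>R x"
    using LIMSEQ_inverse_real_of_nat by (intro tendsto_intros) (simp add: inverse_eq_divide)
  ultimately have "(\<lambda>m. cutoff 0 (0 + (1 / real (Suc m)) *\<^sub>R x)) \<longlonglongrightarrow> cutoff 0 (0 :: real^'d)"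
    unfolding scaleR_zero_left add_0_right by (rule isCont_tendsto_compose)
  moreover have "cutoff 0 (0 :: real^'d) = 1" unfolding cutoff_def by (simp add: bump_0 exp_minus flip: exp_add of_real_mult)
  ultimately show ?thesis unfolding cutoff_scale[symmetric] by simp
qed

text \<open>Second derivatives even scale with the square of 1/(m + 1); the weaker common rate is
  all that is used.\<close>

lemma cutoff_derivs:
  obtains K where "K \<ge> 0"
    "\<And>m j x. cmod (pd j (cutoff m) (x::real^'d::finite)) \<le> K / real (Suc m)"
    "\<And>m j x. cmod (pd j (pd j (cutoff m)) (x::real^'d)) \<le> K / real (Suc m)"
proof -
  let ?c = "cutoff 0 :: real^'d \<Rightarrow> complex"
  have "\<exists>C\<ge>0. \<forall>x. cmod (pd j ?c x) \<le> C" "\<exists>C\<ge>0. \<forall>x. cmod (pd j (pd j ?c) x) \<le> C" for j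
    using test_bounded[OF test_pd[OF test_cutoff]] test_bounded[OF test_pd[OF test_pd[OF test_cutoff]]] by metis+
  then obtain C1 C2 where C: "\<And>j. C1 j \<ge> 0" "\<And>j x. cmod (pd j ?c x) \<le> C1 j" "\<And>j. C2 j \<ge> 0" "\<And>j x. cmod (pd j (pd j ?c) x) \<le> C2 j"
    by metis
  define K where "K = (\<Sum>j\<in>UNIV. C1 j + C2 j)"
  have K: "C1 j + C2 j \<le> K" for j unfolding K_def by (rule member_le_sum) (auto simp: C)
  note s = test_smooth[OF test_cutoff[of 0]]
  have e: "cutoff m = (\<lambda>x. ?c (0 + (1 / real (Suc m)) *\<^sub>R x))" for m using cutoff_scale by blast
  have e1: "pd j (cutoff m) = (\<lambda>x. (1 / real (Suc m)) *\<^sub>R pd j ?c (0 + (1 / real (Suc m)) *\<^sub>R x))" for j m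
    unfolding e[of m] using pd_affine[OF s] by blast
  have e2: "pd j (pd j (cutoff m)) x = (1 / real (Suc m)) *\<^sub>R ((1 / real (Suc m)) *\<^sub>R pd j (pd j ?c) (0 + (1 / real (Suc m)) *\<^sub>R x))" for j m x
    unfolding e1[of j m] pd_linear[OF bounded_linear_scaleR_right smooth_affine[OF smooth_pd[OF s]]] pd_affine[OF smooth_pd[OF s]] ..
  have K0: "K \<ge> 0" unfolding K_def by (intro sum_nonneg) (simp add: C)
  show ?thesis
  proof (rule that[OF K0])
    show "cmod (pd j (cutoff m) x) \<le> K / real (Suc m)" for m j and x :: "real^'d"
      unfolding e1[of j m] norm_scaleR using C(2)[of j "0 + (1 / real (Suc m)) *\<^sub>R x"] K[of j] C(3)[of j]
      by (simp add: divide_right_mono)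
    show "cmod (pd j (pd j (cutoff m)) x) \<le> K / real (Suc m)" for m j and x :: "real^'d"
    proof -
      have "cmod (pd j (pd j ?c) (0 + (1 / real (Suc m)) *\<^sub>R x)) \<le> K" (is "?v \<le> K")
        using C(4)[of j "0 + (1 / real (Suc m)) *\<^sub>R x"] K[of j] C(1)[of j] by linarith
      then have "?v / real (Suc m) \<le> K / 1" using K0 by (intro frac_le) auto
      then have "?v / real (Suc m) / real (Suc m) \<le> K / real (Suc m)" by (intro divide_right_mono) auto
      then show ?thesis unfolding e2[of j m x] norm_scaleR by (simp del: of_nat_Suc)
    qed
  qed
qed

context magnetic begin

text \<open>Test functions are dense for the weighted graph norm: cut off with \<open>\<chi>\<^sup>4\<close>, \<open>\<chi> = cutoff m\<close>, then mollify.
  The energy estimate for \<open>\<chi>\<^sup>2u\<close> is uniform in \<open>m\<close> and controls the commutator terms for \<open>\<chi>\<^sup>4u\<close>.\<close>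
lemma graph_approx:
  assumes p: "smooth p" "\<And>x. p x > 0" "\<And>j x. \<bar>pd j p x\<bar> \<le> M * p x"
    and h: "h > 0" and u: "L2 u" and f: "L2 f" and w: "weak_Lap h A u f"
    and pu: "L2 (\<lambda>x. of_real (p x) * u x)" and pf: "L2 (\<lambda>x. of_real (p x) * f x)"
  obtains \<phi> where "\<And>m. test_fun (\<phi> m)" "L2lim (\<lambda>m x. of_real (p x) * \<phi> m x) (\<lambda>x. of_real (p x) * u x)"
    "L2lim (\<lambda>m x. of_real (p x) * Lapc h A (\<phi> m) x) (\<lambda>x. of_real (p x) * f x)"
proof -
  let ?P = "\<lambda>x. complex_of_real (p x)"
  have sP: "smooth ?P" by (rule smooth_of_real[OF p(1)])
  have M: "M \<ge> 0" using p(2)[of undefined] p(3)[of undefined undefined] by (smt (verit) zero_le_mult_iff)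
  obtain K where K: "K \<ge> 0" "\<And>m j x. cmod (pd j (cutoff m) (x::real^'d)) \<le> K / real (Suc m)"
    "\<And>m j x. cmod (pd j (pd j (cutoff m)) (x::real^'d)) \<le> K / real (Suc m)" using cutoff_derivs by blast
  have "\<exists>G. (\<forall>j. L2 (G j)) \<and> (\<forall>j. weak_L h A j (\<lambda>x. cutoff m x * u x) (G j))" for m
    using local_gradient[OF h u f w test_cutoff cutoff_cnj] by metis
  then obtain G where G: "\<And>m j. L2 (G m j)" "\<And>m j. weak_L h A j (\<lambda>x. cutoff m x * u x) (G m j)" by metis
  define H where "H m j x = cutoff m x * G m j x - \<i> * of_real h * pd j (cutoff m) x * (cutoff m x * u x)" for m j x
  \<comment> \<open>Y is the square of the cutoff. \<open>H\<close> represents L_j(Y u), bounded in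
    the weighted norm uniformly in m; it plays the role of the known gradient when Y itself is used
    as a cutoff, which is how the fourth power arises.\<close>
  define Y where "Y m x = cutoff m x * cutoff m x" for m and x :: "real^'d"
  note sc = test_smooth[OF test_cutoff]
  have tY: "test_fun (Y m)" for m unfolding Y_def by (intro test_mult sc test_cutoff)
  have Yr: "cnj (Y m x) = Y m x" for m x unfolding Y_def by (simp add: cutoff_cnj)
  have HL: "L2 (H m j)" and wH: "weak_L h A j (\<lambda>x. Y m x * u x) (H m j)" for m j
    using cutoff_graph(2,4)[OF u f w test_cutoff cutoff_cnj G(1)[where m=m] G(2)[where m=m]] unfolding H_def[abs_def] Y_def by (simp_all add: mult.assoc)
  have Km: "K / real (Suc m) \<le> K" for m using K(1) mult_left_mono[of 1 "real (Suc m)" K] by (simp add: divide_le_eq)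
  define C where "C = (1 + real CARD('d) * (6 * h^2 * K^2 + 2 * h^2 * K + 4 * h * K + 2 * h * M)) * (L2norm (\<lambda>x. ?P x * f x) + L2norm (\<lambda>x. ?P x * u x))"
  have C0: "C \<ge> 0" unfolding C_def using K h M by (intro mult_nonneg_nonneg add_nonneg_nonneg) auto
  have PH: "L2 (\<lambda>x. ?P x * H m j x)" and PHb: "L2norm (\<lambda>x. ?P x * H m j x) \<le> C" for m j
    using energy_cutoff[OF p h u f w pu pf test_cutoff cutoff_cnj cutoff_le order_trans[OF K(2) Km] order_trans[OF K(3) Km] G(1) G(2)]
    unfolding H_def C_def by blast+
  define U where "U m x = Y m x * (Y m x * u x)" for m x
  define H' where "H' m j x = Y m x * H m j x - \<i> * of_real h * pd j (Y m) x * (Y m x * u x)" for m j x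
  \<comment> \<open>The commutator terms. Each carries a derivative of Y, hence a factor 1/(m + 1),
    times \<open>H\<close> or u in the weighted norm.\<close>
  define T where "T m j x = - 4 * \<i> * of_real h * (pd j (Y m) x * H m j x)
          + 2 * (of_real h)^2 * (((pd j (Y m) x)^2 - Y m x * pd j (pd j (Y m)) x) * u x)" for m j x
  define F where "F m x = Y m x * (Y m x * f x) + (\<Sum>j\<in>UNIV. T m j x)" for m x
  have cg: "L2 (U m)" "L2 (H' m j)" "L2 (F m)" "weak_L h A j (U m) (H' m j)" "weak_Lap h A (U m) (F m)" for m j
    using cutoff_graph[OF u f w tY Yr HL[where m=m] wH[where m=m]] unfolding U_def[abs_def] H'_def[abs_def] F_def[abs_def] T_def[abs_def] by auto
  have dY: "pd j (Y m) x = 2 * (cutoff m x * pd j (cutoff m) x)" for m j x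
    unfolding Y_def[abs_def] by (simp add: pd_mult[OF sc sc] mult.commute)
  have ddY: "pd j (pd j (Y m)) x = 2 * (cutoff m x * pd j (pd j (cutoff m)) x + (pd j (cutoff m) x)^2)" for m j x
  proof -
    have "pd j (Y m) = (\<lambda>x. 2 * (cutoff m x * pd j (cutoff m) x))" using dY by blast
    then show ?thesis
      by (simp add: pd_cmult[OF smooth_mult[OF sc smooth_pd[OF sc]]] pd_mult[OF sc smooth_pd[OF sc]] power2_eq_square)
  qed
  have Y1: "cmod (Y m x) \<le> 1" for m x
    unfolding Y_def norm_mult using mult_mono[OF cutoff_le cutoff_le] by fastforce
  have Ya: "cmod (pd j (Y m) x) \<le> 2 * K / real (Suc m)" for m j x
  proof -
    have "cmod (cutoff m x) * cmod (pd j (cutoff m) x) \<le> 1 * (K / real (Suc m))"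
      by (intro mult_mono cutoff_le K) auto
    then show ?thesis unfolding dY by (simp add: norm_mult)
  qed
  have Yb: "cmod ((pd j (Y m) x)^2 - Y m x * pd j (pd j (Y m)) x) \<le> (6 * K^2 + 2 * K) / real (Suc m)" for m j x
  proof -
    let ?k = "K / real (Suc m)"
    have kk: "?k * ?k \<le> K * ?k" using Km[of m] K(1) by (intro mult_right_mono) auto
    have "cmod ((pd j (Y m) x)^2) \<le> (2 * ?k)^2" using Ya[of j m x] unfolding norm_power by (intro power_mono) auto
    moreover have "cmod (Y m x) * cmod (pd j (pd j (Y m)) x) \<le> 1 * (2 * (?k + ?k^2))"
    proof (intro mult_mono Y1)
      have "cmod (cutoff m x) * cmod (pd j (pd j (cutoff m)) x) \<le> 1 * ?k" by (intro mult_mono cutoff_le K) auto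
      moreover have "cmod ((pd j (cutoff m) x)^2) \<le> ?k^2" unfolding norm_power by (intro power_mono K) auto
      ultimately have "cmod (cutoff m x * pd j (pd j (cutoff m)) x + (pd j (cutoff m) x)^2) \<le> ?k + ?k^2"
        by (intro order_trans[OF norm_triangle_ineq add_mono]) (auto simp: norm_mult)
      then show "cmod (pd j (pd j (Y m)) x) \<le> 2 * (?k + ?k^2)" unfolding ddY norm_mult by simp
    qed auto
    ultimately have "cmod ((pd j (Y m) x)^2 - Y m x * pd j (pd j (Y m)) x) \<le> (2 * ?k)^2 + 2 * (?k + ?k^2)"
      by (intro order_trans[OF norm_triangle_ineq4]) (simp add: norm_mult)
    also have "\<dots> = 6 * (?k * ?k) + 2 * ?k" by (simp add: power2_eq_square)
    also have "\<dots> \<le> 6 * (K * ?k) + 2 * ?k" using kk by simp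
    also have "\<dots> = (6 * K^2 + 2 * K) / real (Suc m)" by (simp add: power2_eq_square add_divide_distrib del: of_nat_Suc)
    finally show ?thesis .
  qed
  have LU: "L2lim (\<lambda>m x. ?P x * U m x) (\<lambda>x. ?P x * u x)" and Lf: "L2lim (\<lambda>m x. ?P x * (Y m x * (Y m x * f x))) (\<lambda>x. ?P x * f x)"
  proof -
    have gen: "L2lim (\<lambda>m x. ?P x * (Y m x * (Y m x * g x))) (\<lambda>x. ?P x * g x)" if g: "L2 g" and pg: "L2 (\<lambda>x. ?P x * g x)" for g
    proof (rule L2lim_dominated[OF _ _ pg])
      note [measurable] = L2_meas[OF g] smooth_meas[OF sP] test_meas[OF tY]
      show "(\<lambda>x. ?P x * (Y m x * (Y m x * g x))) \<in> borel_measurable borel" for m by measurable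
      show "(\<lambda>x. ?P x * g x) \<in> borel_measurable borel" by measurable
      show "cmod (?P x * (Y m x * (Y m x * g x))) \<le> 1 * cmod (?P x * g x)" for m x
      proof -
        have "cmod (Y m x) * cmod (Y m x) \<le> 1 * 1" by (intro mult_mono Y1) auto
        then have "(cmod (Y m x) * cmod (Y m x)) * cmod (?P x * g x) \<le> 1 * cmod (?P x * g x)" by (intro mult_right_mono) auto
        then show ?thesis by (simp add: norm_mult mult_ac)
      qed
      fix x
      have "(\<lambda>m. Y m x) \<longlonglongrightarrow> 1 * 1" unfolding Y_def by (intro tendsto_mult cutoff_tendsto)
      then have "(\<lambda>m. ?P x * (Y m x * (Y m x * g x))) \<longlonglongrightarrow> ?P x * (1 * (1 * g x))" by (intro tendsto_intros) auto
      then show "(\<lambda>m. ?P x * (Y m x * (Y m x * g x))) \<longlonglongrightarrow> ?P x * g x" by simp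
    qed
    show "L2lim (\<lambda>m x. ?P x * U m x) (\<lambda>x. ?P x * u x)" unfolding U_def by (rule gen[OF u pu])
    show "L2lim (\<lambda>m x. ?P x * (Y m x * (Y m x * f x))) (\<lambda>x. ?P x * f x)" by (rule gen[OF f pf])
  qed
  define C' where "C' = 4 * h * (2 * K * C) + 2 * h^2 * ((6 * K^2 + 2 * K) * L2norm (\<lambda>x. ?P x * u x))"
  have PT: "L2 (\<lambda>x. ?P x * T m j x)" and PTb: "L2norm (\<lambda>x. ?P x * T m j x) \<le> C' / real (Suc m)" for m j
  proof -
    let ?a = "\<lambda>x. pd j (Y m) x * (?P x * H m j x)" and ?b = "\<lambda>x. ((pd j (Y m) x)^2 - Y m x * pd j (pd j (Y m)) x) * (?P x * u x)"
    have e: "(\<lambda>x. ?P x * T m j x) = (\<lambda>x. (- 4 * \<i> * of_real h) * ?a x + (2 * (of_real h)^2) * ?b x)"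
      unfolding T_def by (simp add: fun_eq_iff algebra_simps)
    have tb: "test_fun (\<lambda>x. (pd j (Y m) x)^2 - Y m x * pd j (pd j (Y m)) x)"
      unfolding power2_eq_square by (intro test_diff test_mult test_smooth[OF test_pd[OF tY]] test_smooth[OF tY] test_pd tY)
    have La: "L2 ?a" "L2 ?b" by (rule L2_test_mult[OF test_pd[OF tY] PH], rule L2_test_mult[OF tb pu])
    have "L2norm ?a \<le> (2 * K / real (Suc m)) * L2norm (\<lambda>x. ?P x * H m j x)"
    proof (rule L2_dom(2)[OF PH L2_meas[OF La(1)]])
      show "cmod (?a x) \<le> (2 * K / real (Suc m)) * cmod (?P x * H m j x)" for x
        unfolding norm_mult[of "pd j (Y m) x"] by (rule mult_right_mono[OF Ya norm_ge_zero])
    qed (use K(1) in simp)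
    also have "\<dots> \<le> (2 * K / real (Suc m)) * C" using PHb K(1) by (intro mult_left_mono) auto
    finally have na: "L2norm ?a \<le> (2 * K * C) / real (Suc m)" by simp
    have "L2norm ?b \<le> ((6 * K^2 + 2 * K) / real (Suc m)) * L2norm (\<lambda>x. ?P x * u x)"
    proof (rule L2_dom(2)[OF pu L2_meas[OF La(2)]])
      show "cmod (?b x) \<le> ((6 * K^2 + 2 * K) / real (Suc m)) * cmod (?P x * u x)" for x
        unfolding norm_mult[of "(pd j (Y m) x)^2 - Y m x * pd j (pd j (Y m)) x"] by (rule mult_right_mono[OF Yb norm_ge_zero])
    qed (use K(1) in simp)
    then have nb: "L2norm ?b \<le> ((6 * K^2 + 2 * K) * L2norm (\<lambda>x. ?P x * u x)) / real (Suc m)" by simp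
    show "L2 (\<lambda>x. ?P x * T m j x)" unfolding e by (intro L2_add L2_cmult La)
    have "L2norm (\<lambda>x. ?P x * T m j x) \<le> L2norm (\<lambda>x. (- 4 * \<i> * of_real h) * ?a x) + L2norm (\<lambda>x. (2 * (of_real h)^2) * ?b x)"
      unfolding e by (intro L2norm_triangle L2_cmult La)
    also have "\<dots> = 4 * h * L2norm ?a + 2 * h^2 * L2norm ?b"
      unfolding L2norm_cmult using h by (simp add: norm_mult norm_power)
    also have "\<dots> \<le> 4 * h * ((2 * K * C) / real (Suc m)) + 2 * h^2 * (((6 * K^2 + 2 * K) * L2norm (\<lambda>x. ?P x * u x)) / real (Suc m))"
      using h by (intro add_mono mult_left_mono na nb) auto
    also have "\<dots> = C' / real (Suc m)" unfolding C'_def by (simp add: add_divide_distrib del: of_nat_Suc)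
    finally show "L2norm (\<lambda>x. ?P x * T m j x) \<le> C' / real (Suc m)" .
  qed
  have inv0: "(\<lambda>m. c / real (Suc m)) \<longlonglongrightarrow> 0" for c
    using tendsto_mult_left[OF LIMSEQ_inverse_real_of_nat, of c] by (simp add: divide_inverse)
  have LF: "L2lim (\<lambda>m x. ?P x * F m x) (\<lambda>x. ?P x * f x)"
  proof -
    have "L2lim (\<lambda>m x. ?P x * T m j x) (\<lambda>x. 0)" for j
      by (rule L2limI[OF PT _ _ inv0[of C']]) (use PTb in auto)
    then have "L2lim (\<lambda>m x. ?P x * (Y m x * (Y m x * f x)) + (\<Sum>j\<in>UNIV. ?P x * T m j x)) (\<lambda>x. ?P x * f x + (\<Sum>j\<in>(UNIV::'d set). 0))"
      by (intro L2lim_add Lf L2lim_sum)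
    then show ?thesis unfolding F_def by (simp add: distrib_left sum_distrib_left)
  qed
  \<comment> \<open>A diagonal choice: for each cutoff the mollification is taken so fine that both
    weighted errors are at most 1/(m + 1). The weight is bounded on the common support, so
    unweighted convergence is enough.\<close>
  define close where "close m \<phi> \<longleftrightarrow> test_fun \<phi> \<and> L2norm (\<lambda>x. ?P x * \<phi> x - ?P x * U m x) \<le> 1 / real (Suc m)
      \<and> L2norm (\<lambda>x. ?P x * Lapc h A \<phi> x - ?P x * F m x) \<le> 1 / real (Suc m)" for m \<phi>
  have "\<exists>\<phi>. close m \<phi>" for m
  proof -
    obtain r where r: "r \<ge> 0" "\<And>x. norm x > r \<Longrightarrow> Y m x = 0" using test_norm_bound[OF tY] by blast
    have r1: "pd j (Y m) x = 0" if "norm x > r" for j x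
      by (rule pd_vanish[of "cball 0 r"]) (use that r in auto)
    have v: "U m x = 0" "H' m j x = 0" "F m x = 0" if "norm x > r" for x j
      using r(2)[OF that] r1[OF that] by (auto simp: U_def H'_def F_def T_def)
    obtain \<phi> where t: "\<And>k. test_fun (\<phi> k)" and v\<phi>: "\<And>k x. norm x > r + 1 \<Longrightarrow> \<phi> k x = 0"
      and l: "L2lim \<phi> (U m)" "L2lim (\<lambda>k. Lapc h A (\<phi> k)) (F m)"
      using mollify_graph[OF h cg(1,2,3) v cg(4,5)] by metis
    have vL: "Lapc h A (\<phi> k) x = 0" if "norm x > r + 1" for k x
    proof -
      have 1: "pd j (\<phi> k) x = 0" if "norm x > r + 1" for j x
        by (rule pd_vanish[of "cball 0 (r + 1)"]) (use that v\<phi> in auto)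
      have 2: "pd j (pd j (\<phi> k)) x = 0" for j
        by (rule pd_vanish[of "cball 0 (r + 1)"]) (use that 1 in auto)
      show ?thesis unfolding Lapc_expand[OF test_smooth[OF t]] using 1[OF that] 2 v\<phi>[OF that] by simp
    qed
    have "L2lim (\<lambda>k x. ?P x * \<phi> k x) (\<lambda>x. ?P x * U m x)" by (rule L2lim_compact_mult[OF l(1) sP, of "r + 1"]) (use v v\<phi> in force)+
    from LIMSEQ_D[OF L2limD(3)[OF this], of "1 / real (Suc m)"] obtain n1 where
      n1: "\<And>k. k \<ge> n1 \<Longrightarrow> L2norm (\<lambda>x. ?P x * \<phi> k x - ?P x * U m x) < 1 / real (Suc m)" by auto
    have "L2lim (\<lambda>k x. ?P x * Lapc h A (\<phi> k) x) (\<lambda>x. ?P x * F m x)" by (rule L2lim_compact_mult[OF l(2) sP, of "r + 1"]) (use v vL in force)+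
    from LIMSEQ_D[OF L2limD(3)[OF this], of "1 / real (Suc m)"] obtain n2 where
      n2: "\<And>k. k \<ge> n2 \<Longrightarrow> L2norm (\<lambda>x. ?P x * Lapc h A (\<phi> k) x - ?P x * F m x) < 1 / real (Suc m)" by auto
    show ?thesis unfolding close_def using t[of "max n1 n2"] n1[of "max n1 n2"] n2[of "max n1 n2"] by (intro exI[of _ "\<phi> (max n1 n2)"]) auto
  qed
  then obtain \<phi> where "\<And>m. close m (\<phi> m)" by metis
  then have \<phi>: "\<And>m. test_fun (\<phi> m)" "\<And>m. L2norm (\<lambda>x. ?P x * \<phi> m x - ?P x * U m x) \<le> 1 / real (Suc m)"
     "\<And>m. L2norm (\<lambda>x. ?P x * Lapc h A (\<phi> m) x - ?P x * F m x) \<le> 1 / real (Suc m)"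
    unfolding close_def by blast+
  have tP: "L2 (\<lambda>x. ?P x * \<phi> m x)" "L2 (\<lambda>x. ?P x * Lapc h A (\<phi> m) x)" for m
    by (intro test_L2 test_mult sP \<phi> test_Lapc)+
  have conv: "L2lim a c" if a: "\<And>m. L2 (a m)" and ab: "\<And>m. L2norm (\<lambda>x. a m x - b m x) \<le> 1 / real (Suc m)" and b: "L2lim b c" for a b c
  proof (rule L2limI[OF a L2limD(2)[OF b]])
    show "L2norm (\<lambda>x. a m x - c x) \<le> 1 / real (Suc m) + L2norm (\<lambda>x. b m x - c x)" for m
      using L2norm_triangle_mid[OF a[of m] L2limD(1)[OF b, of m] L2limD(2)[OF b]] ab[of m] by linarith
    show "(\<lambda>m. 1 / real (Suc m) + L2norm (\<lambda>x. b m x - c x)) \<longlonglongrightarrow> 0"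
      using tendsto_add[OF inv0[of 1] L2limD(3)[OF b]] by simp
  qed
  show ?thesis
    by (rule that[OF \<phi>(1) conv[OF tP(1) \<phi>(2) LU] conv[OF tP(2) \<phi>(3) LF]])
qed

end

section \<open>A priori estimates\<close>

text \<open>Assumptions (ii) and (iii) are reduced to one quantity, the Frobenius norm: its square
  is smooth, so its powers can serve as weights.\<close>

locale nondegenerate_magnetic = magnetic A for A :: "'d::finite \<Rightarrow> real^'d \<Rightarrow> real" +
  assumes B_lower: "\<exists>c>0. \<forall>x. c \<le> (\<Sum>j\<in>UNIV. \<Sum>k\<in>UNIV. (B j k x)^2)"
    and B_deriv: "\<And>js. \<exists>C>0. \<forall>j k x. \<bar>iterpd js (B j k) x\<bar> \<le> C * sqrt (\<Sum>j\<in>UNIV. \<Sum>k\<in>UNIV. (B j k x)^2)"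
begin

text \<open>\<open>wt s\<close> is \<open>\<bar>B\<bar>\<^sup>s\<close> for the Frobenius norm \<open>\<bar>B\<bar>\<close>.\<close>
definition w0 :: "real^'d \<Rightarrow> real" where "w0 x = (\<Sum>j\<in>UNIV. \<Sum>k\<in>UNIV. (B j k x)^2)"
definition wt :: "real \<Rightarrow> real^'d \<Rightarrow> real" where "wt s x = w0 x powr (s / 2)"
definition wm :: "real \<Rightarrow> (real^'d \<Rightarrow> complex) \<Rightarrow> real^'d \<Rightarrow> complex" where "wm s u x = of_real (wt s x) * u x"

lemma w0_pos: "w0 x > 0"
proof -
  obtain c where "c > 0" "c \<le> w0 x" using B_lower unfolding w0_def by blast
  then show ?thesis by (rule less_le_trans)
qed

lemma smooth_w0: "smooth w0"
  unfolding w0_def[abs_def] by (intro smooth_sum smooth_power smoothB)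

lemma smooth_wt: "smooth (wt s)"
  unfolding wt_def[abs_def] by (rule smooth_powr(2)[OF smooth_w0 w0_pos])

lemma wt_pos: "wt s x > 0"
  unfolding wt_def using w0_pos[of x] by simp

lemma wt_add: "wt s x * wt t x = wt (s + t) x"
  unfolding wt_def by (simp add: powr_add add_divide_distrib)

lemma wt_0: "wt 0 x = 1"
  unfolding wt_def using w0_pos[of x] by simp

lemma wt_1: "wt 1 x = sqrt (w0 x)"
  unfolding wt_def using w0_pos[of x] by (simp add: powr_half_sqrt)

lemma wt_2: "wt 2 x = w0 x"
  unfolding wt_def using w0_pos[of x] by simp

lemma B_le_wt: "\<bar>B j k x\<bar> \<le> wt 1 x"
proof -
  have "(B j k x)^2 \<le> (\<Sum>k\<in>UNIV. (B j k x)^2)" by (rule member_le_sum) auto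
  also have "\<dots> \<le> w0 x" unfolding w0_def by (rule member_le_sum) (auto intro: sum_nonneg)
  finally show ?thesis unfolding wt_1 by (simp add: real_le_rsqrt)
qed

text \<open>A power of |B| with exponent s - t \<le> 0 is bounded because |B| is bounded
  below.\<close>

lemma wt_le: "s \<le> t \<Longrightarrow> \<exists>C>0. \<forall>x. wt s x \<le> C * wt t x"
proof -
  assume st: "s \<le> t"
  obtain c where c: "c > 0" "\<And>x. c \<le> w0 x" using B_lower unfolding w0_def by blast
  have "wt (s - t) x \<le> c powr ((s - t) / 2)" for x
    unfolding wt_def using c st by (intro powr_mono2') auto
  then have "wt s x \<le> c powr ((s - t) / 2) * wt t x" for x
    using wt_add[of "s - t" x t] wt_pos[of t x] by (metis diff_add_cancel less_imp_le mult_right_mono)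
  then show ?thesis using c by (intro exI[of _ "c powr ((s - t) / 2)"]) auto
qed

lemma iterpd_B_le: "\<exists>C>0. \<forall>j k x. \<bar>iterpd js (B j k) x\<bar> \<le> C * wt 1 x"
  using B_deriv[of js] unfolding wt_1 w0_def .

lemma dB_le: "\<exists>C>0. \<forall>l j k x. \<bar>pd l (B j k) x\<bar> \<le> C * wt 1 x"
proof -
  have "\<exists>C>0. \<forall>j k x. \<bar>pd l (B j k) x\<bar> \<le> C * wt 1 x" for l using iterpd_B_le[of "[l]"] by simp
  then obtain C where C: "\<And>l. C l > 0" "\<And>l j k x. \<bar>pd l (B j k) x\<bar> \<le> C l * wt 1 x" by metis
  have "C l \<le> sum C UNIV" for l by (rule member_le_sum) (auto simp: C less_imp_le)
  then have "\<bar>pd l (B j k) x\<bar> \<le> sum C UNIV * wt 1 x" for l j k x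
    using C(2)[of l j k x] wt_pos[of 1 x] by (meson mult_right_mono less_imp_le order_trans)
  moreover have "sum C UNIV > 0" by (intro sum_pos) (auto simp: C)
  ultimately show ?thesis by blast
qed

text \<open>The derivative of |B|^2 is 2 sum B dB, which is O(|B|^2) by (iii); the chain rule passes
  this to every power. This is the condition on weights in \<open>energy_test\<close> and
  \<open>graph_approx\<close>. The summand 1 in the constant keeps it positive also for s =
  0.\<close>

lemma dwt_le: "\<exists>M>0. \<forall>j x. \<bar>pd j (wt s) x\<bar> \<le> M * wt s x"
proof -
  obtain C where C: "C > 0" "\<And>l j k x. \<bar>pd l (B j k) x\<bar> \<le> C * wt 1 x" using dB_le by blast
  define D where "D = real CARD('d) * (real CARD('d) * (2 * C))"
  have d0: "\<bar>pd l w0 x\<bar> \<le> D * w0 x" for l x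
  proof -
    have "pd l w0 x = (\<Sum>j\<in>UNIV. \<Sum>k\<in>UNIV. 2 * (B j k x * pd l (B j k) x))"
      unfolding w0_def[abs_def] power2_eq_square
      by (simp add: pd_sum smooth_sum smooth_mult smoothB pd_mult mult.commute)
    also have "\<bar>\<dots>\<bar> \<le> (\<Sum>j\<in>(UNIV::'d set). \<Sum>k\<in>(UNIV::'d set). 2 * (wt 1 x * (C * wt 1 x)))"
    proof (intro order_trans[OF sum_abs sum_mono])
      fix j k
      have "\<bar>B j k x\<bar> * \<bar>pd l (B j k) x\<bar> \<le> wt 1 x * (C * wt 1 x)"
        by (intro mult_mono B_le_wt C(2)) (auto simp: less_imp_le[OF wt_pos])
      then show "\<bar>2 * (B j k x * pd l (B j k) x)\<bar> \<le> 2 * (wt 1 x * (C * wt 1 x))" by (simp add: abs_mult)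
    qed
    also have "\<dots> = D * (wt 1 x * wt 1 x)" unfolding D_def by simp
    finally show ?thesis by (simp add: wt_add wt_2)
  qed
  have D: "D \<ge> 0" unfolding D_def using C(1) by simp
  have "\<bar>pd j (wt s) x\<bar> \<le> (\<bar>s / 2\<bar> * D + 1) * wt s x" for j x
  proof -
    have e: "pd j (wt s) x = s / 2 * pd j w0 x * w0 x powr (s / 2 - 1)"
      unfolding wt_def[abs_def] by (rule haspd_pd[OF haspd_powr[OF smooth_w0 w0_pos]])
    have "\<bar>pd j (wt s) x\<bar> = \<bar>s / 2\<bar> * \<bar>pd j w0 x\<bar> * w0 x powr (s / 2 - 1)" unfolding e abs_mult by simp
    also have "\<dots> \<le> \<bar>s / 2\<bar> * (D * w0 x) * w0 x powr (s / 2 - 1)"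
      by (intro mult_right_mono mult_left_mono d0) auto
    also have "\<dots> = \<bar>s / 2\<bar> * D * (w0 x powr 1 * w0 x powr (s / 2 - 1))" using w0_pos[of x] by simp
    also have "\<dots> = \<bar>s / 2\<bar> * D * wt s x" unfolding wt_def powr_add[symmetric] by simp
    also have "\<dots> \<le> (\<bar>s / 2\<bar> * D + 1) * wt s x" using wt_pos[of s x] by (intro mult_right_mono) auto
    finally show ?thesis .
  qed
  moreover have "\<bar>s / 2\<bar> * D + 1 > 0" using D by (simp add: add_nonneg_pos)
  ultimately show ?thesis by blast
qed

lemma smooth_cwt: "smooth (\<lambda>x. complex_of_real (wt s x))"
  by (rule smooth_of_real[OF smooth_wt])

lemma test_wm: "test_fun u \<Longrightarrow> test_fun (wm s u)"
  unfolding wm_def by (rule test_mult[OF smooth_cwt])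

lemma wm_wm: "wm s (wm t u) = wm (s + t) u"
  unfolding wm_def by (simp add: fun_eq_iff wt_add[symmetric])

lemma wm_0: "wm 0 u = u"
  unfolding wm_def by (simp add: wt_0)

lemma cmod_wm: "cmod (wm s u x) = wt s x * cmod (u x)"
  unfolding wm_def using wt_pos[of s x] by (simp add: norm_mult)

lemma wm_meas: "u \<in> borel_measurable borel \<Longrightarrow> wm s u \<in> borel_measurable borel"
  unfolding wm_def using smooth_meas[OF smooth_cwt] by measurable

lemma L2_wm_le: "s \<le> t \<Longrightarrow> \<exists>C>0. \<forall>u. L2 (wm t u) \<longrightarrow> L2 (wm s u) \<and> L2norm (wm s u) \<le> C * L2norm (wm t u)"
proof -
  assume "s \<le> t"
  then obtain C where C: "C > 0" "\<And>x. wt s x \<le> C * wt t x" using wt_le by blast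
  have "L2 (wm s u) \<and> L2norm (wm s u) \<le> C * L2norm (wm t u)" if u: "L2 (wm t u)" for u
  proof -
    have m: "wm s u \<in> borel_measurable borel"
      using wm_meas[OF L2_meas[OF u], of "s - t"] by (simp add: wm_wm)
    have "cmod (wm s u x) \<le> C * cmod (wm t u x)" for x
      unfolding cmod_wm using mult_right_mono[OF C(2) norm_ge_zero] by (simp add: mult.assoc)
    from L2_dom[OF u m this] show ?thesis using C(1) by simp
  qed
  with C(1) show ?thesis by blast
qed

lemma quadratic_absorb: "x \<le> p + q" if "x^2 \<le> p * x + q^2" "p \<ge> 0" "q \<ge> 0" for x p q :: real
proof (rule ccontr)
  assume "\<not> ?thesis"
  then have x: "x > p + q" by simp
  then have "q * q \<le> x * q" "x * (p + q) < x * x" using that by (auto intro!: mult_right_mono mult_strict_left_mono)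
  then show False using that(1) by (simp add: power2_eq_square algebra_simps)
qed

lemma L2norm_sum_sq_bound:
  fixes u :: "'i::finite \<Rightarrow> real^'d \<Rightarrow> complex"
  shows "L2norm (u j) \<le> sqrt (\<Sum>j\<in>UNIV. (L2norm (u j))^2)"
  by (rule real_le_rsqrt) (rule member_le_sum, auto)

text \<open>The commutator \<open>[L\<^sub>j, L\<^sub>k] = i h B\<^sub>j\<^sub>k\<close>, tested against \<open>B\<^sub>j\<^sub>k u / \<bar>B\<bar>\<close> and summed, replaces the sharp lower bound.\<close>
lemma magnetic_lower_bound:
  "\<exists>C>0. \<forall>h u. 0 < h \<longrightarrow> h \<le> 1 \<longrightarrow> test_fun u \<longrightarrow>
     h * (L2norm (wm (1/2) u))^2 \<le> C * (\<Sum>j\<in>UNIV. (L2norm (Lc h A j u))^2)"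
proof -
  \<comment> \<open>The field divided by its norm. It is bounded by 1 with bounded first
    derivatives, and the sum of \<open>B j k\<close> times \<open>e j k\<close> is |B|.\<close>
  define e where "e j k x = B j k x * wt (-1) x" for j k x
  have se: "smooth (e j k)" for j k unfolding e_def by (intro smooth_mult smoothB smooth_wt)
  have w1: "wt 1 x * wt (-1) x = 1" for x using wt_add[of 1 x "-1"] by (simp add: wt_0)
  have e1: "\<bar>e j k x\<bar> \<le> 1" for j k x
    using mult_right_mono[OF B_le_wt[of j k x] less_imp_le[OF wt_pos[of "-1" x]]] wt_pos[of "-1" x] unfolding e_def abs_mult w1 by simp
  obtain C where C: "C > 0" "\<And>l j k x. \<bar>pd l (B j k) x\<bar> \<le> C * wt 1 x" using dB_le by blast
  obtain M where M: "M > 0" "\<And>j x. \<bar>pd j (wt (-1)) x\<bar> \<le> M * wt (-1) x" using dwt_le by blast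
  have de: "\<bar>pd l (e j k) x\<bar> \<le> C + M" for l j k x
  proof -
    have "pd l (e j k) x = B j k x * pd l (wt (-1)) x + pd l (B j k) x * wt (-1) x"
      unfolding e_def[abs_def] by (rule pd_mult[OF smoothB smooth_wt])
    also have "\<bar>\<dots>\<bar> \<le> \<bar>B j k x\<bar> * \<bar>pd l (wt (-1)) x\<bar> + \<bar>pd l (B j k) x\<bar> * \<bar>wt (-1) x\<bar>"
      by (rule order_trans[OF abs_triangle_ineq]) (simp add: abs_mult)
    also have "\<dots> \<le> wt 1 x * (M * wt (-1) x) + (C * wt 1 x) * wt (-1) x"
      using wt_pos[of 1 x] wt_pos[of "-1" x] M C by (intro add_mono mult_mono B_le_wt M(2) C(2)) auto
    also have "\<dots> = C + M" using w1[of x] by (simp add: algebra_simps)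
    finally show ?thesis .
  qed
  obtain c1 where c1: "c1 > 0" "\<And>u. L2 (wm (1/2) u) \<Longrightarrow> L2norm (wm 0 u) \<le> c1 * L2norm (wm (1/2) u)"
    using L2_wm_le[of 0 "1/2"] by auto
  let ?d = "real CARD('d)"
  define K where "K = ?d * (?d * (2 * (C + M) * c1))"
  have K: "K \<ge> 0" unfolding K_def using C M c1 by simp
  have "h * (L2norm (wm (1/2) u))^2 \<le> (4 * ?d * ?d + K^2) * (\<Sum>j\<in>UNIV. (L2norm (Lc h A j u))^2)"
    if h: "0 < h" "h \<le> 1" and u: "test_fun u" for h u
  proof -
    note su = test_smooth[OF u]
    define N where "N = sqrt (\<Sum>j\<in>UNIV. (L2norm (Lc h A j u))^2)"
    have N2: "N^2 = (\<Sum>j\<in>UNIV. (L2norm (Lc h A j u))^2)" unfolding N_def by (simp add: sum_nonneg)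
    have N0: "N \<ge> 0" unfolding N_def by (simp add: sum_nonneg)
    have nN: "L2norm (Lc h A j u) \<le> N" for j unfolding N_def by (rule L2norm_sum_sq_bound)
    define q where "q = L2norm (wm (1/2) u)"
    have n0: "L2norm u \<le> c1 * q" using c1(2)[OF test_L2[OF test_wm[OF u]]] unfolding q_def wm_0 .
    have te: "test_fun (\<lambda>x. of_real (e j k x) * u x)" for j k by (rule test_mult[OF smooth_of_real[OF se] u])
    \<comment> \<open>Differentiating \<open>e\<close> costs h times the plain norm of u, which the
      lower bound on |B| converts into the norm q that is being estimated.\<close>
    have Le: "L2norm (Lc h A l (\<lambda>x. of_real (e j k x) * u x)) \<le> N + h * (C + M) * (c1 * q)" for l j k
    proof -
      let ?a = "\<lambda>x. of_real (e j k x) * Lc h A l u x" and ?b = "\<lambda>x. \<i> * of_real h * of_real (pd l (e j k) x) * u x"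
      have ta: "test_fun ?a" "test_fun ?b"
        by (intro test_mult test_Lc u smooth_mult smooth_of_real smooth_const smooth_pd se)+
      have "L2norm ?a \<le> 1 * L2norm (Lc h A l u)"
        by (rule L2_dom(2)[OF test_L2[OF test_Lc[OF u]] test_meas[OF ta(1)]])
          (use mult_right_mono[OF e1 norm_ge_zero] in \<open>auto simp: norm_mult\<close>)
      moreover have "L2norm ?b \<le> (h * (C + M)) * L2norm u"
      proof (rule L2_dom(2)[OF test_L2[OF u] test_meas[OF ta(2)]])
        show "cmod (?b x) \<le> (h * (C + M)) * cmod (u x)" for x
          using h de[of l j k x] by (simp add: norm_mult mult_right_mono mult_left_mono)
      qed (use h C M in simp)
      moreover have "(h * (C + M)) * L2norm u \<le> (h * (C + M)) * (c1 * q)" using h C M n0 by (intro mult_left_mono) auto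
      moreover have "L2norm (\<lambda>x. ?a x - ?b x) \<le> L2norm ?a + L2norm ?b"
        by (intro L2norm_triangle_diff test_L2 ta)
      moreover have "Lc h A l (\<lambda>x. of_real (e j k x) * u x) = (\<lambda>x. ?a x - ?b x)"
        using Lc_rmult[OF se su] by blast
      ultimately show ?thesis using nN[of l] by simp
    qed
    have jk: "cmod (ip (\<lambda>x. of_real (h * B j k x) * u x) (\<lambda>x. of_real (e j k x) * u x)) \<le> 2 * (N * (N + h * (C + M) * (c1 * q)))" for j k
    proof -
      let ?v = "\<lambda>x. of_real (e j k x) * u x"
      have "(\<lambda>x. of_real (h * B j k x) * u x) = (\<lambda>x. (- \<i>) * (Lc h A j (Lc h A k u) x - Lc h A k (Lc h A j u) x))"
        using Lc_comm[OF su, of h j k] by (simp add: fun_eq_iff mult.assoc)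
      then have "ip (\<lambda>x. of_real (h * B j k x) * u x) ?v = (- \<i>) * (ip (Lc h A j (Lc h A k u)) ?v - ip (Lc h A k (Lc h A j u)) ?v)"
        by (simp only: ip_cmult_left ip_diff_left[OF test_L2[OF test_Lc[OF test_Lc[OF u]]] test_L2[OF test_Lc[OF test_Lc[OF u]]] test_L2[OF te]])
      also have "\<dots> = (- \<i>) * (ip (Lc h A k u) (Lc h A j ?v) - ip (Lc h A j u) (Lc h A k ?v))"
        by (simp only: Lc_sym[OF test_Lc[OF u] te])
      finally have "cmod (ip (\<lambda>x. of_real (h * B j k x) * u x) ?v) \<le> cmod (ip (Lc h A k u) (Lc h A j ?v)) + cmod (ip (Lc h A j u) (Lc h A k ?v))"
        by (simp add: norm_mult norm_triangle_ineq4)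
      also have "\<dots> \<le> L2norm (Lc h A k u) * L2norm (Lc h A j ?v) + L2norm (Lc h A j u) * L2norm (Lc h A k ?v)"
        by (intro add_mono ip_CS test_L2 test_Lc u te)
      also have "\<dots> \<le> N * (N + h * (C + M) * (c1 * q)) + N * (N + h * (C + M) * (c1 * q))"
        by (intro add_mono mult_mono nN Le N0 L2norm_nonneg)
      finally show ?thesis by simp
    qed
    have "of_real (h * q^2) = of_real h * ip (wm (1/2) u) (wm (1/2) u)" unfolding q_def ip_self by simp
    also have "\<dots> = ip (\<lambda>x. of_real h * wm (1/2) u x) (wm (1/2) u)" by (simp add: ip_cmult_left)
    also have "\<dots> = ip (\<lambda>x. of_real (h * wt 1 x) * u x) u"
    proof (rule ip_shift)
      fix x
      have "wt 1 x = wt (1/2) x * wt (1/2) x" by (simp add: wt_add)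
      then show "of_real h * wm (1/2) u x * cnj (wm (1/2) u x) = of_real (h * wt 1 x) * u x * cnj (u x)"
        unfolding wm_def by (simp add: mult_ac)
    qed
    also have "\<dots> = (\<integral>x. (\<Sum>j\<in>UNIV. \<Sum>k\<in>UNIV. of_real (h * B j k x) * u x * cnj (of_real (e j k x) * u x)) \<partial>lborel)"
      unfolding ip_def
    proof (intro Bochner_Integration.integral_cong refl)
      fix x
      have "wt 1 x = (\<Sum>j\<in>UNIV. \<Sum>k\<in>UNIV. B j k x * e j k x)"
      proof -
        have "(\<Sum>j\<in>UNIV. \<Sum>k\<in>UNIV. B j k x * e j k x) = w0 x * wt (-1) x"
          unfolding e_def w0_def by (simp add: sum_distrib_right power2_eq_square mult.assoc)
        then show ?thesis using wt_add[of 2 x "-1"] by (simp add: wt_2)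
      qed
      then show "of_real (h * wt 1 x) * u x * cnj (u x) = (\<Sum>j\<in>UNIV. \<Sum>k\<in>UNIV. of_real (h * B j k x) * u x * cnj (of_real (e j k x) * u x))"
        by (simp add: sum_distrib_left sum_distrib_right mult_ac)
    qed
    also have "\<dots> = (\<Sum>j\<in>UNIV. \<Sum>k\<in>UNIV. ip (\<lambda>x. of_real (h * B j k x) * u x) (\<lambda>x. of_real (e j k x) * u x))"
    proof -
      have "integrable lborel (\<lambda>x. of_real (h * B j k x) * u x * cnj (of_real (e j k x) * u x))" for j k
        by (intro L2_ip test_L2 te test_mult[OF smooth_of_real[OF smooth_mult[OF smooth_const smoothB]] u])
      then show ?thesis unfolding ip_def
        by (simp only: Bochner_Integration.integral_sum Bochner_Integration.integrable_sum)
    qed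
    finally have "cmod (of_real (h * q^2)) = cmod (\<Sum>j\<in>UNIV. \<Sum>k\<in>UNIV. ip (\<lambda>x. of_real (h * B j k x) * u x) (\<lambda>x. of_real (e j k x) * u x))" by (rule arg_cong)
    also have "\<dots> \<le> (\<Sum>j\<in>(UNIV::'d set). \<Sum>k\<in>(UNIV::'d set). 2 * (N * (N + h * (C + M) * (c1 * q))))"
      by (intro order_trans[OF norm_sum] sum_mono jk)
    also have "\<dots> = 2 * ?d * ?d * N^2 + h * (K * N * q)" unfolding K_def by (simp add: algebra_simps power2_eq_square)
    finally have "h * q^2 \<le> 2 * ?d * ?d * N^2 + h * (K * N * q)"
      using h by (simp only: norm_of_real)
    \<comment> \<open>Young's inequality: half of h q^2 is absorbed on the left, and h \<le> 1
      removes the factor h from the other half.\<close>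
    also have "h * (K * N * q) \<le> h * ((K^2 * N^2 + q^2) / 2)"
      using sum_squares_bound[of "K * N" q] h by (intro mult_left_mono) (auto simp: power_mult_distrib)
    also have "\<dots> = h * (K^2 * N^2) / 2 + h * q^2 / 2" by (simp add: algebra_simps)
    also have "h * (K^2 * N^2) / 2 \<le> 1 * (K^2 * N^2) / 2" using h by (intro divide_right_mono mult_right_mono) auto
    finally have "h * q^2 \<le> 4 * ?d * ?d * N^2 + K^2 * N^2" by simp
    then show ?thesis unfolding N2[symmetric] q_def by (simp add: algebra_simps)
  qed
  moreover have "4 * ?d * ?d + K^2 > 0" by (intro add_pos_nonneg) auto
  ultimately show ?thesis by blast
qed

text \<open>\<open>magnetic_lower_bound\<close> for |B|^(s + 1/2) u. The commutator of L_j with the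
  weight produces the last term, which has an extra factor h and is absorbed in
  \<open>apriori_12\<close>.\<close>

lemma apriori_zero_order:
  "\<exists>C>0. \<forall>h u. 0 < h \<longrightarrow> h \<le> 1 \<longrightarrow> test_fun u \<longrightarrow>
     (h * L2norm (wm (s + 1) u))^2 \<le> C * (h * (\<Sum>j\<in>UNIV. (L2norm (wm (s + 1/2) (Lc h A j u)))^2) + h * (h * L2norm (wm (s + 1) u))^2)"
proof -
  obtain C where C: "C > 0" "\<And>h u. 0 < h \<Longrightarrow> h \<le> 1 \<Longrightarrow> test_fun u \<Longrightarrow>
     h * (L2norm (wm (1/2) u))^2 \<le> C * (\<Sum>j\<in>UNIV. (L2norm (Lc h A j u))^2)" using magnetic_lower_bound by blast
  let ?p = "s + 1/2"
  obtain M where M: "M > 0" "\<And>j x. \<bar>pd j (wt ?p) x\<bar> \<le> M * wt ?p x" using dwt_le by blast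
  obtain c1 where c1: "c1 > 0" "\<And>u. L2 (wm (s + 1) u) \<Longrightarrow> L2norm (wm ?p u) \<le> c1 * L2norm (wm (s + 1) u)"
    using L2_wm_le[of ?p "s + 1"] by auto
  let ?d = "real CARD('d)"
  have "(h * L2norm (wm (s + 1) u))^2 \<le> (2 * C + 2 * C * ?d * M^2 * c1^2) * (h * (\<Sum>j\<in>UNIV. (L2norm (wm ?p (Lc h A j u)))^2) + h * (h * L2norm (wm (s + 1) u))^2)"
    if h: "0 < h" "h \<le> 1" and u: "test_fun u" for h u
  proof -
    note su = test_smooth[OF u]
    define q where "q = L2norm (wm (s + 1) u)"
    define S where "S = (\<Sum>j\<in>UNIV. (L2norm (wm ?p (Lc h A j u)))^2)"
    have S0: "S \<ge> 0" unfolding S_def by (simp add: sum_nonneg)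
    have pq: "L2norm (wm ?p u) \<le> c1 * q" unfolding q_def by (rule c1(2)[OF test_L2[OF test_wm[OF u]]])
    have "wm (s + 1) u = wm (1/2) (wm ?p u)" by (simp add: wm_wm add_ac)
    then have "h * q^2 \<le> C * (\<Sum>j\<in>UNIV. (L2norm (Lc h A j (wm ?p u)))^2)"
      unfolding q_def using C(2)[OF h test_wm[OF u]] by simp
    also have "\<dots> \<le> C * (\<Sum>j\<in>UNIV. 2 * (L2norm (wm ?p (Lc h A j u)))^2 + 2 * (h * M * (c1 * q))^2)"
    proof (intro mult_left_mono sum_mono)
      fix j
      let ?b = "\<lambda>x. \<i> * of_real h * of_real (pd j (wt ?p) x) * u x"
      have tb: "test_fun ?b"
        by (intro test_mult u smooth_mult smooth_of_real smooth_const smooth_pd smooth_wt)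
      have "Lc h A j (wm ?p u) = (\<lambda>x. wm ?p (Lc h A j u) x - ?b x)"
        unfolding wm_def using Lc_rmult[OF smooth_wt su] by blast
      then have "L2norm (Lc h A j (wm ?p u)) \<le> L2norm (wm ?p (Lc h A j u)) + L2norm ?b"
        using L2norm_triangle_diff[OF test_L2[OF test_wm[OF test_Lc[OF u]]] test_L2[OF tb]] by simp
      also have "L2norm ?b \<le> (h * M) * L2norm (wm ?p u)"
      proof (rule L2_dom(2)[OF test_L2[OF test_wm[OF u]] test_meas[OF tb]])
        show "cmod (?b x) \<le> (h * M) * cmod (wm ?p u x)" for x
          unfolding cmod_wm using h mult_left_mono[OF mult_right_mono[OF M(2)[of j x], of "cmod (u x)"], of h]
          by (simp add: norm_mult mult_ac)
      qed (use h M in simp)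
      also have "(h * M) * L2norm (wm ?p u) \<le> (h * M) * (c1 * q)" using h M pq by (intro mult_left_mono) auto
      finally have "(L2norm (Lc h A j (wm ?p u)))^2 \<le> (L2norm (wm ?p (Lc h A j u)) + h * M * (c1 * q))^2"
        by (intro power_mono) auto
      also have "\<dots> \<le> 2 * (L2norm (wm ?p (Lc h A j u)))^2 + 2 * (h * M * (c1 * q))^2"
        using sum_squares_bound[of "L2norm (wm ?p (Lc h A j u))" "h * M * (c1 * q)"] by (simp add: power2_sum)
      finally show "(L2norm (Lc h A j (wm ?p u)))^2 \<le> 2 * (L2norm (wm ?p (Lc h A j u)))^2 + 2 * (h * M * (c1 * q))^2" .
    qed (use C in simp)
    also have "\<dots> = 2 * C * S + 2 * C * ?d * M^2 * c1^2 * (h * q)^2"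
      unfolding S_def by (simp add: sum.distrib sum_distrib_left[symmetric] power_mult_distrib algebra_simps)
    finally have "h * (h * q^2) \<le> h * (2 * C * S + 2 * C * ?d * M^2 * c1^2 * (h * q)^2)"
      using h by (intro mult_left_mono) auto
    then have "(h * q)^2 \<le> 2 * C * (h * S) + 2 * C * ?d * M^2 * c1^2 * (h * (h * q)^2)"
      by (simp add: power_mult_distrib power2_eq_square algebra_simps)
    also have "\<dots> \<le> (2 * C + 2 * C * ?d * M^2 * c1^2) * (h * S) + (2 * C + 2 * C * ?d * M^2 * c1^2) * (h * (h * q)^2)"
      using C h S0 by (intro add_mono mult_right_mono) auto
    finally show ?thesis unfolding q_def S_def by (simp only: distrib_left)
  qed
  moreover have "2 * C + 2 * C * ?d * M^2 * c1^2 > 0" using C by (intro add_pos_nonneg) auto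
  ultimately show ?thesis by blast
qed

text \<open>The energy estimate with weight |B|^(s + 1/2), the total exponent 2s + 1 being split as
  s on the operator side and s + 1 on u. The weight commutator appears with a small factor
  \<open>sqrt h\<close>.\<close>

lemma apriori_first_order:
  "\<exists>C>0. \<forall>h u. 0 < h \<longrightarrow> h \<le> 1 \<longrightarrow> test_fun u \<longrightarrow>
     h * (\<Sum>j\<in>UNIV. (L2norm (wm (s + 1/2) (Lc h A j u)))^2) \<le> L2norm (wm s (Lapc h A u)) * (h * L2norm (wm (s + 1) u))
       + C * sqrt h * (h * L2norm (wm (s + 1) u)) * sqrt (h * (\<Sum>j\<in>UNIV. (L2norm (wm (s + 1/2) (Lc h A j u)))^2))"
proof -
  let ?p = "s + 1/2"
  obtain M where M: "M > 0" "\<And>j x. \<bar>pd j (wt ?p) x\<bar> \<le> M * wt ?p x" using dwt_le by blast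
  obtain c1 where c1: "c1 > 0" "\<And>u. L2 (wm (s + 1) u) \<Longrightarrow> L2norm (wm ?p u) \<le> c1 * L2norm (wm (s + 1) u)"
    using L2_wm_le[of ?p "s + 1"] by auto
  let ?d = "real CARD('d)"
  have "h * (\<Sum>j\<in>UNIV. (L2norm (wm ?p (Lc h A j u)))^2) \<le> L2norm (wm s (Lapc h A u)) * (h * L2norm (wm (s + 1) u))
       + (2 * M * ?d * c1) * sqrt h * (h * L2norm (wm (s + 1) u)) * sqrt (h * (\<Sum>j\<in>UNIV. (L2norm (wm ?p (Lc h A j u)))^2))"
    if h: "0 < h" "h \<le> 1" and u: "test_fun u" for h u
  proof -
    define q where "q = L2norm (wm (s + 1) u)"
    define S where "S = (\<Sum>j\<in>UNIV. (L2norm (wm ?p (Lc h A j u)))^2)"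
    have S0: "S \<ge> 0" unfolding S_def by (simp add: sum_nonneg)
    have nS: "L2norm (wm ?p (Lc h A j u)) \<le> sqrt S" for j unfolding S_def by (rule L2norm_sum_sq_bound)
    have q0: "q \<ge> 0" unfolding q_def by simp
    have pq: "L2norm (wm ?p u) \<le> c1 * q" unfolding q_def by (rule c1(2)[OF test_L2[OF test_wm[OF u]]])
    have "S \<le> cmod (ip (wm ?p (Lapc h A u)) (wm ?p u)) + 2 * h * M * (\<Sum>j\<in>UNIV. L2norm (wm ?p (Lc h A j u)) * L2norm (wm ?p u))"
      unfolding S_def wm_def by (rule energy_test[OF smooth_wt wt_pos M(2) less_imp_le[OF h(1)] u])
    also have "ip (wm ?p (Lapc h A u)) (wm ?p u) = ip (wm s (Lapc h A u)) (wm (s + 1) u)"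
    proof (rule ip_shift)
      fix x
      have "wt ?p x * wt ?p x = wt s x * wt (s + 1) x" by (simp add: wt_add add_ac)
      then have "complex_of_real (wt ?p x) * of_real (wt ?p x) = of_real (wt s x) * of_real (wt (s + 1) x)"
        by (simp only: of_real_mult[symmetric])
      then show "wm ?p (Lapc h A u) x * cnj (wm ?p u x) = wm s (Lapc h A u) x * cnj (wm (s + 1) u x)"
        unfolding wm_def by (simp add: mult_ac)
    qed
    also have "cmod \<dots> \<le> L2norm (wm s (Lapc h A u)) * q" unfolding q_def by (intro ip_CS test_L2 test_wm test_Lapc u)
    also have "(\<Sum>j\<in>UNIV. L2norm (wm ?p (Lc h A j u)) * L2norm (wm ?p u)) \<le> (\<Sum>j\<in>(UNIV::'d set). sqrt S * (c1 * q))"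
      by (intro sum_mono mult_mono nS pq) (auto simp: S0)
    finally have "S \<le> L2norm (wm s (Lapc h A u)) * q + 2 * h * M * (?d * (sqrt S * (c1 * q)))"
      using h M by (simp add: mult_left_mono)
    then have "h * S \<le> h * (L2norm (wm s (Lapc h A u)) * q + 2 * h * M * (?d * (sqrt S * (c1 * q))))"
      using h by (intro mult_left_mono) auto
    also have "\<dots> = L2norm (wm s (Lapc h A u)) * (h * q) + (2 * M * ?d * c1) * sqrt h * (h * q) * sqrt (h * S)"
    proof -
      have "h = sqrt h * sqrt h" using h by simp
      then have "sqrt h * sqrt (h * S) = h * sqrt S" by (simp add: real_sqrt_mult)
      then show ?thesis by (simp add: algebra_simps)
    qed
    finally show ?thesis unfolding q_def S_def .
  qed
  moreover have "2 * M * ?d * c1 > 0" using M c1 by simp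
  ultimately show ?thesis by blast
qed

text \<open>The two preceding bounds close on each other: the zero order one gives a \<le> D b after
  absorption, and the first order one then becomes a quadratic inequality for b alone.\<close>

lemma apriori_12:
  "\<exists>C>0. \<exists>h0>0. \<forall>h u. 0 < h \<longrightarrow> h < h0 \<longrightarrow> test_fun u \<longrightarrow>
     h * L2norm (wm (s + 1) u) \<le> C * L2norm (wm s (Lapc h A u)) \<and>
     sqrt (h * (\<Sum>j\<in>UNIV. (L2norm (wm (s + 1/2) (Lc h A j u)))^2)) \<le> C * L2norm (wm s (Lapc h A u))"
proof -
  obtain C1 where C1: "C1 > 0" "\<And>h u. 0 < h \<Longrightarrow> h \<le> 1 \<Longrightarrow> test_fun u \<Longrightarrow>
     (h * L2norm (wm (s + 1) u))^2 \<le> C1 * (h * (\<Sum>j\<in>UNIV. (L2norm (wm (s + 1/2) (Lc h A j u)))^2) + h * (h * L2norm (wm (s + 1) u))^2)"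
    using apriori_zero_order[of s] by blast
  obtain C2 where C2: "C2 > 0" "\<And>h u. 0 < h \<Longrightarrow> h \<le> 1 \<Longrightarrow> test_fun u \<Longrightarrow>
     h * (\<Sum>j\<in>UNIV. (L2norm (wm (s + 1/2) (Lc h A j u)))^2) \<le> L2norm (wm s (Lapc h A u)) * (h * L2norm (wm (s + 1) u))
       + C2 * sqrt h * (h * L2norm (wm (s + 1) u)) * sqrt (h * (\<Sum>j\<in>UNIV. (L2norm (wm (s + 1/2) (Lc h A j u)))^2))"
    using apriori_first_order[of s] by blast
  define D where "D = sqrt (2 * C1)"
  have D: "D > 0" "D^2 = 2 * C1" unfolding D_def using C1 by auto
  \<comment> \<open>The second entry gives C1 h \<le> 1/2, for the absorption in the bound of a; the
    third gives C2 D sqrt h \<le> 1/2, for the absorption in the bound of b.\<close>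
  define h0 where "h0 = min 1 (min (1 / (2 * C1)) ((1 / (2 * C2 * D))^2))"
  have h0: "h0 > 0" unfolding h0_def using C1 C2 D by simp
  have "h * L2norm (wm (s + 1) u) \<le> (2 * D^2 + 2 * D) * L2norm (wm s (Lapc h A u)) \<and>
     sqrt (h * (\<Sum>j\<in>UNIV. (L2norm (wm (s + 1/2) (Lc h A j u)))^2)) \<le> (2 * D^2 + 2 * D) * L2norm (wm s (Lapc h A u))"
    if h: "0 < h" "h < h0" and u: "test_fun u" for h u
  proof -
    define a where "a = h * L2norm (wm (s + 1) u)"
    define b where "b = sqrt (h * (\<Sum>j\<in>UNIV. (L2norm (wm (s + 1/2) (Lc h A j u)))^2))"
    define F where "F = L2norm (wm s (Lapc h A u))"
    have b2: "b^2 = h * (\<Sum>j\<in>UNIV. (L2norm (wm (s + 1/2) (Lc h A j u)))^2)"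
      unfolding b_def using h by (simp add: sum_nonneg)
    have nn: "a \<ge> 0" "b \<ge> 0" "F \<ge> 0" unfolding a_def b_def F_def using h by (auto simp: sum_nonneg)
    have h1: "h \<le> 1" "h \<le> 1 / (2 * C1)" "h \<le> (1 / (2 * C2 * D))^2" using h unfolding h0_def by auto
    have i1: "a^2 \<le> C1 * (b^2 + h * a^2)" using C1(2)[OF h(1) h1(1) u] unfolding a_def b2 .
    have i2: "b^2 \<le> F * a + C2 * sqrt h * a * b" using C2(2)[OF h(1) h1(1) u] nn(2) unfolding a_def[symmetric] F_def[symmetric] b2[symmetric] by simp
    have "C1 * h \<le> 1 / 2" using h1(2) C1 by (simp add: field_simps)
    then have "C1 * h * a^2 \<le> 1 / 2 * a^2" by (intro mult_right_mono) auto
    then have "a^2 \<le> (D * b)^2" using i1 unfolding power_mult_distrib D(2) by (simp add: algebra_simps)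
    then have aD: "a \<le> D * b" by (rule power2_le_imp_le) (use D nn in simp)
    have "sqrt h \<le> 1 / (2 * C2 * D)" using h1(3) C2 D by (intro real_le_lsqrt) auto
    then have sh: "C2 * sqrt h * D \<le> 1 / 2" using C2 D by (simp add: field_simps)
    have "b^2 \<le> F * (D * b) + C2 * sqrt h * (D * b) * b"
      by (rule order_trans[OF i2]) (intro add_mono mult_left_mono mult_right_mono aD; use nn C2(1) h C1(1) in simp)
    also have "C2 * sqrt h * (D * b) * b = (C2 * sqrt h * D) * (b * b)" by simp
    also have "\<dots> \<le> 1 / 2 * (b * b)" using sh by (intro mult_right_mono) auto
    finally have "b^2 \<le> (2 * D * F) * b + 0^2" by (simp add: power2_eq_square algebra_simps)
    from quadratic_absorb[OF this] have bF: "b \<le> 2 * D * F" using D(1) nn by simp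
    have "a \<le> D * (2 * D * F)" by (rule order_trans[OF aD]) (use bF D in \<open>simp add: mult_left_mono\<close>)
    then have "a \<le> 2 * D^2 * F" by (simp add: power2_eq_square)
    moreover have "2 * D^2 * F \<le> (2 * D^2 + 2 * D) * F" "2 * D * F \<le> (2 * D^2 + 2 * D) * F" using nn D(1) by (intro mult_right_mono; simp)+
    ultimately show ?thesis using bF unfolding a_def[symmetric] b_def[symmetric] F_def[symmetric] by linarith
  qed
  moreover have "2 * D^2 + 2 * D > 0" using D(1) by (intro add_pos_pos) auto
  ultimately show ?thesis using h0 by blast
qed

end

context nondegenerate_magnetic begin

text \<open>The energy estimate for L_k u. In the main term L_k is moved to the other factor, so
  only the operator applied to u enters and not its derivative; the rest are commutators with one
  factor B or one derivative of B. Naming the four norms by equations keeps the quadratic inequality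
  in c visible.\<close>

lemma apriori_second_order:
  "\<exists>C>0. \<forall>h u F a b c. 0 < h \<longrightarrow> h \<le> 1 \<longrightarrow> test_fun u \<longrightarrow> F = L2norm (wm s (Lapc h A u)) \<longrightarrow> a = h * L2norm (wm (s + 1) u) \<longrightarrow>
     b = sqrt (h * (\<Sum>j\<in>UNIV. (L2norm (wm (s + 1/2) (Lc h A j u)))^2)) \<longrightarrow>
     c = sqrt (\<Sum>k\<in>UNIV. \<Sum>j\<in>UNIV. (L2norm (wm s (Lc h A j (Lc h A k u))))^2) \<longrightarrow>
     c^2 \<le> C * (F * c + F * b + b^2 + a * b + b * c)"
proof -
  let ?p = "s + 1/2"
  obtain M where M: "M > 0" "\<And>j x. \<bar>pd j (wt s) x\<bar> \<le> M * wt s x" using dwt_le by blast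
  obtain C where C: "C > 0" "\<And>l j k x. \<bar>pd l (B j k) x\<bar> \<le> C * wt 1 x" using dB_le by blast
  obtain c1 where c1: "c1 > 0" "\<And>u. L2 (wm ?p u) \<Longrightarrow> L2norm (wm s u) \<le> c1 * L2norm (wm ?p u)"
    using L2_wm_le[of s ?p] by auto
  let ?d = "real CARD('d)"
  define K where "K = ?d * (1 + 2 * M * c1 + 2 * ?d + ?d * C * c1 + 2 * M * ?d * c1)"
  have "c^2 \<le> K * (F * c + F * b + b^2 + a * b + b * c)"
    if h: "0 < h" "h \<le> 1" and u: "test_fun u" and F: "F = L2norm (wm s (Lapc h A u))" and a: "a = h * L2norm (wm (s + 1) u)"
      and b: "b = sqrt (h * (\<Sum>j\<in>UNIV. (L2norm (wm ?p (Lc h A j u)))^2))"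
      and c: "c = sqrt (\<Sum>k\<in>UNIV. \<Sum>j\<in>UNIV. (L2norm (wm s (Lc h A j (Lc h A k u))))^2)" for h u F a b c
  proof -
    note su = test_smooth[OF u]
    have nn: "F \<ge> 0" "a \<ge> 0" "b \<ge> 0" "c \<ge> 0" unfolding F a b c using h by (auto simp: sum_nonneg)
    have b2: "b^2 = h * (\<Sum>j\<in>UNIV. (L2norm (wm ?p (Lc h A j u)))^2)" unfolding b using h by (simp add: sum_nonneg)
    have c2: "c^2 = (\<Sum>k\<in>UNIV. \<Sum>j\<in>UNIV. (L2norm (wm s (Lc h A j (Lc h A k u))))^2)" unfolding c by (simp add: sum_nonneg)
    have njk: "L2norm (wm s (Lc h A j (Lc h A k u))) \<le> c" for j k
    proof (rule power2_le_imp_le[OF _ nn(4)])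
      have "(L2norm (wm s (Lc h A j (Lc h A k u))))^2 \<le> (\<Sum>j\<in>UNIV. (L2norm (wm s (Lc h A j (Lc h A k u))))^2)"
        by (rule member_le_sum) auto
      also have "\<dots> \<le> c^2" unfolding c2 by (rule member_le_sum) (auto intro: sum_nonneg)
      finally show "(L2norm (wm s (Lc h A j (Lc h A k u))))^2 \<le> c^2" .
    qed
    have pb: "sqrt h * L2norm (wm ?p (Lc h A j u)) \<le> b" for j
    proof (rule power2_le_imp_le[OF _ nn(3)])
      have "(L2norm (wm ?p (Lc h A j u)))^2 \<le> (\<Sum>j\<in>UNIV. (L2norm (wm ?p (Lc h A j u)))^2)" by (rule member_le_sum) auto
      then show "(sqrt h * L2norm (wm ?p (Lc h A j u)))^2 \<le> b^2" unfolding b2 power_mult_distrib using h by (simp add: mult_left_mono)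
    qed
    \<comment> \<open>Derivatives falling on the weight come with a full h. One
      \<open>sqrt h\<close> together with the missing half power of |B| gives b; the other is
      bounded by 1.\<close>
    have hg: "h * L2norm (wm s (Lc h A k u)) \<le> c1 * b" for k
    proof -
      have "h * L2norm (wm s (Lc h A k u)) \<le> h * (c1 * L2norm (wm ?p (Lc h A k u)))"
        using h c1(2)[OF test_L2[OF test_wm[OF test_Lc[OF u]]]] by (intro mult_left_mono) auto
      also have "\<dots> = sqrt h * (c1 * (sqrt h * L2norm (wm ?p (Lc h A k u))))" using h by (simp add: algebra_simps flip: power2_eq_square)
      also have "\<dots> \<le> 1 * (c1 * b)" using h c1 pb nn by (intro mult_mono mult_left_mono) auto
      finally show ?thesis by simp
    qed
    have k: "(\<Sum>j\<in>UNIV. (L2norm (wm s (Lc h A j (Lc h A k u))))^2) \<le> F * c + 2 * M * c1 * (F * b) + ?d * (2 * b^2 + C * c1 * (a * b)) + 2 * M * ?d * c1 * (b * c)" for k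
    proof -
      define \<phi> where "\<phi> = Lc h A k u"
      define v where "v = Lapc h A u"
      have t\<phi>: "test_fun \<phi>" and tv: "test_fun v" unfolding \<phi>_def v_def by (intro test_Lc test_Lapc u)+
      define T1 where "T1 j x = 2 * \<i> * of_real h * of_real (B j k x) * Lc h A j u x" for j x
      define T2 where "T2 j x = (of_real h)^2 * of_real (pd j (B j k) x) * u x" for j x
      have tT: "test_fun (T1 j)" "test_fun (T2 j)" for j
        unfolding T1_def T2_def by (intro test_mult smooth_mult smooth_const smooth_of_real smoothB smooth_pd test_Lc u smooth_power)+
      have E: "wm s (Lapc h A \<phi>) = (\<lambda>x. wm s (Lc h A k v) x + (\<Sum>j\<in>UNIV. wm s (T1 j) x + wm s (T2 j) x))"
        unfolding wm_def \<phi>_def v_def T1_def T2_def fun_eq_iff Lapc_Lc_comm[OF su]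
        by (simp add: distrib_left sum_distrib_left)
      have I0: "cmod (ip (wm s (Lc h A k v)) (wm s \<phi>)) \<le> F * c + 2 * M * c1 * (F * b)"
      proof -
        have sPP: "smooth (\<lambda>x. complex_of_real (wt s x) * complex_of_real (wt s x))" by (intro smooth_mult smooth_cwt)
        let ?a = "\<lambda>x. complex_of_real (wt s x) * complex_of_real (wt s x) * Lc h A k \<phi> x"
        let ?b = "\<lambda>x. \<i> * of_real h * (2 * (of_real (wt s x) * of_real (pd k (wt s) x))) * \<phi> x"
        have tt: "test_fun ?a" "test_fun ?b"
          by (intro test_mult test_Lc t\<phi> smooth_mult smooth_const smooth_of_real smooth_wt smooth_pd)+
        have "ip (wm s (Lc h A k v)) (wm s \<phi>) = ip (Lc h A k v) (\<lambda>x. complex_of_real (wt s x) * complex_of_real (wt s x) * \<phi> x)"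
          unfolding wm_def by (rule ip_shift) (simp add: mult_ac)
        also have "\<dots> = ip v (Lc h A k (\<lambda>x. complex_of_real (wt s x) * complex_of_real (wt s x) * \<phi> x))"
          by (rule Lc_sym[OF tv test_mult[OF sPP t\<phi>]])
        also have "Lc h A k (\<lambda>x. complex_of_real (wt s x) * complex_of_real (wt s x) * \<phi> x) = (\<lambda>x. ?a x - ?b x)"
          unfolding fun_eq_iff Lc_mult[OF sPP test_smooth[OF t\<phi>]]
          by (simp add: pd_mult[OF smooth_cwt smooth_cwt] pd_of_real[OF smooth_wt])
        also have "ip v \<dots> = ip v ?a - ip v ?b" by (intro ip_diff_right test_L2 tt tv)
        finally have "cmod (ip (wm s (Lc h A k v)) (wm s \<phi>)) \<le> cmod (ip v ?a) + cmod (ip v ?b)"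
          by (simp add: norm_triangle_ineq4)
        also have "ip v ?a = ip (wm s v) (wm s (Lc h A k \<phi>))" unfolding wm_def by (rule ip_shift) (simp add: mult_ac)
        also have "cmod \<dots> \<le> F * c"
          unfolding F v_def[symmetric]
          by (rule order_trans[OF ip_CS mult_left_mono]) (auto intro!: test_L2 test_wm test_Lc tv t\<phi> simp: \<phi>_def njk u)
        also have "cmod (ip v ?b) \<le> (h * (2 * M)) * (L2norm (wm s v) * L2norm (wm s \<phi>))"
        proof (rule ip_bound)
          fix x
          have "h * (2 * (wt s x * \<bar>pd k (wt s) x\<bar>)) * (cmod (v x) * cmod (\<phi> x)) \<le> h * (2 * (wt s x * (M * wt s x))) * (cmod (v x) * cmod (\<phi> x))"
            using h wt_pos[of s x] M(2)[of k x] by (intro mult_right_mono mult_left_mono) auto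
          then show "cmod (v x) * cmod (?b x) \<le> (h * (2 * M)) * (cmod (wm s v x) * cmod (wm s \<phi> x))"
            unfolding cmod_wm using h wt_pos[of s x] by (simp add: norm_mult mult_ac)
        qed (use h M in \<open>auto intro!: test_L2 test_wm tv t\<phi>\<close>)
        also have "\<dots> = 2 * M * F * (h * L2norm (wm s \<phi>))" unfolding F v_def by simp
        also have "\<dots> \<le> 2 * M * F * (c1 * b)" using hg[of k] M nn unfolding \<phi>_def by (intro mult_left_mono) auto
        finally show ?thesis by (simp add: mult_ac)
      qed
      \<comment> \<open>The factor h|B| from the commutator is split evenly: each first derivative
        receives its square root, which is exactly the weight in b.\<close>
      have I1: "cmod (ip (wm s (T1 j)) (wm s \<phi>)) \<le> 2 * b^2" for j
      proof -
        have "cmod (ip (wm s (T1 j)) (wm s \<phi>)) \<le> 2 * h * (L2norm (wm ?p (Lc h A j u)) * L2norm (wm ?p \<phi>))"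
        proof (rule ip_bound)
          fix x
          have w: "wt ?p x * wt ?p x = wt s x * wt s x * wt 1 x" by (simp add: wt_add add_ac)
          have "2 * h * (wt s x * wt s x * \<bar>B j k x\<bar>) * (cmod (Lc h A j u x) * cmod (\<phi> x)) \<le> 2 * h * (wt s x * wt s x * wt 1 x) * (cmod (Lc h A j u x) * cmod (\<phi> x))"
            using h wt_pos[of s x] B_le_wt[of j k x] by (intro mult_right_mono mult_left_mono) auto
          then show "cmod (wm s (T1 j) x) * cmod (wm s \<phi> x) \<le> 2 * h * (cmod (wm ?p (Lc h A j u) x) * cmod (wm ?p \<phi> x))"
            unfolding cmod_wm T1_def w[symmetric] using h by (simp add: norm_mult mult_ac)
        qed (use h in \<open>auto intro!: test_L2 test_wm test_Lc u t\<phi>\<close>)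
        also have "\<dots> = 2 * ((sqrt h * L2norm (wm ?p (Lc h A j u))) * (sqrt h * L2norm (wm ?p \<phi>)))"
        proof -
          have e: "(sqrt h * x) * (sqrt h * y) = (sqrt h * sqrt h) * (x * y)" for x y by (simp only: mult_ac)
          show ?thesis unfolding e using h by simp
        qed
        also have "\<dots> \<le> 2 * (b * b)" using pb nn h unfolding \<phi>_def by (intro mult_left_mono mult_mono) auto
        finally show ?thesis by (simp add: power2_eq_square)
      qed
      \<comment> \<open>Here |B| comes from a derivative of the field and is given entirely to u;
        one h forms a, the other goes to \<open>hg\<close>.\<close>
      have I2: "cmod (ip (wm s (T2 j)) (wm s \<phi>)) \<le> C * c1 * (a * b)" for j
      proof -
        have "cmod (ip (wm s (T2 j)) (wm s \<phi>)) \<le> (C * h^2) * (L2norm (wm (s + 1) u) * L2norm (wm s \<phi>))"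
        proof (rule ip_bound)
          fix x
          have w: "wt (s + 1) x = wt s x * wt 1 x" by (simp add: wt_add)
          have "h^2 * wt s x * \<bar>pd j (B j k) x\<bar> * (cmod (u x) * (wt s x * cmod (\<phi> x))) \<le> h^2 * wt s x * (C * wt 1 x) * (cmod (u x) * (wt s x * cmod (\<phi> x)))"
            using h wt_pos[of s x] C(2)[of j j k x] by (intro mult_right_mono mult_left_mono) auto
          then show "cmod (wm s (T2 j) x) * cmod (wm s \<phi> x) \<le> (C * h^2) * (cmod (wm (s + 1) u x) * cmod (wm s \<phi> x))"
            unfolding cmod_wm T2_def w by (simp add: norm_mult norm_power mult_ac)
        qed (use h C in \<open>auto intro!: test_L2 test_wm u t\<phi>\<close>)
        also have "\<dots> = C * (a * (h * L2norm (wm s \<phi>)))" unfolding a by (simp add: power2_eq_square)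
        also have "\<dots> \<le> C * (a * (c1 * b))" using hg[of k] C nn unfolding \<phi>_def by (intro mult_left_mono) auto
        finally show ?thesis by (simp add: mult_ac)
      qed
      have LL: "L2 (wm s (Lc h A k v))" "L2 (wm s (T1 j))" "L2 (wm s (T2 j))" "L2 (wm s \<phi>)" for j
        by (intro test_L2 test_wm test_Lc tv tT t\<phi>)+
      have "ip (wm s (Lapc h A \<phi>)) (wm s \<phi>) = ip (wm s (Lc h A k v)) (wm s \<phi>) + (\<Sum>j\<in>UNIV. ip (wm s (T1 j)) (wm s \<phi>) + ip (wm s (T2 j)) (wm s \<phi>))"
        unfolding E ip_add_left[OF LL(1) L2_sum[OF L2_add[OF LL(2,3)]] LL(4)] ip_sum_left[OF L2_add[OF LL(2,3)] LL(4)]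
          ip_add_left[OF LL(2,3,4)] ..
      then have "cmod (ip (wm s (Lapc h A \<phi>)) (wm s \<phi>)) \<le> cmod (ip (wm s (Lc h A k v)) (wm s \<phi>)) + (\<Sum>j\<in>UNIV. cmod (ip (wm s (T1 j)) (wm s \<phi>)) + cmod (ip (wm s (T2 j)) (wm s \<phi>)))"
        by (auto intro!: order_trans[OF norm_triangle_ineq] order_trans[OF norm_sum] sum_mono)
      also have "\<dots> \<le> (F * c + 2 * M * c1 * (F * b)) + (\<Sum>j\<in>(UNIV::'d set). 2 * b^2 + C * c1 * (a * b))"
        by (intro add_mono sum_mono I0 I1 I2)
      finally have J: "cmod (ip (wm s (Lapc h A \<phi>)) (wm s \<phi>)) \<le> F * c + 2 * M * c1 * (F * b) + ?d * (2 * b^2 + C * c1 * (a * b))" by simp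
      have "(\<Sum>j\<in>UNIV. (L2norm (wm s (Lc h A j \<phi>)))^2) \<le> cmod (ip (wm s (Lapc h A \<phi>)) (wm s \<phi>))
          + 2 * h * M * (\<Sum>j\<in>UNIV. L2norm (wm s (Lc h A j \<phi>)) * L2norm (wm s \<phi>))"
        unfolding wm_def by (rule energy_test[OF smooth_wt wt_pos M(2) less_imp_le[OF h(1)] t\<phi>])
      also have "2 * h * M * (\<Sum>j\<in>UNIV. L2norm (wm s (Lc h A j \<phi>)) * L2norm (wm s \<phi>)) \<le> 2 * h * M * (\<Sum>j\<in>(UNIV::'d set). c * L2norm (wm s \<phi>))"
        using h M njk unfolding \<phi>_def by (intro mult_left_mono sum_mono mult_right_mono) auto
      also have "\<dots> = 2 * M * ?d * c * (h * L2norm (wm s \<phi>))" by simp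
      also have "\<dots> \<le> 2 * M * ?d * c * (c1 * b)" using hg[of k] M nn unfolding \<phi>_def by (intro mult_left_mono) auto
      finally show ?thesis using J unfolding \<phi>_def by (simp add: mult_ac)
    qed
    have "c^2 \<le> (\<Sum>k\<in>(UNIV::'d set). F * c + 2 * M * c1 * (F * b) + ?d * (2 * b^2 + C * c1 * (a * b)) + 2 * M * ?d * c1 * (b * c))"
      unfolding c2 by (intro sum_mono k)
    also have "\<dots> = ?d * (1 * (F * c) + 2 * M * c1 * (F * b) + 2 * ?d * b^2 + ?d * C * c1 * (a * b) + 2 * M * ?d * c1 * (b * c))"
      by (simp add: algebra_simps)
    also have "\<dots> \<le> ?d * ((1 + 2 * M * c1 + 2 * ?d + ?d * C * c1 + 2 * M * ?d * c1) * (F * c + F * b + b^2 + a * b + b * c))"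
    proof (rule mult_left_mono)
      let ?T = "1 + 2 * M * c1 + 2 * ?d + ?d * C * c1 + 2 * M * ?d * c1"
      have pos: "2 * M * c1 \<ge> 0" "?d * C * c1 \<ge> 0" "2 * M * ?d * c1 \<ge> 0" using M C c1 by auto
      have "1 * (F * c) + 2 * M * c1 * (F * b) + 2 * ?d * b^2 + ?d * C * c1 * (a * b) + 2 * M * ?d * c1 * (b * c)
         \<le> ?T * (F * c) + ?T * (F * b) + ?T * b^2 + ?T * (a * b) + ?T * (b * c)"
        using pos nn by (intro add_mono mult_right_mono) auto
      then show "1 * (F * c) + 2 * M * c1 * (F * b) + 2 * ?d * b^2 + ?d * C * c1 * (a * b) + 2 * M * ?d * c1 * (b * c) \<le> ?T * (F * c + F * b + b^2 + a * b + b * c)"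
        by (simp only: distrib_left)
    qed simp
    finally show ?thesis unfolding K_def by (simp only: mult.assoc)
  qed
  moreover have "K > 0" unfolding K_def using M C c1 by (intro mult_pos_pos add_pos_nonneg) auto
  ultimately show ?thesis by blast
qed

lemma apriori:
  "\<exists>C>0. \<exists>h0>0. \<forall>h u. 0 < h \<longrightarrow> h < h0 \<longrightarrow> test_fun u \<longrightarrow>
     h * L2norm (wm (s + 1) u) \<le> C * L2norm (wm s (Lapc h A u)) \<and>
     (\<forall>j. sqrt h * L2norm (wm (s + 1/2) (Lc h A j u)) \<le> C * L2norm (wm s (Lapc h A u))) \<and>
     (\<forall>j k. L2norm (wm s (Lc h A j (Lc h A k u))) \<le> C * L2norm (wm s (Lapc h A u)))"
proof -
  obtain D h0 where D: "D > 0" and h0: "h0 > 0" and D12: "\<And>h u. 0 < h \<Longrightarrow> h < h0 \<Longrightarrow> test_fun u \<Longrightarrow>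
     h * L2norm (wm (s + 1) u) \<le> D * L2norm (wm s (Lapc h A u)) \<and>
     sqrt (h * (\<Sum>j\<in>UNIV. (L2norm (wm (s + 1/2) (Lc h A j u)))^2)) \<le> D * L2norm (wm s (Lapc h A u))"
    using apriori_12[of s] by blast
  obtain C where C: "C > 0" "\<And>h u F a b c. 0 < h \<Longrightarrow> h \<le> 1 \<Longrightarrow> test_fun u \<Longrightarrow> F = L2norm (wm s (Lapc h A u)) \<Longrightarrow> a = h * L2norm (wm (s + 1) u) \<Longrightarrow>
     b = sqrt (h * (\<Sum>j\<in>UNIV. (L2norm (wm (s + 1/2) (Lc h A j u)))^2)) \<Longrightarrow>
     c = sqrt (\<Sum>k\<in>UNIV. \<Sum>j\<in>UNIV. (L2norm (wm s (Lc h A j (Lc h A k u))))^2) \<Longrightarrow>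
     c^2 \<le> C * (F * c + F * b + b^2 + a * b + b * c)" using apriori_second_order[of s] by blast
  \<comment> \<open>With a and b at most D F, the terms free of c contribute D from F b and the
    square of D from each of b^2 and a b.\<close>
  define q where "q = sqrt (C * (D + 2 * D^2))"
  define E where "E = D + (C * (1 + D) + q)"
  have q: "q \<ge> 0" "q^2 = C * (D + 2 * D^2)" unfolding q_def using C D by auto
  have E: "E \<ge> D" "E \<ge> C * (1 + D) + q" "E > 0" unfolding E_def using C D q by (auto intro!: add_pos_nonneg)
  have "h * L2norm (wm (s + 1) u) \<le> E * L2norm (wm s (Lapc h A u)) \<and>
     (\<forall>j. sqrt h * L2norm (wm (s + 1/2) (Lc h A j u)) \<le> E * L2norm (wm s (Lapc h A u))) \<and>
     (\<forall>j k. L2norm (wm s (Lc h A j (Lc h A k u))) \<le> E * L2norm (wm s (Lapc h A u)))"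
    if h: "0 < h" "h < min 1 h0" and u: "test_fun u" for h u
  proof -
    define F where "F = L2norm (wm s (Lapc h A u))"
    define a where "a = h * L2norm (wm (s + 1) u)"
    define b where "b = sqrt (h * (\<Sum>j\<in>UNIV. (L2norm (wm (s + 1/2) (Lc h A j u)))^2))"
    define c where "c = sqrt (\<Sum>k\<in>UNIV. \<Sum>j\<in>UNIV. (L2norm (wm s (Lc h A j (Lc h A k u))))^2)"
    have nn: "F \<ge> 0" "a \<ge> 0" "b \<ge> 0" "c \<ge> 0" unfolding F_def a_def b_def c_def using h by (auto simp: sum_nonneg)
    have ab: "a \<le> D * F" "b \<le> D * F" using D12[OF h(1) _ u] h(2) unfolding a_def b_def F_def by auto
    have "c^2 \<le> C * (F * c + F * b + b^2 + a * b + b * c)" by (rule C(2)[OF h(1) _ u F_def a_def b_def c_def]) (use h in simp)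
    also have "\<dots> \<le> C * (F * c + F * (D * F) + (D * F)^2 + (D * F) * (D * F) + (D * F) * c)"
      using C(1) nn D ab by (intro mult_left_mono add_mono mult_mono power_mono order_refl) auto
    also have "\<dots> = (C * (1 + D) * F) * c + (q * F)^2" unfolding power_mult_distrib q(2) by (simp add: algebra_simps power2_eq_square)
    finally have cF: "c \<le> C * (1 + D) * F + q * F" 
      using quadratic_absorb[of c "C * (1 + D) * F" "q * F"] C(1) D nn q(1) by simp
    have le: "D * F \<le> E * F" "(C * (1 + D) + q) * F \<le> E * F" using E nn by (auto intro!: mult_right_mono)
    have "sqrt h * L2norm (wm (s + 1/2) (Lc h A j u)) \<le> b" for j
      unfolding b_def real_sqrt_mult using h by (intro mult_left_mono L2norm_sum_sq_bound) auto
    moreover have "L2norm (wm s (Lc h A j (Lc h A k u))) \<le> c" for j k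
    proof (rule power2_le_imp_le[OF _ nn(4)])
      have "(L2norm (wm s (Lc h A j (Lc h A k u))))^2 \<le> (\<Sum>j\<in>UNIV. (L2norm (wm s (Lc h A j (Lc h A k u))))^2)"
        by (rule member_le_sum) auto
      also have "\<dots> \<le> (\<Sum>k\<in>UNIV. \<Sum>j\<in>UNIV. (L2norm (wm s (Lc h A j (Lc h A k u))))^2)"
        by (rule member_le_sum) (auto intro: sum_nonneg)
      finally show "(L2norm (wm s (Lc h A j (Lc h A k u))))^2 \<le> c^2" unfolding c_def by (simp add: sum_nonneg)
    qed
    ultimately show ?thesis using ab le cF unfolding a_def[symmetric] F_def[symmetric] distrib_right
      by (intro conjI allI) (blast intro: order_trans)+
  qed
  moreover have "min 1 h0 > 0" using h0 by simp
  ultimately show ?thesis using E(3) by blast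
qed

section \<open>From test functions to weak solutions\<close>

lemma L2lim_wm:
  assumes "L2lim (\<lambda>m. wm t (F m)) (wm t f)" "s \<le> t"
  shows "L2lim (\<lambda>m. wm s (F m)) (wm s f)"
proof -
  obtain C where C: "C > 0" "\<And>u. L2 (wm t u) \<Longrightarrow> L2 (wm s u) \<and> L2norm (wm s u) \<le> C * L2norm (wm t u)"
    using L2_wm_le[OF assms(2)] by blast
  have e: "(\<lambda>x. wm r (F m) x - wm r f x) = wm r (\<lambda>x. F m x - f x)" for r m unfolding wm_def by (simp add: right_diff_distrib)
  note l = L2limD(1)[OF assms(1)] L2limD(2)[OF assms(1)]
  show ?thesis
  proof (rule L2limI)
    show "L2 (wm s (F m))" for m using C(2)[OF l(1)] by blast
    show "L2 (wm s f)" using C(2)[OF l(2)] by blast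
    show "L2norm (\<lambda>x. wm s (F m) x - wm s f x) \<le> C * L2norm (\<lambda>x. wm t (F m) x - wm t f x)" for m
      using L2_diff[OF l] C(2) unfolding e by blast
    show "(\<lambda>m. C * L2norm (\<lambda>x. wm t (F m) x - wm t f x)) \<longlonglongrightarrow> 0"
      using tendsto_mult_left[OF L2limD(3)[OF assms(1)], of C] by simp
  qed
qed

lemma weak_L_lim:
  assumes t: "\<And>m. test_fun (\<phi> m)" and "L2lim \<phi> u" "L2lim (\<lambda>m. Lc h A j (\<phi> m)) g"
  shows "weak_L h A j u g"
  unfolding weak_L_ip
proof (intro allI impI)
  fix \<psi> :: "real^'d \<Rightarrow> complex" assume \<psi>: "test_fun \<psi>"
  have "(\<lambda>m. ip (\<phi> m) (Lc h A j \<psi>)) \<longlonglongrightarrow> ip u (Lc h A j \<psi>)" by (intro L2lim_ip assms L2lim_const test_L2 test_Lc \<psi>)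
  moreover have "(\<lambda>m. ip (Lc h A j (\<phi> m)) \<psi>) \<longlonglongrightarrow> ip g \<psi>" by (intro L2lim_ip assms L2lim_const test_L2 \<psi>)
  ultimately show "ip u (Lc h A j \<psi>) = ip g \<psi>" using Lc_sym[OF t \<psi>] LIMSEQ_unique by simp
qed

text \<open>A gain of regularity: weight s on u and on the right-hand side suffices to conclude
  weight s + 1 on u. The density theorem supplies approximants, and linearity turns the estimates
  into Cauchy bounds.\<close>

lemma weak_apriori:
  assumes s: "s \<ge> 0"
  shows "\<exists>C>0. \<exists>h0>0. \<forall>h u f. 0 < h \<longrightarrow> h < h0 \<longrightarrow> L2 (wm s u) \<longrightarrow> L2 (wm s f) \<longrightarrow> weak_Lap h A u f \<longrightarrow>
     L2 (wm (s + 1) u) \<and> h * L2norm (wm (s + 1) u) \<le> C * L2norm (wm s f) \<and>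
     (\<exists>G1 G2. (\<forall>j. weak_L h A j u (G1 j) \<and> L2 (wm (s + 1/2) (G1 j)) \<and> sqrt h * L2norm (wm (s + 1/2) (G1 j)) \<le> C * L2norm (wm s f)) \<and>
       (\<forall>j k. weak_L h A j (G1 k) (G2 j k) \<and> L2 (wm s (G2 j k)) \<and> L2norm (wm s (G2 j k)) \<le> C * L2norm (wm s f)))"
proof -
  obtain C h0 where C: "C > 0" "h0 > 0" and ap: "\<And>h u. 0 < h \<Longrightarrow> h < h0 \<Longrightarrow> test_fun u \<Longrightarrow>
     h * L2norm (wm (s + 1) u) \<le> C * L2norm (wm s (Lapc h A u)) \<and>
     (\<forall>j. sqrt h * L2norm (wm (s + 1/2) (Lc h A j u)) \<le> C * L2norm (wm s (Lapc h A u))) \<and>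
     (\<forall>j k. L2norm (wm s (Lc h A j (Lc h A k u))) \<le> C * L2norm (wm s (Lapc h A u)))" using apriori[of s] by blast
  obtain M where M: "M > 0" "\<And>j x. \<bar>pd j (wt s) x\<bar> \<le> M * wt s x" using dwt_le by blast
  show ?thesis
  proof (rule exI[of _ C], intro conjI C(1), rule exI[of _ h0], intro conjI C(2) allI impI)
    fix h u f assume h: "0 < h" "h < h0" and pu: "L2 (wm s u)" and pf: "L2 (wm s f)" and w: "weak_Lap h A u f"
    have L0: "L2 u" if "L2 (wm t u)" "t \<ge> 0" for t u using L2_wm_le[OF that(2)] that(1) unfolding wm_0 by blast
    obtain \<phi> where t: "\<And>m. test_fun (\<phi> m)" and lu: "L2lim (\<lambda>m. wm s (\<phi> m)) (wm s u)" and lf: "L2lim (\<lambda>m. wm s (Lapc h A (\<phi> m))) (wm s f)"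
      using graph_approx[OF smooth_wt wt_pos M(2) h(1) L0[OF pu s] L0[OF pf s] w pu[unfolded wm_def] pf[unfolded wm_def]]
      unfolding wm_def by blast
    define F where "F = L2norm (wm s f)"
    \<comment> \<open>One argument for all three estimates: T is any operator, linear for
      differences, that is controlled by the weighted norm of the equation; applied to differences
      of approximants the control yields convergence.\<close>
    have lim: "\<exists>Y. L2lim (\<lambda>m. T (\<phi> m)) Y \<and> r * L2norm Y \<le> C * F"
      if r: "r > 0" and T: "\<And>\<psi>. test_fun \<psi> \<Longrightarrow> L2 (T \<psi>)" and Td: "\<And>\<psi> \<theta>. test_fun \<psi> \<Longrightarrow> test_fun \<theta> \<Longrightarrow> T (\<lambda>x. \<psi> x - \<theta> x) = (\<lambda>x. T \<psi> x - T \<theta> x)"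
        and Tb: "\<And>\<psi>. test_fun \<psi> \<Longrightarrow> r * L2norm (T \<psi>) \<le> C * L2norm (wm s (Lapc h A \<psi>))" for r T
    proof -
      define d where "d m = (C / r) * L2norm (\<lambda>x. wm s (Lapc h A (\<phi> m)) x - wm s f x)" for m
      have dd: "L2norm (\<lambda>x. T (\<phi> m) x - T (\<phi> k) x) \<le> d m + d k" for m k
      proof -
        have "r * L2norm (\<lambda>x. T (\<phi> m) x - T (\<phi> k) x) \<le> C * L2norm (wm s (Lapc h A (\<lambda>x. \<phi> m x - \<phi> k x)))"
          using Tb[OF test_diff[OF t t], of m k] unfolding Td[OF t t] .
        also have "wm s (Lapc h A (\<lambda>x. \<phi> m x - \<phi> k x)) = (\<lambda>x. wm s (Lapc h A (\<phi> m)) x - wm s (Lapc h A (\<phi> k)) x)"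
          unfolding wm_def Lapc_diff[OF test_smooth[OF t] test_smooth[OF t]] by (simp add: right_diff_distrib)
        also have "C * L2norm \<dots> \<le> C * (L2norm (\<lambda>x. wm s (Lapc h A (\<phi> m)) x - wm s f x) + L2norm (\<lambda>x. wm s (Lapc h A (\<phi> k)) x - wm s f x))"
          using C(1) L2lim_Cauchy_bound[OF lf, of m k] by (intro mult_left_mono) auto
        finally show ?thesis unfolding d_def using r by (simp add: field_simps)
      qed
      have d0: "d \<longlonglongrightarrow> 0" unfolding d_def using tendsto_mult_left[OF L2limD(3)[OF lf], of "C / r"] by simp
      obtain Y where Y: "L2lim (\<lambda>m. T (\<phi> m)) Y"
        by (rule L2_complete_dominated[of "\<lambda>m. T (\<phi> m)" d, OF T[OF t] dd d0])
      have "r * L2norm Y \<le> C * F"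
      proof (rule LIMSEQ_le)
        show "(\<lambda>m. r * L2norm (T (\<phi> m))) \<longlonglongrightarrow> r * L2norm Y" by (intro tendsto_mult_left L2lim_norm Y)
        show "(\<lambda>m. C * L2norm (wm s (Lapc h A (\<phi> m)))) \<longlonglongrightarrow> C * F" unfolding F_def by (intro tendsto_mult_left L2lim_norm lf)
      qed (use Tb[OF t] in blast)
      with Y show ?thesis by blast
    qed
    have wd: "wm r (\<lambda>x. \<psi> x - \<theta> x) = (\<lambda>x. wm r \<psi> x - wm r \<theta> x)" for r \<psi> \<theta> unfolding wm_def by (simp add: right_diff_distrib)
    have Ld: "Lc h A j (\<lambda>x. \<psi> x - \<theta> x) = (\<lambda>x. Lc h A j \<psi> x - Lc h A j \<theta> x)" if "test_fun \<psi>" "test_fun \<theta>" for j \<psi> \<theta>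
      using Lc_diff[OF test_smooth[OF that(1)] test_smooth[OF that(2)]] by blast
    have "\<exists>Y. L2lim (\<lambda>m. wm (s + 1) (\<phi> m)) Y \<and> h * L2norm Y \<le> C * F"
      by (rule lim) (use h ap in \<open>auto intro!: test_L2 test_wm simp: wd\<close>)
    then obtain Y where Y: "L2lim (\<lambda>m. wm (s + 1) (\<phi> m)) Y" "h * L2norm Y \<le> C * F" by blast
    have "\<exists>Y. L2lim (\<lambda>m. wm (s + 1/2) (Lc h A j (\<phi> m))) Y \<and> sqrt h * L2norm Y \<le> C * F" for j
      by (rule lim) (use h ap in \<open>auto intro!: test_L2 test_wm test_Lc simp: wd Ld\<close>)
    then obtain Y1 where Y1: "\<And>j. L2lim (\<lambda>m. wm (s + 1/2) (Lc h A j (\<phi> m))) (Y1 j)" "\<And>j. sqrt h * L2norm (Y1 j) \<le> C * F" by metis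
    have "\<exists>Y. L2lim (\<lambda>m. wm s (Lc h A j (Lc h A k (\<phi> m)))) Y \<and> 1 * L2norm Y \<le> C * F" for j k
      by (rule lim) (use h ap in \<open>auto intro!: test_L2 test_wm test_Lc simp: wd Ld test_Lc\<close>)
    then obtain Y2 where Y2: "\<And>j k. L2lim (\<lambda>m. wm s (Lc h A j (Lc h A k (\<phi> m)))) (Y2 j k)" "\<And>j k. 1 * L2norm (Y2 j k) \<le> C * F" by metis
    \<comment> \<open>The limits were taken with the weight included; dividing by it gives the weak
      derivatives themselves.\<close>
    define G1 where "G1 j = wm (- (s + 1/2)) (Y1 j)" for j
    define G2 where "G2 j k = wm (- s) (Y2 j k)" for j k
    have g1: "wm (s + 1/2) (G1 j) = Y1 j" for j unfolding G1_def wm_wm by (simp add: wm_0)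
    have g2: "wm s (G2 j k) = Y2 j k" for j k unfolding G2_def wm_wm by (simp add: wm_0)
    have l0: "L2lim \<phi> u" using L2lim_wm[OF lu s] unfolding wm_0 .
    have l1: "L2lim (\<lambda>m. Lc h A j (\<phi> m)) (G1 j)" for j
      using L2lim_wm[of "s + 1/2" "\<lambda>m. Lc h A j (\<phi> m)" "G1 j" 0] Y1(1) s unfolding g1 wm_0 by simp
    have l2: "L2lim (\<lambda>m. Lc h A j (Lc h A k (\<phi> m))) (G2 j k)" for j k
      using L2lim_wm[of s "\<lambda>m. Lc h A j (Lc h A k (\<phi> m))" "G2 j k" 0] Y2(1) s unfolding g2 wm_0 by simp
    define Z where "Z = wm (- (s + 1)) Y"
    have z: "wm (s + 1) Z = Y" unfolding Z_def wm_wm by (simp add: wm_0)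
    have "L2lim \<phi> Z" using L2lim_wm[of "s + 1" \<phi> Z 0] Y(1) s unfolding z wm_0 by simp
    \<comment> \<open>Here u is given, so the weighted limit is identified with it only almost
      everywhere; the measurability of both sides transfers the norm.\<close>
    then have "AE x in lborel. Z x = u x" using l0 by (rule L2lim_unique)
    then have ae: "AE x in lborel. Y x = wm (s + 1) u x" unfolding z[symmetric] wm_def by (auto elim: eventually_mono)
    have um: "wm (s + 1) u \<in> borel_measurable borel" by (rule wm_meas[OF L2_meas[OF L0[OF pu s]]])
    note Yae = L2norm_cong_AE[OF ae L2_meas[OF L2limD(2)[OF Y(1)]] um]
    show "L2 (wm (s + 1) u)" using Yae(2) L2limD(2)[OF Y(1)] by simp
    show "h * L2norm (wm (s + 1) u) \<le> C * L2norm (wm s f)" using Yae(1) Y(2) unfolding F_def by simp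
    show "\<exists>G1 G2. (\<forall>j. weak_L h A j u (G1 j) \<and> L2 (wm (s + 1/2) (G1 j)) \<and> sqrt h * L2norm (wm (s + 1/2) (G1 j)) \<le> C * L2norm (wm s f)) \<and>
       (\<forall>j k. weak_L h A j (G1 k) (G2 j k) \<and> L2 (wm s (G2 j k)) \<and> L2norm (wm s (G2 j k)) \<le> C * L2norm (wm s f))"
    proof (intro exI[of _ G1] exI[of _ G2] conjI allI)
      show "weak_L h A j u (G1 j)" for j by (rule weak_L_lim[OF t l0 l1])
      show "weak_L h A j (G1 k) (G2 j k)" for j k by (rule weak_L_lim[OF test_Lc[OF t] l1 l2])
    qed (use Y1 Y2 L2limD(2)[OF Y1(1)] L2limD(2)[OF Y2(1)] in \<open>auto simp: g1 g2 F_def\<close>)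
  qed
qed

end

section \<open>Commutators and powers\<close>

text \<open>Constants and thresholds chosen word by word become common ones, as there are finitely
  many words of bounded length and the bounds are monotone in C.\<close>

lemma finite_uniform:
  fixes P :: "'a \<Rightarrow> real \<Rightarrow> real \<Rightarrow> bool"
  assumes "finite S" "\<And>t. t \<in> S \<Longrightarrow> \<exists>C>0. \<exists>h0>0. \<forall>h. 0 < h \<longrightarrow> h < h0 \<longrightarrow> P t C h"
    and mono: "\<And>t C C' h. C \<le> C' \<Longrightarrow> P t C h \<Longrightarrow> P t C' h"
  shows "\<exists>C>0. \<exists>h0>0. \<forall>t\<in>S. \<forall>h. 0 < h \<longrightarrow> h < h0 \<longrightarrow> P t C h"
  using assms(1,2)
proof (induction S)
  case empty
  show ?case using gt_ex[of "0::real"] by auto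
next
  case (insert s S)
  have "\<exists>C>0. \<exists>h0>0. \<forall>t\<in>S. \<forall>h. 0 < h \<longrightarrow> h < h0 \<longrightarrow> P t C h"
    by (rule insert.IH) (rule insert.prems, simp)
  then obtain C h0 where 1: "C > 0" "h0 > 0" and "\<forall>t\<in>S. \<forall>h. 0 < h \<longrightarrow> h < h0 \<longrightarrow> P t C h" by (elim exE conjE)
  note 1 = 1 this(3)[rule_format]
  have "\<exists>C>0. \<exists>h0>0. \<forall>h. 0 < h \<longrightarrow> h < h0 \<longrightarrow> P s C h" by (rule insert.prems) simp
  then obtain D k0 where 2: "D > 0" "k0 > 0" and "\<forall>h. 0 < h \<longrightarrow> h < k0 \<longrightarrow> P s D h" by (elim exE conjE)
  note 2 = 2 this(3)[rule_format]
  have "P t (max C D) h" if "t \<in> insert s S" "0 < h" "h < min h0 k0" for t h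
    using that 1(3)[of t h] 2(3)[of h] mono[of C "max C D" t h] mono[of D "max C D" t h] by auto
  then show ?case using 1 2 by (intro exI[of _ "max C D"] conjI exI[of _ "min h0 k0"]) auto
qed

lemma iterpd_cmult: "smooth f \<Longrightarrow> iterpd js (\<lambda>x. c * f x) = (\<lambda>x. (c::complex) * iterpd js f x) \<and> smooth (iterpd js f)"
  by (induction js) (auto intro!: ext pd_cmult smooth_pd)

lemma iterpd_of_real: "smooth f \<Longrightarrow> iterpd js (\<lambda>x. complex_of_real (f x)) = (\<lambda>x. of_real (iterpd js f x)) \<and> smooth (iterpd js f)"
  by (induction js) (auto intro!: ext pd_of_real smooth_pd)

context nondegenerate_magnetic begin

text \<open>The coefficients that commutators can produce. The class is closed under derivatives and
  scalar multiples, and each member costs exactly one power of |B| however often it is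
  differentiated.\<close>

definition field_coeff :: "(real^'d \<Rightarrow> complex) \<Rightarrow> bool" where
  "field_coeff a \<longleftrightarrow> smooth a \<and> (\<forall>js. \<exists>C>0. \<forall>x. cmod (iterpd js a x) \<le> C * wt 1 x)"

lemma field_coeff_smooth: "field_coeff a \<Longrightarrow> smooth a"
  unfolding field_coeff_def by simp

lemma field_coeff_bound: "field_coeff a \<Longrightarrow> \<exists>C>0. \<forall>x. cmod (a x) \<le> C * wt 1 x"
  unfolding field_coeff_def by (metis iterpd.simps(1))

lemma field_coeff_pd: "field_coeff a \<Longrightarrow> field_coeff (pd j a)"
  unfolding field_coeff_def by (metis iterpd_snoc smooth_pd)

lemma field_coeff_cmult:
  assumes a: "field_coeff a" shows "field_coeff (\<lambda>x. c * a x)"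
  unfolding field_coeff_def
proof (intro conjI allI)
  show "smooth (\<lambda>x. c * a x)" by (intro smooth_mult smooth_const field_coeff_smooth a)
  fix js
  obtain C where C: "C > 0" "\<And>x. cmod (iterpd js a x) \<le> C * wt 1 x" using a unfolding field_coeff_def by blast
  have "cmod (iterpd js (\<lambda>x. c * a x) x) \<le> ((cmod c + 1) * C) * wt 1 x" for x
  proof -
    have "cmod (iterpd js (\<lambda>x. c * a x) x) = cmod c * cmod (iterpd js a x)"
      using iterpd_cmult[OF field_coeff_smooth[OF a]] by (simp add: norm_mult)
    also have "\<dots> \<le> (cmod c + 1) * (C * wt 1 x)" by (intro mult_mono C) auto
    finally show ?thesis by (simp add: mult.assoc)
  qed
  then show "\<exists>C>0. \<forall>x. cmod (iterpd js (\<lambda>x. c * a x) x) \<le> C * wt 1 x"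
    using C(1) by (intro exI[of _ "(cmod c + 1) * C"]) (auto intro!: mult_pos_pos add_nonneg_pos)
qed

lemma field_coeff_B: "field_coeff (\<lambda>x. of_real (B j k x))"
  unfolding field_coeff_def
proof (intro conjI allI)
  show "smooth (\<lambda>x. complex_of_real (B j k x))" by (intro smooth_of_real smoothB)
  fix js
  obtain C where "C > 0" "\<And>j k x. \<bar>iterpd js (B j k) x\<bar> \<le> C * wt 1 x" using iterpd_B_le by blast
  then show "\<exists>C>0. \<forall>x. cmod (iterpd js (\<lambda>x. complex_of_real (B j k x)) x) \<le> C * wt 1 x"
    using iterpd_of_real[OF smoothB, of js j k] by auto
qed

text \<open>The commutator \<open>[L, L\<^sub>\<tau>]\<close>, \<open>|\<tau>| = m\<close>, is a sum of terms \<open>h\<^bsup>1+m-|\<rho>|\<^esup> a L\<^sub>\<rho>\<close> with \<open>|\<rho>| \<le> m\<close> and \<open>a\<close> a combination of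
  derivatives of \<open>B\<close>; the list of pairs \<open>(a, \<rho>)\<close> does not depend on \<open>h\<close>.\<close>
definition csum :: "real \<Rightarrow> nat \<Rightarrow> ('d list \<Rightarrow> real^'d \<Rightarrow> complex) \<Rightarrow> ((real^'d \<Rightarrow> complex) \<times> 'd list) list \<Rightarrow> real^'d \<Rightarrow> complex" where
  "csum h m g xs x = (\<Sum>(a, \<rho>)\<leftarrow>xs. of_real (h ^ (1 + m - length \<rho>)) * a x * g \<rho> x)"

lemma csum_Nil: "csum h m g [] = (\<lambda>x. 0)"
  unfolding csum_def by simp

lemma csum_Cons: "csum h m g ((a, \<rho>) # xs) = (\<lambda>x. of_real (h ^ (1 + m - length \<rho>)) * a x * g \<rho> x + csum h m g xs x)"
  unfolding csum_def by simp

lemma csum_append: "csum h m g (xs @ ys) x = csum h m g xs x + csum h m g ys x"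
  unfolding csum_def by simp

lemma csum_concat: "csum h m g (concat (map F ls)) x = (\<Sum>l\<leftarrow>ls. csum h m g (F l) x)"
  by (induction ls) (auto simp: csum_append csum_Nil)

lemma csum_term_smooth: "smooth a \<Longrightarrow> smooth (\<lambda>x. complex_of_real r * a x)"
  by (intro smooth_mult smooth_const)

lemma csum_tint:
  assumes "\<And>a \<rho>. (a, \<rho>) \<in> set xs \<Longrightarrow> smooth a \<and> L2 (g \<rho>)"
  shows "tint (csum h m g xs)"
  using assms
proof (induction xs)
  case Nil
  then show ?case by (simp add: csum_Nil tint_zero)
next
  case (Cons y xs)
  obtain a \<rho> where y: "y = (a, \<rho>)" by (cases y)
  show ?case unfolding y csum_Cons
    by (intro tint_add tint_mult csum_term_smooth tint_L2 Cons.IH) (use Cons.prems y in auto)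
qed

text \<open>L_j applied to a L_rho is a L_j L_rho - i h (d_j a) L_rho. The factor h is not stored in
  the list: passing from m to m + 1 in \<open>csum\<close> raises the power for rho by one and
  leaves it unchanged for the longer word.\<close>

definition dlist :: "'d \<Rightarrow> ((real^'d \<Rightarrow> complex) \<times> 'd list) list \<Rightarrow> ((real^'d \<Rightarrow> complex) \<times> 'd list) list" where
  "dlist j xs = concat (map (\<lambda>(a, \<rho>). [(a, j # \<rho>), (\<lambda>x. - \<i> * pd j a x, \<rho>)]) xs)"

lemma csum_weak_L:
  assumes "\<And>a \<rho>. (a, \<rho>) \<in> set xs \<Longrightarrow> smooth a \<and> length \<rho> \<le> m \<and> L2 (g \<rho>) \<and> L2 (g (j # \<rho>)) \<and> weak_L h A j (g \<rho>) (g (j # \<rho>))"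
  shows "weak_L h A j (csum h m g xs) (csum h (Suc m) g (dlist j xs)) \<and> tint (csum h m g xs) \<and> tint (csum h (Suc m) g (dlist j xs))"
  using assms
proof (induction xs)
  case Nil
  then show ?case by (simp add: csum_Nil dlist_def tint_zero weak_L_ip)
next
  case (Cons y xs)
  obtain a \<rho> where y: "y = (a, \<rho>)" by (cases y)
  have p: "smooth a" "length \<rho> \<le> m" "L2 (g \<rho>)" "L2 (g (j # \<rho>))" "weak_L h A j (g \<rho>) (g (j # \<rho>))"
    using Cons.prems y by auto
  have IH: "weak_L h A j (csum h m g xs) (csum h (Suc m) g (dlist j xs))" "tint (csum h m g xs)" "tint (csum h (Suc m) g (dlist j xs))"
    using Cons.IH Cons.prems by auto
  let ?r = "complex_of_real (h ^ (1 + m - length \<rho>))"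
  let ?t = "\<lambda>x. ?r * a x * g (j # \<rho>) x - \<i> * of_real h * pd j (\<lambda>x. ?r * a x) x * g \<rho> x"
  have sa: "smooth (\<lambda>x. ?r * a x)" by (rule csum_term_smooth[OF p(1)])
  have w: "weak_L h A j (\<lambda>x. ?r * a x * g \<rho> x) ?t" by (rule weak_L_mult[OF p(5) tint_L2[OF p(3)] tint_L2[OF p(4)] sa])
  have t1: "tint (\<lambda>x. ?r * a x * g \<rho> x)" by (rule tint_mult[OF tint_L2[OF p(3)] sa])
  have t2: "tint ?t"
    by (intro tint_diff tint_mult[OF tint_L2[OF p(4)] sa] tint_mult[OF tint_L2[OF p(3)] smooth_mult[OF smooth_const smooth_pd[OF sa]]])
  have e: "csum h (Suc m) g (dlist j (y # xs)) = (\<lambda>x. ?t x + csum h (Suc m) g (dlist j xs) x)"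
  proof
    fix x
    have s: "1 + Suc m - length \<rho> = Suc (1 + m - length \<rho>)" using p(2) by simp
    show "csum h (Suc m) g (dlist j (y # xs)) x = ?t x + csum h (Suc m) g (dlist j xs) x"
      unfolding dlist_def y pd_cmult[OF p(1)]
      by (simp add: csum_Cons s[simplified] algebra_simps Suc_diff_le[OF p(2)])
  qed
  show ?case unfolding e unfolding y csum_Cons
    using weak_L_add[OF w IH(1) t1 t2 IH(2,3)] tint_add[OF t1 IH(2)] tint_add[OF t2 IH(3)] by blast
qed

text \<open>\<open>g \<sigma>\<close> stands for L_sigma psi, the head of the word being the
  outermost operator. A family is used because weak derivatives are unique only almost
  everywhere.\<close>

definition chain :: "real \<Rightarrow> nat \<Rightarrow> ('d list \<Rightarrow> real^'d \<Rightarrow> complex) \<Rightarrow> bool" where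
  "chain h N g \<longleftrightarrow> (\<forall>\<sigma>. length \<sigma> \<le> N \<longrightarrow> L2 (g \<sigma>)) \<and> (\<forall>j \<sigma>. length \<sigma> < N \<longrightarrow> weak_L h A j (g \<sigma>) (g (j # \<sigma>)))"

text \<open>Induction by [L, L_j L_tau] = L_j [L, L_tau] + [L, L_j] L_tau, with L the full operator:
  \<open>dlist\<close> accounts for the first part and \<open>ys\<close> for the second. The list is
  chosen before h and the functions, which makes all later constants uniform; it is empty for the
  empty word, so the induction on length can start without prior bounds.\<close>

lemma weak_commutator:
  "\<exists>xs. (\<forall>(a, \<rho>)\<in>set xs. field_coeff a \<and> length \<rho> \<le> length \<tau>) \<and> (\<tau> = [] \<longrightarrow> xs = []) \<and>
    (\<forall>h N g k. length \<tau> \<le> N \<longrightarrow> chain h N g \<longrightarrow> chain h N k \<longrightarrow> weak_Lap h A (g []) (k []) \<longrightarrow>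
       weak_Lap h A (g \<tau>) (\<lambda>x. k \<tau> x + csum h (length \<tau>) g xs x))"
proof (induction \<tau>)
  case Nil
  show ?case by (intro exI[of _ "[]"]) (auto simp: csum_Nil)
next
  case (Cons j \<tau>)
  let ?m = "length \<tau>"
  from Cons obtain xs where xs: "\<And>a \<rho>. (a, \<rho>) \<in> set xs \<Longrightarrow> field_coeff a \<and> length \<rho> \<le> ?m"
    and IH: "\<And>h N g k. ?m \<le> N \<Longrightarrow> chain h N g \<Longrightarrow> chain h N k \<Longrightarrow> weak_Lap h A (g []) (k []) \<Longrightarrow>
       weak_Lap h A (g \<tau>) (\<lambda>x. k \<tau> x + csum h ?m g xs x)" by blast
  obtain ls :: "'d list" where ls: "set ls = UNIV" "distinct ls" using finite_distinct_list[OF finite[of UNIV]] by blast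
  define ys where "ys = concat (map (\<lambda>l. [(\<lambda>x. 2 * \<i> * of_real (B l j x), l # \<tau>), (pd l (\<lambda>x. complex_of_real (B l j x)), \<tau>)]) ls)"
  show ?case
  proof (intro exI[of _ "dlist j xs @ ys"] conjI allI impI)
    show "\<forall>(a, \<rho>)\<in>set (dlist j xs @ ys). field_coeff a \<and> length \<rho> \<le> length (j # \<tau>)"
    proof (intro ballI, split prod.split, intro allI impI)
      fix y a \<rho> assume y: "y \<in> set (dlist j xs @ ys)" "y = (a, \<rho>)"
      then consider a' \<rho>' where "(a', \<rho>') \<in> set xs" "a = a'" "\<rho> = j # \<rho>'"
        | a' where "(a', \<rho>) \<in> set xs" "a = (\<lambda>x. - \<i> * pd j a' x)"
        | l where "a = (\<lambda>x. 2 * \<i> * of_real (B l j x))" "\<rho> = l # \<tau>"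
        | l where "a = pd l (\<lambda>x. complex_of_real (B l j x))" "\<rho> = \<tau>"
        by (auto simp: dlist_def ys_def)
      then show "field_coeff a \<and> length \<rho> \<le> length (j # \<tau>)"
      proof cases
        case 2
        then show ?thesis using xs field_coeff_cmult[OF field_coeff_pd, of a' "- \<i>" j] by fastforce
      next
        case 3
        then show ?thesis using field_coeff_cmult[OF field_coeff_B, of "2 * \<i>" l j] by simp
      next
        case 4
        then show ?thesis using field_coeff_pd[OF field_coeff_B, of l l j] by simp
      qed (use xs in auto)
    qed
    fix h N g k assume N: "length (j # \<tau>) \<le> N" and g: "chain h N g" and k: "chain h N k" and w: "weak_Lap h A (g []) (k [])"
    have Lg: "L2 (g \<sigma>)" and Lk: "L2 (k \<sigma>)" if "length \<sigma> \<le> N" for \<sigma> using that g k unfolding chain_def by auto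
    have wg: "weak_L h A i (g \<sigma>) (g (i # \<sigma>))" and wk: "weak_L h A i (k \<sigma>) (k (i # \<sigma>))" if "length \<sigma> < N" for i \<sigma>
      using that g k unfolding chain_def by auto
    have m: "?m < N" using N by simp
    have lt: "weak_Lap h A (g \<tau>) (\<lambda>x. k \<tau> x + csum h ?m g xs x)" by (rule IH[OF _ g k w]) (use N in simp)
    have cw: "weak_L h A j (csum h ?m g xs) (csum h (Suc ?m) g (dlist j xs))" "tint (csum h ?m g xs)" "tint (csum h (Suc ?m) g (dlist j xs))"
    proof -
      have "smooth a \<and> length \<rho> \<le> ?m \<and> L2 (g \<rho>) \<and> L2 (g (j # \<rho>)) \<and> weak_L h A j (g \<rho>) (g (j # \<rho>))" if "(a, \<rho>) \<in> set xs" for a \<rho>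
        using xs[OF that] m Lg[of \<rho>] Lg[of "j # \<rho>"] wg[of \<rho> j] field_coeff_smooth[of a] by auto
      from csum_weak_L[OF this] show "weak_L h A j (csum h ?m g xs) (csum h (Suc ?m) g (dlist j xs))"
        "tint (csum h ?m g xs)" "tint (csum h (Suc ?m) g (dlist j xs))" by blast+
    qed
    have gt: "tint (g \<tau>)" and kt: "tint (k \<tau>)" "tint (k (j # \<tau>))" using Lg Lk m by (auto intro: tint_L2)
    have ty: "tint (csum h (Suc ?m) g ys)"
    proof (rule csum_tint)
      fix a \<rho> assume "(a, \<rho>) \<in> set ys"
      then show "smooth a \<and> L2 (g \<rho>)" unfolding ys_def using Lg m
        by (auto intro!: smooth_mult smooth_const smooth_of_real smoothB smooth_pd)
    qed
    have sB: "smooth (\<lambda>x. complex_of_real (B l j x))" for l by (intro smooth_of_real smoothB)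
    show "weak_Lap h A (g (j # \<tau>)) (\<lambda>x. k (j # \<tau>) x + csum h (length (j # \<tau>)) g (dlist j xs @ ys) x)"
      unfolding weak_Lap_ip
    proof (intro allI impI)
      fix \<phi> :: "real^'d \<Rightarrow> complex" assume \<phi>: "test_fun \<phi>"
      note s\<phi> = test_smooth[OF \<phi>]
      let ?b = "\<lambda>l x. complex_of_real (B l j x)"
      have tb: "test_fun (\<lambda>x. ?b l x * \<phi> x)" "test_fun (\<lambda>x. pd l (?b l) x * \<phi> x)" for l
        by (intro test_mult[OF sB \<phi>] test_mult[OF smooth_pd[OF sB] \<phi>])+
      have t1: "test_fun (\<lambda>x. 2 * \<i> * of_real h * Lc h A l (\<lambda>x. ?b l x * \<phi> x) x)" "test_fun (\<lambda>x. (of_real h)^2 * (pd l (?b l) x * \<phi> x))" for l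
        by (intro test_cmult test_Lc tb)+
      \<comment> \<open>B is put inside L_l here, so that the pairing can move L_l onto
        \<open>g \<tau>\<close>; this reverses the sign of the term with the derivative of
        B.\<close>
      have e: "Lc h A j (Lapc h A \<phi>) = (\<lambda>x. Lapc h A (Lc h A j \<phi>) x - (\<Sum>l\<in>UNIV. 2 * \<i> * of_real h * Lc h A l (\<lambda>x. ?b l x * \<phi> x) x - (of_real h)^2 * (pd l (?b l) x * \<phi> x)))"
        unfolding fun_eq_iff Lapc_Lc_comm[OF s\<phi>] Lc_mult[OF sB s\<phi>] pd_of_real[OF smoothB]
        by (simp add: algebra_simps power2_eq_square)
      have "ip (g (j # \<tau>)) (Lapc h A \<phi>) = ip (g \<tau>) (Lc h A j (Lapc h A \<phi>))"
        using wg[OF m, of j] test_Lapc[OF \<phi>] unfolding weak_L_ip by simp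
      also have "\<dots> = ip (g \<tau>) (Lapc h A (Lc h A j \<phi>)) - (\<Sum>l\<in>UNIV. ip (g \<tau>) (\<lambda>x. 2 * \<i> * of_real h * Lc h A l (\<lambda>x. ?b l x * \<phi> x) x) - ip (g \<tau>) (\<lambda>x. (of_real h)^2 * (pd l (?b l) x * \<phi> x)))"
        unfolding e tip_diff_right[OF gt test_Lapc[OF test_Lc[OF \<phi>]] test_sum[OF test_diff[OF t1]]] tip_sum_right[OF gt test_diff[OF t1]] tip_diff_right[OF gt t1] ..
      also have "ip (g \<tau>) (Lapc h A (Lc h A j \<phi>)) = ip (\<lambda>x. k \<tau> x + csum h ?m g xs x) (Lc h A j \<phi>)"
        using lt test_Lc[OF \<phi>] unfolding weak_Lap_ip by blast
      also have "\<dots> = ip (k (j # \<tau>)) \<phi> + ip (csum h (Suc ?m) g (dlist j xs)) \<phi>"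
        unfolding tip_add[OF kt(1) cw(2) test_Lc[OF \<phi>]] using wk[OF m, of j] cw(1) \<phi> unfolding weak_L_ip by simp
      also have "(\<Sum>l\<in>UNIV. ip (g \<tau>) (\<lambda>x. 2 * \<i> * of_real h * Lc h A l (\<lambda>x. ?b l x * \<phi> x) x) - ip (g \<tau>) (\<lambda>x. (of_real h)^2 * (pd l (?b l) x * \<phi> x)))
         = - ip (csum h (Suc ?m) g ys) \<phi>"
      proof -
        have c1: "ip (g \<tau>) (\<lambda>x. 2 * \<i> * of_real h * Lc h A l (\<lambda>x. ?b l x * \<phi> x) x) = - (2 * \<i> * of_real h) * ip (\<lambda>x. ?b l x * g (l # \<tau>) x) \<phi>" for l
        proof -
          have "ip (g \<tau>) (Lc h A l (\<lambda>x. ?b l x * \<phi> x)) = ip (g (l # \<tau>)) (\<lambda>x. ?b l x * \<phi> x)"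
            using wg[OF m, of l] tb(1) unfolding weak_L_ip by blast
          then show ?thesis unfolding ip_cmult_right by (simp add: ip_mult_left)
        qed
        have c2: "ip (g \<tau>) (\<lambda>x. (of_real h)^2 * (pd l (?b l) x * \<phi> x)) = (of_real h)^2 * ip (\<lambda>x. pd l (?b l) x * g \<tau> x) \<phi>" for l
          unfolding ip_cmult_right by (simp add: ip_mult_left pd_of_real[OF smoothB])
        have tt: "tint (\<lambda>x. ?b l x * g (l # \<tau>) x)" "tint (\<lambda>x. pd l (?b l) x * g \<tau> x)" for l
          by (rule tint_mult[OF tint_L2[OF Lg] sB], use m in simp, rule tint_mult[OF gt smooth_pd[OF sB]])
        have ce: "csum h (Suc ?m) g ys = (\<lambda>x. \<Sum>l\<in>UNIV. 2 * \<i> * of_real h * (?b l x * g (l # \<tau>) x) + (of_real h)^2 * (pd l (?b l) x * g \<tau> x))"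
        proof
          fix x
          have "csum h (Suc ?m) g ys x = (\<Sum>l\<leftarrow>ls. 2 * \<i> * of_real h * (?b l x * g (l # \<tau>) x) + (of_real h)^2 * (pd l (?b l) x * g \<tau> x))"
            unfolding ys_def csum_concat
            by (intro arg_cong[where f=sum_list] map_cong refl) (simp add: csum_Cons csum_Nil power2_eq_square mult_ac)
          then show "csum h (Suc ?m) g ys x = (\<Sum>l\<in>UNIV. 2 * \<i> * of_real h * (?b l x * g (l # \<tau>) x) + (of_real h)^2 * (pd l (?b l) x * g \<tau> x))"
            using sum_list_distinct_conv_sum_set[OF ls(2)] ls(1) by simp
        qed
        have "ip (csum h (Suc ?m) g ys) \<phi> = (\<Sum>l\<in>UNIV. 2 * \<i> * of_real h * ip (\<lambda>x. ?b l x * g (l # \<tau>) x) \<phi> + (of_real h)^2 * ip (\<lambda>x. pd l (?b l) x * g \<tau> x) \<phi>)"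
          unfolding ce tip_sum[OF tint_add[OF tint_cmult[OF tt(1)] tint_cmult[OF tt(2)]] \<phi>] tip_add[OF tint_cmult[OF tt(1)] tint_cmult[OF tt(2)] \<phi>] ip_cmult_left ..
        then show ?thesis unfolding c1 c2 by (simp add: sum_negf[symmetric])
      qed
      finally have 1: "ip (g (j # \<tau>)) (Lapc h A \<phi>) = ip (k (j # \<tau>)) \<phi> + ip (csum h (Suc ?m) g (dlist j xs)) \<phi> + ip (csum h (Suc ?m) g ys) \<phi>" by simp
      have "(\<lambda>x. k (j # \<tau>) x + csum h (length (j # \<tau>)) g (dlist j xs @ ys) x) = (\<lambda>x. (k (j # \<tau>) x + csum h (Suc ?m) g (dlist j xs) x) + csum h (Suc ?m) g ys x)"
        by (simp add: csum_append fun_eq_iff)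
      then show "ip (g (j # \<tau>)) (Lapc h A \<phi>) = ip (\<lambda>x. k (j # \<tau>) x + csum h (length (j # \<tau>)) g (dlist j xs @ ys) x) \<phi>"
        unfolding 1 by (simp only: tip_add[OF tint_add[OF kt(2) cw(3)] ty \<phi>] tip_add[OF kt(2) cw(3) \<phi>])
    qed
  qed simp
qed

text \<open>The weight \<open>(h\<bar>B\<bar>)\<^bsup>n - |\<sigma>|/2\<^esup>\<close> makes all terms of the induction homogeneous.\<close>
definition scale_exp :: "nat \<Rightarrow> 'd list \<Rightarrow> real" where "scale_exp n \<sigma> = real n - real (length \<sigma>) / 2"

definition scaled_bound :: "nat \<Rightarrow> real \<Rightarrow> ('d list \<Rightarrow> real^'d \<Rightarrow> complex) \<Rightarrow> real \<Rightarrow> 'd list \<Rightarrow> bool" where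
  "scaled_bound n h g b \<sigma> \<longleftrightarrow> L2 (wm (scale_exp n \<sigma>) (g \<sigma>)) \<and> h powr scale_exp n \<sigma> * L2norm (wm (scale_exp n \<sigma>) (g \<sigma>)) \<le> b"

lemma wm_add: "wm s (\<lambda>x. f x + g x) = (\<lambda>x. wm s f x + wm s g x)"
  unfolding wm_def by (simp add: distrib_left)

text \<open>The count of powers: a coefficient costs one |B|, and |rho| \<le> |tau| gives
  \<open>scale_exp n \<tau> + 1 \<le> scale_exp (Suc n) \<rho>\<close>. The power of h in each term
  is at least the required one, with excess (|tau| - |rho|)/2, harmless for h \<le> 1.\<close>

lemma csum_bound:
  assumes "\<And>a \<rho>. (a, \<rho>) \<in> set xs \<Longrightarrow> field_coeff a \<and> length \<rho> \<le> length \<tau>"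
  shows "\<exists>K\<ge>0. \<forall>h g b. 0 < h \<longrightarrow> h \<le> 1 \<longrightarrow> (\<forall>\<rho>. length \<rho> \<le> length \<tau> \<longrightarrow> scaled_bound (Suc n) h g b \<rho>) \<longrightarrow>
     L2 (wm (scale_exp n \<tau>) (csum h (length \<tau>) g xs)) \<and> h powr scale_exp n \<tau> * L2norm (wm (scale_exp n \<tau>) (csum h (length \<tau>) g xs)) \<le> K * b"
  using assms
proof (induction xs)
  case Nil
  have "wm s (\<lambda>x. 0) = (\<lambda>x. 0)" for s unfolding wm_def by simp
  then show ?case by (intro exI[of _ 0]) (auto simp: csum_Nil L2norm_def)
next
  case (Cons y xs)
  obtain a \<rho> where y: "y = (a, \<rho>)" by (cases y)
  let ?s = "scale_exp n \<tau>" and ?m = "length \<tau>"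
  have p: "field_coeff a" "length \<rho> \<le> ?m" using Cons.prems y by auto
  from Cons obtain K where K: "K \<ge> 0" "\<And>h g b. 0 < h \<Longrightarrow> h \<le> 1 \<Longrightarrow> (\<And>\<rho>. length \<rho> \<le> ?m \<Longrightarrow> scaled_bound (Suc n) h g b \<rho>) \<Longrightarrow>
     L2 (wm ?s (csum h ?m g xs)) \<and> h powr ?s * L2norm (wm ?s (csum h ?m g xs)) \<le> K * b" by (metis list.set_intros(2))
  obtain C where C: "C > 0" "\<And>x. cmod (a x) \<le> C * wt 1 x" using field_coeff_bound[OF p(1)] by blast
  have "?s + 1 \<le> scale_exp (Suc n) \<rho>" unfolding scale_exp_def using p(2) by simp
  then obtain D where D: "D > 0" "\<And>u. L2 (wm (scale_exp (Suc n) \<rho>) u) \<Longrightarrow> L2 (wm (?s + 1) u) \<and> L2norm (wm (?s + 1) u) \<le> D * L2norm (wm (scale_exp (Suc n) \<rho>) u)"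
    using L2_wm_le by blast
  have "L2 (wm ?s (csum h ?m g (y # xs))) \<and> h powr ?s * L2norm (wm ?s (csum h ?m g (y # xs))) \<le> (C * D + K) * b"
    if h: "0 < h" "h \<le> 1" and b: "\<And>\<rho>. length \<rho> \<le> ?m \<Longrightarrow> scaled_bound (Suc n) h g b \<rho>" for h g b
  proof -
    define r where "r = h ^ (1 + ?m - length \<rho>)"
    define T where "T x = of_real r * a x * g \<rho> x" for x
    have r0: "r > 0" unfolding r_def using h by simp
    have g: "L2 (wm (?s + 1) (g \<rho>))" "L2norm (wm (?s + 1) (g \<rho>)) \<le> D * L2norm (wm (scale_exp (Suc n) \<rho>) (g \<rho>))"
      and gb: "h powr scale_exp (Suc n) \<rho> * L2norm (wm (scale_exp (Suc n) \<rho>) (g \<rho>)) \<le> b"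
      using D(2)[of "g \<rho>"] b[OF p(2)] unfolding scaled_bound_def by auto
    have gm: "g \<rho> \<in> borel_measurable borel"
    proof -
      have "g \<rho> = wm (- (?s + 1)) (wm (?s + 1) (g \<rho>))" unfolding wm_wm by (simp add: wm_0)
      then show ?thesis using wm_meas[OF L2_meas[OF g(1)]] by metis
    qed
    have Tm: "wm ?s T \<in> borel_measurable borel" unfolding T_def
      by (rule wm_meas[OF borel_measurable_times[OF smooth_meas[OF csum_term_smooth[OF field_coeff_smooth[OF p(1)]]] gm]])
    have Tb: "cmod (wm ?s T x) \<le> (r * C) * cmod (wm (?s + 1) (g \<rho>) x)" for x
    proof -
      have "wt ?s x * (r * cmod (a x) * cmod (g \<rho> x)) \<le> wt ?s x * (r * (C * wt 1 x) * cmod (g \<rho> x))"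
        using r0 wt_pos[of ?s x] C(2)[of x] by (intro mult_left_mono mult_right_mono) auto
      then show ?thesis unfolding cmod_wm T_def wt_add[symmetric] using r0 by (simp add: norm_mult mult_ac)
    qed
    have LT: "L2 (wm ?s T)" "L2norm (wm ?s T) \<le> (r * C) * L2norm (wm (?s + 1) (g \<rho>))"
      using L2_dom[OF g(1) Tm Tb] r0 C(1) by auto
    have "h powr ?s * L2norm (wm ?s T) \<le> h powr ?s * ((r * C) * (D * L2norm (wm (scale_exp (Suc n) \<rho>) (g \<rho>))))"
      using LT(2) g(2) r0 C(1) by (intro mult_left_mono order_trans[OF LT(2)]) auto
    also have "\<dots> = (C * D) * ((h powr ?s * r) * L2norm (wm (scale_exp (Suc n) \<rho>) (g \<rho>)))" by simp
    also have "h powr ?s * r \<le> h powr scale_exp (Suc n) \<rho>"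
    proof -
      have "h powr ?s * r = h powr (?s + real (1 + ?m - length \<rho>))" unfolding r_def using h by (simp add: powr_add powr_realpow)
      also have "\<dots> \<le> h powr scale_exp (Suc n) \<rho>"
        using h p(2) by (intro powr_mono') (auto simp: scale_exp_def of_nat_diff)
      finally show ?thesis .
    qed
    then have "(C * D) * ((h powr ?s * r) * L2norm (wm (scale_exp (Suc n) \<rho>) (g \<rho>))) \<le> (C * D) * (h powr scale_exp (Suc n) \<rho> * L2norm (wm (scale_exp (Suc n) \<rho>) (g \<rho>)))"
      using C D by (intro mult_left_mono mult_right_mono) auto
    also have "\<dots> \<le> (C * D) * b" using C D gb by (intro mult_left_mono) auto
    finally have Tn: "h powr ?s * L2norm (wm ?s T) \<le> (C * D) * b" .
    note X = K(2)[OF h b]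
    have e: "wm ?s (csum h ?m g (y # xs)) = (\<lambda>x. wm ?s T x + wm ?s (csum h ?m g xs) x)"
      unfolding y csum_Cons wm_add[symmetric] T_def r_def ..
    have "h powr ?s * L2norm (wm ?s (csum h ?m g (y # xs))) \<le> h powr ?s * (L2norm (wm ?s T) + L2norm (wm ?s (csum h ?m g xs)))"
      unfolding e using X LT(1) by (intro mult_left_mono L2norm_triangle) auto
    also have "\<dots> \<le> (C * D) * b + K * b" unfolding distrib_left using Tn X by (intro add_mono) auto
    finally show ?thesis unfolding e using L2_add[OF LT(1) conjunct1[OF X]] by (simp add: algebra_simps)
  qed
  moreover have "C * D + K \<ge> 0" using C D K by simp
  ultimately show ?case by blast
qed

section \<open>The induction on n and on the length of words\<close>

text \<open>\<open>g\<close> belongs to psi and \<open>k\<close> to the operator applied to psi.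
  Quantitative bounds are assumed for \<open>k\<close> only; for \<open>g\<close> mere finiteness of
  the weighted norms is enough, since \<open>weak_apriori\<close> then supplies the bound.\<close>

definition step_data :: "nat \<Rightarrow> real \<Rightarrow> ('d list \<Rightarrow> real^'d \<Rightarrow> complex) \<Rightarrow> ('d list \<Rightarrow> real^'d \<Rightarrow> complex) \<Rightarrow> real \<Rightarrow> bool" where
  "step_data n h g k b \<longleftrightarrow> chain h (2 * n) g \<and> chain h (2 * n) k \<and> weak_Lap h A (g []) (k []) \<and>
     (\<forall>\<sigma>. length \<sigma> \<le> 2 * n \<longrightarrow> L2 (wm (scale_exp n \<sigma>) (g \<sigma>)) \<and> scaled_bound n h k b \<sigma>)"

text \<open>\<open>G1\<close> and \<open>G2\<close> extend the word by one and two letters. They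
  enter \<open>scaled_bound\<close> as constant families because only the length of the word matters
  there, through the weight.\<close>

definition step_concl :: "nat \<Rightarrow> real \<Rightarrow> ('d list \<Rightarrow> real^'d \<Rightarrow> complex) \<Rightarrow> real \<Rightarrow> 'd list \<Rightarrow> bool" where
  "step_concl n h g b \<tau> \<longleftrightarrow> scaled_bound (Suc n) h g b \<tau> \<and>
     (\<exists>G1 G2. (\<forall>j. weak_L h A j (g \<tau>) (G1 j) \<and> scaled_bound (Suc n) h (\<lambda>\<sigma>. G1 j) b (j # \<tau>)) \<and>
       (\<forall>j k. weak_L h A j (G1 k) (G2 j k) \<and> scaled_bound (Suc n) h (\<lambda>\<sigma>. G2 j k) b (j # k # \<tau>)))"

lemma scaled_bound_mono: "scaled_bound n h g b \<sigma> \<Longrightarrow> b \<le> b' \<Longrightarrow> scaled_bound n h g b' \<sigma>"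
  unfolding scaled_bound_def by auto

lemma step_concl_mono: "step_concl n h g b \<tau> \<Longrightarrow> b \<le> b' \<Longrightarrow> step_concl n h g b' \<tau>"
  unfolding step_concl_def using scaled_bound_mono by blast

text \<open>L_tau psi solves the equation whose right-hand side is L_tau applied to the image of psi
  plus the commutator. With weight exponent s = \<open>scale_exp n \<tau>\<close>, the three gains s
  + 1, s + 1/2 and s of \<open>weak_apriori\<close> are the exponents of level n + 1 for words with
  zero, one and two further letters. The commutator contains words as long as tau, so their bounds
  at level n + 1 must be available beforehand, except for the empty word.\<close>

lemma step_local:
  assumes \<tau>: "length \<tau> \<le> 2 * n" and C1: "C1 > 0"
  shows "\<exists>C>0. \<exists>h0>0. \<forall>h. 0 < h \<longrightarrow> h < h0 \<longrightarrow> (\<forall>g k b. b \<ge> 0 \<longrightarrow> step_data n h g k b \<longrightarrow>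
     (\<tau> \<noteq> [] \<longrightarrow> (\<forall>\<rho>. length \<rho> \<le> length \<tau> \<longrightarrow> scaled_bound (Suc n) h g (C1 * b) \<rho>)) \<longrightarrow> step_concl n h g (C * b) \<tau>)"
proof -
  let ?s = "scale_exp n \<tau>"
  have s0: "?s \<ge> 0" unfolding scale_exp_def using \<tau> by simp
  obtain C h0 where C: "C > 0" "h0 > 0" and ap: "\<And>h u f. 0 < h \<Longrightarrow> h < h0 \<Longrightarrow> L2 (wm ?s u) \<Longrightarrow> L2 (wm ?s f) \<Longrightarrow> weak_Lap h A u f \<Longrightarrow>
     L2 (wm (?s + 1) u) \<and> h * L2norm (wm (?s + 1) u) \<le> C * L2norm (wm ?s f) \<and>
     (\<exists>G1 G2. (\<forall>j. weak_L h A j u (G1 j) \<and> L2 (wm (?s + 1/2) (G1 j)) \<and> sqrt h * L2norm (wm (?s + 1/2) (G1 j)) \<le> C * L2norm (wm ?s f)) \<and>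
       (\<forall>j k. weak_L h A j (G1 k) (G2 j k) \<and> L2 (wm ?s (G2 j k)) \<and> L2norm (wm ?s (G2 j k)) \<le> C * L2norm (wm ?s f)))"
    using weak_apriori[OF s0] by blast
  obtain xs where xs: "\<And>a \<rho>. (a, \<rho>) \<in> set xs \<Longrightarrow> field_coeff a \<and> length \<rho> \<le> length \<tau>" "\<tau> = [] \<Longrightarrow> xs = []"
    and wc: "\<And>h N g k. length \<tau> \<le> N \<Longrightarrow> chain h N g \<Longrightarrow> chain h N k \<Longrightarrow> weak_Lap h A (g []) (k []) \<Longrightarrow>
       weak_Lap h A (g \<tau>) (\<lambda>x. k \<tau> x + csum h (length \<tau>) g xs x)" using weak_commutator[of \<tau>] by blast
  obtain K where K: "K \<ge> 0" "\<And>h g b. 0 < h \<Longrightarrow> h \<le> 1 \<Longrightarrow> (\<And>\<rho>. length \<rho> \<le> length \<tau> \<Longrightarrow> scaled_bound (Suc n) h g b \<rho>) \<Longrightarrow>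
     L2 (wm ?s (csum h (length \<tau>) g xs)) \<and> h powr ?s * L2norm (wm ?s (csum h (length \<tau>) g xs)) \<le> K * b"
    using csum_bound[OF xs(1), where n=n] by blast
  have "step_concl n h g (C * (1 + K * C1) * b) \<tau>"
    if h: "0 < h" "h < min 1 h0" and b: "b \<ge> 0" and d: "step_data n h g k b"
      and H: "\<tau> \<noteq> [] \<Longrightarrow> (\<forall>\<rho>. length \<rho> \<le> length \<tau> \<longrightarrow> scaled_bound (Suc n) h g (C1 * b) \<rho>)" for h g k b
  proof -
    define c where "c = csum h (length \<tau>) g xs"
    define f where "f x = k \<tau> x + c x" for x
    have Lc: "L2 (wm ?s c)" "h powr ?s * L2norm (wm ?s c) \<le> K * (C1 * b)"
    proof -
      have "L2 (wm ?s c) \<and> h powr ?s * L2norm (wm ?s c) \<le> K * (C1 * b)"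
      proof (cases "\<tau> = []")
        case True
        have "wm ?s (\<lambda>x. 0) = (\<lambda>x. 0)" unfolding wm_def by simp
        then show ?thesis unfolding c_def xs(2)[OF True] csum_Nil using K(1) C1 b by (simp add: L2norm_def)
      next
        case False
        then show ?thesis unfolding c_def using K(2)[of h g "C1 * b"] H h by auto
      qed
      then show "L2 (wm ?s c)" "h powr ?s * L2norm (wm ?s c) \<le> K * (C1 * b)" by auto
    qed
    have Lk: "L2 (wm ?s (k \<tau>))" "h powr ?s * L2norm (wm ?s (k \<tau>)) \<le> b" and Lg: "L2 (wm ?s (g \<tau>))"
      using d \<tau> unfolding step_data_def scaled_bound_def by auto
    have Lf: "L2 (wm ?s f)" unfolding f_def[abs_def] wm_add by (rule L2_add[OF Lk(1) Lc(1)])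
    have "h powr ?s * L2norm (wm ?s f) \<le> h powr ?s * (L2norm (wm ?s (k \<tau>)) + L2norm (wm ?s c))"
      unfolding f_def[abs_def] wm_add by (intro mult_left_mono L2norm_triangle Lk Lc) simp
    also have "\<dots> \<le> b + K * (C1 * b)" unfolding distrib_left by (intro add_mono Lk Lc)
    finally have fb: "C * (h powr ?s * L2norm (wm ?s f)) \<le> C * (1 + K * C1) * b" using C(1) by (simp add: mult.assoc mult_left_mono distrib_right)
    have w: "weak_Lap h A (g \<tau>) f" unfolding f_def[abs_def] c_def by (rule wc[OF \<tau>]) (use d in \<open>auto simp: step_data_def\<close>)
    have scale: "h powr (?s + e) * v \<le> C * (1 + K * C1) * b" if "h powr e * v \<le> C * L2norm (wm ?s f)" for e v
    proof -
      have "h powr (?s + e) * v = h powr ?s * (h powr e * v)" by (simp add: powr_add)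
      also have "\<dots> \<le> h powr ?s * (C * L2norm (wm ?s f))" using that by (intro mult_left_mono) auto
      finally show ?thesis using fb by (simp add: mult_ac)
    qed
    have e: "scale_exp (Suc n) \<tau> = ?s + 1" "scale_exp (Suc n) (j # \<tau>) = ?s + 1/2" "scale_exp (Suc n) (j # l # \<tau>) = ?s + 0" for j l
      unfolding scale_exp_def by (auto simp: field_simps)
    have hp: "h powr 1 = h" "h powr (1/2) = sqrt h" "h powr 0 = 1" using h by (auto simp: powr_half_sqrt)
    have h2: "h < h0" using h by simp
    from ap[OF h(1) h2 Lg Lf w] obtain G1 G2 where
      a0: "L2 (wm (?s + 1) (g \<tau>))" "h powr 1 * L2norm (wm (?s + 1) (g \<tau>)) \<le> C * L2norm (wm ?s f)" and
      a1: "\<And>j. weak_L h A j (g \<tau>) (G1 j)" "\<And>j. L2 (wm (?s + 1/2) (G1 j))" "\<And>j. h powr (1/2) * L2norm (wm (?s + 1/2) (G1 j)) \<le> C * L2norm (wm ?s f)" and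
      a2: "\<And>j k. weak_L h A j (G1 k) (G2 j k)" "\<And>j k. L2 (wm (?s + 0) (G2 j k))" "\<And>j k. h powr 0 * L2norm (wm (?s + 0) (G2 j k)) \<le> C * L2norm (wm ?s f)"
      unfolding hp add_0_right mult_1_left by blast
    show ?thesis unfolding step_concl_def scaled_bound_def e
      using a0(1) scale[OF a0(2)] a1(1,2) scale[OF a1(3)] a2(1,2) scale[OF a2(3)] by blast
  qed
  moreover have "C * (1 + K * C1) > 0" using C K C1 by (intro mult_pos_pos add_pos_nonneg) auto
  moreover have "min 1 h0 > 0" using C by simp
  ultimately show ?thesis by blast
qed

lemma finite_lists: "finite {\<tau>::'d list. length \<tau> \<le> N}"
  using finite_lists_length_le[of "UNIV::'d set" N] by simp

lemma step_uniform:
  assumes m: "m \<le> 2 * n" and C1: "C1 > 0"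
  shows "\<exists>C>0. \<exists>h0>0. \<forall>\<tau>\<in>{\<tau>. length \<tau> \<le> m}. \<forall>h. 0 < h \<longrightarrow> h < h0 \<longrightarrow> (\<forall>g k b. b \<ge> 0 \<longrightarrow> step_data n h g k b \<longrightarrow>
     (\<tau> \<noteq> [] \<longrightarrow> (\<forall>\<rho>. length \<rho> \<le> length \<tau> \<longrightarrow> scaled_bound (Suc n) h g (C1 * b) \<rho>)) \<longrightarrow> step_concl n h g (C * b) \<tau>)"
proof (rule finite_uniform)
  show "finite {\<tau>::'d list. length \<tau> \<le> m}" by (rule finite_lists)
next
  fix \<tau> :: "'d list" assume "\<tau> \<in> {\<tau>. length \<tau> \<le> m}"
  then show "\<exists>C>0. \<exists>h0>0. \<forall>h. 0 < h \<longrightarrow> h < h0 \<longrightarrow> (\<forall>g k b. b \<ge> 0 \<longrightarrow> step_data n h g k b \<longrightarrow>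
     (\<tau> \<noteq> [] \<longrightarrow> (\<forall>\<rho>. length \<rho> \<le> length \<tau> \<longrightarrow> scaled_bound (Suc n) h g (C1 * b) \<rho>)) \<longrightarrow> step_concl n h g (C * b) \<tau>)"
    using m C1 by (intro step_local) auto
next
  fix \<tau> :: "'d list" and C C' h :: real
  assume le: "C \<le> C'" and H: "\<forall>g k b. b \<ge> 0 \<longrightarrow> step_data n h g k b \<longrightarrow>
     (\<tau> \<noteq> [] \<longrightarrow> (\<forall>\<rho>. length \<rho> \<le> length \<tau> \<longrightarrow> scaled_bound (Suc n) h g (C1 * b) \<rho>)) \<longrightarrow> step_concl n h g (C * b) \<tau>"
  show "\<forall>g k b. b \<ge> 0 \<longrightarrow> step_data n h g k b \<longrightarrow>
     (\<tau> \<noteq> [] \<longrightarrow> (\<forall>\<rho>. length \<rho> \<le> length \<tau> \<longrightarrow> scaled_bound (Suc n) h g (C1 * b) \<rho>)) \<longrightarrow> step_concl n h g (C' * b) \<tau>"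
  proof (intro allI impI)
    fix g k and b :: real
    assume b: "b \<ge> 0" "step_data n h g k b" "\<tau> \<noteq> [] \<longrightarrow> (\<forall>\<rho>. length \<rho> \<le> length \<tau> \<longrightarrow> scaled_bound (Suc n) h g (C1 * b) \<rho>)"
    then have "step_concl n h g (C * b) \<tau>" using H by blast
    moreover have "C * b \<le> C' * b" using le b by (intro mult_right_mono) auto
    ultimately show "step_concl n h g (C' * b) \<tau>" by (rule step_concl_mono)
  qed
qed

lemma step_uniform':
  assumes "m \<le> 2 * n" "C1 > 0"
  shows "\<exists>C>0. \<exists>h0>0. \<forall>\<tau> h g k b. length \<tau> \<le> m \<longrightarrow> 0 < h \<longrightarrow> h < h0 \<longrightarrow> b \<ge> 0 \<longrightarrow> step_data n h g k b \<longrightarrow>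
     (\<forall>\<rho>. length \<rho> \<le> length \<tau> \<longrightarrow> scaled_bound (Suc n) h g (C1 * b) \<rho>) \<longrightarrow> step_concl n h g (C * b) \<tau>"
proof -
  from step_uniform[OF assms] obtain C h0 where C: "C > 0" "h0 > 0"
    and "\<forall>\<tau>\<in>{\<tau>. length \<tau> \<le> m}. \<forall>h. 0 < h \<longrightarrow> h < h0 \<longrightarrow> (\<forall>g k b. b \<ge> 0 \<longrightarrow> step_data n h g k b \<longrightarrow>
     (\<tau> \<noteq> [] \<longrightarrow> (\<forall>\<rho>. length \<rho> \<le> length \<tau> \<longrightarrow> scaled_bound (Suc n) h g (C1 * b) \<rho>)) \<longrightarrow> step_concl n h g (C * b) \<tau>)"
    by (elim exE conjE)
  note H = this(3)[rule_format]
  show ?thesis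
    by (rule exI[of _ C], rule conjI[OF C(1)], rule exI[of _ h0], rule conjI[OF C(2)], intro allI impI, rule H) auto
qed

text \<open>The apparent circularity in \<open>step_local\<close> is broken by length: words with m
  + 1 letters are bounded as the one-letter extensions \<open>G1\<close> of words with m letters,
  whose commutators involve at most m letters.\<close>

lemma step_lower:
  "m \<le> 2 * n \<Longrightarrow> \<exists>C>0. \<exists>h0>0. \<forall>h. 0 < h \<longrightarrow> h < h0 \<longrightarrow> (\<forall>g k b. b \<ge> 0 \<longrightarrow> step_data n h g k b \<longrightarrow>
     (\<forall>\<rho>. length \<rho> \<le> m \<longrightarrow> scaled_bound (Suc n) h g (C * b) \<rho>))"
proof (induction m)
  case 0
  obtain C h0 where "C > 0" "h0 > 0" and C: "\<And>h g k b. 0 < h \<Longrightarrow> h < h0 \<Longrightarrow> b \<ge> 0 \<Longrightarrow> step_data n h g k b \<Longrightarrow> step_concl n h g (C * b) []"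
    using step_local[of "[]" n 1] by auto
  then show ?case unfolding step_concl_def by (intro exI[of _ C] conjI exI[of _ h0]) auto
next
  case (Suc m)
  then obtain C h0 where C0: "C > 0" "h0 > 0" and IH: "\<forall>h. 0 < h \<longrightarrow> h < h0 \<longrightarrow> (\<forall>g k b. b \<ge> 0 \<longrightarrow> step_data n h g k b \<longrightarrow>
     (\<forall>\<rho>. length \<rho> \<le> m \<longrightarrow> scaled_bound (Suc n) h g (C * b) \<rho>))" by (meson Suc_leD)
  note C = C0 IH[rule_format]
  obtain D k0 where D0: "D > 0" "k0 > 0" and st: "\<forall>\<tau> h g k b. length \<tau> \<le> m \<longrightarrow> 0 < h \<longrightarrow> h < k0 \<longrightarrow> b \<ge> 0 \<longrightarrow> step_data n h g k b \<longrightarrow>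
     (\<forall>\<rho>. length \<rho> \<le> length \<tau> \<longrightarrow> scaled_bound (Suc n) h g (C * b) \<rho>) \<longrightarrow> step_concl n h g (D * b) \<tau>"
    using step_uniform'[OF Suc_leD[OF Suc.prems] C(1)] by blast
  note D = D0 st[rule_format]
  have "scaled_bound (Suc n) h g ((C + D) * b) \<rho>" if h: "0 < h" "h < min h0 k0" and b: "b \<ge> 0" and d: "step_data n h g k b" and \<rho>: "length \<rho> \<le> Suc m" for h g k b \<rho>
  proof (cases "length \<rho> \<le> m")
    case True
    have "C * b \<le> (C + D) * b" using D b by (intro mult_right_mono) auto
    then show ?thesis using C(3)[OF h(1) _ b d True] h by (auto intro: scaled_bound_mono)
  next
    case False
    then obtain j \<tau> where \<tau>: "\<rho> = j # \<tau>" "length \<tau> = m" using \<rho> by (cases \<rho>) auto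
    have "step_concl n h g (D * b) \<tau>" by (rule D(3)[OF _ h(1) _ b d]) (use \<tau> h C(3)[OF h(1) _ b d] in auto)
    then obtain G where G: "weak_L h A j (g \<tau>) G" "scaled_bound (Suc n) h (\<lambda>\<sigma>. G) (D * b) (j # \<tau>)" unfolding step_concl_def by blast
    have ch: "weak_L h A j (g \<tau>) (g (j # \<tau>))" "L2 (g (j # \<tau>))" using d \<tau>(2) Suc.prems unfolding step_data_def chain_def by auto
    let ?e = "scale_exp (Suc n) (j # \<tau>)"
    have "?e \<ge> 0" unfolding scale_exp_def using \<tau>(2) Suc.prems by simp
    then have LG: "L2 G" using L2_wm_le[of 0 ?e] G(2) unfolding scaled_bound_def wm_0 by blast
    \<comment> \<open>The extension produced by the estimate and the member of the given chain are
      both weak L_j-derivatives of the same function.\<close>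
    have "AE x in lborel. G x = g (j # \<tau>) x" by (rule weak_L_unique[OF G(1) ch(1) LG ch(2)])
    then have "AE x in lborel. wm ?e G x = wm ?e (g (j # \<tau>)) x" unfolding wm_def by (auto elim: eventually_mono)
    from L2norm_cong_AE[OF this wm_meas[OF L2_meas[OF LG]] wm_meas[OF L2_meas[OF ch(2)]]]
    have "scaled_bound (Suc n) h g (D * b) (j # \<tau>)" using G(2) unfolding scaled_bound_def by simp
    moreover have "D * b \<le> (C + D) * b" using C b by (intro mult_right_mono) auto
    ultimately show ?thesis unfolding \<tau>(1) by (rule scaled_bound_mono)
  qed
  then show ?case using C D by (intro exI[of _ "C + D"] conjI exI[of _ "min h0 k0"]) auto
qed

text \<open>The induction hypothesis is used twice: for psi up to its n-th image, giving words with
  finite weighted norms, and for the first image of psi up to f, giving the quantitative data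
  \<open>k\<close>. Words with at most 2n letters are then improved to level n + 1 by
  \<open>step_lower\<close>, and the two missing lengths come from the extensions of words with 2n
  letters.\<close>

lemma power_estimate:
  "\<exists>C>0. \<exists>h0>0. \<forall>h. 0 < h \<longrightarrow> h < h0 \<longrightarrow> (\<forall>\<psi> f. Lpow_rel h A n \<psi> f \<longrightarrow>
     (\<exists>g. g [] = \<psi> \<and> chain h (2 * n) g \<and> (\<forall>\<sigma>. length \<sigma> \<le> 2 * n \<longrightarrow> scaled_bound n h g (C * L2norm f) \<sigma>)))"
proof (induction n)
  case 0
  show ?case
  proof (intro exI[of _ "1::real"] conjI allI impI)
    fix h \<psi> f assume "Lpow_rel h A 0 \<psi> f"
    then have "\<psi> = f" "L2 f" unfolding Lpow_rel_def by auto
    then show "\<exists>g. g [] = \<psi> \<and> chain h (2 * 0) g \<and> (\<forall>\<sigma>. length \<sigma> \<le> 2 * 0 \<longrightarrow> scaled_bound 0 h g (1 * L2norm f) \<sigma>)"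
      by (intro exI[of _ "\<lambda>\<sigma>. f"]) (auto simp: chain_def scaled_bound_def scale_exp_def wm_0)
  qed auto
next
  case (Suc n)
  then obtain C h0 where C0: "C > 0" "h0 > 0" and IH: "\<forall>h. 0 < h \<longrightarrow> h < h0 \<longrightarrow> (\<forall>\<psi> f. Lpow_rel h A n \<psi> f \<longrightarrow>
     (\<exists>g. g [] = \<psi> \<and> chain h (2 * n) g \<and> (\<forall>\<sigma>. length \<sigma> \<le> 2 * n \<longrightarrow> scaled_bound n h g (C * L2norm f) \<sigma>)))" by blast
  note C = C0 IH[rule_format]
  obtain D h1 where D0: "D > 0" "h1 > 0" and low: "\<forall>h. 0 < h \<longrightarrow> h < h1 \<longrightarrow> (\<forall>g k b. b \<ge> 0 \<longrightarrow> step_data n h g k b \<longrightarrow>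
     (\<forall>\<rho>. length \<rho> \<le> 2 * n \<longrightarrow> scaled_bound (Suc n) h g (D * b) \<rho>))" using step_lower[OF order_refl, of n] by blast
  note D = D0 low[rule_format]
  obtain E h2 where E0: "E > 0" "h2 > 0" and st: "\<forall>\<tau> h g k b. length \<tau> \<le> 2 * n \<longrightarrow> 0 < h \<longrightarrow> h < h2 \<longrightarrow> b \<ge> 0 \<longrightarrow> step_data n h g k b \<longrightarrow>
     (\<forall>\<rho>. length \<rho> \<le> length \<tau> \<longrightarrow> scaled_bound (Suc n) h g (D * b) \<rho>) \<longrightarrow> step_concl n h g (E * b) \<tau>"
    using step_uniform'[OF order_refl D(1), of n] by blast
  note E = E0 st[rule_format]
  have "\<exists>g. g [] = \<psi> \<and> chain h (2 * Suc n) g \<and> (\<forall>\<sigma>. length \<sigma> \<le> 2 * Suc n \<longrightarrow> scaled_bound (Suc n) h g ((E + D) * C * L2norm f) \<sigma>)"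
    if h: "0 < h" "h < min h0 (min h1 h2)" and L: "Lpow_rel h A (Suc n) \<psi> f" for h \<psi> f
  proof -
    obtain u where u: "u 0 = \<psi>" "u (Suc n) = f" "\<And>k. k \<le> Suc n \<Longrightarrow> L2 (u k)" "\<And>k. k < Suc n \<Longrightarrow> weak_Lap h A (u k) (u (Suc k))"
      using L unfolding Lpow_rel_def by blast
    have "Lpow_rel h A n \<psi> (u n)" unfolding Lpow_rel_def using u by (intro exI[of _ u]) auto
    from C(3)[OF h(1) _ this] obtain g where g: "g [] = \<psi>" "chain h (2 * n) g" "\<And>\<sigma>. length \<sigma> \<le> 2 * n \<Longrightarrow> scaled_bound n h g (C * L2norm (u n)) \<sigma>"
      using h(2) by auto
    have "Lpow_rel h A n (u 1) f" unfolding Lpow_rel_def using u by (intro exI[of _ "\<lambda>k. u (Suc k)"]) auto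
    from C(3)[OF h(1) _ this] obtain k where k: "k [] = u 1" "chain h (2 * n) k" "\<And>\<sigma>. length \<sigma> \<le> 2 * n \<Longrightarrow> scaled_bound n h k (C * L2norm f) \<sigma>"
      using h(2) by auto
    define b where "b = C * L2norm f"
    have b: "b \<ge> 0" unfolding b_def using C by simp
    \<comment> \<open>The bound of \<open>g\<close> by the norm of \<open>u n\<close> is discarded
      here; only its finiteness is kept.\<close>
    have d: "step_data n h g k b" unfolding step_data_def b_def
      using g k u(4)[of 0] u(1) by (auto simp: scaled_bound_def)
    have low: "scaled_bound (Suc n) h g (D * b) \<rho>" if "length \<rho> \<le> 2 * n" for \<rho> by (rule D(3)[OF h(1) _ b d that]) (use h in simp)
    have "step_concl n h g (E * b) \<tau>" if "length \<tau> \<le> 2 * n" for \<tau> by (rule E(3)[OF that h(1) _ b d]) (use h that low in auto)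
    then have "\<exists>G1 G2. (\<forall>j. weak_L h A j (g \<tau>) (G1 j) \<and> scaled_bound (Suc n) h (\<lambda>\<sigma>. G1 j) (E * b) (j # \<tau>)) \<and>
       (\<forall>j k. weak_L h A j (G1 k) (G2 j k) \<and> scaled_bound (Suc n) h (\<lambda>\<sigma>. G2 j k) (E * b) (j # k # \<tau>))" if "length \<tau> \<le> 2 * n" for \<tau>
      using that unfolding step_concl_def by blast
    then have "\<forall>\<tau>. \<exists>G1 G2. length \<tau> \<le> 2 * n \<longrightarrow> ((\<forall>j. weak_L h A j (g \<tau>) (G1 j) \<and> scaled_bound (Suc n) h (\<lambda>\<sigma>. G1 j) (E * b) (j # \<tau>)) \<and>
       (\<forall>j k. weak_L h A j (G1 k) (G2 j k) \<and> scaled_bound (Suc n) h (\<lambda>\<sigma>. G2 j k) (E * b) (j # k # \<tau>)))" by blast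
    from choice[OF this] obtain G1 where "\<forall>\<tau>. \<exists>G2. length \<tau> \<le> 2 * n \<longrightarrow> ((\<forall>j. weak_L h A j (g \<tau>) (G1 \<tau> j) \<and> scaled_bound (Suc n) h (\<lambda>\<sigma>. G1 \<tau> j) (E * b) (j # \<tau>)) \<and>
       (\<forall>j k. weak_L h A j (G1 \<tau> k) (G2 j k) \<and> scaled_bound (Suc n) h (\<lambda>\<sigma>. G2 j k) (E * b) (j # k # \<tau>)))" by (elim exE)
    from choice[OF this] obtain G2 where "\<forall>\<tau>. length \<tau> \<le> 2 * n \<longrightarrow> ((\<forall>j. weak_L h A j (g \<tau>) (G1 \<tau> j) \<and> scaled_bound (Suc n) h (\<lambda>\<sigma>. G1 \<tau> j) (E * b) (j # \<tau>)) \<and>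
       (\<forall>j k. weak_L h A j (G1 \<tau> k) (G2 \<tau> j k) \<and> scaled_bound (Suc n) h (\<lambda>\<sigma>. G2 \<tau> j k) (E * b) (j # k # \<tau>)))" by (elim exE)
    then have G1: "\<And>\<tau> j. length \<tau> \<le> 2 * n \<Longrightarrow> weak_L h A j (g \<tau>) (G1 \<tau> j)" "\<And>\<tau> j. length \<tau> \<le> 2 * n \<Longrightarrow> scaled_bound (Suc n) h (\<lambda>\<sigma>. G1 \<tau> j) (E * b) (j # \<tau>)"
      and G2: "\<And>\<tau> j k. length \<tau> \<le> 2 * n \<Longrightarrow> weak_L h A j (G1 \<tau> k) (G2 \<tau> j k)" "\<And>\<tau> j k. length \<tau> \<le> 2 * n \<Longrightarrow> scaled_bound (Suc n) h (\<lambda>\<sigma>. G2 \<tau> j k) (E * b) (j # k # \<tau>)"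
      by blast+
    \<comment> \<open>\<open>G2 \<tau> j l\<close> represents L_j L_l L_tau and is linked to
      \<open>G1 \<tau> l\<close>, which in turn is linked to \<open>g \<tau>\<close>; this makes the
      enlarged family a chain.\<close>
    define g' where "g' \<sigma> = (if length \<sigma> \<le> 2 * n then g \<sigma> else if length \<sigma> = Suc (2 * n) then G1 (tl \<sigma>) (hd \<sigma>) else G2 (tl (tl \<sigma>)) (hd \<sigma>) (hd (tl \<sigma>)))" for \<sigma>
    have DE: "D * b \<le> (E + D) * C * L2norm f" "E * b \<le> (E + D) * C * L2norm f"
      using b D E C unfolding b_def mult.assoc by (auto intro!: mult_right_mono)
    have scaled_bound': "scaled_bound (Suc n) h g' ((E + D) * C * L2norm f) \<sigma>" if s: "length \<sigma> \<le> 2 * Suc n" for \<sigma>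
    proof -
      consider "length \<sigma> \<le> 2 * n" | j \<tau> where "\<sigma> = j # \<tau>" "length \<tau> = 2 * n" | j l \<tau> where "\<sigma> = j # l # \<tau>" "length \<tau> = 2 * n"
      proof -
        have "length \<sigma> \<le> 2 * n \<or> length \<sigma> = Suc (2 * n) \<or> length \<sigma> = Suc (Suc (2 * n))" using s by auto
        then show ?thesis using that by (auto simp: length_Suc_conv)
      qed
      then show ?thesis
      proof cases
        case 1
        then show ?thesis using scaled_bound_mono[OF low[OF 1] DE(1)] unfolding scaled_bound_def g'_def by simp
      next
        case 2
        then show ?thesis using scaled_bound_mono[OF G1(2)[of \<tau> j] DE(2)] unfolding scaled_bound_def g'_def by simp
      next
        case 3
        then show ?thesis using scaled_bound_mono[OF G2(2)[of \<tau> j l] DE(2)] unfolding scaled_bound_def g'_def by simp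
      qed
    qed
    have "L2 (g' \<sigma>)" if "length \<sigma> \<le> 2 * Suc n" for \<sigma>
    proof -
      have "scale_exp (Suc n) \<sigma> \<ge> 0" using that unfolding scale_exp_def by simp
      then show ?thesis using L2_wm_le[of 0 "scale_exp (Suc n) \<sigma>"] scaled_bound'[OF that] unfolding scaled_bound_def wm_0 by blast
    qed
    moreover have "weak_L h A j (g' \<sigma>) (g' (j # \<sigma>))" if s: "length \<sigma> < 2 * Suc n" for j \<sigma>
    proof -
      consider "length \<sigma> < 2 * n" | "length \<sigma> = 2 * n" | l \<tau> where "\<sigma> = l # \<tau>" "length \<tau> = 2 * n"
      proof -
        have "length \<sigma> < 2 * n \<or> length \<sigma> = 2 * n \<or> length \<sigma> = Suc (2 * n)" using s by auto
        then show ?thesis using that by (auto simp: length_Suc_conv)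
      qed
      then show ?thesis
      proof cases
        case 1
        then show ?thesis using g(2) unfolding chain_def g'_def by simp
      next
        case 2
        then show ?thesis using G1(1)[of \<sigma> j] unfolding g'_def by simp
      next
        case 3
        then show ?thesis using G2(1)[of \<tau> j l] unfolding g'_def by simp
      qed
    qed
    ultimately have "chain h (2 * Suc n) g'" unfolding chain_def by blast
    moreover have "g' [] = \<psi>" unfolding g'_def using g(1) by simp
    ultimately show ?thesis using scaled_bound' by blast
  qed
  moreover have "(E + D) * C > 0" using C D E by simp
  moreover have "min h0 (min h1 h2) > 0" using C D E by simp
  ultimately show ?case by blast
qed

end

section \<open>The trace of the magnetic field\<close>

lemma norm_matrix_sq: "(norm (M::real^'d::finite^'d))^2 = (\<Sum>i\<in>UNIV. \<Sum>j\<in>UNIV. (M $ i $ j)^2)"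
  by (simp add: norm_vec_def L2_set_def sum_nonneg)

lemma entry_le_norm: "\<bar>M $ i $ j\<bar> \<le> norm (M::real^'d::finite^'d)"
  using order_trans[OF component_le_norm_cart Finite_Cartesian_Product.norm_nth_le, of M i j] by simp

lemma poly_charpoly: "poly (charpoly M) z = det (\<chi> i j. (if i = j then z else 0) - complex_of_real (M $ i $ j))"
  unfolding charpoly_def det_def by (simp add: poly_sum poly_prod if_distrib[of "\<lambda>p. poly p z"] cong: if_cong)

lemma degree_charpoly: "degree (charpoly (M::real^'d::finite^'d)) \<le> CARD('d)"
  unfolding charpoly_def det_def
proof (rule degree_sum_le)
  show "finite {p. p permutes (UNIV::'d set)}" by (rule finite_permutations) simp
  fix p :: "'d \<Rightarrow> 'd"
  let ?N = "\<chi> i j. (if i = j then [:0, 1:] else 0) - [:complex_of_real (M $ i $ j):]"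
  have "degree (\<Prod>i\<in>UNIV. ?N $ i $ p i) \<le> sum (degree \<circ> (\<lambda>i. ?N $ i $ p i)) UNIV" by (rule degree_prod_sum_le) simp
  also have "\<dots> \<le> (\<Sum>i\<in>(UNIV::'d set). 1)" by (rule sum_mono) (auto intro!: degree_diff_le)
  finally have "degree (\<Prod>i\<in>UNIV. ?N $ i $ p i) \<le> CARD('d)" by simp
  then show "degree (of_int (sign p) * (\<Prod>i\<in>UNIV. ?N $ i $ p i)) \<le> CARD('d)"
    using degree_mult_le[of "of_int (sign p) :: complex poly" "\<Prod>i\<in>UNIV. ?N $ i $ p i"] by simp
qed

text \<open>The eigenvector equation is read in the row of the largest component of the eigenvector.
  The dimension factor is the price of bounding each entry by the norm; it only changes
  constants.\<close>

lemma charpoly_root_bound: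
  fixes M :: "real^'d::finite^'d"
  assumes "poly (charpoly M) z = 0"
  shows "cmod z \<le> real CARD('d) * norm M"
proof -
  let ?N = "\<chi> i j. (if i = j then z else 0) - complex_of_real (M $ i $ j)"
  have "\<not> invertible ?N" using assms unfolding poly_charpoly by (simp add: invertible_det_nz)
  then have "\<not> (\<forall>v. ?N *v v = 0 \<longrightarrow> v = 0)" unfolding matrix_left_invertible_ker[symmetric] invertible_left_inverse .
  then obtain v where v: "?N *v v = 0" "v \<noteq> 0" by blast
  have "\<exists>i. \<forall>j. cmod (v $ j) \<le> cmod (v $ i)"
  proof -
    have "Max (range (\<lambda>j. cmod (v $ j))) \<in> range (\<lambda>j. cmod (v $ j))" by (rule Max_in) auto
    then obtain i where i: "Max (range (\<lambda>j. cmod (v $ j))) = cmod (v $ i)" by blast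
    have "cmod (v $ j) \<le> Max (range (\<lambda>j. cmod (v $ j)))" for j by (rule Max_ge) auto
    then show ?thesis unfolding i by blast
  qed
  then obtain i where i: "\<And>j. cmod (v $ j) \<le> cmod (v $ i)" by blast
  have vi: "cmod (v $ i) > 0"
  proof (rule ccontr)
    assume "\<not> ?thesis"
    then have "v $ j = 0" for j using i[of j] by (metis norm_le_zero_iff order_trans not_less)
    then show False using v(2) by (simp add: vec_eq_iff)
  qed
  have "(?N *v v) $ i = z * v $ i - (\<Sum>j\<in>UNIV. of_real (M $ i $ j) * v $ j)"
    by (simp add: matrix_vector_mult_def left_diff_distrib sum_subtractf if_distrib[of "\<lambda>a. a * _"] cong: if_cong)
  then have "z * v $ i = (\<Sum>j\<in>UNIV. of_real (M $ i $ j) * v $ j)" using v(1) by simp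
  then have "cmod z * cmod (v $ i) = cmod (\<Sum>j\<in>UNIV. of_real (M $ i $ j) * v $ j)" by (metis norm_mult)
  also have "\<dots> \<le> (\<Sum>j\<in>(UNIV::'d set). norm M * cmod (v $ i))"
    by (intro order_trans[OF norm_sum sum_mono]) (auto simp: norm_mult intro!: mult_mono entry_le_norm i)
  also have "\<dots> = (real CARD('d) * norm M) * cmod (v $ i)" by simp
  finally show ?thesis using vi by (simp only: mult_le_cancel_right_pos)
qed

text \<open>The three dimension factors bound the number of roots, their multiplicities and their
  moduli. For a zero polynomial the index set would be infinite, and the sum is then 0 by
  convention.\<close>

lemma trplus_le: "trplus (M::real^'d::finite^'d) \<le> real CARD('d) ^ 3 * norm M"
proof (cases "charpoly M = 0")
  case True
  have "infinite {z. Im z > 0}"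
  proof
    assume "finite {z. Im z > 0}"
    then have "finite (Im ` {z. Im z > 0})" by (rule finite_imageI)
    moreover have "{0<..} \<subseteq> Im ` {z. Im z > 0}" by (auto intro!: image_eqI[of _ _ "Complex 0 _"])
    ultimately have "finite {0::real<..}" by (rule finite_subset[rotated])
    then show False by (simp add: infinite_Ioi)
  qed
  then show ?thesis unfolding trplus_def True by simp
next
  case False
  let ?S = "{z. poly (charpoly M) z = 0 \<and> Im z > 0}"
  have fin: "finite {z. poly (charpoly M) z = 0}" by (rule poly_roots_finite[OF False])
  have "card ?S \<le> card {z. poly (charpoly M) z = 0}" by (rule card_mono[OF fin]) auto
  also have "\<dots> \<le> degree (charpoly M)" by (rule card_poly_roots_bound[OF False])
  finally have c: "card ?S \<le> CARD('d)" using degree_charpoly[of M] by linarith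
  have "trplus M \<le> (\<Sum>z\<in>?S. real CARD('d) * (real CARD('d) * norm M))"
    unfolding trplus_def
  proof (intro sum_mono mult_mono)
    fix z assume "z \<in> ?S"
    then show "cmod z \<le> real CARD('d) * norm M" using charpoly_root_bound by blast
    show "real (order z (charpoly M)) \<le> real CARD('d)"
      using order_degree[OF False, of z] degree_charpoly[of M] by simp
  qed auto
  also have "\<dots> = real (card ?S) * (real CARD('d) * (real CARD('d) * norm M))" by simp
  also have "\<dots> \<le> real CARD('d) * (real CARD('d) * (real CARD('d) * norm M))"
    using c by (intro mult_right_mono) auto
  finally show ?thesis by (simp add: power3_eq_cube mult_ac)
qed

theorem theorem1p4:
  fixes A :: "'d::finite \<Rightarrow> real^'d \<Rightarrow> real" and n :: nat
  assumes hA: "\<forall>j. classP (A j)"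
    and hb0: "\<exists>b0>0. \<forall>x. trplus (magB A x) \<ge> b0"
    and hB: "\<forall>js. \<exists>C>0. \<forall>x. norm (\<chi> k l. iterpd js (\<lambda>y. magB A y $ k $ l) x) \<le> C * norm (magB A x)"
  shows "\<exists>h0>0. \<exists>C>0. \<forall>h. 0 < h \<and> h < h0 \<longrightarrow>
     (\<forall>\<psi> f. Lpow_rel h A n \<psi> f \<longrightarrow>
        (\<exists>g :: 'd list \<Rightarrow> real^'d \<Rightarrow> complex.
            g [] = \<psi>
          \<and> (\<forall>\<sigma>. length \<sigma> \<le> 2 * n \<longrightarrow> L2 (g \<sigma>))
          \<and> (\<forall>j \<tau>. length \<tau> < 2 * n \<longrightarrow> weak_L h A j (g \<tau>) (g (j # \<tau>)))
          \<and> (\<Sum>\<sigma>\<in>{\<sigma>. length \<sigma> \<le> 2 * n}. L2norm (g \<sigma>))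
              \<le> C * h powr (- 3 * real n / 2) * L2norm f))"
proof -
  interpret magnetic A
    by standard (use hA in \<open>simp add: classP_def\<close>)
  have nB: "norm (magB A x) = sqrt (\<Sum>j\<in>UNIV. \<Sum>k\<in>UNIV. (B j k x)^2)" for x
    using norm_matrix_sq[of "magB A x"] unfolding magB_nth by (metis norm_ge_zero real_sqrt_unique)
  interpret nondegenerate_magnetic A
  proof
    obtain b0 where b0: "b0 > 0" "\<And>x. trplus (magB A x) \<ge> b0" using hb0 by blast
    let ?d = "real CARD('d) ^ 3"
    have "(b0 / ?d)^2 \<le> (\<Sum>j\<in>UNIV. \<Sum>k\<in>UNIV. (B j k x)^2)" for x
    proof -
      have "b0 \<le> ?d * norm (magB A x)" using b0(2)[of x] trplus_le[of "magB A x"] by linarith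
      then have "b0 / ?d \<le> norm (magB A x)" by (simp add: divide_le_eq mult.commute)
      then have "(b0 / ?d)^2 \<le> (norm (magB A x))^2" using b0(1) by (intro power_mono) auto
      then show ?thesis unfolding norm_matrix_sq magB_nth .
    qed
    moreover have "(b0 / ?d)^2 > 0" using b0 by simp
    ultimately show "\<exists>c>0. \<forall>x. c \<le> (\<Sum>j\<in>UNIV. \<Sum>k\<in>UNIV. (B j k x)^2)" by blast
  next
    fix js
    obtain C where C: "C > 0" "\<And>x. norm (\<chi> k l. iterpd js (\<lambda>y. magB A y $ k $ l) x) \<le> C * norm (magB A x)" using hB by blast
    have "\<bar>iterpd js (B j k) x\<bar> \<le> C * sqrt (\<Sum>j\<in>UNIV. \<Sum>k\<in>UNIV. (B j k x)^2)" for j k x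
      using order_trans[OF entry_le_norm[of "\<chi> k l. iterpd js (\<lambda>y. magB A y $ k $ l) x" j k] C(2)[of x]]
      unfolding nB by (simp add: magB_nth)
    then show "\<exists>C>0. \<forall>j k x. \<bar>iterpd js (B j k) x\<bar> \<le> C * sqrt (\<Sum>j\<in>UNIV. \<Sum>k\<in>UNIV. (B j k x)^2)" using C(1) by blast
  qed
  obtain C h0 where C: "C > 0" "h0 > 0" and P: "\<forall>h. 0 < h \<longrightarrow> h < h0 \<longrightarrow> (\<forall>\<psi> f. Lpow_rel h A n \<psi> f \<longrightarrow>
     (\<exists>g. g [] = \<psi> \<and> chain h (2 * n) g \<and> (\<forall>\<sigma>. length \<sigma> \<le> 2 * n \<longrightarrow> scaled_bound n h g (C * L2norm f) \<sigma>)))"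
    using power_estimate[of n] by blast
  let ?S = "{\<sigma>::'d list. length \<sigma> \<le> 2 * n}"
  have "\<exists>K>0. \<forall>u. L2 (wm (scale_exp n \<sigma>) u) \<longrightarrow> L2norm u \<le> K * L2norm (wm (scale_exp n \<sigma>) u)" if "length \<sigma> \<le> 2 * n" for \<sigma>
    using L2_wm_le[of 0 "scale_exp n \<sigma>"] that unfolding wm_0 by (auto simp: scale_exp_def)
  then obtain K where K: "\<And>\<sigma>. length \<sigma> \<le> 2 * n \<Longrightarrow> K \<sigma> > 0"
    "\<And>\<sigma> u. length \<sigma> \<le> 2 * n \<Longrightarrow> L2 (wm (scale_exp n \<sigma>) u) \<Longrightarrow> L2norm u \<le> K \<sigma> * L2norm (wm (scale_exp n \<sigma>) u)" by metis
  have Spos: "(\<Sum>\<sigma>\<in>?S. K \<sigma> * C) > 0"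
    using K(1) C(1) finite_lists by (intro sum_pos) (auto intro!: exI[of _ "[]"])
  show ?thesis
  proof (rule exI[of _ "min 1 h0"], rule conjI, use C in simp, rule exI[of _ "\<Sum>\<sigma>\<in>?S. K \<sigma> * C"], rule conjI[OF Spos], intro allI impI)
    fix h \<psi> f assume h: "0 < h \<and> h < min 1 h0" and L: "Lpow_rel h A n \<psi> f"
    obtain g where g: "g [] = \<psi>" "chain h (2 * n) g" "\<And>\<sigma>. length \<sigma> \<le> 2 * n \<Longrightarrow> scaled_bound n h g (C * L2norm f) \<sigma>"
      using P[rule_format, of h \<psi> f] h L by auto
    have "L2norm (g \<sigma>) \<le> K \<sigma> * C * (h powr (- 3 * real n / 2) * L2norm f)" if \<sigma>: "length \<sigma> \<le> 2 * n" for \<sigma>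
    proof -
      let ?e = "scale_exp n \<sigma>"
      have b: "L2 (wm ?e (g \<sigma>))" "h powr ?e * L2norm (wm ?e (g \<sigma>)) \<le> C * L2norm f" using g(3)[OF \<sigma>] unfolding scaled_bound_def by auto
      have "L2norm (wm ?e (g \<sigma>)) = h powr (- ?e) * (h powr ?e * L2norm (wm ?e (g \<sigma>)))"
        using h by (simp add: powr_minus)
      also have "\<dots> \<le> h powr (- ?e) * (C * L2norm f)" using b(2) by (intro mult_left_mono) auto
      \<comment> \<open>Since h < 1 and the exponent \<open>?e\<close> is at most n, the loss h^(-n)
        is bounded by h^(-3n/2).\<close>
      also have "\<dots> \<le> h powr (- 3 * real n / 2) * (C * L2norm f)"
        using h C by (intro mult_right_mono powr_mono') (auto simp: scale_exp_def)
      finally have "K \<sigma> * L2norm (wm ?e (g \<sigma>)) \<le> K \<sigma> * (h powr (- 3 * real n / 2) * (C * L2norm f))"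
        using K(1)[OF \<sigma>] by (intro mult_left_mono) auto
      then show ?thesis using K(2)[OF \<sigma> b(1)] by (simp add: mult_ac)
    qed
    then have "(\<Sum>\<sigma>\<in>?S. L2norm (g \<sigma>)) \<le> (\<Sum>\<sigma>\<in>?S. K \<sigma> * C * (h powr (- 3 * real n / 2) * L2norm f))"
      by (intro sum_mono) simp
    also have "\<dots> = (\<Sum>\<sigma>\<in>?S. K \<sigma> * C) * h powr (- 3 * real n / 2) * L2norm f"
      unfolding sum_distrib_right[symmetric] by (simp only: mult.assoc)
    finally show "\<exists>g. g [] = \<psi> \<and> (\<forall>\<sigma>. length \<sigma> \<le> 2 * n \<longrightarrow> L2 (g \<sigma>))
        \<and> (\<forall>j \<tau>. length \<tau> < 2 * n \<longrightarrow> weak_L h A j (g \<tau>) (g (j # \<tau>)))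
        \<and> (\<Sum>\<sigma>\<in>?S. L2norm (g \<sigma>)) \<le> (\<Sum>\<sigma>\<in>?S. K \<sigma> * C) * h powr (- 3 * real n / 2) * L2norm f"
      using g(1,2) unfolding chain_def by blast
  qed
qed

end
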